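(* Let $k$ be a field, $n\ge2$, and let $\mathcal A$ be a commutative, non-negatively graded, augmented differential graded Poisson algebra over $k$ with bracket of degree $n-1$. Then the bar construction $\mathrm B_{*,*}(\mathcal A)$ is a commutative differential bigraded Poisson Hopf algebra, where the bracket has bidegree $(-1,n-1)$ and satisfies the Leibniz rule with respect to both the internal differential $d$ and the external differential $\delta$. Explicitly, for $x_1,\dots,x_p,y_1,\dots,y_q$ in the augmentation ideal $\overline{\mathcal A}$, the bracket $\big[[x_1|\cdots|x_p],[y_1|\cdots|y_q]\big]$ is given by $$\sum_{(p,q)\text{-shuffles }\varphi}\ \sum_{\substack{1\le i<p+q\\ \varphi^{-1}(i)\le p\\ \varphi^{-1}(i+1)>p}}(-1)^{\sigma(\varphi)}\big[a_{\varphi^{-1}(1)}|\cdots|(-1)^{\sigma'(\varphi,i)}[a_{\varphi^{-1}(i)},a_{\varphi^{-1}(i+1)}]|\cdots|a_{\varphi^{-1}(p+q)}\big],$$ where $a_i=x_i$ if $i\le p$ and $a_i=y_{i-p}$ if $i>p$, $$\sigma(\varphi)=\sum_{\substack{1\le i\le p,\ 1\le j\le q\\ \varphi(i)>\varphi(j+p)}}(|x_i|+1)(|y_j|+1),$$ $$\sigma'(\varphi,i)=n\Big(\sum_{\substack{1\le j\le p\\ \varphi(j)>i+1}}(|x_j|+1)+\sum_{\substack{1\le j\le q\\ \varphi(j+p)<i}}(|y_j|+1)\Big).$$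
   Context: "Commutative" means graded commutative, $xy=(-1)^{|x||y|}yx$; for bigraded objects $|x|$ is the total degree. A DGA has a differential of degree $-1$. **Differential graded Poisson algebra with bracket of degree $m$:** a DGA with a bilinear bracket of degree $m$ such that - (antisymmetry) $[x,y]=-(-1)^{(|x|+m)(|y|+m)}[y,x]$; - (Poisson identity) $[x,yz]=[x,y]z+(-1)^{|y|(|x|+m)}y[x,z]$; - (Jacobi identity) $[x,[y,z]]=[[x,y],z]+(-1)^{(|x|+m)(|y|+m)}[y,[x,z]]$; - (Leibniz rule) $d[x,y]=[dx,y]+(-1)^{|x|+m}[x,dy]$. In $\mathrm B_{*,*}(\mathcal A)$ the bracket has total degree $m=n-2$, signs are computed with total degrees, and the Leibniz rule is required for each of $d$ and $\delta$ in place of the differential. A Poisson Hopf algebra is a Hopf algebra with a bracket satisfying the first three identities and also $\Delta[x,y]=[\Delta x,\Delta y]$, where the bracket on the tensor square is $$[x_1\otimes x_2,y_1\otimes y_2]=(-1)^{|x_2|(|y_1|+m)}[x_1,y_1]\otimes x_2y_2+(-1)^{(|x_2|+m)|y_1|}x_1y_1\otimes[x_2,y_2].$$ **Bar construction.** For a DGA $\mathcal A$ with augmentation $\epsilon\colon\mathcal A\to k$, $\overline{\mathcal A}=\ker\epsilon$, let $\mathrm B_{s,*}(\mathcal A)=\overline{\mathcal A}^{\otimes s}$, with component of internal degree $t$ denoted $\mathrm B_{s,t}(\mathcal A)$; $s$ is the external degree and $s+t$ the total degree. Write $[\alpha_1|\cdots|\alpha_s]$ for $\alpha_1\otimes\cdots\otimes\alpha_s$.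 With $\sigma(i)=\sum_{j\le i}(|\alpha_j|+1)$, $$d[\alpha_1|\cdots|\alpha_s]=\sum_{i=1}^s(-1)^{\sigma(i-1)}[\alpha_1|\cdots|d_{\mathcal A}\alpha_i|\cdots|\alpha_s],\qquad\delta[\alpha_1|\cdots|\alpha_s]=\sum_{i=1}^{s-1}(-1)^{\sigma(i)}[\alpha_1|\cdots|\alpha_i\alpha_{i+1}|\cdots|\alpha_s].$$ The comultiplication is $\Delta[\alpha_1|\cdots|\alpha_s]=\sum_{i=0}^s[\alpha_1|\cdots|\alpha_i]\otimes[\alpha_{i+1}|\cdots|\alpha_s]$. A $(p,q)$-shuffle is a permutation $\varphi$ of $\{1,\dots,p+q\}$ with $\varphi(a)<\varphi(b)$ whenever $1\le a<b\le p$ or $p+1\le a<b\le p+q$. For commutative $\mathcal A$ the product on $\mathrm B_{*,*}(\mathcal A)$ is the shuffle product $$[x_1|\cdots|x_p]\cdot[y_1|\cdots|y_q]=\sum_{(p,q)\text{-shuffles }\varphi}(-1)^{\sigma(\varphi)}[a_{\varphi^{-1}(1)}|\cdots|a_{\varphi^{-1}(p+q)}],$$ with $a_i$ and $\sigma(\varphi)$ as in the claim. *)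

theory Defs
  imports
    "HOL-Algebra.Algebraic_Closure_Type"
    "HOL-Library.Poly_Mapping"
    "HOL-Library.Product_Plus"
    "HOL-Combinatorics.Permutations"
begin

section \<open>Linear algebra over a field\<close>

text \<open>
  The ground field is a type of class \<^class>\<open>field\<close>; as a HOL-Algebra ring it is
  \<^const>\<open>ring_of_type_algebra\<close>. Vector spaces and algebras over it are carried by the
  HOL-Algebra record \<open>module\<close>, whose fields \<open>mult\<close> and \<open>one\<close> hold the product of an algebra.
\<close>

abbreviation ground :: "'k::field ring" where
  "ground \<equiv> ring_of_type_algebra"

definition klinear :: "('k::field, 'v) module \<Rightarrow> ('k, 'w) module \<Rightarrow> ('v \<Rightarrow> 'w) \<Rightarrow> bool" where
  "klinear V W f \<longleftrightarrow>
     f \<in> carrier V \<rightarrow> carrier W \<and>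
     (\<forall>x\<in>carrier V. \<forall>y\<in>carrier V. f (x \<oplus>\<^bsub>V\<^esub> y) = f x \<oplus>\<^bsub>W\<^esub> f y) \<and>
     (\<forall>c. \<forall>x\<in>carrier V. f (c \<odot>\<^bsub>V\<^esub> x) = c \<odot>\<^bsub>W\<^esub> f x)"

definition klinear_form :: "('k::field, 'v) module \<Rightarrow> ('v \<Rightarrow> 'k) \<Rightarrow> bool" where
  "klinear_form V f \<longleftrightarrow>
     (\<forall>x\<in>carrier V. \<forall>y\<in>carrier V. f (x \<oplus>\<^bsub>V\<^esub> y) = f x + f y) \<and>
     (\<forall>c. \<forall>x\<in>carrier V. f (c \<odot>\<^bsub>V\<^esub> x) = c * f x)"

definition kbilinear ::
  "('k::field, 'v) module \<Rightarrow> ('k, 'w) module \<Rightarrow> ('k, 'u) module \<Rightarrow> ('v \<Rightarrow> 'w \<Rightarrow> 'u) \<Rightarrow> bool" where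
  "kbilinear V W U f \<longleftrightarrow>
     (\<forall>x\<in>carrier V. klinear W U (f x)) \<and> (\<forall>y\<in>carrier W. klinear V U (\<lambda>x. f x y))"

definition sg :: "('k::field, 'v) module \<Rightarrow> int \<Rightarrow> 'v \<Rightarrow> 'v" where
  "sg V e x = (if even e then x else \<ominus>\<^bsub>V\<^esub> x)"

subsection \<open>Spaces given by generators and relations\<close>

text \<open>
  \<open>'x \<Rightarrow>\<^sub>0 'k\<close> is the free vector space on \<open>'x\<close>. \<open>quotient_space S N\<close> is the quotient of the
  subspace spanned by \<open>S\<close> by the subspace \<open>N\<close>; its elements are cosets. Its fields \<open>mult\<close> and
  \<open>one\<close> are meaningless.
\<close>

definition fscale :: "'k::field \<Rightarrow> ('x \<Rightarrow>\<^sub>0 'k) \<Rightarrow> ('x \<Rightarrow>\<^sub>0 'k)" where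
  "fscale c = Poly_Mapping.map ((*) c)"

definition coset_of :: "('x \<Rightarrow>\<^sub>0 'k::field) set \<Rightarrow> ('x \<Rightarrow>\<^sub>0 'k) \<Rightarrow> ('x \<Rightarrow>\<^sub>0 'k) set" where
  "coset_of N p = {p + r | r. r \<in> N}"

definition quotient_space ::
  "'x set \<Rightarrow> ('x \<Rightarrow>\<^sub>0 'k::field) set \<Rightarrow> ('k, ('x \<Rightarrow>\<^sub>0 'k) set) module" where
  "quotient_space S N =
     \<lparr> carrier = {coset_of N p | p. Poly_Mapping.keys p \<subseteq> S},
       monoid.mult = undefined, one = undefined,
       ring.zero = N,
       ring.add = (\<lambda>\<xi> \<eta>. {p + q | p q. p \<in> \<xi> \<and> q \<in> \<eta>}),
       module.smult = (\<lambda>c \<xi>. {fscale c p + r | p r. p \<in> \<xi> \<and> r \<in> N}) \<rparr>"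

text \<open>
  The linear map out of such a quotient that sends the class of each generator \<open>x\<close> to \<open>f x\<close>,
  for \<open>f\<close> compatible with the relations.
\<close>

definition lift :: "('k::field, 'u) module \<Rightarrow> ('x \<Rightarrow> 'u) \<Rightarrow> ('x \<Rightarrow>\<^sub>0 'k) set \<Rightarrow> 'u" where
  "lift U f \<xi> =
     (THE u. \<exists>p\<in>\<xi>. u =
        (\<Oplus>\<^bsub>U\<^esub>x\<in>Poly_Mapping.keys p. Poly_Mapping.lookup p x \<odot>\<^bsub>U\<^esub> f x))"

subsection \<open>Tensor products\<close>

definition tensor_relations ::
  "('k::field, 'v) module \<Rightarrow> ('k, 'w) module \<Rightarrow> ('v \<times> 'w \<Rightarrow>\<^sub>0 'k) set" where
  "tensor_relations V W = module.span fscale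
     ({Poly_Mapping.single (x \<oplus>\<^bsub>V\<^esub> x', y) 1
         - Poly_Mapping.single (x, y) 1 - Poly_Mapping.single (x', y) 1 | x x' y.
         x \<in> carrier V \<and> x' \<in> carrier V \<and> y \<in> carrier W} \<union>
      {Poly_Mapping.single (x, y \<oplus>\<^bsub>W\<^esub> y') 1
         - Poly_Mapping.single (x, y) 1 - Poly_Mapping.single (x, y') 1 | x y y'.
         x \<in> carrier V \<and> y \<in> carrier W \<and> y' \<in> carrier W} \<union>
      {Poly_Mapping.single (c \<odot>\<^bsub>V\<^esub> x, y) 1 - Poly_Mapping.single (x, y) c | c x y.
         x \<in> carrier V \<and> y \<in> carrier W} \<union>
      {Poly_Mapping.single (x, c \<odot>\<^bsub>W\<^esub> y) 1 - Poly_Mapping.single (x, y) c | c x y.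
         x \<in> carrier V \<and> y \<in> carrier W})"

definition tensor ::
  "('k::field, 'v) module \<Rightarrow> ('k, 'w) module \<Rightarrow> ('k, ('v \<times> 'w \<Rightarrow>\<^sub>0 'k) set) module" where
  "tensor V W = quotient_space (carrier V \<times> carrier W) (tensor_relations V W)"

definition tens ::
  "('k::field, 'v) module \<Rightarrow> ('k, 'w) module \<Rightarrow> 'v \<Rightarrow> 'w \<Rightarrow> ('v \<times> 'w \<Rightarrow>\<^sub>0 'k) set" where
  "tens V W x y = coset_of (tensor_relations V W) (Poly_Mapping.single (x, y) 1)"

definition tensor_map ::
  "('k::field, 'v) module \<Rightarrow> ('k, 'w) module \<Rightarrow> ('x \<Rightarrow> 'v) \<Rightarrow> ('y \<Rightarrow> 'w) \<Rightarrow>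
   ('x \<times> 'y \<Rightarrow>\<^sub>0 'k) set \<Rightarrow> ('v \<times> 'w \<Rightarrow>\<^sub>0 'k) set" where
  "tensor_map V W f h = lift (tensor V W) (\<lambda>(x, y). tens V W (f x) (h y))"

definition tensor_assoc ::
  "('k::field, 'v) module \<Rightarrow> ('k, 'w) module \<Rightarrow> ('k, 'u) module \<Rightarrow>
   (('v \<times> 'w \<Rightarrow>\<^sub>0 'k) set \<times> 'u \<Rightarrow>\<^sub>0 'k) set \<Rightarrow> ('v \<times> ('w \<times> 'u \<Rightarrow>\<^sub>0 'k) set \<Rightarrow>\<^sub>0 'k) set" where
  "tensor_assoc V W U =
     lift (tensor V (tensor W U)) (\<lambda>(\<xi>, z).
       lift (tensor V (tensor W U)) (\<lambda>(x, y). tens V (tensor W U) x (tens W U y z)) \<xi>)"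

section \<open>Graded algebras\<close>

text \<open>
  The index group \<open>'g\<close> is \<^typ>\<open>int\<close> for graded and \<^typ>\<open>int \<times> int\<close> for bigraded objects;
  \<open>tot\<close> is the total degree, which governs all signs.
\<close>

definition decomposition ::
  "('k::field, 'v) module \<Rightarrow> ('g \<Rightarrow> 'v set) \<Rightarrow> 'v \<Rightarrow> ('g \<Rightarrow> 'v) \<Rightarrow> bool" where
  "decomposition V G x f \<longleftrightarrow>
     (\<forall>g. f g \<in> G g) \<and> finite {g. f g \<noteq> \<zero>\<^bsub>V\<^esub>} \<and> x = (\<Oplus>\<^bsub>V\<^esub>g\<in>{g. f g \<noteq> \<zero>\<^bsub>V\<^esub>}. f g)"

definition grading :: "('k::field, 'v) module \<Rightarrow> ('g \<Rightarrow> 'v set) \<Rightarrow> bool" where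
  "grading V G \<longleftrightarrow>
     (\<forall>g. submodule (G g) ground V) \<and> (\<forall>x\<in>carrier V. \<exists>!f. decomposition V G x f)"

definition hcomp :: "('k::field, 'v) module \<Rightarrow> ('g \<Rightarrow> 'v set) \<Rightarrow> 'v \<Rightarrow> 'g \<Rightarrow> 'v" where
  "hcomp V G x = (THE f. decomposition V G x f)"

text \<open>
  Additive extension of a formula \<open>f g x\<close>, given for homogeneous \<open>x\<close> of degree \<open>g\<close>,
  to arbitrary elements.
\<close>

definition hsum ::
  "('k::field, 'u) module \<Rightarrow> ('k, 'v) module \<Rightarrow> ('g \<Rightarrow> 'v set) \<Rightarrow> ('g \<Rightarrow> 'v \<Rightarrow> 'u) \<Rightarrow> 'v \<Rightarrow> 'u" where
  "hsum U V G f x = (\<Oplus>\<^bsub>U\<^esub>g\<in>{g. hcomp V G x g \<noteq> \<zero>\<^bsub>V\<^esub>}. f g (hcomp V G x g))"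

locale graded_algebra =
  fixes V :: "('k::field, 'v) module" (structure) and G :: "'g::ab_group_add \<Rightarrow> 'v set"
    and tot :: "'g \<Rightarrow> int"
  assumes is_ring: "ring V"
    and is_module: "module ground V"
    and smult_mult_left:
      "x \<in> carrier V \<Longrightarrow> y \<in> carrier V \<Longrightarrow> (c \<odot> x) \<otimes> y = c \<odot> (x \<otimes> y)"
    and smult_mult_right:
      "x \<in> carrier V \<Longrightarrow> y \<in> carrier V \<Longrightarrow> x \<otimes> (c \<odot> y) = c \<odot> (x \<otimes> y)"
    and is_grading: "grading V G"
    and one_degree: "\<one> \<in> G 0"
    and mult_degree: "x \<in> G g \<Longrightarrow> y \<in> G h \<Longrightarrow> x \<otimes> y \<in> G (g + h)"
    and tot_add: "tot (g + h) = tot g + tot h"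

locale graded_commutative_algebra = graded_algebra V G tot
  for V :: "('k::field, 'v) module" (structure) and G :: "'g::ab_group_add \<Rightarrow> 'v set"
    and tot :: "'g \<Rightarrow> int" +
  assumes graded_commutative:
    "x \<in> G g \<Longrightarrow> y \<in> G h \<Longrightarrow> x \<otimes> y = sg V (tot g * tot h) (y \<otimes> x)"

locale dg_algebra = graded_algebra V G tot
  for V :: "('k::field, 'v) module" (structure) and G :: "'g::ab_group_add \<Rightarrow> 'v set"
    and tot :: "'g \<Rightarrow> int" +
  fixes e :: 'g and D :: "'v \<Rightarrow> 'v"
  assumes e_total: "tot e = -1"
    and D_linear: "klinear V V D"
    and D_degree: "x \<in> G g \<Longrightarrow> D x \<in> G (g + e)"
    and D_D: "x \<in> carrier V \<Longrightarrow> D (D x) = \<zero>"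
    and D_mult: "x \<in> G g \<Longrightarrow> y \<in> carrier V \<Longrightarrow>
      D (x \<otimes> y) = (D x \<otimes> y) \<oplus> sg V (tot g) (x \<otimes> D y)"

text \<open>A bracket \<open>br\<close> of degree \<open>b\<close>; the number \<open>m\<close> in the signs is \<open>tot b\<close>.\<close>

locale graded_poisson_algebra = graded_algebra V G tot
  for V :: "('k::field, 'v) module" (structure) and G :: "'g::ab_group_add \<Rightarrow> 'v set"
    and tot :: "'g \<Rightarrow> int" +
  fixes b :: 'g and br :: "'v \<Rightarrow> 'v \<Rightarrow> 'v"
  assumes br_bilinear: "kbilinear V V V br"
    and br_degree: "x \<in> G g \<Longrightarrow> y \<in> G h \<Longrightarrow> br x y \<in> G (g + h + b)"
    and br_antisym: "x \<in> G g \<Longrightarrow> y \<in> G h \<Longrightarrow>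
      br x y = \<ominus> sg V ((tot g + tot b) * (tot h + tot b)) (br y x)"
    and br_poisson: "x \<in> G g \<Longrightarrow> y \<in> G h \<Longrightarrow> z \<in> G i \<Longrightarrow>
      br x (y \<otimes> z) = (br x y \<otimes> z) \<oplus> sg V (tot h * (tot g + tot b)) (y \<otimes> br x z)"
    and br_jacobi: "x \<in> G g \<Longrightarrow> y \<in> G h \<Longrightarrow> z \<in> G i \<Longrightarrow>
      br x (br y z) =
        br (br x y) z \<oplus> sg V ((tot g + tot b) * (tot h + tot b)) (br y (br x z))"

locale dg_poisson_algebra =
  dg_algebra V G tot e D + graded_poisson_algebra V G tot b br
  for V :: "('k::field, 'v) module" (structure) and G :: "'g::ab_group_add \<Rightarrow> 'v set"
    and tot :: "'g \<Rightarrow> int" and e D b br +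
  assumes leibniz: "x \<in> G g \<Longrightarrow> y \<in> G h \<Longrightarrow>
      D (br x y) = br (D x) y \<oplus> sg V (tot g + tot b) (br x (D y))"

text \<open>
  An augmentation of a DGA: a morphism of DGAs to the ground field. When the grading is
  non-negative and the bracket has positive degree, it automatically annihilates brackets.
\<close>

locale augmentation =
  dg_algebra V G tot e D
  for V :: "('k::field, 'v) module" (structure) and G :: "'g::ab_group_add \<Rightarrow> 'v set"
    and tot :: "'g \<Rightarrow> int" and e D +
  fixes eps :: "'v \<Rightarrow> 'k"
  assumes eps_linear: "klinear_form V eps"
    and eps_one: "eps \<one> = 1"
    and eps_mult: "x \<in> carrier V \<Longrightarrow> y \<in> carrier V \<Longrightarrow> eps (x \<otimes> y) = eps x * eps y"
    and eps_degree: "x \<in> G g \<Longrightarrow> g \<noteq> 0 \<Longrightarrow> eps x = 0"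
    and eps_D: "x \<in> carrier V \<Longrightarrow> eps (D x) = 0"

section \<open>Structure on the tensor square\<close>

definition tensor_grading ::
  "('k::field, 'v) module \<Rightarrow> ('g::ab_group_add \<Rightarrow> 'v set) \<Rightarrow> 'g \<Rightarrow> ('v \<times> 'v \<Rightarrow>\<^sub>0 'k) set set" where
  "tensor_grading V G g =
     {\<xi> \<in> carrier (tensor V V).
        \<exists>p\<in>\<xi>. Poly_Mapping.keys p \<subseteq> (\<Union>h. G h \<times> G (g - h))}"

definition tensor_mult ::
  "('k::field, 'v) module \<Rightarrow> ('g \<Rightarrow> 'v set) \<Rightarrow> ('g \<Rightarrow> int) \<Rightarrow>
   ('v \<times> 'v \<Rightarrow>\<^sub>0 'k) set \<Rightarrow> ('v \<times> 'v \<Rightarrow>\<^sub>0 'k) set \<Rightarrow> ('v \<times> 'v \<Rightarrow>\<^sub>0 'k) set" where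
  "tensor_mult V G tot \<xi> \<eta> = (let T = tensor V V in
     lift T (\<lambda>(x1, x2). lift T (\<lambda>(y1, y2).
       hsum T V G (\<lambda>g2 x2. hsum T V G (\<lambda>h1 y1.
         sg T (tot g2 * tot h1) (tens V V (x1 \<otimes>\<^bsub>V\<^esub> y1) (x2 \<otimes>\<^bsub>V\<^esub> y2))) y1) x2) \<eta>) \<xi>)"

definition tensor_bracket ::
  "('k::field, 'v) module \<Rightarrow> ('g \<Rightarrow> 'v set) \<Rightarrow> ('g \<Rightarrow> int) \<Rightarrow> int \<Rightarrow> ('v \<Rightarrow> 'v \<Rightarrow> 'v) \<Rightarrow>
   ('v \<times> 'v \<Rightarrow>\<^sub>0 'k) set \<Rightarrow> ('v \<times> 'v \<Rightarrow>\<^sub>0 'k) set \<Rightarrow> ('v \<times> 'v \<Rightarrow>\<^sub>0 'k) set" where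
  "tensor_bracket V G tot m br \<xi> \<eta> = (let T = tensor V V in
     lift T (\<lambda>(x1, x2). lift T (\<lambda>(y1, y2).
       hsum T V G (\<lambda>g2 x2. hsum T V G (\<lambda>h1 y1.
         sg T (tot g2 * (tot h1 + m)) (tens V V (br x1 y1) (x2 \<otimes>\<^bsub>V\<^esub> y2)) \<oplus>\<^bsub>T\<^esub>
         sg T ((tot g2 + m) * tot h1) (tens V V (x1 \<otimes>\<^bsub>V\<^esub> y1) (br x2 y2))) y1) x2) \<eta>) \<xi>)"

text \<open>\<open>D \<otimes> 1 + 1 \<otimes> D\<close> with the Koszul sign for \<open>D\<close> of total degree \<open>-1\<close>.\<close>

definition tensor_differential ::
  "('k::field, 'v) module \<Rightarrow> ('g \<Rightarrow> 'v set) \<Rightarrow> ('g \<Rightarrow> int) \<Rightarrow> ('v \<Rightarrow> 'v) \<Rightarrow>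
   ('v \<times> 'v \<Rightarrow>\<^sub>0 'k) set \<Rightarrow> ('v \<times> 'v \<Rightarrow>\<^sub>0 'k) set" where
  "tensor_differential V G tot D = (let T = tensor V V in
     lift T (\<lambda>(x, y). tens V V (D x) y \<oplus>\<^bsub>T\<^esub>
       hsum T V G (\<lambda>g x. sg T (tot g) (tens V V x (D y))) x))"

section \<open>Hopf algebras\<close>

locale graded_hopf_algebra = graded_algebra V G tot
  for V :: "('k::field, 'v) module" (structure) and G :: "'g::ab_group_add \<Rightarrow> 'v set"
    and tot :: "'g \<Rightarrow> int" +
  fixes comult :: "'v \<Rightarrow> ('v \<times> 'v \<Rightarrow>\<^sub>0 'k) set" and counit :: "'v \<Rightarrow> 'k"
  assumes comult_linear: "klinear V (tensor V V) comult"
    and comult_degree: "x \<in> G g \<Longrightarrow> comult x \<in> tensor_grading V G g"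
    and counit_linear: "klinear_form V counit"
    and counit_degree: "x \<in> G g \<Longrightarrow> g \<noteq> 0 \<Longrightarrow> counit x = 0"
    and coassoc: "x \<in> carrier V \<Longrightarrow>
      tensor_assoc V V V (tensor_map (tensor V V) V comult (\<lambda>y. y) (comult x)) =
      tensor_map V (tensor V V) (\<lambda>y. y) comult (comult x)"
    and counit_left: "x \<in> carrier V \<Longrightarrow> lift V (\<lambda>(y, z). counit y \<odot> z) (comult x) = x"
    and counit_right: "x \<in> carrier V \<Longrightarrow> lift V (\<lambda>(y, z). counit z \<odot> y) (comult x) = x"
    and comult_one: "comult \<one> = tens V V \<one> \<one>"
    and comult_mult: "x \<in> carrier V \<Longrightarrow> y \<in> carrier V \<Longrightarrow>
      comult (x \<otimes> y) = tensor_mult V G tot (comult x) (comult y)"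
    and counit_one: "counit \<one> = 1"
    and counit_mult: "x \<in> carrier V \<Longrightarrow> y \<in> carrier V \<Longrightarrow>
      counit (x \<otimes> y) = counit x * counit y"
    and antipode: "\<exists>S. klinear V V S \<and> (\<forall>g. \<forall>x\<in>G g. S x \<in> G g) \<and>
      (\<forall>x\<in>carrier V.
         lift V (\<lambda>(y, z). S y \<otimes> z) (comult x) = counit x \<odot> \<one> \<and>
         lift V (\<lambda>(y, z). y \<otimes> S z) (comult x) = counit x \<odot> \<one>)"

locale graded_poisson_hopf_algebra =
  graded_hopf_algebra V G tot comult counit + graded_poisson_algebra V G tot b br
  for V :: "('k::field, 'v) module" (structure) and G :: "'g::ab_group_add \<Rightarrow> 'v set"
    and tot :: "'g \<Rightarrow> int" and comult counit b br +
  assumes comult_br: "x \<in> carrier V \<Longrightarrow> y \<in> carrier V \<Longrightarrow>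
      comult (br x y) = tensor_bracket V G tot (tot b) br (comult x) (comult y)"

locale dg_hopf_algebra =
  graded_hopf_algebra V G tot comult counit + dg_algebra V G tot e D
  for V :: "('k::field, 'v) module" (structure) and G :: "'g::ab_group_add \<Rightarrow> 'v set"
    and tot :: "'g \<Rightarrow> int" and comult counit e D +
  assumes comult_D: "x \<in> carrier V \<Longrightarrow>
      comult (D x) = tensor_differential V G tot D (comult x)"
    and counit_D: "x \<in> carrier V \<Longrightarrow> counit (D x) = 0"

abbreviation bitotal :: "int \<times> int \<Rightarrow> int" where
  "bitotal g \<equiv> fst g + snd g"

text \<open>
  Bidegrees are (external, internal); \<open>d\<close> is the internal and \<open>delta\<close> the external differential.
\<close>

locale commutative_differential_bigraded_poisson_hopf_algebra =
  graded_commutative_algebra V G bitotal +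
  graded_poisson_hopf_algebra V G bitotal comult counit b br +
  int: dg_hopf_algebra V G bitotal comult counit "(0, -1)" d +
  ext: dg_hopf_algebra V G bitotal comult counit "(-1, 0)" delta +
  int: dg_poisson_algebra V G bitotal "(0, -1)" d b br +
  ext: dg_poisson_algebra V G bitotal "(-1, 0)" delta b br
  for V :: "('k::field, 'v) module" (structure) and G :: "int \<times> int \<Rightarrow> 'v set"
    and comult counit d delta b br +
  assumes d_delta: "x \<in> carrier V \<Longrightarrow> d (delta x) \<oplus> delta (d x) = \<zero>"

section \<open>The bar construction\<close>

type_synonym ('k, 'a) bar = "('a list \<Rightarrow>\<^sub>0 'k) set"

definition augmentation_ideal :: "('k::field, 'a) module \<Rightarrow> ('a \<Rightarrow> 'k) \<Rightarrow> 'a set" where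
  "augmentation_ideal A eps = {a \<in> carrier A. eps a = 0}"

text \<open>
  The sum over all \<open>s\<close> of the tensor powers of the augmentation ideal: the free vector space on
  words in the augmentation ideal, modulo multilinearity in every letter.
\<close>

definition bar_relations ::
  "('k::field, 'a) module \<Rightarrow> ('a \<Rightarrow> 'k) \<Rightarrow> ('a list \<Rightarrow>\<^sub>0 'k) set" where
  "bar_relations A eps = (let I = augmentation_ideal A eps in module.span fscale
     ({Poly_Mapping.single (us @ [x \<oplus>\<^bsub>A\<^esub> y] @ vs) 1
         - Poly_Mapping.single (us @ [x] @ vs) 1 - Poly_Mapping.single (us @ [y] @ vs) 1
         | us vs x y. us \<in> lists I \<and> vs \<in> lists I \<and> x \<in> I \<and> y \<in> I} \<union>
      {Poly_Mapping.single (us @ [c \<odot>\<^bsub>A\<^esub> x] @ vs) 1 - Poly_Mapping.single (us @ [x] @ vs) c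
         | us vs c x. us \<in> lists I \<and> vs \<in> lists I \<and> x \<in> I}))"

definition bar_space ::
  "('k::field, 'a) module \<Rightarrow> ('a \<Rightarrow> 'k) \<Rightarrow> ('k, ('k, 'a) bar) module" where
  "bar_space A eps = quotient_space (lists (augmentation_ideal A eps)) (bar_relations A eps)"

text \<open>\<open>word A eps [a1, ..., as]\<close> is the element \<open>[a1|...|as]\<close>.\<close>

definition word :: "('k::field, 'a) module \<Rightarrow> ('a \<Rightarrow> 'k) \<Rightarrow> 'a list \<Rightarrow> ('k, 'a) bar" where
  "word A eps as = coset_of (bar_relations A eps) (Poly_Mapping.single as 1)"

definition bar_grading ::
  "('k::field, 'a) module \<Rightarrow> (int \<Rightarrow> 'a set) \<Rightarrow> ('a \<Rightarrow> 'k) \<Rightarrow> int \<times> int \<Rightarrow> ('k, 'a) bar set" where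
  "bar_grading A G eps g =
     {\<xi> \<in> carrier (bar_space A eps). \<exists>p\<in>\<xi>. Poly_Mapping.keys p \<subseteq>
       {as. int (length as) = fst g \<and>
            (\<exists>ts. list_all2 (\<lambda>a t. a \<in> G t) as ts \<and> sum_list ts = snd g)}}"

text \<open>
  Linear extension of a formula \<open>f ts as\<close>, given for words \<open>as\<close> whose letters are homogeneous of
  degrees \<open>ts\<close>: every letter of a word is split into its homogeneous components.
\<close>

definition bar_lift ::
  "('k::field, 'a) module \<Rightarrow> (int \<Rightarrow> 'a set) \<Rightarrow> ('k, 'u) module \<Rightarrow>
   (int list \<Rightarrow> 'a list \<Rightarrow> 'u) \<Rightarrow> ('k, 'a) bar \<Rightarrow> 'u" where
  "bar_lift A G U f = lift U (\<lambda>as.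
     (\<Oplus>\<^bsub>U\<^esub>ts\<in>{ts. list_all2 (\<lambda>a t. hcomp A G a t \<noteq> \<zero>\<^bsub>A\<^esub>) as ts}.
        f ts (map2 (hcomp A G) as ts)))"

definition bar_sigma :: "int list \<Rightarrow> nat \<Rightarrow> int" where
  "bar_sigma ts i = (\<Sum>t\<leftarrow>take i ts. t + 1)"

definition bar_internal ::
  "('k::field, 'a) module \<Rightarrow> (int \<Rightarrow> 'a set) \<Rightarrow> ('a \<Rightarrow> 'k) \<Rightarrow> ('a \<Rightarrow> 'a) \<Rightarrow>
   ('k, 'a) bar \<Rightarrow> ('k, 'a) bar" where
  "bar_internal A G eps dA = (let B = bar_space A eps in
     bar_lift A G B (\<lambda>ts as.
       (\<Oplus>\<^bsub>B\<^esub>i\<in>{1..length as}. sg B (bar_sigma ts (i - 1))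
          (word A eps (take (i - 1) as @ [dA (as ! (i - 1))] @ drop i as)))))"

definition bar_external ::
  "('k::field, 'a) module \<Rightarrow> (int \<Rightarrow> 'a set) \<Rightarrow> ('a \<Rightarrow> 'k) \<Rightarrow> ('k, 'a) bar \<Rightarrow> ('k, 'a) bar" where
  "bar_external A G eps = (let B = bar_space A eps in
     bar_lift A G B (\<lambda>ts as.
       (\<Oplus>\<^bsub>B\<^esub>i\<in>{1..<length as}. sg B (bar_sigma ts i)
          (word A eps (take (i - 1) as @ [as ! (i - 1) \<otimes>\<^bsub>A\<^esub> as ! i] @ drop (i + 1) as)))))"

definition bar_comult ::
  "('k::field, 'a) module \<Rightarrow> ('a \<Rightarrow> 'k) \<Rightarrow>
   ('k, 'a) bar \<Rightarrow> (('k, 'a) bar \<times> ('k, 'a) bar \<Rightarrow>\<^sub>0 'k) set" where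
  "bar_comult A eps = (let B = bar_space A eps; T = tensor B B in
     lift T (\<lambda>as.
       (\<Oplus>\<^bsub>T\<^esub>i\<in>{0..length as}. tens B B (word A eps (take i as)) (word A eps (drop i as)))))"

text \<open>The projection to external degree 0, which is spanned by the empty word.\<close>

definition bar_counit :: "('k::field, 'a) bar \<Rightarrow> 'k" where
  "bar_counit \<xi> = (THE c. \<exists>p\<in>\<xi>. c = Poly_Mapping.lookup p [])"

definition pq_shuffles :: "nat \<Rightarrow> nat \<Rightarrow> (nat \<Rightarrow> nat) set" where
  "pq_shuffles p q =
     {\<phi>. \<phi> permutes {1..p+q} \<and> strict_mono_on {1..p} \<phi> \<and> strict_mono_on {p+1..p+q} \<phi>}"

text \<open>
  In what follows \<open>ps\<close> and \<open>qs\<close> list the degrees of \<open>x\<^sub>1, ..., x\<^sub>p\<close> and \<open>y\<^sub>1, ..., y\<^sub>q\<close>. Positions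
  are counted from 1, so that \<open>a\<^sub>i\<close> is \<open>(xs @ ys) ! (i - 1)\<close>.
\<close>

definition shuffle_sign :: "int list \<Rightarrow> int list \<Rightarrow> (nat \<Rightarrow> nat) \<Rightarrow> int" where
  "shuffle_sign ps qs \<phi> = (let p = length ps; q = length qs in
     (\<Sum>(i, j)\<in>{(i, j). i \<in> {1..p} \<and> j \<in> {1..q} \<and> \<phi> i > \<phi> (j + p)}.
        (ps ! (i - 1) + 1) * (qs ! (j - 1) + 1)))"

definition bracket_sign :: "nat \<Rightarrow> int list \<Rightarrow> int list \<Rightarrow> (nat \<Rightarrow> nat) \<Rightarrow> nat \<Rightarrow> int" where
  "bracket_sign n ps qs \<phi> i = (let p = length ps; q = length qs in
     int n * ((\<Sum>j\<in>{j\<in>{1..p}. \<phi> j > i + 1}. ps ! (j - 1) + 1) +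
              (\<Sum>j\<in>{j\<in>{1..q}. \<phi> (j + p) < i}. qs ! (j - 1) + 1)))"

definition bar_mult ::
  "('k::field, 'a) module \<Rightarrow> (int \<Rightarrow> 'a set) \<Rightarrow> ('a \<Rightarrow> 'k) \<Rightarrow>
   ('k, 'a) bar \<Rightarrow> ('k, 'a) bar \<Rightarrow> ('k, 'a) bar" where
  "bar_mult A G eps \<xi> \<eta> = (let B = bar_space A eps in
     bar_lift A G B (\<lambda>ps xs. bar_lift A G B (\<lambda>qs ys.
       let p = length xs; q = length ys; a = (\<lambda>i. (xs @ ys) ! (i - 1)) in
       (\<Oplus>\<^bsub>B\<^esub>\<phi>\<in>pq_shuffles p q. sg B (shuffle_sign ps qs \<phi>)
          (word A eps (map (\<lambda>j. a (inv_into UNIV \<phi> j)) [1..<p+q+1])))) \<eta>) \<xi>)"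

definition bar_algebra ::
  "('k::field, 'a) module \<Rightarrow> (int \<Rightarrow> 'a set) \<Rightarrow> ('a \<Rightarrow> 'k) \<Rightarrow> ('k, ('k, 'a) bar) module" where
  "bar_algebra A G eps =
     (bar_space A eps)\<lparr>monoid.mult := bar_mult A G eps, one := word A eps []\<rparr>"

definition bar_bracket_words ::
  "('k::field, 'a) module \<Rightarrow> ('a \<Rightarrow> 'k) \<Rightarrow> ('a \<Rightarrow> 'a \<Rightarrow> 'a) \<Rightarrow> nat \<Rightarrow>
   int list \<Rightarrow> 'a list \<Rightarrow> int list \<Rightarrow> 'a list \<Rightarrow> ('k, 'a) bar" where
  "bar_bracket_words A eps br n ps xs qs ys =
    (let B = bar_space A eps; p = length xs; q = length ys; a = (\<lambda>i. (xs @ ys) ! (i - 1)) in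
     (\<Oplus>\<^bsub>B\<^esub>\<phi>\<in>pq_shuffles p q.
      \<Oplus>\<^bsub>B\<^esub>i\<in>{i. 1 \<le> i \<and> i < p + q \<and> inv_into UNIV \<phi> i \<le> p \<and> inv_into UNIV \<phi> (i + 1) > p}.
        sg B (shuffle_sign ps qs \<phi>)
          (word A eps
            (map (\<lambda>j. a (inv_into UNIV \<phi> j)) [1..<i] @
             [sg A (bracket_sign n ps qs \<phi> i)
                (br (a (inv_into UNIV \<phi> i)) (a (inv_into UNIV \<phi> (i + 1))))] @
             map (\<lambda>j. a (inv_into UNIV \<phi> j)) [i+2..<p+q+1]))))"

end

theory Submission
  imports Defs "HOL-Library.Z2"
begin

text \<open>
  A homogeneous basis \<open>E\<close> of the augmentation ideal identifies the bar construction with the free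
  vector space on the words in \<open>E\<close>. There all structure maps are given by recursions on the first
  letters of words: the first letter of a term of a bracket is the first letter of one of the two
  words, or the bracket of both first letters, after which the remaining words are shuffled. So
  every identity follows by induction on words from the corresponding identity for letters. The
  differentials \<open>d\<close> and \<open>\<delta>\<close> are the coderivations given by the differential and by the product
  of the algebra; that \<open>\<delta>\<close> is a derivation of the bracket is the Poisson identity for letters. The
  antipode is a convolution inverse of the identity, found by recursion on the length of a word.
\<close>

section \<open>Free vector spaces and signs\<close>

text \<open>The weight of the argument lies in the signs. Each letter carries the parity of its
  degree plus one; in these parities the bracket of degree n - 1 has parity n, the product becomes
  antisymmetric, and associativity becomes an alternating identity. Exponents of signs live in the
  two-element field, so comparing two signs is an identity in a commutative ring with x * x = x,
  settled by ring normalisation. The Poisson identity for words has to precede the Jacobi identity: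
  when two of three first letters are bracketed, the words left behind combine a bracket with a
  shuffle product. The second obstacle is the encoding. Elements of the bar construction are cosets,
  and maps out of it are definite descriptions, so nothing can be computed until the quotient is
  known to be free. It is free because the ground ring is a field, which provides a basis of the
  augmentation ideal. Homogeneity of that basis is what makes the signs well defined letter by
  letter. The relation between d and \<delta> comes from squaring d + \<delta>, which is again a
  coderivation.\<close>

declare add_bit_eq_xor [simp del] mult_bit_eq_and [simp del]

text \<open>With a bit as exponent, sums of exponents reduce modulo two by themselves, and the sign
  acts on every abelian group, scalars included.\<close>

definition sc :: "bit \<Rightarrow> 'a::ab_group_add \<Rightarrow> 'a" where
  "sc e x = (if e = 0 then x else - x)"

lemma sc_simps [simp]:
  "sc 0 x = x" "sc 1 x = - x" "sc e 0 = 0"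
  "sc e (x + y) = sc e x + sc e y" "sc e (x - y) = sc e x - sc e y" "sc e (- x) = - sc e x"
  "sc (e + 1) x = - sc e x" "sc (1 + e) x = - sc e x"
  "sc e (sc f x) = sc (e + f) x"
  by (cases e; cases f; simp add: sc_def)+

lemma sc_sum [simp]: "sc e (sum f S) = (\<Sum>x\<in>S. sc e (f x))"
  by (simp add: sc_def sum_negf)

lemma bit_self [simp]: "(a::bit) + a = 0" "a + (a + b) = b" "a * a = a" "a * (a * b) = a * b"
  by (cases a; cases b; simp)+

lemma bit_uminus [simp]: "- (a::bit) = a"
  by (cases a) simp_all

lemmas bit_ring = distrib_left distrib_right mult.commute mult.assoc mult.left_commute
  add.commute add.assoc add.left_commute

lemma lookup_fscale [simp]: "Poly_Mapping.lookup (fscale c p) x = c * Poly_Mapping.lookup p x"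
  by (simp add: fscale_def Poly_Mapping.map.rep_eq when_def)

lemma fscale_add: "fscale c (p + q) = fscale c p + fscale c q"
  by (rule poly_mapping_eqI) (simp add: lookup_add algebra_simps)

lemma fscale_add_left: "fscale (c + d) p = fscale c p + fscale d p"
  by (rule poly_mapping_eqI) (simp add: lookup_add algebra_simps)

lemma fscale_simps [simp]:
  "fscale c (fscale d p) = fscale (c * d) p" "fscale 1 p = p" "fscale 0 p = 0" "fscale c 0 = 0"
  "fscale c (- p) = - fscale c p" "fscale (- c) p = - fscale c p"
  "fscale c (Poly_Mapping.single x d) = Poly_Mapping.single x (c * d)"
  by (auto intro!: poly_mapping_eqI simp: lookup_single when_def)

lemma keys_fscale: "Poly_Mapping.keys (fscale c p) \<subseteq> Poly_Mapping.keys p"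
  by (auto simp: in_keys_iff)

lemma fscale_sc [simp]: "fscale c (sc e p) = sc e (fscale c p)"
  by (simp add: sc_def)

interpretation fs: vector_space "fscale :: 'k::field \<Rightarrow> ('x \<Rightarrow>\<^sub>0 'k) \<Rightarrow> _"
  by unfold_locales (simp_all add: fscale_add fscale_add_left)

abbreviation pt :: "'x \<Rightarrow> ('x \<Rightarrow>\<^sub>0 'k::field)" where
  "pt x \<equiv> Poly_Mapping.single x 1"

lemma poly_mapping_sum_pt:
  fixes p :: "'x \<Rightarrow>\<^sub>0 'k::field"
  shows "p = (\<Sum>x\<in>Poly_Mapping.keys p. fscale (Poly_Mapping.lookup p x) (pt x))"
  by (rule poly_mapping_eqI)
     (auto simp: lookup_sum lookup_single when_def in_keys_iff sum.delta')

definition lin :: "(('x \<Rightarrow>\<^sub>0 'k::field) \<Rightarrow> ('y \<Rightarrow>\<^sub>0 'k)) \<Rightarrow> bool" where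
  "lin f \<longleftrightarrow> (\<forall>p q. f (p + q) = f p + f q) \<and> (\<forall>c p. f (fscale c p) = fscale c (f p))"

definition ext :: "('x \<Rightarrow> ('y \<Rightarrow>\<^sub>0 'k)) \<Rightarrow> ('x \<Rightarrow>\<^sub>0 'k::field) \<Rightarrow> ('y \<Rightarrow>\<^sub>0 'k)" where
  "ext f p = (\<Sum>x\<in>Poly_Mapping.keys p. fscale (Poly_Mapping.lookup p x) (f x))"

lemma linD: "lin f \<Longrightarrow> f (p + q) = f p + f q" "lin f \<Longrightarrow> f (fscale c p) = fscale c (f p)"
  by (auto simp: lin_def)

lemma lin_0: "lin f \<Longrightarrow> f 0 = 0"
  using linD(2)[of f 0 0] by simp

lemma lin_uminus: "lin f \<Longrightarrow> f (- p) = - f p"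
  using linD(2)[of f "- 1" p] by simp

lemma lin_diff: "lin f \<Longrightarrow> f (p - q) = f p - f q"
  using linD(1)[of f p "- q"] lin_uminus[of f q] by simp

lemma lin_sc: "lin f \<Longrightarrow> f (sc e p) = sc e (f p)"
  by (simp add: sc_def lin_uminus)

lemma lin_sum: "lin f \<Longrightarrow> f (sum h S) = (\<Sum>x\<in>S. f (h x))"
  by (induction S rule: infinite_finite_induct) (auto simp: linD lin_0)

lemmas lin_simps = linD lin_0 lin_uminus lin_diff lin_sc lin_sum

lemma ext_superset:
  assumes "finite S" "Poly_Mapping.keys p \<subseteq> S"
  shows "ext f p = (\<Sum>x\<in>S. fscale (Poly_Mapping.lookup p x) (f x))"
  unfolding ext_def by (rule sum.mono_neutral_left) (use assms in \<open>auto simp: in_keys_iff\<close>)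

lemma lin_ext [simp]: "lin (ext f)"
  unfolding lin_def
proof (intro conjI allI)
  fix p q :: "'a \<Rightarrow>\<^sub>0 'b"
  let ?S = "Poly_Mapping.keys p \<union> Poly_Mapping.keys q"
  have "ext f (p + q) = (\<Sum>x\<in>?S. fscale (Poly_Mapping.lookup (p + q) x) (f x))"
    by (rule ext_superset) (use Poly_Mapping.keys_add[of p q] in auto)
  also have "\<dots> = ext f p + ext f q"
    by (simp add: ext_superset[of ?S p] ext_superset[of ?S q] lookup_add fscale_add_left sum.distrib)
  finally show "ext f (p + q) = ext f p + ext f q" .
next
  fix c and p :: "'a \<Rightarrow>\<^sub>0 'b"
  show "ext f (fscale c p) = fscale c (ext f p)"
    by (simp add: ext_superset[OF _ keys_fscale] ext_def[of f p] fs.scale_sum_right)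
qed

lemmas ext_simps [simp] = lin_simps[OF lin_ext]

lemma ext_pt [simp]: "ext f (pt x) = f x"
  by (simp add: ext_def)

lemma lin_ext_eq: "lin f \<Longrightarrow> f p = ext (\<lambda>x. f (pt x)) p"
  by (subst poly_mapping_sum_pt[of p]) (simp only: lin_sum linD ext_def)

lemma ext_cong: "(\<And>x. x \<in> Poly_Mapping.keys p \<Longrightarrow> f x = g x) \<Longrightarrow> ext f p = ext g p"
  by (simp add: ext_def)

text \<open>Only points in the support of \<open>p\<close> are tested, so a homogeneity assumption
  on \<open>p\<close> turns into a degree equation at each tested point.\<close>

lemma lin_eqI:
  assumes "lin f" "lin g" "\<And>x. x \<in> Poly_Mapping.keys p \<Longrightarrow> f (pt x) = g (pt x)"
  shows "f p = g p"
proof -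
  have "f p = ext (\<lambda>x. f (pt x)) p" using assms(1) by (rule lin_ext_eq)
  also have "\<dots> = ext (\<lambda>x. g (pt x)) p" using assms(3) by (rule ext_cong)
  also have "\<dots> = g p" using assms(2) by (rule lin_ext_eq[symmetric])
  finally show ?thesis .
qed

lemma ext_add_fun: "ext (\<lambda>x. f x + g x) p = ext f p + ext g p"
  by (simp add: ext_def fscale_add sum.distrib)

lemma ext_fscale_fun: "ext (\<lambda>x. fscale c (f x)) p = fscale c (ext f p)"
  by (simp add: ext_def fs.scale_sum_right mult.commute)

lemma ext_pt_id [simp]: "ext pt p = p"
  using poly_mapping_sum_pt[of p] by (simp add: ext_def)

lemma ext_zero_fun [simp]: "ext (\<lambda>x. 0) p = 0"
  by (simp add: ext_def)

lemma lin_lin_ext: "lin f \<Longrightarrow> f (ext g p) = ext (\<lambda>x. f (g x)) p"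
  by (simp add: ext_def lin_simps)

definition ext2 :: "('x \<Rightarrow> 'y \<Rightarrow> ('z \<Rightarrow>\<^sub>0 'k)) \<Rightarrow> ('x \<Rightarrow>\<^sub>0 'k::field) \<Rightarrow> ('y \<Rightarrow>\<^sub>0 'k) \<Rightarrow> ('z \<Rightarrow>\<^sub>0 'k)" where
  "ext2 f p q = ext (\<lambda>x. ext (f x) q) p"

lemma lin_ext2: "lin (\<lambda>p. ext2 f p q)" "lin (\<lambda>q. ext2 f p q)"
  by (simp_all add: ext2_def lin_def ext_add_fun ext_fscale_fun)

lemmas ext2_simps [simp] = lin_simps[OF lin_ext2(1)] lin_simps[OF lin_ext2(2)]

lemma ext2_pt: "ext2 f (pt x) (pt y) = f x y"
  by (simp add: ext2_def)

named_theorems lin_intros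

lemma lin_comp: "lin f \<Longrightarrow> lin g \<Longrightarrow> lin (\<lambda>p. f (g p))"
  by (simp add: lin_def)

lemma lin_id [lin_intros]: "lin (\<lambda>p. p)" and lin_zero [lin_intros]: "lin (\<lambda>p. 0)"
  by (simp_all add: lin_def)

lemma lin_add [lin_intros]: "lin f \<Longrightarrow> lin g \<Longrightarrow> lin (\<lambda>p. f p + g p)"
  by (simp add: lin_def algebra_simps fscale_add)

lemma lin_minus [lin_intros]: "lin f \<Longrightarrow> lin (\<lambda>p. - f p)"
  by (simp add: lin_def)

lemma lin_sub [lin_intros]: "lin f \<Longrightarrow> lin g \<Longrightarrow> lin (\<lambda>p. f p - g p)"
  using lin_add[of f "\<lambda>p. - g p"] lin_minus[of g] by simp

lemma lin_sc_fun [lin_intros]: "lin f \<Longrightarrow> lin (\<lambda>p. sc e (f p))"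
  by (simp add: lin_def)

lemma lin_fscale_fun [lin_intros]: "lin f \<Longrightarrow> lin (\<lambda>p. fscale c (f p))"
  by (simp add: lin_def fscale_add mult.commute)

lemma lin_sum_fun [lin_intros]: "(\<And>i. i \<in> S \<Longrightarrow> lin (f i)) \<Longrightarrow> lin (\<lambda>p. \<Sum>i\<in>S. f i p)"
  by (induction S rule: infinite_finite_induct) (auto intro: lin_intros)

lemma lin_ext_comp [lin_intros]: "lin f \<Longrightarrow> lin (\<lambda>p. ext h (f p))"
  by (rule lin_comp[OF lin_ext])

lemma lin_ext2_comp_left [lin_intros]: "lin f \<Longrightarrow> lin (\<lambda>p. ext2 h (f p) q)"
  by (rule lin_comp[OF lin_ext2(1)])

lemma lin_ext2_comp_right [lin_intros]: "lin f \<Longrightarrow> lin (\<lambda>p. ext2 h q (f p))"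
  by (rule lin_comp[OF lin_ext2(2)])

lemma lin_eqI2:
  assumes "\<And>q. lin (\<lambda>p. f p q)" "\<And>q. lin (\<lambda>p. g p q)" "\<And>p. lin (f p)" "\<And>p. lin (g p)"
    "\<And>x y. x \<in> Poly_Mapping.keys p \<Longrightarrow> y \<in> Poly_Mapping.keys q \<Longrightarrow> f (pt x) (pt y) = g (pt x) (pt y)"
  shows "f p q = g p q"
proof (rule lin_eqI[of "\<lambda>p. f p q" "\<lambda>p. g p q"])
  fix x assume "x \<in> Poly_Mapping.keys p"
  then show "f (pt x) q = g (pt x) q"
    using assms by (intro lin_eqI[of "f (pt x)" "g (pt x)" q]) auto
qed (use assms in auto)

lemma lin_eqI3:
  assumes "\<And>q r. lin (\<lambda>p. f p q r)" "\<And>q r. lin (\<lambda>p. g p q r)"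
    "\<And>p r. lin (\<lambda>q. f p q r)" "\<And>p r. lin (\<lambda>q. g p q r)" "\<And>p q. lin (f p q)" "\<And>p q. lin (g p q)"
    "\<And>x y z. x \<in> Poly_Mapping.keys p \<Longrightarrow> y \<in> Poly_Mapping.keys q \<Longrightarrow> z \<in> Poly_Mapping.keys r \<Longrightarrow>
      f (pt x) (pt y) (pt z) = g (pt x) (pt y) (pt z)"
  shows "f p q r = g p q r"
proof (rule lin_eqI[of "\<lambda>p. f p q r" "\<lambda>p. g p q r"])
  fix x assume "x \<in> Poly_Mapping.keys p"
  then show "f (pt x) q r = g (pt x) q r"
    using assms by (intro lin_eqI2[of "f (pt x)" "g (pt x)" q r]) auto
qed (use assms in auto)

definition homog :: "('x \<Rightarrow> 'g) \<Rightarrow> 'g \<Rightarrow> ('x \<Rightarrow>\<^sub>0 'k::field) \<Rightarrow> bool" where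
  "homog D g p \<longleftrightarrow> (\<forall>x\<in>Poly_Mapping.keys p. D x = g)"

lemma homog_pt [simp, intro]: "homog D (D x) (pt x)"
  by (simp add: homog_def)

lemma homog_0 [simp, intro]: "homog D g 0"
  by (simp add: homog_def)

lemma homog_add [intro]: "homog D g p \<Longrightarrow> homog D g q \<Longrightarrow> homog D g (p + q)"
  using Poly_Mapping.keys_add[of p q] by (auto simp: homog_def)

lemma homog_uminus [intro]: "homog D g p \<Longrightarrow> homog D g (- p)"
  by (auto simp: homog_def in_keys_iff)

lemma homog_fscale [intro]: "homog D g p \<Longrightarrow> homog D g (fscale c p)"
  by (auto simp: homog_def in_keys_iff)

lemma homog_sc [intro]: "homog D g p \<Longrightarrow> homog D g (sc e p)"
  by (auto simp: sc_def homog_uminus)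

lemma homog_sum [intro]: "(\<And>x. x \<in> S \<Longrightarrow> homog D g (f x)) \<Longrightarrow> homog D g (sum f S)"
  by (induction S rule: infinite_finite_induct) auto

lemma homog_ext:
  assumes "\<And>x. D x = g \<Longrightarrow> homog D' g' (f x)" "homog D g p"
  shows "homog D' g' (ext f p)"
  using assms unfolding ext_def homog_def[of D g p] by (intro homog_sum homog_fscale) auto

lemma homog_ext2:
  assumes "\<And>x y. D1 x = g \<Longrightarrow> D2 y = h \<Longrightarrow> homog D' g' (f x y)" "homog D1 g p" "homog D2 h q"
  shows "homog D' g' (ext2 f p q)"
  unfolding ext2_def
  by (rule homog_ext[where D=D1 and g=g], rule homog_ext[where D=D2 and g=h]) (use assms in auto)

section \<open>Shuffles of words\<close>

lemma lin_eqI4: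
  assumes "\<And>q r s. lin (\<lambda>p. f p q r s)" "\<And>q r s. lin (\<lambda>p. g p q r s)"
    "\<And>p r s. lin (\<lambda>q. f p q r s)" "\<And>p r s. lin (\<lambda>q. g p q r s)"
    "\<And>p q s. lin (\<lambda>r. f p q r s)" "\<And>p q s. lin (\<lambda>r. g p q r s)"
    "\<And>p q r. lin (f p q r)" "\<And>p q r. lin (g p q r)"
    "\<And>x y z w. x \<in> Poly_Mapping.keys p \<Longrightarrow> y \<in> Poly_Mapping.keys q \<Longrightarrow> z \<in> Poly_Mapping.keys r \<Longrightarrow>
      w \<in> Poly_Mapping.keys s \<Longrightarrow> f (pt x) (pt y) (pt z) (pt w) = g (pt x) (pt y) (pt z) (pt w)"
  shows "f p q r s = g p q r s"
proof (rule lin_eqI[of "\<lambda>p. f p q r s" "\<lambda>p. g p q r s"])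
  fix x assume "x \<in> Poly_Mapping.keys p"
  then show "f (pt x) q r s = g (pt x) q r s"
    using assms by (intro lin_eqI3[of "f (pt x)" "g (pt x)" q r s]) auto
qed (use assms in auto)

lemma word_induct2 [case_names Nil_left Nil_right step]:
  assumes "\<And>v. R [] v" "\<And>u. R u []"
    "\<And>a u b v. R u (b # v) \<Longrightarrow> R (a # u) v \<Longrightarrow> R u v \<Longrightarrow> R (a # u) (b # v)"
  shows "R u v"
proof (induction "length u + length v" arbitrary: u v rule: less_induct)
  case less
  show ?case
  proof (cases "u = [] \<or> v = []")
    case False
    then obtain a u' b v' where "u = a # u'" "v = b # v'"
      by (meson neq_Nil_conv)
    then show ?thesis using assms(3) less by simp
  qed (use assms(1,2) in auto)
qed

lemma word_induct3 [case_names Nil_left Nil_mid Nil_right step]: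
  assumes "\<And>v w. R [] v w" "\<And>u w. R u [] w" "\<And>u v. R u v []"
    "\<And>a u b v c w. R u (b # v) (c # w) \<Longrightarrow> R (a # u) v (c # w) \<Longrightarrow> R (a # u) (b # v) w \<Longrightarrow>
      R u v (c # w) \<Longrightarrow> R u (b # v) w \<Longrightarrow> R (a # u) v w \<Longrightarrow> R u v w \<Longrightarrow> R (a # u) (b # v) (c # w)"
  shows "R u v w"
proof (induction "length u + length v + length w" arbitrary: u v w rule: less_induct)
  case less
  show ?case
  proof (cases "u = [] \<or> v = [] \<or> w = []")
    case False
    then obtain a u' b v' c w' where "u = a # u'" "v = b # v'" "w = c # w'"
      by (meson neq_Nil_conv)
    then show ?thesis using assms(4) less by simp
  qed (use assms(1,2,3) in auto)
qed

text \<open>Polymorphic in the degree: parities govern the signs, bidegrees the grading, and the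
  same homogeneity lemmas serve both.\<close>

abbreviation wd :: "('e \<Rightarrow> 'g::comm_monoid_add) \<Rightarrow> 'e list \<Rightarrow> 'g" where
  "wd D w \<equiv> sum_list (map D w)"

abbreviation cv :: "('e \<Rightarrow>\<^sub>0 'k::field) \<Rightarrow> ('e list \<Rightarrow>\<^sub>0 'k) \<Rightarrow> ('e list \<Rightarrow>\<^sub>0 'k)" where
  "cv \<equiv> ext2 (\<lambda>a w. pt (a # w))"

lemma cv_pt [simp]: "cv (pt a) (pt w) = pt (a # w)"
  by (simp add: ext2_pt)

lemma homog_cv:
  "homog D dx x \<Longrightarrow> homog (wd D) dp p \<Longrightarrow> homog (wd D) (dx + dp) (cv x p)"
  by (rule homog_ext2[of D dx "wd D" dp]) (auto simp: homog_def)

text \<open>The sign in the last clause is the Koszul sign for moving \<open>b\<close> in front of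
  all of \<open>a # u\<close>. Inversions are thus counted one letter at a time, without
  permutations.\<close>

fun shw :: "('e \<Rightarrow> bit) \<Rightarrow> 'e list \<Rightarrow> 'e list \<Rightarrow> ('e list \<Rightarrow>\<^sub>0 'k::field)" where
  "shw par [] v = pt v"
| "shw par (a # u) [] = pt (a # u)"
| "shw par (a # u) (b # v) =
     cv (pt a) (shw par u (b # v)) + sc (par b * wd par (a # u)) (cv (pt b) (shw par (a # u) v))"

lemma homog_shw: "homog (wd D) (wd D u + wd D v) (shw par u v)"
proof (induction par u v rule: shw.induct)
  case (1 par v)
  then show ?case using homog_pt[of "wd D" v] by simp
next
  case (2 par a u)
  then show ?case using homog_pt[of "wd D" "a # u"] by simp
next
  case (3 par a u b v)
  show ?case
    using homog_cv[OF homog_pt 3(1), of a] homog_sc[OF homog_cv[OF homog_pt 3(2)], of b]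
    by (simp add: homog_add ac_simps)
qed

lemma homog_Sh:
  "homog (wd D) dp p \<Longrightarrow> homog (wd D) dq q \<Longrightarrow> homog (wd D) (dp + dq) (ext2 (shw par) p q)"
  by (rule homog_ext2[of "wd D" dp "wd D" dq]) (auto simp: homog_shw)

locale shuffle_words =
  fixes par :: "'e \<Rightarrow> bit" and ty :: "'k::field itself"
begin

abbreviation Sh :: "('e list \<Rightarrow>\<^sub>0 'k) \<Rightarrow> ('e list \<Rightarrow>\<^sub>0 'k) \<Rightarrow> ('e list \<Rightarrow>\<^sub>0 'k)" where
  "Sh \<equiv> ext2 (shw par)"

abbreviation hl :: "bit \<Rightarrow> ('e \<Rightarrow>\<^sub>0 'k) \<Rightarrow> bool" where "hl \<equiv> homog par"
abbreviation hw :: "bit \<Rightarrow> ('e list \<Rightarrow>\<^sub>0 'k) \<Rightarrow> bool" where "hw \<equiv> homog (wd par)"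

lemma Sh_Nil [simp]: "Sh (pt []) p = p" "Sh p (pt []) = p"
proof -
  show "Sh (pt []) p = p"
    by (rule lin_eqI[of "\<lambda>p. Sh (pt []) p"]) (auto intro!: lin_intros simp: ext2_pt)
  have [simp]: "shw par u [] = pt u" for u by (cases u) auto
  show "Sh p (pt []) = p"
    by (rule lin_eqI[of "\<lambda>p. Sh p (pt [])"]) (auto intro!: lin_intros simp: ext2_pt)
qed

text \<open>The recursion is restated for homogeneous combinations, so that it applies again when
  the first letter is itself a bracket of letters or the tail is itself a shuffle product.\<close>

lemma Sh_cv:
  assumes "hl dx x" "hw dp p" "hl dy y"
  shows "Sh (cv x p) (cv y q) = cv x (Sh p (cv y q)) + sc (dy * (dx + dp)) (cv y (Sh (cv x p) q))"
proof (rule lin_eqI4[of "\<lambda>x p y q. Sh (cv x p) (cv y q)"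
      "\<lambda>x p y q. cv x (Sh p (cv y q)) + sc (dy * (dx + dp)) (cv y (Sh (cv x p) q))"])
  fix a u b v
  assume "a \<in> Poly_Mapping.keys x" "u \<in> Poly_Mapping.keys p" "b \<in> Poly_Mapping.keys y"
  then have "par a = dx" "wd par u = dp" "par b = dy"
    using assms by (auto simp: homog_def)
  then show "Sh (cv (pt a) (pt u)) (cv (pt b) (pt v)) = cv (pt a) (Sh (pt u) (cv (pt b) (pt v)))
      + sc (dy * (dx + dp)) (cv (pt b) (Sh (cv (pt a) (pt u)) (pt v)))"
    by (simp add: ext2_pt[of "shw par"])
qed (rule lin_intros)+

text \<open>Triple products are sorted by the word that supplies the first letter. The other
  bracketing gives the same three signs, so associativity reduces to shorter words.\<close>

lemma Sh_cv3_right: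
  assumes x: "hl dx x" and p: "hw dp p" and y: "hl dy y" and q: "hw dq q" and z: "hl dz z"
  shows "Sh (cv x p) (Sh (cv y q) (cv z r)) = cv x (Sh p (Sh (cv y q) (cv z r)))
    + sc (dy * (dx + dp)) (cv y (Sh (cv x p) (Sh q (cv z r))))
    + sc (dz * (dx + dp + dy + dq)) (cv z (Sh (cv x p) (Sh (cv y q) r)))"
  by (simp add: Sh_cv[OF y q z] Sh_cv[OF x p y] Sh_cv[OF x p z] bit_ring)

lemma Sh_cv3_left:
  assumes x: "hl dx x" and p: "hw dp p" and y: "hl dy y" and q: "hw dq q" and z: "hl dz z"
  shows "Sh (Sh (cv x p) (cv y q)) (cv z r) = cv x (Sh (Sh p (cv y q)) (cv z r))
    + sc (dy * (dx + dp)) (cv y (Sh (Sh (cv x p) q) (cv z r)))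
    + sc (dz * (dx + dp + dy + dq)) (cv z (Sh (Sh (cv x p) (cv y q)) r))"
proof -
  note 1 = Sh_cv[OF x homog_Sh[OF p homog_cv[OF y q]] z]
  note 2 = Sh_cv[OF y homog_Sh[OF homog_cv[OF x p] q] z]
  show ?thesis by (simp add: Sh_cv[OF x p y] 1 2 bit_ring)
qed

lemma Sh_assoc_pt: "Sh (Sh (pt u) (pt v)) (pt w) = Sh (pt u) (Sh (pt v) (pt w))"
proof (induction u v w rule: word_induct3)
  case (step a u b v c w)
  show ?case
    using Sh_cv3_left[OF homog_pt homog_pt homog_pt homog_pt homog_pt, of a u b v c "pt w"]
      Sh_cv3_right[OF homog_pt homog_pt homog_pt homog_pt homog_pt, of a u b v c "pt w"]
      step by simp
qed auto

lemma Sh_assoc: "Sh (Sh p q) r = Sh p (Sh q r)"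
  by (rule lin_eqI3[of "\<lambda>p q r. Sh (Sh p q) r" "\<lambda>p q r. Sh p (Sh q r)"]; ((rule lin_intros)+)?)
     (rule Sh_assoc_pt)

lemma Sh_comm_pt: "Sh (pt u) (pt v) = sc (wd par u * wd par v) (Sh (pt v) (pt u))"
proof (induction u v rule: word_induct2)
  case (step a u b v)
  have 1: "Sh (pt (a # u)) (pt (b # v)) =
      cv (pt a) (Sh (pt u) (pt (b # v))) + sc (par b * (par a + wd par u)) (cv (pt b) (Sh (pt (a # u)) (pt v)))"
    using Sh_cv[OF homog_pt homog_pt homog_pt, of a u b "pt v"] by simp
  have 2: "Sh (pt (b # v)) (pt (a # u)) =
      cv (pt b) (Sh (pt v) (pt (a # u))) + sc (par a * (par b + wd par v)) (cv (pt a) (Sh (pt (b # v)) (pt u)))"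
    using Sh_cv[OF homog_pt homog_pt homog_pt, of b v a "pt u"] by simp
  show ?case
    unfolding 1 2 step(1,2) by (simp add: bit_ring)
qed auto

lemma Sh_comm: "hw dp p \<Longrightarrow> hw dq q \<Longrightarrow> Sh p q = sc (dp * dq) (Sh q p)"
  by (rule lin_eqI2[of "\<lambda>p q. Sh p q" "\<lambda>p q. sc (dp * dq) (Sh q p)"]; ((rule lin_intros)+)?)
     (simp add: homog_def, subst Sh_comm_pt, simp)

lemma Sh_left_comm: "hw dp p \<Longrightarrow> hw dq q \<Longrightarrow> Sh p (Sh q r) = sc (dp * dq) (Sh q (Sh p r))"
  by (subst (1 2) Sh_assoc[symmetric], subst Sh_comm[of dp p dq q]) simp_all

end

section \<open>The bracket on words\<close>

text \<open>The signs follow the Koszul rule with a bracket symbol of parity \<open>n\<close>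
  standing between the two words: in the second summand \<open>b\<close> passes that symbol and all
  of \<open>a # u\<close>; in the third the symbol and \<open>b\<close> together pass
  \<open>u\<close> to reach \<open>a\<close>.\<close>

fun brw :: "('e \<Rightarrow> bit) \<Rightarrow> bit \<Rightarrow> ('e \<Rightarrow> 'e \<Rightarrow> ('e \<Rightarrow>\<^sub>0 'k::field)) \<Rightarrow> 'e list \<Rightarrow> 'e list \<Rightarrow> ('e list \<Rightarrow>\<^sub>0 'k)"
where
  "brw par n \<beta> [] v = 0"
| "brw par n \<beta> (a # u) [] = 0"
| "brw par n \<beta> (a # u) (b # v) =
     cv (pt a) (brw par n \<beta> u (b # v))
     + sc (par b * (wd par (a # u) + n)) (cv (pt b) (brw par n \<beta> (a # u) v))
     + sc ((par b + n) * wd par u) (cv (\<beta> a b) (shw par u v))"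

lemma homog_brw:
  assumes "\<And>a b. homog D (D a + D b + c) (\<beta> a b)"
  shows "homog (wd D) (wd D u + wd D v + c) (brw par n \<beta> u v)"
proof (induction u v rule: word_induct2)
  case (Nil_right u)
  then show ?case by (cases u) auto
next
  case (step a u b v)
  have "homog (wd D) (wd D (a # u) + wd D (b # v) + c) (cv (pt a) (brw par n \<beta> u (b # v)))"
    using homog_cv[OF homog_pt step(1), of a] by (simp add: ac_simps)
  moreover have "homog (wd D) (wd D (a # u) + wd D (b # v) + c) (cv (pt b) (brw par n \<beta> (a # u) v))"
    using homog_cv[OF homog_pt step(2), of b] by (simp add: ac_simps)
  moreover have "homog (wd D) (wd D (a # u) + wd D (b # v) + c) (cv (\<beta> a b) (shw par u v))"
    using homog_cv[OF assms homog_shw, of a b] by (simp add: ac_simps)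
  ultimately show ?case by (simp add: homog_add homog_sc)
qed auto

lemma homog_Br:
  "(\<And>a b. homog D (D a + D b + c) (\<beta> a b)) \<Longrightarrow> homog (wd D) dp p \<Longrightarrow> homog (wd D) dq q \<Longrightarrow>
    homog (wd D) (dp + dq + c) (ext2 (brw par n \<beta>) p q)"
  by (rule homog_ext2[of "wd D" dp "wd D" dq]) (use homog_brw[of D c \<beta>] in auto)

text \<open>The laws of a graded Lie bracket of parity \<open>n\<close>, written in parities that
  are meant to include the shift of each letter by one.\<close>

locale bracket_words = shuffle_words par ty
  for par :: "'e \<Rightarrow> bit" and ty :: "'k::field itself" +
  fixes n :: bit and \<beta> :: "'e \<Rightarrow> 'e \<Rightarrow> ('e \<Rightarrow>\<^sub>0 'k)"
  assumes bracket_par: "homog par (par a + par b + n) (\<beta> a b)"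
    and bracket_antisym: "\<beta> a b = - sc ((par a + n) * (par b + n)) (\<beta> b a)"
    and bracket_jacobi: "ext2 \<beta> (pt a) (\<beta> b c) =
      ext2 \<beta> (\<beta> a b) (pt c) + sc ((par a + n) * (par b + n)) (ext2 \<beta> (pt b) (\<beta> a c))"
begin

abbreviation Be :: "('e \<Rightarrow>\<^sub>0 'k) \<Rightarrow> ('e \<Rightarrow>\<^sub>0 'k) \<Rightarrow> ('e \<Rightarrow>\<^sub>0 'k)" where "Be \<equiv> ext2 \<beta>"
abbreviation Br :: "('e list \<Rightarrow>\<^sub>0 'k) \<Rightarrow> ('e list \<Rightarrow>\<^sub>0 'k) \<Rightarrow> ('e list \<Rightarrow>\<^sub>0 'k)" where
  "Br \<equiv> ext2 (brw par n \<beta>)"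

lemma Be_par: "hl dx x \<Longrightarrow> hl dy y \<Longrightarrow> hl (dx + dy + n) (Be x y)"
  by (rule homog_ext2[of par dx par dy]) (auto intro: bracket_par)

lemma Br_par: "hw dp p \<Longrightarrow> hw dq q \<Longrightarrow> hw (dp + dq + n) (Br p q)"
  by (rule homog_Br[OF bracket_par])

lemma Be_antisym:
  assumes "hl dx x" "hl dy y"
  shows "Be x y = - sc ((dx + n) * (dy + n)) (Be y x)"
proof (rule lin_eqI2[of "\<lambda>x y. Be x y" "\<lambda>x y. - sc ((dx + n) * (dy + n)) (Be y x)"])
  fix a b assume "a \<in> Poly_Mapping.keys x" "b \<in> Poly_Mapping.keys y"
  then have "par a = dx" "par b = dy" using assms by (auto simp: homog_def)
  then show "Be (pt a) (pt b) = - sc ((dx + n) * (dy + n)) (Be (pt b) (pt a))"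
    unfolding ext2_pt using bracket_antisym[of a b] by simp
qed (rule lin_intros)+

lemma Be_jacobi:
  assumes "hl dx x" "hl dy y"
  shows "Be x (Be y z) = Be (Be x y) z + sc ((dx + n) * (dy + n)) (Be y (Be x z))"
proof (rule lin_eqI3[of "\<lambda>x y z. Be x (Be y z)"
      "\<lambda>x y z. Be (Be x y) z + sc ((dx + n) * (dy + n)) (Be y (Be x z))"])
  fix a b c assume "a \<in> Poly_Mapping.keys x" "b \<in> Poly_Mapping.keys y"
  then have "par a = dx" "par b = dy" using assms by (auto simp: homog_def)
  then show "Be (pt a) (Be (pt b) (pt c)) = Be (Be (pt a) (pt b)) (pt c)
      + sc ((dx + n) * (dy + n)) (Be (pt b) (Be (pt a) (pt c)))"
    using bracket_jacobi[of a b c] by (simp add: ext2_pt)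
qed (rule lin_intros)+

lemma Br_Nil [simp]: "Br (pt []) p = 0" "Br p (pt []) = 0"
proof -
  show "Br (pt []) p = 0"
    by (rule lin_eqI[of "\<lambda>p. Br (pt []) p" "\<lambda>p. 0"]) (auto intro!: lin_intros simp: ext2_pt)
  have [simp]: "brw par n \<beta> u [] = 0" for u by (cases u) auto
  show "Br p (pt []) = 0"
    by (rule lin_eqI[of "\<lambda>p. Br p (pt [])" "\<lambda>p. 0"]) (auto intro!: lin_intros simp: ext2_pt)
qed

lemma Br_cv:
  assumes "hl dx x" "hw dp p" "hl dy y"
  shows "Br (cv x p) (cv y q) = cv x (Br p (cv y q)) + sc (dy * (dx + dp + n)) (cv y (Br (cv x p) q))
    + sc ((dy + n) * dp) (cv (Be x y) (Sh p q))"
proof (rule lin_eqI4[of "\<lambda>x p y q. Br (cv x p) (cv y q)"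
      "\<lambda>x p y q. cv x (Br p (cv y q)) + sc (dy * (dx + dp + n)) (cv y (Br (cv x p) q))
        + sc ((dy + n) * dp) (cv (Be x y) (Sh p q))"])
  fix a u b v
  assume "a \<in> Poly_Mapping.keys x" "u \<in> Poly_Mapping.keys p" "b \<in> Poly_Mapping.keys y"
  then have "par a = dx" "wd par u = dp" "par b = dy"
    using assms by (auto simp: homog_def)
  then show "Br (cv (pt a) (pt u)) (cv (pt b) (pt v)) = cv (pt a) (Br (pt u) (cv (pt b) (pt v)))
      + sc (dy * (dx + dp + n)) (cv (pt b) (Br (cv (pt a) (pt u)) (pt v)))
      + sc ((dy + n) * dp) (cv (Be (pt a) (pt b)) (Sh (pt u) (pt v)))"
    by (simp add: ext2_pt[of "shw par"] ext2_pt[of "brw par n \<beta>"] ext2_pt[of \<beta>])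
qed (rule lin_intros)+

text \<open>Swapping the words exchanges the terms that begin with \<open>a\<close> and with
  \<open>b\<close>. The terms that begin with a bracket match by antisymmetry for letters together
  with commutativity of the shuffle product of the tails.\<close>

lemma Br_antisym_pt: "Br (pt u) (pt v) = - sc ((wd par u + n) * (wd par v + n)) (Br (pt v) (pt u))"
proof (induction u v rule: word_induct2)
  case (step a u b v)
  have 1: "Br (pt (a # u)) (pt (b # v)) = cv (pt a) (Br (pt u) (pt (b # v)))
      + sc (par b * (par a + wd par u + n)) (cv (pt b) (Br (pt (a # u)) (pt v)))
      + sc ((par b + n) * wd par u) (cv (Be (pt a) (pt b)) (Sh (pt u) (pt v)))"
    using Br_cv[OF homog_pt homog_pt homog_pt, of a u b "pt v"] by simp
  have 2: "Br (pt (b # v)) (pt (a # u)) = cv (pt b) (Br (pt v) (pt (a # u)))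
      + sc (par a * (par b + wd par v + n)) (cv (pt a) (Br (pt (b # v)) (pt u)))
      + sc ((par a + n) * wd par v) (cv (Be (pt b) (pt a)) (Sh (pt v) (pt u)))"
    using Br_cv[OF homog_pt homog_pt homog_pt, of b v a "pt u"] by simp
  show ?case
    unfolding 1 2 step(1,2) Be_antisym[OF homog_pt homog_pt, of a b] Sh_comm_pt[of u v]
    by (simp add: bit_ring)
qed auto

lemma Br_antisym:
  "hw dp p \<Longrightarrow> hw dq q \<Longrightarrow> Br p q = - sc ((dp + n) * (dq + n)) (Br q p)"
  by (rule lin_eqI2[of "\<lambda>p q. Br p q" "\<lambda>p q. - sc ((dp + n) * (dq + n)) (Br q p)"];
      ((rule lin_intros)+)?)
     (simp add: homog_def, subst Br_antisym_pt, simp)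

lemma Br_cv_Sh:
  assumes x: "hl dx x" and p: "hw dp p" and y: "hl dy y" and q: "hw dq q" and z: "hl dz z"
  shows "Br (cv x p) (Sh (cv y q) (cv z r)) = cv x (Br p (Sh (cv y q) (cv z r)))
    + sc (dy * (dx + dp + n)) (cv y (Br (cv x p) (Sh q (cv z r))))
    + sc (dz * (dx + dp + n + dy + dq)) (cv z (Br (cv x p) (Sh (cv y q) r)))
    + sc ((dy + n) * dp) (cv (Be x y) (Sh p (Sh q (cv z r))))
    + sc ((dy + dq) * dz + (dz + n) * dp) (cv (Be x z) (Sh p (Sh (cv y q) r)))"
  by (simp add: Sh_cv[OF y q z] Br_cv[OF x p y] Br_cv[OF x p z] bit_ring)

lemma Sh_Br_cv:
  assumes x: "hl dx x" and p: "hw dp p" and y: "hl dy y" and q: "hw dq q" and z: "hl dz z"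
  shows "Sh (Br (cv x p) (cv y q)) (cv z r) = cv x (Sh (Br p (cv y q)) (cv z r))
    + sc (dy * (dx + dp + n)) (cv y (Sh (Br (cv x p) q) (cv z r)))
    + sc (dz * (dx + dp + dy + dq + n)) (cv z (Sh (Br (cv x p) (cv y q)) r))
    + sc ((dy + n) * dp) (cv (Be x y) (Sh (Sh p q) (cv z r)))"
proof -
  note 1 = Sh_cv[OF x Br_par[OF p homog_cv[OF y q]] z]
  note 2 = Sh_cv[OF y Br_par[OF homog_cv[OF x p] q] z]
  note 3 = Sh_cv[OF Be_par[OF x y] homog_Sh[OF p q] z]
  show ?thesis by (simp add: Br_cv[OF x p y] 1 2 3 bit_ring)
qed

lemma Sh_cv_Br:
  assumes x: "hl dx x" and p: "hw dp p" and y: "hl dy y" and q: "hw dq q" and z: "hl dz z"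
  shows "Sh (cv y q) (Br (cv x p) (cv z r)) = cv y (Sh q (Br (cv x p) (cv z r)))
    + sc (dx * (dy + dq)) (cv x (Sh (cv y q) (Br p (cv z r))))
    + sc (dz * (dx + dp + dy + dq + n)) (cv z (Sh (cv y q) (Br (cv x p) r)))
    + sc ((dz + n) * dp + (dx + dz + n) * (dy + dq)) (cv (Be x z) (Sh (cv y q) (Sh p r)))"
  by (simp add: Br_cv[OF x p z] Sh_cv[OF y q x] Sh_cv[OF y q z] Sh_cv[OF y q Be_par[OF x z]] bit_ring)

text \<open>Five kinds of first letter occur. For \<open>a\<close>, \<open>b\<close> and
  \<open>c\<close> the induction hypotheses apply; for the bracket of \<open>a\<close> and
  \<open>b\<close> the tails agree by associativity of the shuffle product, and for that of
  \<open>a\<close> and \<open>c\<close> by moving \<open>u\<close> past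
  \<open>b # v\<close>.\<close>

lemma Br_Sh_pt:
  "Br (pt u) (Sh (pt v) (pt w)) = Sh (Br (pt u) (pt v)) (pt w)
    + sc (wd par v * (wd par u + n)) (Sh (pt v) (Br (pt u) (pt w)))"
proof (induction u v w rule: word_induct3)
  case (step a u b v c w)
  note h = homog_pt[of "wd par" u] homog_pt[of par b] homog_pt[of "wd par" v] homog_pt[of par c]
  note 1 = Br_cv_Sh[OF homog_pt h, of a "pt w"]
  note 2 = Sh_Br_cv[OF homog_pt h, of a "pt w"]
  note 3 = Sh_cv_Br[OF homog_pt h, of a "pt w"]
  note 4 = Sh_left_comm[OF homog_pt homog_pt, of u "b # v" "pt w"]
  show ?case
    unfolding 1[unfolded cv_pt] 2[unfolded cv_pt] 3[unfolded cv_pt] step(1-3) 4 Sh_assoc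
    by (simp add: bit_ring)
qed auto

lemma Br_Sh:
  assumes "hw dp p" "hw dq q"
  shows "Br p (Sh q r) = Sh (Br p q) r + sc (dq * (dp + n)) (Sh q (Br p r))"
proof (rule lin_eqI3[of "\<lambda>p q r. Br p (Sh q r)"
      "\<lambda>p q r. Sh (Br p q) r + sc (dq * (dp + n)) (Sh q (Br p r))"])
  fix u v w assume "u \<in> Poly_Mapping.keys p" "v \<in> Poly_Mapping.keys q"
  then have "wd par u = dp" "wd par v = dq" using assms by (auto simp: homog_def)
  then show "Br (pt u) (Sh (pt v) (pt w)) = Sh (Br (pt u) (pt v)) (pt w)
      + sc (dq * (dp + n)) (Sh (pt v) (Br (pt u) (pt w)))"
    using Br_Sh_pt[of u v w] by simp
qed (rule lin_intros)+

text \<open>The derivation rule in the left argument comes from the one in the right argument by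
  antisymmetry; the Jacobi identity uses both.\<close>

lemma Sh_Br:
  assumes p: "hw dp p" and q: "hw dq q" and r: "hw dr r"
  shows "Br (Sh p q) r = Sh p (Br q r) + sc (dp * dq) (Sh q (Br p r))"
  unfolding Br_antisym[OF homog_Sh[OF p q] r] Br_Sh[OF r p] Br_antisym[OF r p] Br_antisym[OF r q]
    ext2_simps Sh_comm[OF Br_par[OF p r] q]
  by (simp add: bit_ring)

lemma Br_cv3_right:
  assumes x: "hl dx x" and p: "hw dp p" and y: "hl dy y" and q: "hw dq q" and z: "hl dz z"
  shows "Br (cv x p) (Br (cv y q) (cv z r)) = cv x (Br p (Br (cv y q) (cv z r)))
    + sc (dy * (dx + dp + n)) (cv y (Br (cv x p) (Br q (cv z r))))
    + sc (dz * (dx + dp + dy + dq)) (cv z (Br (cv x p) (Br (cv y q) r)))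
    + sc ((dy + n) * dp) (cv (Be x y) (Sh p (Br q (cv z r))))
    + sc (dz * (dy + dq + n) + (dz + n) * dp) (cv (Be x z) (Sh p (Br (cv y q) r)))
    + sc ((dz + n) * dq + (dy + dz + n) * (dx + dp + n)) (cv (Be y z) (Br (cv x p) (Sh q r)))
    + sc ((dz + n) * dq + (dy + dz) * dp) (cv (Be x (Be y z)) (Sh p (Sh q r)))"
  by (simp add: Br_cv[OF y q z] Br_cv[OF x p y] Br_cv[OF x p z] Br_cv[OF x p Be_par[OF y z]] bit_ring)

lemma Br_cv3_left:
  assumes x: "hl dx x" and p: "hw dp p" and y: "hl dy y" and q: "hw dq q" and z: "hl dz z"
  shows "Br (Br (cv x p) (cv y q)) (cv z r) = cv x (Br (Br p (cv y q)) (cv z r))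
    + sc (dy * (dx + dp + n)) (cv y (Br (Br (cv x p) q) (cv z r)))
    + sc (dz * (dx + dp + dy + dq)) (cv z (Br (Br (cv x p) (cv y q)) r))
    + sc ((dy + n) * dp) (cv (Be x y) (Br (Sh p q) (cv z r)))
    + sc ((dz + n) * (dp + dy + dq + n)) (cv (Be x z) (Sh (Br p (cv y q)) r))
    + sc (dy * (dx + dp + n) + (dz + n) * (dx + dp + dq + n)) (cv (Be y z) (Sh (Br (cv x p) q) r))
    + sc ((dy + n) * dp + (dz + n) * (dp + dq)) (cv (Be (Be x y) z) (Sh (Sh p q) r))"
proof -
  note 1 = Br_cv[OF x Br_par[OF p homog_cv[OF y q]] z]
  note 2 = Br_cv[OF y Br_par[OF homog_cv[OF x p] q] z]
  note 3 = Br_cv[OF Be_par[OF x y] homog_Sh[OF p q] z]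
  show ?thesis by (simp add: Br_cv[OF x p y] 1 2 3 bit_ring)
qed

text \<open>Sorted by first letter: a single letter is covered by induction, a double bracket by the
  Jacobi identity for letters. If the first letter is a bracket of two of the three letters, the
  tails combine brackets with shuffle products and match by the Poisson identity for words.\<close>

lemma Br_jacobi_pt:
  "Br (pt u) (Br (pt v) (pt w)) = Br (Br (pt u) (pt v)) (pt w)
    + sc ((wd par u + n) * (wd par v + n)) (Br (pt v) (Br (pt u) (pt w)))"
proof (induction u v w rule: word_induct3)
  case (step a u b v c w)
  note 1 = Br_cv3_right[OF homog_pt homog_pt homog_pt homog_pt homog_pt, of a u b v c "pt w"]
  note 2 = Br_cv3_left[OF homog_pt homog_pt homog_pt homog_pt homog_pt, of a u b v c "pt w"]
  note 3 = Br_cv3_right[OF homog_pt homog_pt homog_pt homog_pt homog_pt, of b v a u c "pt w"]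
  note xy = Sh_Br[OF homog_pt homog_pt homog_pt, of u v "c # w"]
  note yz = Br_Sh[OF homog_pt homog_pt, of "a # u" v "pt w"]
  note xz = Br_Sh[OF homog_pt homog_pt, of "b # v" u "pt w"]
  note ba = Br_antisym[OF homog_pt homog_pt, of "b # v" u]
  note be = Be_antisym[OF homog_pt homog_pt, of b a] Be_jacobi[OF homog_pt homog_pt, of a b "pt c"]
  note lc = Sh_left_comm[OF homog_pt homog_pt, of v u "pt w"]
  show ?case
    unfolding 1[unfolded cv_pt] 2[unfolded cv_pt] 3[unfolded cv_pt] step(1-3) xy yz xz ba be lc Sh_assoc
    by (simp add: bit_ring)
qed auto

lemma Br_jacobi:
  assumes "hw dp p" "hw dq q"
  shows "Br p (Br q r) = Br (Br p q) r + sc ((dp + n) * (dq + n)) (Br q (Br p r))"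
proof (rule lin_eqI3[of "\<lambda>p q r. Br p (Br q r)"
      "\<lambda>p q r. Br (Br p q) r + sc ((dp + n) * (dq + n)) (Br q (Br p r))"])
  fix u v w assume "u \<in> Poly_Mapping.keys p" "v \<in> Poly_Mapping.keys q"
  then have "wd par u = dp" "wd par v = dq" using assms by (auto simp: homog_def)
  then show "Br (pt u) (Br (pt v) (pt w)) = Br (Br (pt u) (pt v)) (pt w)
      + sc ((dp + n) * (dq + n)) (Br (pt v) (Br (pt u) (pt w)))"
    using Br_jacobi_pt[of u v w] by simp
qed (rule lin_intros)+

end

section \<open>Coderivations of the word algebra\<close>

text \<open>Merging a letter with the head of a word is separated from the recursion below because
  it must be applied to shuffle products and brackets, whose heads vary from term to term.\<close>

fun mh :: "('e \<Rightarrow> 'e \<Rightarrow> ('e \<Rightarrow>\<^sub>0 'k::field)) \<Rightarrow> 'e \<Rightarrow> 'e list \<Rightarrow> ('e list \<Rightarrow>\<^sub>0 'k)" where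
  "mh b2 a [] = 0"
| "mh b2 a (b # w) = cv (b2 a b) (pt w)"

text \<open>The coderivation of the deconcatenation coalgebra with components \<open>b1\<close> and
  \<open>b2\<close> of one and two arguments. The last sign is that of an odd operator passing the
  letter \<open>a\<close>.\<close>

fun cdw :: "('e \<Rightarrow> bit) \<Rightarrow> ('e \<Rightarrow> ('e \<Rightarrow>\<^sub>0 'k::field)) \<Rightarrow> ('e \<Rightarrow> 'e \<Rightarrow> ('e \<Rightarrow>\<^sub>0 'k)) \<Rightarrow>
    'e list \<Rightarrow> ('e list \<Rightarrow>\<^sub>0 'k)" where
  "cdw par b1 b2 [] = 0"
| "cdw par b1 b2 (a # w) = cv (b1 a) (pt w) + mh b2 a w + sc (par a) (cv (pt a) (cdw par b1 b2 w))"

lemma homog_cdw: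
  assumes "\<And>a. homog D (D a + c) (b1 a)" "\<And>a b. homog D (D a + D b + c) (b2 a b)"
  shows "homog (wd D) (wd D w + c) (cdw par b1 b2 w)"
proof (induction w)
  case (Cons a w)
  have "homog (wd D) (wd D (a # w) + c) (cv (b1 a) (pt w))"
    using homog_cv[OF assms(1) homog_pt, of a w] by (simp add: ac_simps)
  moreover have "homog (wd D) (wd D (a # w) + c) (mh b2 a w)"
  proof (cases w)
    case (Cons b v)
    then show ?thesis using homog_cv[OF assms(2) homog_pt, of a b v] by (simp add: ac_simps)
  qed simp
  moreover have "homog (wd D) (wd D (a # w) + c) (cv (pt a) (cdw par b1 b2 w))"
    using homog_cv[OF homog_pt Cons, of a] by (simp add: ac_simps)
  ultimately show ?case by (simp add: homog_add homog_sc)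
qed simp

lemma homog_Df:
  assumes "\<And>a. homog D (D a + c) (b1 a)" "\<And>a b. homog D (D a + D b + c) (b2 a b)"
    "homog (wd D) g p"
  shows "homog (wd D) (g + c) (ext (cdw par b1 b2) p)"
  using homog_cdw[of D c b1 b2, OF assms(1,2)] assms(3) by (intro homog_ext[of "wd D" g]) auto

lemma cdw_add:
  "cdw par (\<lambda>a. b1 a + c1 a) (\<lambda>a b. b2 a b + c2 a b) w = cdw par b1 b2 w + cdw par c1 c2 w"
proof (induction w)
  case (Cons a w)
  have "mh (\<lambda>a b. b2 a b + c2 a b) a w = mh b2 a w + mh c2 a w" by (cases w) auto
  then show ?case using Cons by simp
qed simp

locale coder_words = shuffle_words par ty
  for par :: "'e \<Rightarrow> bit" and ty :: "'k::field itself" +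
  fixes b1 :: "'e \<Rightarrow> ('e \<Rightarrow>\<^sub>0 'k)" and b2 :: "'e \<Rightarrow> 'e \<Rightarrow> ('e \<Rightarrow>\<^sub>0 'k)"
  assumes b1_par: "homog par (par a + 1) (b1 a)"
    and b2_par: "homog par (par a + par b + 1) (b2 a b)"
begin

abbreviation Bu :: "('e \<Rightarrow>\<^sub>0 'k) \<Rightarrow> ('e \<Rightarrow>\<^sub>0 'k)" where "Bu \<equiv> ext b1"
abbreviation Bb :: "('e \<Rightarrow>\<^sub>0 'k) \<Rightarrow> ('e \<Rightarrow>\<^sub>0 'k) \<Rightarrow> ('e \<Rightarrow>\<^sub>0 'k)" where "Bb \<equiv> ext2 b2"
abbreviation Mh :: "('e \<Rightarrow>\<^sub>0 'k) \<Rightarrow> ('e list \<Rightarrow>\<^sub>0 'k) \<Rightarrow> ('e list \<Rightarrow>\<^sub>0 'k)" where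
  "Mh \<equiv> ext2 (mh b2)"
abbreviation Df :: "('e list \<Rightarrow>\<^sub>0 'k) \<Rightarrow> ('e list \<Rightarrow>\<^sub>0 'k)" where "Df \<equiv> ext (cdw par b1 b2)"

lemma Bb_par: "hl dx x \<Longrightarrow> hl dy y \<Longrightarrow> hl (dx + dy + 1) (Bb x y)"
  by (rule homog_ext2[of par dx par dy]) (auto intro: b2_par)

lemma Df_par: "hw dp p \<Longrightarrow> hw (dp + 1) (Df p)"
  by (rule homog_Df[OF b1_par b2_par])

lemma Mh_Nil [simp]: "Mh x (pt []) = 0"
  by (rule lin_eqI[of "\<lambda>x. Mh x (pt [])" "\<lambda>x. 0"]) (auto intro!: lin_intros simp: ext2_pt)

lemma Mh_cv [simp]: "Mh x (cv y q) = cv (Bb x y) q"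
  by (rule lin_eqI3[of "\<lambda>x y q. Mh x (cv y q)" "\<lambda>x y q. cv (Bb x y) q"]; ((rule lin_intros)+)?)
     (simp add: ext2_pt[of "mh b2"] ext2_pt[of b2])

lemma Df_cv:
  assumes "hl dx x"
  shows "Df (cv x p) = cv (Bu x) p + Mh x p + sc dx (cv x (Df p))"
proof (rule lin_eqI2[of "\<lambda>x p. Df (cv x p)" "\<lambda>x p. cv (Bu x) p + Mh x p + sc dx (cv x (Df p))"])
  fix a w assume "a \<in> Poly_Mapping.keys x"
  then have "par a = dx" using assms by (auto simp: homog_def)
  then show "Df (cv (pt a) (pt w)) = cv (Bu (pt a)) (pt w) + Mh (pt a) (pt w) + sc dx (cv (pt a) (Df (pt w)))"
    by (simp add: ext2_pt[of "mh b2"])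
qed (rule lin_intros)+

text \<open>The square of an odd coderivation is a coderivation, hence vanishes once its components
  with one, two and three arguments do. The hypotheses are these components: the A-infinity
  relations for operations of one and two arguments.\<close>

lemma Df_Df_pt:
  assumes b1_b1: "\<And>a. Bu (b1 a) = 0"
    and b1_b2: "\<And>a b. Bu (b2 a b) + Bb (b1 a) (pt b) + sc (par a) (Bb (pt a) (b1 b)) = 0"
    and b2_b2: "\<And>a b c. Bb (b2 a b) (pt c) + sc (par a) (Bb (pt a) (b2 b c)) = 0"
  shows "Df (Df (pt w)) = 0"
proof (induction w)
  case (Cons a w)
  have 0: "Df (pt (a # w)) = cv (b1 a) (pt w) + Mh (pt a) (pt w) + sc (par a) (cv (pt a) (Df (pt w)))"
    using Df_cv[OF homog_pt, of a "pt w"] by simp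
  have 1: "Df (cv (b1 a) (pt w)) = Mh (b1 a) (pt w) - sc (par a) (cv (b1 a) (Df (pt w)))"
    using Df_cv[OF b1_par, of a "pt w"] by (simp add: b1_b1)
  have 2: "Df (cv (pt a) (Df (pt w))) = cv (b1 a) (Df (pt w)) + Mh (pt a) (Df (pt w))"
    using Df_cv[OF homog_pt, of a "Df (pt w)"] Cons by simp
  \<comment> \<open>These are the terms in which \<open>a\<close> is merged with its successor. A
    merge and an adjacent use of \<open>b1\<close> cancel by \<open>b1_b2\<close>, two overlapping
    merges by \<open>b2_b2\<close>, and disjoint operations by the sign of an odd operator.\<close>
  have 3: "Mh (b1 a) (pt w) + Df (Mh (pt a) (pt w)) + sc (par a) (Mh (pt a) (Df (pt w))) = 0"
  proof (cases w)
    case (Cons b v)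
    have m: "Mh (pt a) (pt w) = cv (b2 a b) (pt v)" "Mh (b1 a) (pt w) = cv (Bb (b1 a) (pt b)) (pt v)"
      using Mh_cv[of "pt a" "pt b" "pt v"] Mh_cv[of "b1 a" "pt b" "pt v"]
      by (simp_all add: Cons ext2_pt[of b2])
    have d: "Df (pt w) = cv (b1 b) (pt v) + Mh (pt b) (pt v) + sc (par b) (cv (pt b) (Df (pt v)))"
      using Df_cv[OF homog_pt, of b "pt v"] by (simp add: Cons)
    have 4: "Mh (b2 a b) (pt v) + sc (par a) (Mh (pt a) (Mh (pt b) (pt v))) = 0"
    proof (cases v)
      case (Cons c u)
      have "Mh (b2 a b) (pt v) + sc (par a) (Mh (pt a) (Mh (pt b) (pt v)))
          = cv (Bb (b2 a b) (pt c) + sc (par a) (Bb (pt a) (b2 b c))) (pt u)"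
        using Mh_cv[of "b2 a b" "pt c" "pt u"] Mh_cv[of "pt b" "pt c" "pt u"]
        by (simp add: Cons ext2_pt[of b2])
      then show ?thesis by (simp add: b2_b2)
    qed simp
    have "Mh (b1 a) (pt w) + Df (Mh (pt a) (pt w)) + sc (par a) (Mh (pt a) (Df (pt w)))
        = cv (Bu (b2 a b) + Bb (b1 a) (pt b) + sc (par a) (Bb (pt a) (b1 b))) (pt v)
          + (Mh (b2 a b) (pt v) + sc (par a) (Mh (pt a) (Mh (pt b) (pt v))))"
      by (simp add: m d Df_cv[OF b2_par] bit_ring ext2_pt[of b2] del: ext_pt)
    then show ?thesis by (simp add: b1_b2 4)
  qed simp
  have "Df (Df (pt (a # w))) = Mh (b1 a) (pt w) + Df (Mh (pt a) (pt w)) + sc (par a) (Mh (pt a) (Df (pt w)))"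
    by (simp only: 0 ext_simps 1 2) (simp add: bit_ring)
  then show ?case by (simp only: 3)
qed simp

lemma Df_Df:
  assumes "\<And>a. Bu (b1 a) = 0"
    and "\<And>a b. Bu (b2 a b) + Bb (b1 a) (pt b) + sc (par a) (Bb (pt a) (b1 b)) = 0"
    and "\<And>a b c. Bb (b2 a b) (pt c) + sc (par a) (Bb (pt a) (b2 b c)) = 0"
  shows "Df (Df p) = 0"
  by (rule lin_eqI[of "\<lambda>p. Df (Df p)" "\<lambda>p. 0"]; ((rule lin_intros)+)?) (rule Df_Df_pt[OF assms])

end

text \<open>Antisymmetry of \<open>b2\<close> expresses graded commutativity of a product after the
  shift. In a shuffle, two adjacent letters from different words occur in both orders, and
  antisymmetry makes their merges cancel.\<close>

locale derivation_words = coder_words par ty b1 b2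
  for par :: "'e \<Rightarrow> bit" and ty :: "'k::field itself"
    and b1 :: "'e \<Rightarrow> ('e \<Rightarrow>\<^sub>0 'k)" and b2 :: "'e \<Rightarrow> 'e \<Rightarrow> ('e \<Rightarrow>\<^sub>0 'k)" +
  assumes b2_antisym: "b2 a b = - sc (par a * par b) (b2 b a)"
begin

lemma Bb_antisym:
  assumes "hl dx x" "hl dy y"
  shows "Bb x y = - sc (dx * dy) (Bb y x)"
proof (rule lin_eqI2[of "\<lambda>x y. Bb x y" "\<lambda>x y. - sc (dx * dy) (Bb y x)"])
  fix a b assume "a \<in> Poly_Mapping.keys x" "b \<in> Poly_Mapping.keys y"
  then have "par a = dx" "par b = dy" using assms by (auto simp: homog_def)
  then show "Bb (pt a) (pt b) = - sc (dx * dy) (Bb (pt b) (pt a))"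
    unfolding ext2_pt using b2_antisym[of a b] by simp
qed (rule lin_intros)+

text \<open>The letter \<open>x\<close> is merged with the first letter of a shuffle; that letter comes from \<open>p\<close>
  or is \<open>y\<close>.\<close>

lemma Mh_Sh_left:
  assumes x: "hl dx x" and y: "hl dy y"
  shows "Mh x (Sh (pt u) (cv y q)) = Sh (Mh x (pt u)) (cv y q)
    - sc (dy * (dx + wd par u + 1)) (cv y (Sh (Mh x (pt u)) q)) + sc (dy * wd par u) (cv (Bb x y) (Sh (pt u) q))"
proof (cases u)
  case (Cons a v)
  show ?thesis
    using Sh_cv[OF homog_pt homog_pt y, of a v q] Mh_cv[of x "pt a" "pt v"]
      Sh_cv[OF Bb_par[OF x homog_pt] homog_pt y, of a v q]
    by (simp add: Cons bit_ring)
qed simp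

text \<open>Here the first letter of the shuffle is \<open>x\<close> or comes from \<open>v\<close>.
  The difference in the last summand discards those terms of the shuffle product that begin with
  \<open>x\<close>.\<close>

lemma Mh_Sh_right:
  assumes x: "hl dx x" and p: "hw dp p" and y: "hl dy y"
  shows "Mh y (Sh (cv x p) (pt v)) = cv (Bb y x) (Sh p (pt v))
    + sc ((dy + 1) * (dx + dp)) (Sh (cv x p) (Mh y (pt v)) - cv x (Sh p (Mh y (pt v))))"
proof (cases v)
  case (Cons b w)
  show ?thesis
    using Sh_cv[OF x p homog_pt, of b "pt w"] Mh_cv[of y "pt b" "pt w"]
      Sh_cv[OF x p Bb_par[OF y homog_pt], of b "pt w"]
    by (simp add: Cons bit_ring)
qed simp

text \<open>The merge of \<open>a\<close> with \<open>b\<close> arises from the shuffles that begin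
  with \<open>a\<close> and from those that begin with \<open>b\<close>; the two contributions
  cancel by \<open>Bb_antisym\<close>.\<close>

lemma Df_Sh_pt: "Df (Sh (pt u) (pt v)) = Sh (Df (pt u)) (pt v) + sc (wd par u) (Sh (pt u) (Df (pt v)))"
proof (induction u v rule: word_induct2)
  case (step a u b v)
  let ?x = "pt a :: 'e \<Rightarrow>\<^sub>0 'k" and ?y = "pt b :: 'e \<Rightarrow>\<^sub>0 'k"
  let ?p = "pt u :: 'e list \<Rightarrow>\<^sub>0 'k" and ?q = "pt v :: 'e list \<Rightarrow>\<^sub>0 'k"
  note cp = cv_pt[symmetric, where 'b='k]
  note dx = Df_cv[OF homog_pt, of a] and dy = Df_cv[OF homog_pt, of b]
  note s = Sh_cv[OF homog_pt homog_pt homog_pt]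
  note s1 = Sh_cv[OF b1_par homog_pt homog_pt]
  note s2 = Sh_cv[OF homog_pt homog_pt b1_par]
  note s3 = Sh_cv[OF homog_pt Df_par[OF homog_pt] homog_pt]
  note ml = Mh_Sh_left[OF homog_pt homog_pt, where q = ?q]
  note mr = Mh_Sh_right[OF homog_pt homog_pt homog_pt]
  note ba = Bb_antisym[OF homog_pt homog_pt, of b a]
  have IH: "Df (Sh ?p (cv ?y ?q)) = Sh (Df ?p) (cv ?y ?q) + sc (wd par u) (Sh ?p (Df (cv ?y ?q)))"
    "Df (Sh (cv ?x ?p) ?q) = Sh (Df (cv ?x ?p)) ?q + sc (par a + wd par u) (Sh (cv ?x ?p) (Df ?q))"
    using step(1,2) by simp_all
  have "Df (Sh (cv ?x ?p) (cv ?y ?q))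
      = Sh (Df (cv ?x ?p)) (cv ?y ?q) + sc (par a + wd par u) (Sh (cv ?x ?p) (Df (cv ?y ?q)))"
    by (simp only: s s1 s2 s3 dx dy ext_simps ext2_simps ml mr IH ext_pt[of b1] ba)
       (simp add: bit_ring s s1 s2 s3 del: cv_pt ext_pt)
  then show ?case by simp
qed auto

lemma Df_Sh:
  assumes "hw dp p"
  shows "Df (Sh p q) = Sh (Df p) q + sc dp (Sh p (Df q))"
proof (rule lin_eqI2[of "\<lambda>p q. Df (Sh p q)" "\<lambda>p q. Sh (Df p) q + sc dp (Sh p (Df q))"])
  fix u v assume "u \<in> Poly_Mapping.keys p"
  then have "wd par u = dp" using assms by (auto simp: homog_def)
  then show "Df (Sh (pt u) (pt v)) = Sh (Df (pt u)) (pt v) + sc dp (Sh (pt u) (Df (pt v)))"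
    using Df_Sh_pt[of u v] by simp
qed (rule lin_intros)+

end

text \<open>\<open>b2_bracket\<close> is the Poisson identity for letters in shifted parities. The
  sign on its left side comes from the odd operation \<open>b2\<close> passing \<open>a\<close> and
  the bracket.\<close>

locale leibniz_words =
  bracket_words par ty n \<beta> + derivation_words par ty b1 b2
  for par :: "'e \<Rightarrow> bit" and ty :: "'k::field itself" and n \<beta> b1 b2 +
  assumes b1_bracket: "ext b1 (\<beta> a b) = ext2 \<beta> (b1 a) (pt b) + sc (par a + n) (ext2 \<beta> (pt a) (b1 b))"
    and b2_bracket: "sc (par a + n) (ext2 \<beta> (pt a) (b2 b c)) =
      ext2 b2 (\<beta> a b) (pt c) + sc ((par a + n) * par b) (ext2 b2 (pt b) (\<beta> a c))"
begin

lemma Bu_Be: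
  assumes "hl dx x"
  shows "Bu (Be x y) = Be (Bu x) y + sc (dx + n) (Be x (Bu y))"
proof (rule lin_eqI2[of "\<lambda>x y. Bu (Be x y)" "\<lambda>x y. Be (Bu x) y + sc (dx + n) (Be x (Bu y))"])
  fix a b assume "a \<in> Poly_Mapping.keys x"
  then have "par a = dx" using assms by (auto simp: homog_def)
  then show "Bu (Be (pt a) (pt b)) = Be (Bu (pt a)) (pt b) + sc (dx + n) (Be (pt a) (Bu (pt b)))"
    using b1_bracket[of a b] by (simp add: ext2_pt)
qed (rule lin_intros)+

lemma Be_Bb:
  assumes "hl dx x" "hl dy y"
  shows "Be x (Bb y z) = sc (dx + n) (Bb (Be x y) z) + sc ((dx + n) * (dy + 1)) (Bb y (Be x z))"
proof (rule lin_eqI3[of "\<lambda>x y z. Be x (Bb y z)"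
      "\<lambda>x y z. sc (dx + n) (Bb (Be x y) z) + sc ((dx + n) * (dy + 1)) (Bb y (Be x z))"])
  fix a b c assume "a \<in> Poly_Mapping.keys x" "b \<in> Poly_Mapping.keys y"
  then have "par a = dx" "par b = dy" using assms by (auto simp: homog_def)
  then have "sc (dx + n) (sc (dx + n) (Be (pt a) (b2 b c))) = sc (dx + n) (Bb (\<beta> a b) (pt c))
      + sc ((dx + n) * (dy + 1)) (Bb (pt b) (\<beta> a c))"
    using b2_bracket[of a b c] by (simp add: bit_ring)
  then show "Be (pt a) (Bb (pt b) (pt c)) = sc (dx + n) (Bb (Be (pt a) (pt b)) (pt c))
      + sc ((dx + n) * (dy + 1)) (Bb (pt b) (Be (pt a) (pt c)))"
    by (simp add: ext2_pt)
qed (rule lin_intros)+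

lemma Bb_Be:
  assumes x: "hl dx x" and y: "hl dy y" and z: "hl dz z"
  shows "Be (Bb x y) z = Bb x (Be y z) + sc (dy * (dz + n)) (Bb (Be x z) y)"
  unfolding Be_antisym[OF Bb_par[OF x y] z] Be_Bb[OF z x] Be_antisym[OF x z] Be_antisym[OF y z] ext2_simps
  by (simp add: bit_ring)

text \<open>The merge of \<open>w\<close> with the head of a shuffle, restricted to heads that come
  from \<open>u\<close>; \<open>Mr\<close> collects those from \<open>v\<close>. They are kept apart
  because each of the two expansions of merged brackets below produces only one of them.\<close>

definition Ml :: "('e \<Rightarrow>\<^sub>0 'k) \<Rightarrow> 'e list \<Rightarrow> ('e list \<Rightarrow>\<^sub>0 'k) \<Rightarrow> ('e list \<Rightarrow>\<^sub>0 'k)" where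
  "Ml w u q = (case u of [] \<Rightarrow> 0 | a # u \<Rightarrow> cv (Bb w (pt a)) (Sh (pt u) q))"

definition Mr :: "('e \<Rightarrow>\<^sub>0 'k) \<Rightarrow> 'e list \<Rightarrow> 'e list \<Rightarrow> ('e list \<Rightarrow>\<^sub>0 'k)" where
  "Mr w u v = (case v of [] \<Rightarrow> 0 | b # v \<Rightarrow> sc (par b * wd par u) (cv (Bb w (pt b)) (Sh (pt u) (pt v))))"

lemma Mh_Sh: "Mh w (Sh (pt u) (pt v)) = Ml w u (pt v) + Mr w u v"
proof (cases "u = [] \<or> v = []")
  case True
  have "Mh w (pt v) = cv (Bb w (pt b)) (pt v')" if "v = b # v'" for b v' v
    using that Mh_cv[of w "pt b" "pt v'"] by simp
  with True show ?thesis by (auto simp: Ml_def Mr_def split: list.splits)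
next
  case False
  then obtain a u' b v' where "u = a # u'" "v = b # v'" by (meson neq_Nil_conv)
  then show ?thesis
    using Sh_cv[OF homog_pt homog_pt homog_pt, of a u' b "pt v'"] by (simp add: Ml_def Mr_def)
qed

text \<open>Bracketing a merged letter with \<open>y\<close> gives two terms by
  \<open>Bb_Be\<close>. One of them, in which \<open>x\<close> is bracketed with \<open>y\<close>
  and then merged with the head of \<open>u\<close>, has no counterpart on the left and is removed
  by the \<open>Ml\<close> term.\<close>

lemma Mh_Br_left:
  assumes x: "hl dx x" and y: "hl dy y"
  shows "Mh x (Br (pt u) (cv y q)) = Br (Mh x (pt u)) (cv y q)
    - sc (dy * (dx + wd par u + 1 + n)) (cv y (Br (Mh x (pt u)) q))
    + sc (dy * (wd par u + n)) (cv (Bb x y) (Br (pt u) q))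
    - sc ((dy + n) * wd par u) (Ml (Be x y) u q)"
proof (cases u)
  case (Cons a v)
  show ?thesis
    using Br_cv[OF homog_pt homog_pt y, of a v q] Mh_cv[of x "pt a" "pt v"]
      Br_cv[OF Bb_par[OF x homog_pt] homog_pt y, of a v q] Bb_Be[OF x homog_pt y, of a]
    by (simp add: Cons bit_ring Ml_def)
qed (simp add: Ml_def)

lemma Mh_Br_right:
  assumes x: "hl dx x" and y: "hl dy y"
  shows "Mh y (Br (cv x (pt u)) (pt v)) = cv (Bb y x) (Br (pt u) (pt v))
    + sc ((dy + 1) * (dx + wd par u + n)) (Br (cv x (pt u)) (Mh y (pt v)) - cv x (Br (pt u) (Mh y (pt v))))
    - sc (dy * (dx + n) + n * wd par u) (Mr (Be x y) u v)"
proof (cases v)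
  case (Cons b w)
  show ?thesis
    using Br_cv[OF x homog_pt homog_pt, of u b "pt w"] Mh_cv[of y "pt b" "pt w"]
      Br_cv[OF x homog_pt Bb_par[OF y homog_pt], of u b "pt w"] Be_Bb[OF x y, of "pt b"]
    by (simp add: Cons bit_ring Mr_def)
qed (simp add: Mr_def)

text \<open>The corrections \<open>Ml\<close> and \<open>Mr\<close> from terms that begin with
  \<open>a\<close> and with \<open>b\<close> are cancelled by merging the bracketed letter with the
  head of the shuffle of \<open>u\<close> and \<open>v\<close>. The remaining words behind that
  letter are handled by the derivation rule for the shuffle product.\<close>

lemma Df_Br_pt: "Df (Br (pt u) (pt v)) = Br (Df (pt u)) (pt v) + sc (wd par u + n) (Br (pt u) (Df (pt v)))"
proof (induction u v rule: word_induct2)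
  case (step a u b v)
  let ?x = "pt a :: 'e \<Rightarrow>\<^sub>0 'k" and ?y = "pt b :: 'e \<Rightarrow>\<^sub>0 'k"
  let ?p = "pt u :: 'e list \<Rightarrow>\<^sub>0 'k" and ?q = "pt v :: 'e list \<Rightarrow>\<^sub>0 'k"
  note dx = Df_cv[OF homog_pt, of a] and dy = Df_cv[OF homog_pt, of b]
    and dxy = Df_cv[OF Be_par[OF homog_pt homog_pt], of a b]
  note s = Br_cv[OF homog_pt homog_pt homog_pt]
  note s1 = Br_cv[OF b1_par homog_pt homog_pt]
  note s2 = Br_cv[OF homog_pt homog_pt b1_par]
  note s3 = Br_cv[OF homog_pt Df_par[OF homog_pt] homog_pt]
  note ml = Mh_Br_left[OF homog_pt homog_pt, where q = ?q]
  note mr = Mh_Br_right[OF homog_pt homog_pt]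
  note ba = Bb_antisym[OF homog_pt homog_pt, of b a]
  have IH: "Df (Br ?p (cv ?y ?q)) = Br (Df ?p) (cv ?y ?q) + sc (wd par u + n) (Br ?p (Df (cv ?y ?q)))"
    "Df (Br (cv ?x ?p) ?q) = Br (Df (cv ?x ?p)) ?q + sc (par a + wd par u + n) (Br (cv ?x ?p) (Df ?q))"
    using step(1,2) by simp_all
  note bb = Bu_Be[OF homog_pt, of a ?y] and ds = Df_Sh[OF homog_pt, of u ?q]
  have "Df (Br (cv ?x ?p) (cv ?y ?q))
      = Br (Df (cv ?x ?p)) (cv ?y ?q) + sc (par a + wd par u + n) (Br (cv ?x ?p) (Df (cv ?y ?q)))"
    by (simp only: s s1 s2 s3 dx dy dxy ext_simps ext2_simps ml mr Mh_Sh IH ext_pt[of b1] ba bb ds)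
       (simp add: bit_ring s s1 s2 s3 del: cv_pt ext_pt)
  then show ?case by simp
qed auto

lemma Df_Br:
  assumes "hw dp p"
  shows "Df (Br p q) = Br (Df p) q + sc (dp + n) (Br p (Df q))"
proof (rule lin_eqI2[of "\<lambda>p q. Df (Br p q)" "\<lambda>p q. Br (Df p) q + sc (dp + n) (Br p (Df q))"])
  fix u v assume "u \<in> Poly_Mapping.keys p"
  then have "wd par u = dp" using assms by (auto simp: homog_def)
  then show "Df (Br (pt u) (pt v)) = Br (Df (pt u)) (pt v) + sc (dp + n) (Br (pt u) (Df (pt v)))"
    using Df_Br_pt[of u v] by simp
qed (rule lin_intros)+

end

section \<open>Deconcatenation\<close>

lemma ext_ext: "ext f (ext g p) = ext (\<lambda>x. ext f (g x)) p"
  by (rule lin_lin_ext[OF lin_ext])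

abbreviation tn :: "('x \<Rightarrow>\<^sub>0 'k::field) \<Rightarrow> ('y \<Rightarrow>\<^sub>0 'k) \<Rightarrow> ('x \<times> 'y \<Rightarrow>\<^sub>0 'k)" where
  "tn \<equiv> ext2 (\<lambda>x y. pt (x, y))"

definition consp :: "'e \<Rightarrow> 'e list \<times> 'y \<Rightarrow> 'e list \<times> 'y" where
  "consp a p = (a # fst p, snd p)"

lemma consp_Pair [simp]: "consp a (u, v) = (a # u, v)"
  by (simp add: consp_def)

abbreviation cvl :: "('e \<Rightarrow>\<^sub>0 'k::field) \<Rightarrow> ('e list \<times> 'y \<Rightarrow>\<^sub>0 'k) \<Rightarrow> ('e list \<times> 'y \<Rightarrow>\<^sub>0 'k)" where
  "cvl \<equiv> ext2 (\<lambda>a p. pt (consp a p))"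

lemma tn_pt [simp]: "tn (pt u) (pt v) = pt (u, v)"
  by (simp add: ext2_pt)

lemma cvl_pt [simp]: "cvl (pt a) (pt (u, v)) = pt (a # u, v)"
  by (simp add: ext2_pt)

lemma cvl_tn [simp]: "cvl x (tn p q) = tn (cv x p) q"
  by (rule lin_eqI3[of "\<lambda>x p q. cvl x (tn p q)" "\<lambda>x p q. tn (cv x p) q"]; ((rule lin_intros)+)?) simp

fun dcw :: "'e list \<Rightarrow> ('e list \<times> 'e list \<Rightarrow>\<^sub>0 'k::field)" where
  "dcw [] = pt ([], [])"
| "dcw (a # w) = pt ([], a # w) + cvl (pt a) (dcw w)"

abbreviation Dc :: "('e list \<Rightarrow>\<^sub>0 'k::field) \<Rightarrow> ('e list \<times> 'e list \<Rightarrow>\<^sub>0 'k)" where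
  "Dc \<equiv> ext dcw"

lemma Dc_cv: "Dc (cv x p) = tn (pt []) (cv x p) + cvl x (Dc p)"
  by (rule lin_eqI2[of "\<lambda>x p. Dc (cv x p)" "\<lambda>x p. tn (pt []) (cv x p) + cvl x (Dc p)"];
      ((rule lin_intros)+)?) simp

lemma ext_cvl: "ext f (cvl (pt a) p) = ext (\<lambda>(u, v). f (a # u, v)) p"
  by (simp add: ext2_def ext_ext consp_def split_def)

lemma dcw_coassoc:
  fixes w :: "'e list"
  shows "ext (\<lambda>((u, v), w). pt (u, v, w)) (ext (\<lambda>(u, v). tn (dcw u) (pt v)) (dcw w))
    = ext (\<lambda>(u, v). tn (pt u) (dcw v)) (dcw w :: _ \<Rightarrow>\<^sub>0 'k::field)"
proof (induction w)
  case (Cons a w)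
  let ?A = "ext (\<lambda>((u, v), w). pt (u, v, w)) :: ((_ \<times> _) \<times> 'e list \<Rightarrow>\<^sub>0 'k) \<Rightarrow> _"
  have 1: "?A (tn (cvl (pt a) f) (pt v)) = cvl (pt a) (?A (tn f (pt v)))" for f and v :: "'e list" and a
    by (rule lin_eqI[of "\<lambda>f. ?A (tn (cvl (pt a) f) (pt v))" "\<lambda>f. cvl (pt a) (?A (tn f (pt v)))"];
        ((rule lin_intros)+)?) auto
  have 3: "tn (pt []) (cvl (pt a) f) = ext (\<lambda>(u, v). pt ([], a # u, v)) f"
    for a and f :: "'e list \<times> 'e list \<Rightarrow>\<^sub>0 'k"
    by (rule lin_eqI[of "\<lambda>f. tn (pt []) (cvl (pt a) f)" "ext (\<lambda>(u, v). pt ([], a # u, v))"];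
        ((rule lin_intros lin_ext)+)?) auto
  have "?A (ext (\<lambda>(u, v). tn (dcw u) (pt v)) (dcw (a # w)) :: _ \<Rightarrow>\<^sub>0 'k)
      = pt ([], [], a # w) + ext (\<lambda>(u, v). pt ([], a # u, v) + cvl (pt a) (?A (tn (dcw u) (pt v)))) (dcw w)"
    by (simp add: ext_cvl ext_ext 1[unfolded split_def] split_def)
  also have "\<dots> = pt ([], [], a # w) + ext (\<lambda>(u, v). pt ([], a # u, v)) (dcw w)
      + cvl (pt a) (?A (ext (\<lambda>(u, v). tn (dcw u) (pt v)) (dcw w)))"
    by (simp add: ext_ext ext_add_fun lin_lin_ext[OF lin_ext2(2)] split_def)
  also have "\<dots> = ext (\<lambda>(u, v). tn (pt u) (dcw v)) (dcw (a # w))"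
    unfolding Cons
    by (simp add: ext_cvl 3[unfolded split_def] lin_lin_ext[OF lin_ext2(2)] split_def)
  finally show ?case .
qed simp

lemma dcw_counit:
  fixes w :: "'e list"
  shows "ext (\<lambda>(u, v). if u = [] then pt v else 0) (dcw w) = (pt w :: _ \<Rightarrow>\<^sub>0 'k::field)"
    and "ext (\<lambda>(u, v). if v = [] then pt u else 0) (dcw w) = (pt w :: _ \<Rightarrow>\<^sub>0 'k)"
proof -
  show "ext (\<lambda>(u, v). if u = [] then pt v else 0) (dcw w) = (pt w :: _ \<Rightarrow>\<^sub>0 'k)"
    by (cases w) (auto simp: ext_cvl split_def)
  show "ext (\<lambda>(u, v). if v = [] then pt u else 0) (dcw w) = (pt w :: _ \<Rightarrow>\<^sub>0 'k)"
  proof (induction w)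
    case (Cons a w)
    have "ext (\<lambda>(u, v). if v = [] then pt (a # u) else 0) f = cv (pt a) (ext (\<lambda>(u, v). if v = [] then pt u else 0) f)"
      for a and f :: "'e list \<times> 'e list \<Rightarrow>\<^sub>0 'k"
      by (rule lin_eqI[of "ext (\<lambda>(u, v). if v = [] then pt (a # u) else 0)"];
          ((rule lin_intros lin_ext)+)?) auto
    with Cons show ?case by (simp add: ext_cvl)
  qed simp
qed

text \<open>Inductions follow the recursion; this closed form serves degree counting and the
  convolution identities of the antipode.\<close>

lemma dcw_sum: "dcw w = (\<Sum>i\<in>{0..length w}. pt (take i w, drop i w))"
proof (induction w)
  case (Cons a w)
  have "(\<Sum>i\<in>{0..length (a # w)}. pt (take i (a # w), drop i (a # w)))
      = pt ([], a # w) + (\<Sum>i\<in>{0..length w}. pt (take (Suc i) (a # w), drop (Suc i) (a # w)) :: _ \<Rightarrow>\<^sub>0 'b)"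
    unfolding list.size add_0_right add_Suc_right by (subst sum.atLeast0_atMost_Suc_shift) simp
  then show ?case using Cons by simp
qed simp

lemma homog_dcw: "homog (\<lambda>(u, v). wd D u + wd D v) (wd D w) (dcw w)"
  unfolding dcw_sum
proof (rule homog_sum)
  fix i
  have "wd D (take i w) + wd D (drop i w) = wd D w"
    by (metis append_take_drop_id map_append sum_list_append)
  then show "homog (\<lambda>(u, v). wd D u + wd D v) (wd D w) (pt (take i w, drop i w))"
    using homog_pt[of "\<lambda>(u, v). wd D u + wd D v" "(take i w, drop i w)"] by simp
qed

section \<open>Deconcatenation of shuffle products and brackets\<close>

definition sh2w :: "('e \<Rightarrow> bit) \<Rightarrow> 'e list \<times> 'e list \<Rightarrow> 'e list \<times> 'e list \<Rightarrow>
    ('e list \<times> 'e list \<Rightarrow>\<^sub>0 'k::field)" where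
  "sh2w par f g = sc (wd par (snd f) * wd par (fst g)) (tn (shw par (fst f) (fst g)) (shw par (snd f) (snd g)))"

context shuffle_words
begin

abbreviation Sh2 :: "('e list \<times> 'e list \<Rightarrow>\<^sub>0 'k) \<Rightarrow> ('e list \<times> 'e list \<Rightarrow>\<^sub>0 'k) \<Rightarrow> ('e list \<times> 'e list \<Rightarrow>\<^sub>0 'k)"
  where "Sh2 \<equiv> ext2 (sh2w par)"

lemma Sh2_pt: "Sh2 (pt (u1, u2)) (pt (v1, v2)) = sc (wd par u2 * wd par v1) (tn (shw par u1 v1) (shw par u2 v2))"
  by (simp add: ext2_pt[of "sh2w par"] sh2w_def)

abbreviation hf :: "bit \<Rightarrow> ('e list \<times> 'e list \<Rightarrow>\<^sub>0 'k) \<Rightarrow> bool" where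
  "hf \<equiv> homog (\<lambda>(u, v). wd par u + wd par v)"

lemma Sh2_tn:
  assumes "hw dp2 p2" "hw dq1 q1"
  shows "Sh2 (tn p1 p2) (tn q1 q2) = sc (dp2 * dq1) (tn (Sh p1 q1) (Sh p2 q2))"
proof (rule lin_eqI4[of "\<lambda>p1 p2 q1 q2. Sh2 (tn p1 p2) (tn q1 q2)"
      "\<lambda>p1 p2 q1 q2. sc (dp2 * dq1) (tn (Sh p1 q1) (Sh p2 q2))"])
  fix u1 u2 v1 v2 assume "u2 \<in> Poly_Mapping.keys p2" "v1 \<in> Poly_Mapping.keys q1"
  then have "wd par u2 = dp2" "wd par v1 = dq1" using assms by (auto simp: homog_def)
  then show "Sh2 (tn (pt u1) (pt u2)) (tn (pt v1) (pt v2))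
      = sc (dp2 * dq1) (tn (Sh (pt u1) (pt v1)) (Sh (pt u2) (pt v2)))"
    by (simp add: Sh2_pt ext2_pt[of "shw par"])
qed (rule lin_intros)+

text \<open>When both left factors begin with a letter, the tensor square obeys the recursion of the
  shuffle product, with the total parity of \<open>f\<close> in place of the parity of a
  tail.\<close>

lemma Sh2_cvl:
  assumes "hl dx x" "hf df f" "hl dy y"
  shows "Sh2 (cvl x f) (cvl y g) = cvl x (Sh2 f (cvl y g)) + sc (dy * (dx + df)) (cvl y (Sh2 (cvl x f) g))"
proof (rule lin_eqI4[of "\<lambda>x f y g. Sh2 (cvl x f) (cvl y g)"
      "\<lambda>x f y g. cvl x (Sh2 f (cvl y g)) + sc (dy * (dx + df)) (cvl y (Sh2 (cvl x f) g))"])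
  fix a and f' :: "'e list \<times> 'e list" and b and g' :: "'e list \<times> 'e list"
  obtain u1 u2 v1 v2 where e: "f' = (u1, u2)" "g' = (v1, v2)" by fastforce
  assume "a \<in> Poly_Mapping.keys x" "f' \<in> Poly_Mapping.keys f" "b \<in> Poly_Mapping.keys y"
  then have d: "par a = dx" "wd par u1 + wd par u2 = df" "par b = dy"
    using assms by (auto simp: homog_def e)
  show "Sh2 (cvl (pt a) (pt f')) (cvl (pt b) (pt g')) = cvl (pt a) (Sh2 (pt f') (cvl (pt b) (pt g')))
      + sc (dy * (dx + df)) (cvl (pt b) (Sh2 (cvl (pt a) (pt f')) (pt g')))"
    by (simp add: e Sh2_pt bit_ring flip: d)
qed (rule lin_intros)+

lemma Sh2_Nil_left:
  assumes "hw dr r" "hl dy y"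
  shows "Sh2 (tn (pt []) r) (cvl y g) = sc (dr * dy) (cvl y (Sh2 (tn (pt []) r) g))"
proof (rule lin_eqI3[of "\<lambda>r y g. Sh2 (tn (pt []) r) (cvl y g)"
      "\<lambda>r y g. sc (dr * dy) (cvl y (Sh2 (tn (pt []) r) g))"])
  fix w b and g' :: "'e list \<times> 'e list"
  obtain v1 v2 where e: "g' = (v1, v2)" by fastforce
  assume "w \<in> Poly_Mapping.keys r" "b \<in> Poly_Mapping.keys y"
  then have d: "wd par w = dr" "par b = dy" using assms by (auto simp: homog_def)
  show "Sh2 (tn (pt []) (pt w)) (cvl (pt b) (pt g')) = sc (dr * dy) (cvl (pt b) (Sh2 (tn (pt []) (pt w)) (pt g')))"
    by (simp add: e Sh2_pt bit_ring flip: d)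
qed (rule lin_intros)+

lemma Sh2_Nil_right: "Sh2 (cvl x f) (tn (pt []) r) = cvl x (Sh2 f (tn (pt []) r))"
proof (rule lin_eqI3[of "\<lambda>x f r. Sh2 (cvl x f) (tn (pt []) r)" "\<lambda>x f r. cvl x (Sh2 f (tn (pt []) r))"])
  fix a w and f' :: "'e list \<times> 'e list"
  obtain u1 u2 where e: "f' = (u1, u2)" by fastforce
  have [simp]: "shw par u [] = pt u" for u by (cases u) auto
  show "Sh2 (cvl (pt a) (pt f')) (tn (pt []) (pt w)) = cvl (pt a) (Sh2 (pt f') (tn (pt []) (pt w)))"
    by (simp add: e Sh2_pt)
qed (rule lin_intros)+

text \<open>Each deconcatenation is split into the term with empty left factor and the rest. The
  four products that result are \<open>n\<close>, \<open>l\<close>, \<open>r\<close> and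
  \<open>s2\<close>, and together they reproduce the splittings of the shuffles by first
  letter.\<close>

lemma Dc_Sh_pt: "Dc (Sh (pt u) (pt v)) = Sh2 (dcw u) (dcw v)"
proof (induction u v rule: word_induct2)
  case (Nil_left v)
  have "Sh2 (pt ([], [])) f = f" for f
    by (rule lin_eqI[of "Sh2 (pt ([], []))" "\<lambda>f. f"]; ((rule lin_intros)+)?) (auto simp: Sh2_pt)
  then show ?case by simp
next
  case (Nil_right u)
  have [simp]: "shw par u [] = pt u" for u by (cases u) auto
  have "Sh2 f (pt ([], [])) = f" for f
    by (rule lin_eqI[of "\<lambda>f. Sh2 f (pt ([], []))" "\<lambda>f. f"]; ((rule lin_intros)+)?) (auto simp: Sh2_pt)
  then show ?case by simp
next
  case (step a u b v)
  note s = Sh_cv[OF homog_pt homog_pt homog_pt, of a u b "pt v"]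
  note s2 = Sh2_cvl[OF homog_pt homog_dcw homog_pt, of a u b "dcw v"]
  note l = Sh2_Nil_left[OF homog_pt homog_pt, of "a # u" b "dcw v"]
  note r = Sh2_Nil_right[of "pt a" "dcw u" "pt (b # v)"]
  note n = Sh2_tn[OF homog_pt homog_pt, where ?p1.0 = "pt []" and ?q2.0 = "pt (b # v)"]
  have "Dc (Sh (cv (pt a) (pt u)) (cv (pt b) (pt v)))
      = tn (pt []) (Sh (cv (pt a) (pt u)) (cv (pt b) (pt v)))
        + cvl (pt a) (Sh2 (dcw u) (dcw (b # v)))
        + sc (par b * (par a + wd par u)) (cvl (pt b) (Sh2 (dcw (a # u)) (dcw v)))"
    unfolding s by (simp add: Dc_cv step(1,2) del: dcw.simps)
  then show ?case using s2 l r n by (simp add: bit_ring)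
qed

lemma Dc_Sh: "Dc (Sh p q) = Sh2 (Dc p) (Dc q)"
  by (rule lin_eqI2[of "\<lambda>p q. Dc (Sh p q)" "\<lambda>p q. Sh2 (Dc p) (Dc q)"]; ((rule lin_intros)+)?)
     (simp add: Dc_Sh_pt)

end

definition br2w :: "('e \<Rightarrow> bit) \<Rightarrow> bit \<Rightarrow> ('e \<Rightarrow> 'e \<Rightarrow> ('e \<Rightarrow>\<^sub>0 'k)) \<Rightarrow> 'e list \<times> 'e list \<Rightarrow>
    'e list \<times> 'e list \<Rightarrow> ('e list \<times> 'e list \<Rightarrow>\<^sub>0 'k::field)" where
  "br2w par n \<beta> f g =
     sc (wd par (snd f) * (wd par (fst g) + n)) (tn (brw par n \<beta> (fst f) (fst g)) (shw par (snd f) (snd g)))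
     + sc ((wd par (snd f) + n) * wd par (fst g)) (tn (shw par (fst f) (fst g)) (brw par n \<beta> (snd f) (snd g)))"

context bracket_words
begin

abbreviation Br2 :: "('e list \<times> 'e list \<Rightarrow>\<^sub>0 'k) \<Rightarrow> ('e list \<times> 'e list \<Rightarrow>\<^sub>0 'k) \<Rightarrow> ('e list \<times> 'e list \<Rightarrow>\<^sub>0 'k)"
  where "Br2 \<equiv> ext2 (br2w par n \<beta>)"

lemma Br2_pt: "Br2 (pt (u1, u2)) (pt (v1, v2)) =
    sc (wd par u2 * (wd par v1 + n)) (tn (brw par n \<beta> u1 v1) (shw par u2 v2))
    + sc ((wd par u2 + n) * wd par v1) (tn (shw par u1 v1) (brw par n \<beta> u2 v2))"
  by (simp add: ext2_pt[of "br2w par n \<beta>"] br2w_def)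

lemma brw_Nil_right [simp]: "brw par n \<beta> u [] = 0"
  by (cases u) auto

lemma Br2_tn:
  assumes "hw dp2 p2" "hw dq1 q1"
  shows "Br2 (tn p1 p2) (tn q1 q2) = sc (dp2 * (dq1 + n)) (tn (Br p1 q1) (Sh p2 q2))
    + sc ((dp2 + n) * dq1) (tn (Sh p1 q1) (Br p2 q2))"
proof (rule lin_eqI4[of "\<lambda>p1 p2 q1 q2. Br2 (tn p1 p2) (tn q1 q2)"
      "\<lambda>p1 p2 q1 q2. sc (dp2 * (dq1 + n)) (tn (Br p1 q1) (Sh p2 q2))
        + sc ((dp2 + n) * dq1) (tn (Sh p1 q1) (Br p2 q2))"])
  fix u1 u2 v1 v2 assume "u2 \<in> Poly_Mapping.keys p2" "v1 \<in> Poly_Mapping.keys q1"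
  then have "wd par u2 = dp2" "wd par v1 = dq1" using assms by (auto simp: homog_def)
  then show "Br2 (tn (pt u1) (pt u2)) (tn (pt v1) (pt v2))
      = sc (dp2 * (dq1 + n)) (tn (Br (pt u1) (pt v1)) (Sh (pt u2) (pt v2)))
        + sc ((dp2 + n) * dq1) (tn (Sh (pt u1) (pt v1)) (Br (pt u2) (pt v2)))"
    by (simp add: Br2_pt ext2_pt[of "shw par"] ext2_pt[of "brw par n \<beta>"])
qed (rule lin_intros)+

text \<open>A bracketed first letter arises only from the summand that brackets the left factors;
  what that summand leaves behind is exactly the product of the tensor square.\<close>

lemma Br2_cvl:
  assumes "hl dx x" "hf df f" "hl dy y"
  shows "Br2 (cvl x f) (cvl y g) = cvl x (Br2 f (cvl y g)) + sc (dy * (dx + df + n)) (cvl y (Br2 (cvl x f) g))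
    + sc ((dy + n) * df) (cvl (Be x y) (Sh2 f g))"
proof (rule lin_eqI4[of "\<lambda>x f y g. Br2 (cvl x f) (cvl y g)"
      "\<lambda>x f y g. cvl x (Br2 f (cvl y g)) + sc (dy * (dx + df + n)) (cvl y (Br2 (cvl x f) g))
        + sc ((dy + n) * df) (cvl (Be x y) (Sh2 f g))"])
  fix a and f' :: "'e list \<times> 'e list" and b and g' :: "'e list \<times> 'e list"
  obtain u1 u2 v1 v2 where e: "f' = (u1, u2)" "g' = (v1, v2)" by fastforce
  assume "a \<in> Poly_Mapping.keys x" "f' \<in> Poly_Mapping.keys f" "b \<in> Poly_Mapping.keys y"
  then have d: "par a = dx" "wd par u1 + wd par u2 = df" "par b = dy"
    using assms by (auto simp: homog_def e)
  show "Br2 (cvl (pt a) (pt f')) (cvl (pt b) (pt g')) = cvl (pt a) (Br2 (pt f') (cvl (pt b) (pt g')))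
      + sc (dy * (dx + df + n)) (cvl (pt b) (Br2 (cvl (pt a) (pt f')) (pt g')))
      + sc ((dy + n) * df) (cvl (Be (pt a) (pt b)) (Sh2 (pt f') (pt g')))"
    by (simp add: e Br2_pt Sh2_pt ext2_pt[of \<beta>] bit_ring flip: d)
qed (rule lin_intros)+

lemma Br2_Nil_left:
  assumes "hw dr r" "hl dy y"
  shows "Br2 (tn (pt []) r) (cvl y g) = sc ((dr + n) * dy) (cvl y (Br2 (tn (pt []) r) g))"
proof (rule lin_eqI3[of "\<lambda>r y g. Br2 (tn (pt []) r) (cvl y g)"
      "\<lambda>r y g. sc ((dr + n) * dy) (cvl y (Br2 (tn (pt []) r) g))"])
  fix w b and g' :: "'e list \<times> 'e list"
  obtain v1 v2 where e: "g' = (v1, v2)" by fastforce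
  assume "w \<in> Poly_Mapping.keys r" "b \<in> Poly_Mapping.keys y"
  then have d: "wd par w = dr" "par b = dy" using assms by (auto simp: homog_def)
  show "Br2 (tn (pt []) (pt w)) (cvl (pt b) (pt g')) = sc ((dr + n) * dy) (cvl (pt b) (Br2 (tn (pt []) (pt w)) (pt g')))"
    by (simp add: e Br2_pt bit_ring flip: d)
qed (rule lin_intros)+

lemma Br2_Nil_right: "Br2 (cvl x f) (tn (pt []) r) = cvl x (Br2 f (tn (pt []) r))"
proof (rule lin_eqI3[of "\<lambda>x f r. Br2 (cvl x f) (tn (pt []) r)" "\<lambda>x f r. cvl x (Br2 f (tn (pt []) r))"])
  fix a w and f' :: "'e list \<times> 'e list"
  obtain u1 u2 where e: "f' = (u1, u2)" by fastforce
  have [simp]: "shw par u [] = pt u" for u by (cases u) auto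
  show "Br2 (cvl (pt a) (pt f')) (tn (pt []) (pt w)) = cvl (pt a) (Br2 (pt f') (tn (pt []) (pt w)))"
    by (simp add: e Br2_pt)
qed (rule lin_intros)+

lemma Dc_Br_pt: "Dc (Br (pt u) (pt v)) = Br2 (dcw u) (dcw v)"
proof (induction u v rule: word_induct2)
  case (Nil_left v)
  have "Br2 (pt ([], [])) f = 0" for f
    by (rule lin_eqI[of "Br2 (pt ([], []))" "\<lambda>f. 0"]; ((rule lin_intros)+)?) (auto simp: Br2_pt)
  then show ?case by simp
next
  case (Nil_right u)
  have "Br2 f (pt ([], [])) = 0" for f
    by (rule lin_eqI[of "\<lambda>f. Br2 f (pt ([], []))" "\<lambda>f. 0"]; ((rule lin_intros)+)?) (auto simp: Br2_pt)
  then show ?case by simp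
next
  case (step a u b v)
  note s = Br_cv[OF homog_pt homog_pt homog_pt, of a u b "pt v"]
  note s2 = Br2_cvl[OF homog_pt homog_dcw homog_pt, of a u b "dcw v"]
  note l = Br2_Nil_left[OF homog_pt homog_pt, of "a # u" b "dcw v"]
  note r = Br2_Nil_right[of "pt a" "dcw u" "pt (b # v)"]
  note n = Br2_tn[OF homog_pt homog_pt, where ?p1.0 = "pt []" and ?q2.0 = "pt (b # v)"]
  have "Dc (Br (cv (pt a) (pt u)) (cv (pt b) (pt v)))
      = tn (pt []) (Br (cv (pt a) (pt u)) (cv (pt b) (pt v)))
        + cvl (pt a) (Br2 (dcw u) (dcw (b # v)))
        + sc (par b * (par a + wd par u + n)) (cvl (pt b) (Br2 (dcw (a # u)) (dcw v)))
        + sc ((par b + n) * wd par u) (cvl (Be (pt a) (pt b)) (Sh2 (dcw u) (dcw v)))"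
    unfolding s by (simp add: Dc_cv step(1,2) Dc_Sh_pt del: dcw.simps)
  then show ?case using s2 l r n[of "a # u" "[]"] by (simp add: bit_ring)
qed

lemma Dc_Br: "Dc (Br p q) = Br2 (Dc p) (Dc q)"
  by (rule lin_eqI2[of "\<lambda>p q. Dc (Br p q)" "\<lambda>p q. Br2 (Dc p) (Dc q)"]; ((rule lin_intros)+)?)
     (simp add: Dc_Br_pt)

end

section \<open>The coderivation property\<close>

definition d2w :: "('e \<Rightarrow> bit) \<Rightarrow> ('e \<Rightarrow> ('e \<Rightarrow>\<^sub>0 'k)) \<Rightarrow> ('e \<Rightarrow> 'e \<Rightarrow> ('e \<Rightarrow>\<^sub>0 'k)) \<Rightarrow>
    'e list \<times> 'e list \<Rightarrow> ('e list \<times> 'e list \<Rightarrow>\<^sub>0 'k::field)" where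
  "d2w par b1 b2 f = tn (cdw par b1 b2 (fst f)) (pt (snd f))
     + sc (wd par (fst f)) (tn (pt (fst f)) (cdw par b1 b2 (snd f)))"

context coder_words
begin

abbreviation D2 :: "('e list \<times> 'e list \<Rightarrow>\<^sub>0 'k) \<Rightarrow> ('e list \<times> 'e list \<Rightarrow>\<^sub>0 'k)"
  where "D2 \<equiv> ext (d2w par b1 b2)"

lemma D2_tn:
  assumes "hw dp p"
  shows "D2 (tn p q) = tn (Df p) q + sc dp (tn p (Df q))"
proof (rule lin_eqI2[of "\<lambda>p q. D2 (tn p q)" "\<lambda>p q. tn (Df p) q + sc dp (tn p (Df q))"])
  fix u v assume "u \<in> Poly_Mapping.keys p"
  then have "wd par u = dp" using assms by (auto simp: homog_def)
  then show "D2 (tn (pt u) (pt v)) = tn (Df (pt u)) (pt v) + sc dp (tn (pt u) (Df (pt v)))"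
    by (simp add: d2w_def)
qed (rule lin_intros)+

abbreviation Mh2 :: "'e \<Rightarrow> ('e list \<times> 'e list \<Rightarrow>\<^sub>0 'k) \<Rightarrow> ('e list \<times> 'e list \<Rightarrow>\<^sub>0 'k)"
  where "Mh2 a \<equiv> ext (\<lambda>f. tn (mh b2 a (fst f)) (pt (snd f)))"

lemma D2_cvl: "D2 (cvl (pt a) f) = cvl (b1 a) f + Mh2 a f + sc (par a) (cvl (pt a) (D2 f))"
proof (rule lin_eqI[of "\<lambda>f. D2 (cvl (pt a) f)" "\<lambda>f. cvl (b1 a) f + Mh2 a f + sc (par a) (cvl (pt a) (D2 f))"])
  fix f' :: "'e list \<times> 'e list"
  obtain u v where e: "f' = (u, v)" by fastforce
  have "cvl (b1 a) (pt (u, v)) = tn (cv (b1 a) (pt u)) (pt v)"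
    using cvl_tn[of "b1 a" "pt u" "pt v"] by simp
  then show "D2 (cvl (pt a) (pt f')) = cvl (b1 a) (pt f') + Mh2 a (pt f') + sc (par a) (cvl (pt a) (D2 (pt f')))"
    by (simp add: e d2w_def bit_ring)
qed (rule lin_intros)+

text \<open>The splitting of \<open>w\<close> with empty left factor would cut between the two
  letters that are merged. It contributes nothing because \<open>mh\<close> vanishes on the empty
  word.\<close>

lemma Dc_mh: "Dc (mh b2 a w) = tn (pt []) (mh b2 a w) + Mh2 a (dcw w)"
proof (cases w)
  case (Cons b v)
  have 1: "Mh2 a (cvl (pt b) f) = cvl (b2 a b) f" for f
  proof (rule lin_eqI[of "\<lambda>f. Mh2 a (cvl (pt b) f)" "\<lambda>f. cvl (b2 a b) f"])
    fix f' :: "'e list \<times> 'e list"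
    obtain u v where e: "f' = (u, v)" by fastforce
    show "Mh2 a (cvl (pt b) (pt f')) = cvl (b2 a b) (pt f')"
      using cvl_tn[of "b2 a b" "pt u" "pt v"] by (simp add: e)
  qed (rule lin_intros)+
  show ?thesis by (simp add: Cons Dc_cv 1)
qed simp

lemma Dc_Df: "Dc (Df p) = D2 (Dc p)"
proof -
  have *: "Dc (Df (pt w)) = D2 (dcw w)" for w
  proof (induction w)
    case Nil
    show ?case by (simp add: d2w_def)
  next
    case (Cons a w)
    then show ?case
      by (simp add: D2_cvl Dc_cv Dc_mh) (simp add: d2w_def bit_ring)
  qed
  show ?thesis
    by (rule lin_eqI[of "\<lambda>p. Dc (Df p)" "\<lambda>p. D2 (Dc p)"]; ((rule lin_intros)+)?)
       (use * in simp)
qed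

end

section \<open>The antipode\<close>

context shuffle_words
begin

abbreviation conv :: "('e list \<Rightarrow> ('e list \<Rightarrow>\<^sub>0 'k)) \<Rightarrow> ('e list \<Rightarrow> ('e list \<Rightarrow>\<^sub>0 'k)) \<Rightarrow> 'e list \<Rightarrow> ('e list \<Rightarrow>\<^sub>0 'k)"
  where "conv f g w \<equiv> ext (\<lambda>(u, v). Sh (f u) (g v)) (dcw w)"

lemma conv_Cons: "conv f g (a # w) = Sh (f []) (g (a # w)) + conv (\<lambda>u. f (a # u)) g w"
  by (simp add: ext_cvl)

lemma conv_add_left: "conv (\<lambda>u. f u + f' u) g w = conv f g w + conv f' g w"
  by (simp add: split_def ext_add_fun)

lemma conv_Sh_left: "conv (\<lambda>u. Sh c (f u)) g w = Sh c (conv f g w)"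
  by (simp add: lin_lin_ext[OF lin_ext2(2)] Sh_assoc split_def)

text \<open>The first letter of the word is absorbed into the leftmost function, hence the induction
  over all \<open>f\<close>.\<close>

lemma conv_assoc: "conv (conv f g) h w = conv f (conv g h) w"
proof (induction w arbitrary: f)
  case (Cons a w)
  have "conv (conv f g) h (a # w) = Sh (Sh (f []) (g [])) (h (a # w))
      + conv (\<lambda>u. Sh (f []) (g (a # u)) + conv (\<lambda>u. f (a # u)) g u) h w"
    unfolding conv_Cons by simp
  also have "\<dots> = Sh (f []) (conv g h (a # w)) + conv (\<lambda>u. f (a # u)) (conv g h) w"
    unfolding conv_Cons[of g] conv_add_left conv_Sh_left Cons by (simp add: Sh_assoc add.assoc)
  finally show ?case unfolding conv_Cons[of f] by simp
qed (simp add: Sh_assoc)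

abbreviation counit_word :: "'e list \<Rightarrow> ('e list \<Rightarrow>\<^sub>0 'k)" where
  "counit_word w \<equiv> (if w = [] then pt [] else 0)"

lemma conv_counit: "conv f counit_word w = f w" "conv counit_word f w = f w"
proof -
  show "conv counit_word f w = f w" by (cases w) (simp_all add: ext_cvl split_def)
  show "conv f counit_word w = f w"
  proof (induction w arbitrary: f)
    case (Cons a w)
    then show ?case unfolding conv_Cons by simp
  qed simp
qed

text \<open>Both recursions solve the convolution identity for the longest word that occurs in it.\<close>

function antipode_left :: "'e list \<Rightarrow> ('e list \<Rightarrow>\<^sub>0 'k)" where
  "antipode_left w = (if w = [] then pt [] else
     - (\<Sum>i\<in>{..<length w}. Sh (antipode_left (take i w)) (pt (drop i w))))"
  by auto
termination by (relation "measure length") auto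

function antipode_right :: "'e list \<Rightarrow> ('e list \<Rightarrow>\<^sub>0 'k)" where
  "antipode_right w = (if w = [] then pt [] else
     - (\<Sum>i\<in>{1..length w}. Sh (pt (take i w)) (antipode_right (drop i w))))"
  by auto
termination by (relation "measure length") auto

declare antipode_left.simps [simp del] antipode_right.simps [simp del]

lemma conv_antipode_left: "conv antipode_left pt w = counit_word w"
proof (cases "w = []")
  case False
  have "{0..length w} = insert (length w) {..<length w}" by auto
  then have "conv antipode_left pt w
      = antipode_left w + (\<Sum>i\<in>{..<length w}. Sh (antipode_left (take i w)) (pt (drop i w)))"
    by (simp add: dcw_sum)
  then show ?thesis using False antipode_left.simps[of w] by simp
qed (simp add: antipode_left.simps)

lemma conv_antipode_right: "conv pt antipode_right w = counit_word w"
proof (cases "w = []")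
  case False
  have "{0..length w} = insert 0 {1..length w}" by auto
  then have "conv pt antipode_right w
      = antipode_right w + (\<Sum>i\<in>{1..length w}. Sh (pt (take i w)) (antipode_right (drop i w)))"
    by (simp add: dcw_sum)
  then show ?thesis using False antipode_right.simps[of w] by simp
qed (simp add: antipode_right.simps)

text \<open>In the convolution monoid a left inverse and a right inverse of the same element
  coincide.\<close>

lemma antipode_right_eq: "antipode_right w = antipode_left w"
proof -
  have "antipode_right w = conv (conv antipode_left pt) antipode_right w"
    unfolding conv_antipode_left conv_counit ..
  also have "\<dots> = antipode_left w"
    unfolding conv_assoc conv_antipode_right conv_counit ..
  finally show ?thesis .
qed

lemma conv_antipode: "conv pt antipode_left w = counit_word w"
  using conv_antipode_right[of w] unfolding antipode_right_eq .

text \<open>Stated for an arbitrary degree function, since the signs inside use parities whereas the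
  antipode has to preserve bidegrees.\<close>

lemma homog_antipode: "homog (wd D) (wd D w) (antipode_left w)"
proof (induction w rule: length_induct)
  case (1 w)
  show ?case
  proof (cases "w = []")
    case True
    then show ?thesis using homog_pt[of "wd D" "[]"] by (simp add: antipode_left.simps)
  next
    case False
    have "homog (wd D) (wd D w) (Sh (antipode_left (take i w)) (pt (drop i w)))" if "i < length w" for i
    proof -
      have "wd D (take i w) + wd D (drop i w) = wd D w"
        by (metis append_take_drop_id map_append sum_list_append)
      then show ?thesis
        using homog_Sh[OF 1[rule_format, of "take i w"] homog_pt, of "drop i w"] that by simp
    qed
    then show ?thesis
      unfolding antipode_left.simps[of w] using False by (auto intro!: homog_uminus homog_sum)
  qed
qed

end

section \<open>Shuffles as permutations\<close>

text \<open>A shuffle \<open>\<phi>\<close> is encoded by the list of the indices \<open>\<phi>\<^sup>-\<^sup>1 1, \<phi>\<^sup>-\<^sup>1 2, ...\<close>.\<close>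

definition shuffle_list :: "nat \<Rightarrow> (nat \<Rightarrow> nat) \<Rightarrow> nat list" where
  "shuffle_list N \<phi> = map (inv_into UNIV \<phi>) [1..<N + 1]"

lemma set_shuffle_list:
  assumes "\<phi> permutes {1..N}"
  shows "set (shuffle_list N \<phi>) = {1..N}"
proof -
  have "{1..<N + 1} = {1..N}" by auto
  then show ?thesis
    unfolding shuffle_list_def set_map set_upt using permutes_image[OF permutes_inv[OF assms]] by metis
qed

text \<open>Monotonicity of \<open>\<phi>\<close> on a block is the same as the indices of that
  block occurring in increasing order in the list; an increasing list is determined by its
  set.\<close>

lemma sorted_list_filter_shuffle:
  assumes "\<phi> permutes {1..N}" "strict_mono_on {a..b} \<phi>" "{a..b} \<subseteq> {1..N}"
  shows "filter (\<lambda>j. j \<in> {a..b}) (shuffle_list N \<phi>) = [a..<Suc b]"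
proof -
  let ?l = "filter (\<lambda>j. j \<in> {a..b}) (shuffle_list N \<phi>)"
  have inv: "\<phi> (inv_into UNIV \<phi> i) = i" "inv_into UNIV \<phi> (\<phi> i) = i" for i
    using permutes_inverses[OF assms(1)] by auto
  have "sorted_wrt (<) (filter (\<lambda>i. inv_into UNIV \<phi> i \<in> {a..b}) [1..<N + 1])"
    by (rule sorted_wrt_filter, rule sorted_wrt_upt)
  then have "sorted_wrt (\<lambda>i j. i < j \<and> inv_into UNIV \<phi> i \<in> {a..b} \<and> inv_into UNIV \<phi> j \<in> {a..b})
      (filter (\<lambda>i. inv_into UNIV \<phi> i \<in> {a..b}) [1..<N + 1])"
    by (rule sorted_wrt_mono_rel[rotated]) (auto simp del: upt_Suc)
  then have "sorted_wrt (<) ?l"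
    unfolding shuffle_list_def filter_map o_def sorted_wrt_map
  proof (rule sorted_wrt_mono_rel[rotated])
    fix i j assume *: "i < j \<and> inv_into UNIV \<phi> i \<in> {a..b} \<and> inv_into UNIV \<phi> j \<in> {a..b}"
    show "inv_into UNIV \<phi> i < inv_into UNIV \<phi> j"
    proof (rule ccontr)
      assume "\<not> inv_into UNIV \<phi> i < inv_into UNIV \<phi> j"
      then have "\<phi> (inv_into UNIV \<phi> j) \<le> \<phi> (inv_into UNIV \<phi> i)"
        using strict_mono_on_leD[OF assms(2)] * by auto
      then show False using * inv by simp
    qed
  qed
  moreover have "set ?l = {a..b}"
    using set_shuffle_list[OF assms(1)] assms(3) by auto
  ultimately show ?thesis
    using strict_sorted_equal[OF _ sorted_wrt_upt, of ?l a "Suc b"]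
    by (simp add: atLeastLessThanSuc_atLeastAtMost del: upt_Suc)
qed

text \<open>Replaces permutations by interleavings of two intervals of indices, which have a
  recursion by first entry that can be compared with \<open>shw\<close> and
  \<open>brw\<close>.\<close>

lemma bij_pq_shuffles:
  "bij_betw (shuffle_list (p + q)) (pq_shuffles p q) (shuffles [1..<Suc p] [Suc p..<Suc (p + q)])"
proof (rule bij_betwI')
  fix \<phi> \<psi> assume *: "\<phi> \<in> pq_shuffles p q" "\<psi> \<in> pq_shuffles p q"
  then have p: "\<phi> permutes {1..p+q}" "\<psi> permutes {1..p+q}" by (auto simp: pq_shuffles_def)
  show "(shuffle_list (p + q) \<phi> = shuffle_list (p + q) \<psi>) = (\<phi> = \<psi>)"
  proof
    assume eq: "shuffle_list (p + q) \<phi> = shuffle_list (p + q) \<psi>"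
    have "inv_into UNIV \<phi> i = inv_into UNIV \<psi> i" for i
    proof (cases "i \<in> {1..p+q}")
      case True
      then show ?thesis using eq by (auto simp: shuffle_list_def)
    next
      case False
      then show ?thesis
        using permutes_not_in[OF permutes_inv[OF p(1)]] permutes_not_in[OF permutes_inv[OF p(2)]] by simp
    qed
    then have "inv_into UNIV \<phi> = inv_into UNIV \<psi>" by auto
    then show "\<phi> = \<psi>"
      using permutes_inv_inv[OF p(1)] permutes_inv_inv[OF p(2)] by metis
  qed simp
next
  fix \<phi> assume "\<phi> \<in> pq_shuffles p q"
  then have *: "\<phi> permutes {1..p+q}" "strict_mono_on {1..p} \<phi>" "strict_mono_on {Suc p..p+q} \<phi>"
    by (auto simp: pq_shuffles_def)
  let ?l = "shuffle_list (p + q) \<phi>"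
  have s: "set ?l = {1..p+q}" by (rule set_shuffle_list[OF *(1)])
  have "?l \<in> shuffles (filter (\<lambda>j. j \<in> {1..p}) ?l) (filter (\<lambda>j. \<not> j \<in> {1..p}) ?l)"
    by (rule partition_in_shuffles)
  moreover have "filter (\<lambda>j. \<not> j \<in> {1..p}) ?l = filter (\<lambda>j. j \<in> {Suc p..p+q}) ?l"
    by (rule filter_cong) (use s in auto)
  ultimately show "?l \<in> shuffles [1..<Suc p] [Suc p..<Suc (p + q)]"
    using sorted_list_filter_shuffle[OF *(1,2)] sorted_list_filter_shuffle[OF *(1,3)] by simp
next
  fix l assume l: "l \<in> shuffles [1..<Suc p] [Suc p..<Suc (p + q)]"
  let ?N = "p + q"
  have len: "length l = ?N" using length_shuffles[OF l] by simp
  have "{1..<Suc p} \<union> {Suc p..<Suc ?N} = {1..?N}" by auto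
  then have set: "set l = {1..?N}" using set_shuffles[OF l] unfolding set_upt by metis
  have dist: "distinct l" by (rule distinct_disjoint_shuffles[OF _ _ _ l]) (auto simp del: upt_Suc)
  \<comment> \<open>The list records the inverse of the shuffle to be found. Outside the interval it
    is continued by the identity, as \<open>permutes\<close> requires.\<close>
  define g where "g = (\<lambda>i. if i \<in> {1..?N} then l ! (i - 1) else i)"
  have "bij_betw g {1..?N} {1..?N}"
  proof -
    have "bij_betw (\<lambda>i. i - 1) {1..?N} {..<?N}"
      by (rule bij_betwI[where g = Suc]) auto
    moreover have "bij_betw ((!) l) {..<?N} {1..?N}"
      using bij_betw_nth[OF dist _ refl, of "{..<?N}"] len set by simp
    ultimately have "bij_betw ((!) l \<circ> (\<lambda>i. i - 1)) {1..?N} {1..?N}"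
      by (rule bij_betw_trans)
    then show ?thesis by (rule bij_betw_cong[THEN iffD1, rotated]) (simp add: g_def)
  qed
  then have g: "g permutes {1..?N}"
    by (rule bij_imp_permutes) (auto simp: g_def)
  define \<phi> where "\<phi> = inv_into UNIV g"
  have \<phi>: "\<phi> permutes {1..?N}" unfolding \<phi>_def by (rule permutes_inv[OF g])
  have inv: "inv_into UNIV \<phi> = g" unfolding \<phi>_def by (rule permutes_inv_inv[OF g])
  have l_eq: "l = shuffle_list ?N \<phi>"
    by (rule nth_equalityI) (simp_all add: len shuffle_list_def inv g_def del: upt_Suc)
  have disj: "set [1..<Suc p] \<inter> set [Suc p..<Suc (p + q)] = {}" by (auto simp del: upt_Suc)
  have mono: "strict_mono_on {a..b} \<phi>"
    if "filter (\<lambda>x. x \<in> {a..b}) l = [a..<Suc b]" "{a..b} \<subseteq> {1..?N}" for a b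
  proof (rule strict_mono_onI)
    fix i j assume ij: "i \<in> {a..b}" "j \<in> {a..b}" "i < j"
    show "\<phi> i < \<phi> j"
    proof (rule ccontr)
      assume "\<not> \<phi> i < \<phi> j"
      moreover have "\<phi> i \<noteq> \<phi> j" using ij permutes_inj[OF \<phi>] by (auto dest: injD)
      ultimately have lt: "\<phi> j < \<phi> i" by simp
      \<comment> \<open>The positions occupied by the block, in increasing order. Their images under
        \<open>g\<close> also increase, so the inverse of \<open>g\<close> is increasing on the
        block.\<close>
      define L where "L = filter (\<lambda>i. g i \<in> {a..b}) [1..<?N + 1]"
      have "sorted_wrt (<) (filter (\<lambda>x. x \<in> {a..b}) l)"
        unfolding that(1) by (rule sorted_wrt_upt)
      moreover have "filter (\<lambda>x. x \<in> {a..b}) l = map g L"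
        unfolding l_eq shuffle_list_def inv filter_map o_def L_def ..
      ultimately have gL: "sorted_wrt (\<lambda>i j. g i < g j) L"
        by (simp add: sorted_wrt_map)
      have L: "sorted_wrt (<) L"
        unfolding L_def by (rule sorted_wrt_filter, rule sorted_wrt_upt)
      have in_L: "\<phi> k \<in> set L" if "k \<in> {a..b}" for k
        using that \<open>{a..b} \<subseteq> {1..?N}\<close> permutes_in_image[OF \<phi>, of k] permutes_inverses(2)[OF \<phi>, of k] inv
        by (auto simp: L_def simp del: upt_Suc)
      obtain s t where st: "s < length L" "L ! s = \<phi> j" "t < length L" "L ! t = \<phi> i"
        using in_L[OF ij(1)] in_L[OF ij(2)] by (auto simp: in_set_conv_nth)
      have "s < t"
      proof (rule ccontr)
        assume "\<not> s < t"
        then have "t < s \<or> s = t" by auto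
        then show False using sorted_wrt_nth_less[OF L, of t s] st lt by auto
      qed
      then have "g (\<phi> j) < g (\<phi> i)"
        using sorted_wrt_nth_less[OF gL, of s t] st by simp
      then show False using ij permutes_inverses(2)[OF \<phi>] inv by simp
    qed
  qed
  have "filter (\<lambda>x. x \<in> {1..p}) l = [1..<Suc p]"
    using filter_shuffles_disjoint1(1)[OF disj l] by (simp add: atLeastLessThanSuc_atLeastAtMost del: upt_Suc)
  moreover have "filter (\<lambda>x. x \<in> {Suc p..?N}) l = [Suc p..<Suc ?N]"
    using filter_shuffles_disjoint2(1)[OF disj l] by (simp add: atLeastLessThanSuc_atLeastAtMost del: upt_Suc)
  ultimately have "\<phi> \<in> pq_shuffles p q"
    using mono[of 1 p] mono[of "Suc p" ?N] \<phi> by (auto simp: pq_shuffles_def)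
  then show "\<exists>\<phi>\<in>pq_shuffles p q. l = shuffle_list (p + q) \<phi>"
    using l_eq by blast
qed

text \<open>\<open>shuffles\<close> is a set, so the two families of interleavings are disjoint only
  if the heads differ. This is why distinct indices are interleaved and vectors attached to them,
  rather than letters, which may repeat.\<close>

lemma sum_shuffles_Cons:
  fixes f :: "'a list \<Rightarrow> 'b::ab_group_add"
  assumes "u \<noteq> v"
  shows "sum f (shuffles (u # us) (v # vs))
    = (\<Sum>l\<in>shuffles us (v # vs). f (u # l)) + (\<Sum>l\<in>shuffles (u # us) vs. f (v # l))"
proof -
  have "sum f (shuffles (u # us) (v # vs)) = sum f ((#) u ` shuffles us (v # vs)) + sum f ((#) v ` shuffles (u # us) vs)"
    unfolding shuffles.simps using assms by (intro sum.union_disjoint) auto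
  then show ?thesis by (simp add: sum.reindex inj_on_def)
qed

lemma filter_shuffle:
  assumes "l \<in> shuffles us vs" "\<forall>i\<in>set us. R i" "\<forall>i\<in>set vs. \<not> R i"
  shows "filter R l = us"
proof -
  have "filter R us = us" "filter R vs = []"
    using assms(2,3) by (auto simp: filter_id_conv filter_empty_conv)
  moreover have "filter R l \<in> shuffles (filter R us) (filter R vs)"
    using assms(1) by (simp flip: filter_shuffles)
  ultimately show ?thesis by simp
qed

text \<open>The exponent \<sigma>(\<phi>) modulo two, read off the list of indices: it counts
  entries of the second word that stand before entries of the first, weighted by their
  parities.\<close>

definition shsgn :: "('i \<Rightarrow> bool) \<Rightarrow> ('i \<Rightarrow> bit) \<Rightarrow> 'i list \<Rightarrow> bit" where
  "shsgn isx dg l = (\<Sum>s<length l. \<Sum>t<length l.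
     if s < t \<and> \<not> isx (l ! s) \<and> isx (l ! t) then dg (l ! s) * dg (l ! t) else 0)"

lemma sum_filter_nth:
  "sum_list (map dg (filter R l)) = (\<Sum>t<length l. if R (l ! t) then dg (l ! t) else 0)"
  for dg :: "'i \<Rightarrow> 'b::comm_monoid_add"
  by (induction l) (simp_all add: sum.lessThan_Suc_shift cong: if_cong del: sum.lessThan_Suc)

lemma shsgn_Cons: "shsgn isx dg (h # l) = (if isx h then 0 else dg h * sum_list (map dg (filter isx l))) + shsgn isx dg l"
  by (simp add: shsgn_def sum.lessThan_Suc_shift sum_filter_nth sum_distrib_left if_distrib
      cong: if_cong del: sum.lessThan_Suc)

lemma shsgn_all: "\<forall>i\<in>set l. isx i \<Longrightarrow> shsgn isx dg l = 0" "\<forall>i\<in>set l. \<not> isx i \<Longrightarrow> shsgn isx dg l = 0"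
  by (auto simp: shsgn_def intro!: sum.neutral)

text \<open>The exponent \<sigma>' modulo two, with positions counted from 0, so that
  \<open>i\<close> here is \<open>Suc i\<close> in \<open>bracket_sign\<close>.\<close>

definition brsgn :: "bit \<Rightarrow> ('i \<Rightarrow> bool) \<Rightarrow> ('i \<Rightarrow> bit) \<Rightarrow> 'i list \<Rightarrow> nat \<Rightarrow> bit" where
  "brsgn n isx dg l i = n * ((\<Sum>t<length l. if Suc i < t \<and> isx (l ! t) then dg (l ! t) else 0)
     + (\<Sum>t<length l. if t < i \<and> \<not> isx (l ! t) then dg (l ! t) else 0))"

text \<open>The pure tensor of a list of vectors, expanded in basis words.\<close>

abbreviation wv :: "('e \<Rightarrow>\<^sub>0 'k::field) list \<Rightarrow> ('e list \<Rightarrow>\<^sub>0 'k)" where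
  "wv xs \<equiv> foldr cv xs (pt [])"

lemma homog_wv: "list_all2 (\<lambda>x d. homog D d x) xs ds \<Longrightarrow> homog (wd D) (sum_list ds) (wv xs)"
proof (induction rule: list_all2_induct)
  case Nil
  then show ?case using homog_pt[of "wd D" "[]"] by simp
next
  case (Cons x xs d ds)
  then show ?case using homog_cv by force
qed

context shuffle_words
begin

lemma Sh_shuffles:
  assumes "\<And>i. i \<in> set us \<union> set vs \<Longrightarrow> hl (dg i) (f i)" "\<forall>i\<in>set us. isx i" "\<forall>i\<in>set vs. \<not> isx i"
  shows "Sh (wv (map f us)) (wv (map f vs)) = (\<Sum>l\<in>shuffles us vs. sc (shsgn isx dg l) (wv (map f l)))"
  using assms
proof (induction us vs rule: word_induct2)
  case (Nil_left vs)
  then show ?case by (simp add: shsgn_all)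
next
  case (Nil_right us)
  then show ?case by (cases us) (simp_all add: shsgn_all)
next
  case (step u us v vs)
  have f: "filter isx l = u # us" if "l \<in> shuffles (u # us) vs" for l
    using filter_shuffle[OF that] step.prems by simp
  have hu: "hw (sum_list (map dg us)) (wv (map f us))"
    using step.prems by (intro homog_wv) (auto simp: list.rel_map intro!: list.rel_refl_strong)
  have "u \<noteq> v" using step.prems by auto
  have "Sh (wv (map f (u # us))) (wv (map f (v # vs))) =
      cv (f u) (Sh (wv (map f us)) (wv (map f (v # vs))))
      + sc (dg v * sum_list (map dg (u # us))) (cv (f v) (Sh (wv (map f (u # us))) (wv (map f vs))))"
    using Sh_cv[of "dg u" "f u", OF _ hu, of "dg v" "f v"] step.prems by simp
  also have "\<dots> = (\<Sum>l\<in>shuffles (u # us) (v # vs). sc (shsgn isx dg l) (wv (map f l)))"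
  proof -
    have b: "Sh (wv (map f us)) (wv (map f (v # vs))) = (\<Sum>l\<in>shuffles us (v # vs). sc (shsgn isx dg l) (wv (map f l)))"
      "Sh (wv (map f (u # us))) (wv (map f vs)) = (\<Sum>l\<in>shuffles (u # us) vs. sc (shsgn isx dg l) (wv (map f l)))"
      using step.IH step.prems by auto
    show ?thesis
      unfolding sum_shuffles_Cons[OF \<open>u \<noteq> v\<close>] b using f step.prems by (simp add: shsgn_Cons)
  qed
  finally show ?case .
qed

end

context bracket_words
begin

definition brl :: "('i \<Rightarrow> bool) \<Rightarrow> ('i \<Rightarrow> bit) \<Rightarrow> ('i \<Rightarrow> 'e \<Rightarrow>\<^sub>0 'k) \<Rightarrow> 'i list \<Rightarrow> 'e list \<Rightarrow>\<^sub>0 'k" where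
  "brl isx dg f l = (\<Sum>i<length l. if Suc i < length l \<and> isx (l ! i) \<and> \<not> isx (l ! Suc i)
     then wv (map f (take i l) @ [sc (brsgn n isx dg l i) (Be (f (l ! i)) (f (l ! Suc i)))] @ map f (drop (i + 2) l))
     else 0)"

text \<open>The summand of \<open>brl\<close> whose bracket occupies the first two positions.
  Nothing stands before that bracket, so only later entries of the first word enter its
  sign.\<close>

definition brh :: "('i \<Rightarrow> bool) \<Rightarrow> ('i \<Rightarrow> bit) \<Rightarrow> ('i \<Rightarrow> 'e \<Rightarrow>\<^sub>0 'k) \<Rightarrow> 'i \<Rightarrow> 'i list \<Rightarrow> 'e list \<Rightarrow>\<^sub>0 'k" where
  "brh isx dg f h l = (case l of [] \<Rightarrow> 0 | k # l \<Rightarrow> if isx h \<and> \<not> isx k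
     then sc (n * sum_list (map dg (filter isx l))) (cv (Be (f h) (f k)) (wv (map f l))) else 0)"

lemma wv_sc: "wv (xs @ [sc e x] @ ys) = sc e (wv (xs @ [x] @ ys))"
  by (induction xs) simp_all

text \<open>An entry of the second word put in front precedes every later bracket and adds
  \<open>n * dg h\<close> to its exponent. An entry of the first word adds nothing there, since such
  entries count only behind the bracket.\<close>

lemma brl_Cons:
  "brl isx dg f (h # l) = brh isx dg f h l + sc (if isx h then 0 else n * dg h) (cv (f h) (brl isx dg f l))"
proof -
  have 1: "brsgn n isx dg (h # l) (Suc i) = (if isx h then 0 else n * dg h) + brsgn n isx dg l i" for l i
    by (simp add: brsgn_def sum.lessThan_Suc_shift distrib_left ac_simps cong: if_cong del: sum.lessThan_Suc)
  have 2: "brsgn n isx dg (h # k # l') 0 = n * sum_list (map dg (filter isx l'))" for k l'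
    by (simp add: brsgn_def sum.lessThan_Suc_shift sum_filter_nth cong: if_cong del: sum.lessThan_Suc)
  show ?thesis
    unfolding brl_def length_Cons sum.lessThan_Suc_shift
    by (cases l) (auto simp: brh_def 1 2 wv_sc[simplified] intro!: sum.cong simp del: sum.lessThan_Suc)
qed

text \<open>Interleavings that begin with \<open>u\<close> give the terms of the recursion that
  begin with \<open>f u\<close> and, through \<open>brh\<close>, those that begin with the bracket;
  interleavings that begin with \<open>v\<close> give the rest.\<close>

lemma Br_shuffles:
  assumes "\<And>i. i \<in> set us \<union> set vs \<Longrightarrow> hl (dg i) (f i)" "\<forall>i\<in>set us. isx i" "\<forall>i\<in>set vs. \<not> isx i"
  shows "Br (wv (map f us)) (wv (map f vs)) = (\<Sum>l\<in>shuffles us vs. sc (shsgn isx dg l) (brl isx dg f l))"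
  using assms
proof (induction us vs rule: word_induct2)
  case (Nil_left vs)
  then show ?case by (auto simp: brl_def intro!: sum.neutral)
next
  case (Nil_right us)
  then show ?case by (cases us) (auto simp: brl_def intro!: sum.neutral)
next
  case (step u us v vs)
  have f: "filter isx l = us'" if "l \<in> shuffles us' vs" "set us' \<subseteq> set (u # us)" for l us'
    using filter_shuffle[OF that(1)] step.prems that(2) by auto
  have hu: "hw (sum_list (map dg us)) (wv (map f us))"
    using step.prems by (intro homog_wv) (auto simp: list.rel_map intro!: list.rel_refl_strong)
  have "u \<noteq> v" and x: "isx u" "\<not> isx v" using step.prems by auto
  \<comment> \<open>Only interleavings that begin with \<open>v\<close> contribute, since a bracket
    needs an entry of the second word right after \<open>u\<close>. Moving \<open>v\<close> past
    \<open>us\<close> and the factor \<open>n\<close> from \<sigma>' together give the sign of the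
    last summand of \<open>brw\<close>.\<close>
  have h: "(\<Sum>l\<in>shuffles us (v # vs). sc (shsgn isx dg l) (brh isx dg f u l)) =
      (\<Sum>l\<in>shuffles us vs. sc (dg v * sum_list (map dg us) + shsgn isx dg l)
        (sc (n * sum_list (map dg us)) (cv (Be (f u) (f v)) (wv (map f l)))))"
  proof (cases us)
    case Nil
    have "filter isx vs = []" using step.prems by (simp add: filter_empty_conv)
    with Nil x show ?thesis by (simp add: brh_def shsgn_Cons)
  next
    case (Cons u' us')
    have "u' \<noteq> v" "isx u'" using Cons step.prems by auto
    moreover have "filter isx l = u' # us'" if "l \<in> shuffles (u' # us') vs" for l
      using f[OF that] Cons by auto
    ultimately show ?thesis
      unfolding Cons sum_shuffles_Cons[OF \<open>u' \<noteq> v\<close>]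
      using x by (auto simp: brh_def shsgn_Cons intro!: sum.cong)
  qed
  have "Br (wv (map f (u # us))) (wv (map f (v # vs))) =
      cv (f u) (Br (wv (map f us)) (wv (map f (v # vs))))
      + sc (dg v * (dg u + sum_list (map dg us) + n)) (cv (f v) (Br (wv (map f (u # us))) (wv (map f vs))))
      + sc ((dg v + n) * sum_list (map dg us)) (cv (Be (f u) (f v)) (Sh (wv (map f us)) (wv (map f vs))))"
    using Br_cv[of "dg u" "f u", OF _ hu, of "dg v" "f v"] step.prems by simp
  also have "\<dots> = (\<Sum>l\<in>shuffles us (v # vs). sc (shsgn isx dg l) (brl isx dg f (u # l)))
      + (\<Sum>l\<in>shuffles (u # us) vs. sc (shsgn isx dg (v # l)) (brl isx dg f (v # l)))"
  proof -
    have s: "Sh (wv (map f us)) (wv (map f vs)) = (\<Sum>l\<in>shuffles us vs. sc (shsgn isx dg l) (wv (map f l)))"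
      using step.prems by (intro Sh_shuffles) auto
    have b: "Br (wv (map f us)) (wv (map f (v # vs))) = (\<Sum>l\<in>shuffles us (v # vs). sc (shsgn isx dg l) (brl isx dg f l))"
      "Br (wv (map f (u # us))) (wv (map f vs)) = (\<Sum>l\<in>shuffles (u # us) vs. sc (shsgn isx dg l) (brl isx dg f l))"
      using step.IH step.prems by auto
    have v: "brh isx dg f v l = 0" for l using x by (simp add: brh_def split: list.split)
    have u: "(\<Sum>l\<in>shuffles us (v # vs). sc (shsgn isx dg l) (brl isx dg f (u # l)))
      = cv (f u) (Br (wv (map f us)) (wv (map f (v # vs))))
        + sc ((dg v + n) * sum_list (map dg us)) (cv (Be (f u) (f v)) (Sh (wv (map f us)) (wv (map f vs))))"
      unfolding brl_Cons sc_simps sum.distrib h b s using x by (simp add: bit_ring)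
    have w: "(\<Sum>l\<in>shuffles (u # us) vs. sc (shsgn isx dg (v # l)) (brl isx dg f (v # l)))
      = sc (dg v * (dg u + sum_list (map dg us) + n)) (cv (f v) (Br (wv (map f (u # us))) (wv (map f vs))))"
      unfolding brl_Cons b v using f[of _ "u # us"] x
      by (auto simp: shsgn_Cons bit_ring intro!: sum.cong)
    show ?thesis unfolding u w by (simp add: ac_simps)
  qed
  also have "\<dots> = (\<Sum>l\<in>shuffles (u # us) (v # vs). sc (shsgn isx dg l) (brl isx dg f l))"
    using x by (simp add: sum_shuffles_Cons[OF \<open>u \<noteq> v\<close>] shsgn_Cons del: shuffles.simps)
  finally show ?case .
qed

end

lemma nth_shuffle_list: "s < N \<Longrightarrow> shuffle_list N \<phi> ! s = inv_into UNIV \<phi> (Suc s)"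
  by (simp add: shuffle_list_def del: upt_Suc)

lemma length_shuffle_list [simp]: "length (shuffle_list N \<phi>) = N"
  by (simp add: shuffle_list_def)

text \<open>Sums over positions of the list become sums over indices, split into the two blocks,
  which is how \<sigma>(\<phi>) and \<sigma>' are written.\<close>

lemma sum_shuffle_list:
  fixes H :: "nat \<Rightarrow> nat \<Rightarrow> 'b::comm_monoid_add"
  assumes "\<phi> permutes {1..p + q}"
  shows "(\<Sum>s<p + q. H (shuffle_list (p + q) \<phi> ! s) (Suc s))
    = (\<Sum>i\<in>{1..p}. H i (\<phi> i)) + (\<Sum>j\<in>{1..q}. H (j + p) (\<phi> (j + p)))"
proof -
  have "(\<Sum>s<p + q. H (shuffle_list (p + q) \<phi> ! s) (Suc s)) = (\<Sum>m\<in>{1..p + q}. H (inv_into UNIV \<phi> m) m)"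
    by (rule sum.reindex_bij_witness[of _ "\<lambda>m. m - 1" Suc]) (auto simp: nth_shuffle_list)
  also have "\<dots> = (\<Sum>m\<in>{1..p + q}. H m (\<phi> m))"
    by (rule sum.reindex_bij_witness[of _ \<phi> "inv_into UNIV \<phi>"])
       (use permutes_in_image[OF assms] permutes_in_image[OF permutes_inv[OF assms]] permutes_inverses[OF assms] in auto)
  also have "\<dots> = (\<Sum>i\<in>{1..p}. H i (\<phi> i)) + (\<Sum>m\<in>{1 + p..q + p}. H m (\<phi> m))"
    by (subst sum.ub_add_nat) (simp_all add: ac_simps)
  also have "(\<Sum>m\<in>{1 + p..q + p}. H m (\<phi> m)) = (\<Sum>j\<in>{1..q}. H (j + p) (\<phi> (j + p)))"
    by (rule sum.shift_bounds_cl_nat_ivl)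
  finally show ?thesis .
qed

context
  fixes ps qs :: "int list" and p q :: nat and isx :: "nat \<Rightarrow> bool" and dg :: "nat \<Rightarrow> bit"
  defines "p \<equiv> length ps" and "q \<equiv> length qs" and "isx \<equiv> \<lambda>j. j \<le> p"
    and "dg \<equiv> \<lambda>j. of_int ((ps @ qs) ! (j - 1) + 1)"
begin

lemma dg_left: "i \<in> {1..p} \<Longrightarrow> dg i = of_int (ps ! (i - 1) + 1)"
  by (auto simp: dg_def p_def nth_append)

lemma dg_right: "j \<in> {1..q} \<Longrightarrow> dg (j + p) = of_int (qs ! (j - 1) + 1)"
  by (auto simp: dg_def p_def q_def nth_append)

lemma shsgn_shuffle:
  assumes "\<phi> permutes {1..p + q}"
  shows "shsgn isx dg (shuffle_list (p + q) \<phi>) = of_int (shuffle_sign ps qs \<phi>)"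
proof -
  define H :: "nat \<Rightarrow> nat \<Rightarrow> nat \<Rightarrow> nat \<Rightarrow> bit"
    where "H = (\<lambda>m a m' b. if a < b \<and> \<not> isx m \<and> isx m' then dg m * dg m' else 0)"
  let ?l = "shuffle_list (p + q) \<phi>"
  have "shsgn isx dg ?l = (\<Sum>s<p + q. \<Sum>t<p + q. H (?l ! s) (Suc s) (?l ! t) (Suc t))"
    by (simp add: shsgn_def H_def)
  also have "\<dots> = (\<Sum>s<p + q. \<Sum>i\<in>{1..p}. H (?l ! s) (Suc s) i (\<phi> i))"
    by (rule sum.cong[OF refl], subst sum_shuffle_list[OF assms]) (simp add: H_def isx_def)
  also have "\<dots> = (\<Sum>j\<in>{1..q}. \<Sum>i\<in>{1..p}. H (j + p) (\<phi> (j + p)) i (\<phi> i))"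
    by (subst sum_shuffle_list[OF assms, where H = "\<lambda>m b. \<Sum>i\<in>{1..p}. H m b i (\<phi> i)"]) (simp add: H_def isx_def)
  also have "\<dots> = (\<Sum>j\<in>{1..q}. \<Sum>i\<in>{1..p}. if \<phi> (j + p) < \<phi> i then dg (j + p) * dg i else 0)"
    by (auto simp: H_def isx_def intro!: sum.cong)
  also have "\<dots> = (\<Sum>i\<in>{1..p}. \<Sum>j\<in>{1..q}. of_int (if \<phi> (j + p) < \<phi> i then (ps ! (i - 1) + 1) * (qs ! (j - 1) + 1) else 0))"
    by (subst sum.swap) (auto intro!: sum.cong simp: dg_left dg_right mult.commute)
  also have "\<dots> = of_int (\<Sum>i\<in>{1..p}. \<Sum>j\<in>{1..q}. if \<phi> i > \<phi> (j + p) then (ps ! (i - 1) + 1) * (qs ! (j - 1) + 1) else 0)"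
    by (simp only: of_int_sum)
  also have "(\<Sum>i\<in>{1..p}. \<Sum>j\<in>{1..q}. if \<phi> i > \<phi> (j + p) then (ps ! (i - 1) + 1) * (qs ! (j - 1) + 1) else 0)
      = shuffle_sign ps qs \<phi>"
    unfolding shuffle_sign_def Let_def p_def q_def sum.cartesian_product
    by (rule sum.mono_neutral_cong_right) (auto split: if_splits)
  finally show ?thesis .
qed

lemma brsgn_shuffle:
  assumes "\<phi> permutes {1..p + q}"
  shows "brsgn (of_nat n) isx dg (shuffle_list (p + q) \<phi>) i = of_int (bracket_sign n ps qs \<phi> (Suc i))"
proof -
  have 1: "(\<Sum>t<p + q. if Suc i < t \<and> isx (shuffle_list (p + q) \<phi> ! t) then dg (shuffle_list (p + q) \<phi> ! t) else 0)
      = of_int (\<Sum>j\<in>{j\<in>{1..p}. \<phi> j > Suc i + 1}. ps ! (j - 1) + 1)"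
  proof -
    have "(\<Sum>t<p + q. if Suc i < t \<and> isx (shuffle_list (p + q) \<phi> ! t) then dg (shuffle_list (p + q) \<phi> ! t) else 0)
      = (\<Sum>t<p + q. (\<lambda>m b. if Suc (Suc i) < b \<and> isx m then dg m else 0) (shuffle_list (p + q) \<phi> ! t) (Suc t))"
      by simp
    also have "\<dots> = (\<Sum>j\<in>{1..p}. of_int (if \<phi> j > Suc i + 1 then ps ! (j - 1) + 1 else 0))"
      by (subst sum_shuffle_list[OF assms, where H = "\<lambda>m b. if Suc (Suc i) < b \<and> isx m then dg m else 0"])
         (auto simp: isx_def dg_left intro!: sum.cong)
    also have "\<dots> = of_int (\<Sum>j\<in>{j\<in>{1..p}. \<phi> j > Suc i + 1}. ps ! (j - 1) + 1)"
      by (simp only: of_int_sum[symmetric] sum.inter_filter finite_atLeastAtMost)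
    finally show ?thesis .
  qed
  have 2: "(\<Sum>t<p + q. if t < i \<and> \<not> isx (shuffle_list (p + q) \<phi> ! t) then dg (shuffle_list (p + q) \<phi> ! t) else 0)
      = of_int (\<Sum>j\<in>{j\<in>{1..q}. \<phi> (j + p) < Suc i}. qs ! (j - 1) + 1)"
  proof -
    have "(\<Sum>t<p + q. if t < i \<and> \<not> isx (shuffle_list (p + q) \<phi> ! t) then dg (shuffle_list (p + q) \<phi> ! t) else 0)
      = (\<Sum>t<p + q. (\<lambda>m b. if b < Suc i \<and> \<not> isx m then dg m else 0) (shuffle_list (p + q) \<phi> ! t) (Suc t))"
      by simp
    also have "\<dots> = (\<Sum>j\<in>{1..q}. of_int (if \<phi> (j + p) < Suc i then qs ! (j - 1) + 1 else 0))"
      by (subst sum_shuffle_list[OF assms, where H = "\<lambda>m b. if b < Suc i \<and> \<not> isx m then dg m else 0"])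
         (auto simp: isx_def dg_right intro!: sum.cong)
    also have "\<dots> = of_int (\<Sum>j\<in>{j\<in>{1..q}. \<phi> (j + p) < Suc i}. qs ! (j - 1) + 1)"
      by (simp only: of_int_sum[symmetric] sum.inter_filter finite_atLeastAtMost)
    finally show ?thesis .
  qed
  have "bracket_sign n ps qs \<phi> (Suc i) = int n * ((\<Sum>j\<in>{j\<in>{1..p}. \<phi> j > Suc i + 1}. ps ! (j - 1) + 1)
      + (\<Sum>j\<in>{j\<in>{1..q}. \<phi> (j + p) < Suc i}. qs ! (j - 1) + 1))"
    by (simp only: bracket_sign_def Let_def p_def q_def)
  then show ?thesis
    unfolding brsgn_def length_shuffle_list 1 2 by (simp only: of_int_mult of_int_add of_int_of_nat_eq)
qed

end

lemma take_shuffle_list: "i \<le> N \<Longrightarrow> take i (shuffle_list N \<phi>) = map (inv_into UNIV \<phi>) [1..<Suc i]"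
  by (simp add: shuffle_list_def take_map del: upt_Suc)

lemma drop_shuffle_list: "drop i (shuffle_list N \<phi>) = map (inv_into UNIV \<phi>) [Suc i..<N + 1]"
  by (simp add: shuffle_list_def drop_map del: upt_Suc)

lemma map_nth_append_left: "map (\<lambda>j. (xs @ ys) ! (j - 1)) [1..<Suc (length xs)] = xs"
  by (rule nth_equalityI) (simp_all add: nth_append del: upt_Suc)

lemma map_nth_append_right: "map (\<lambda>j. (xs @ ys) ! (j - 1)) [Suc (length xs)..<Suc (length xs + length ys)] = ys"
  by (rule nth_equalityI) (simp_all add: nth_append del: upt_Suc)

lemma list_all2_append_nth:
  assumes "list_all2 R xs ps" "list_all2 R ys qs" "i < length xs + length ys"
  shows "R ((xs @ ys) ! i) ((ps @ qs) ! i)"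
  using list_all2_appendI[OF assms(1,2)] assms(3) by (simp add: list_all2_conv_all_nth)

context shuffle_words
begin

lemma Sh_pq_shuffles:
  assumes xs: "list_all2 (\<lambda>x t. hl (of_int (t + 1)) x) xs ps" and ys: "list_all2 (\<lambda>y t. hl (of_int (t + 1)) y) ys qs"
    and p: "p = length xs" and q: "q = length ys"
  shows "Sh (wv xs) (wv ys) = (\<Sum>\<phi>\<in>pq_shuffles p q. sc (of_int (shuffle_sign ps qs \<phi>))
    (wv (map (\<lambda>j. (xs @ ys) ! (inv_into UNIV \<phi> j - 1)) [1..<p + q + 1])))"
proof -
  define f where "f = (\<lambda>j. (xs @ ys) ! (j - 1))"
  define dg :: "nat \<Rightarrow> bit" where "dg = (\<lambda>j. of_int ((ps @ qs) ! (j - 1) + 1))"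
  have len: "p = length ps" "q = length qs"
    using list_all2_lengthD[OF xs] list_all2_lengthD[OF ys] p q by auto
  have "Sh (wv (map f [1..<Suc p])) (wv (map f [Suc p..<Suc (p + q)]))
      = (\<Sum>l\<in>shuffles [1..<Suc p] [Suc p..<Suc (p + q)]. sc (shsgn (\<lambda>j. j \<le> p) dg l) (wv (map f l)))"
    using list_all2_append_nth[OF xs ys] by (intro Sh_shuffles) (auto simp: dg_def f_def p q simp del: upt_Suc)
  also have "\<dots> = (\<Sum>\<phi>\<in>pq_shuffles p q. sc (shsgn (\<lambda>j. j \<le> p) dg (shuffle_list (p + q) \<phi>)) (wv (map f (shuffle_list (p + q) \<phi>))))"
    by (rule sum.reindex_bij_betw[OF bij_pq_shuffles, symmetric])
  also have "\<dots> = (\<Sum>\<phi>\<in>pq_shuffles p q. sc (of_int (shuffle_sign ps qs \<phi>)) (wv (map (\<lambda>j. f (inv_into UNIV \<phi> j)) [1..<p + q + 1])))"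
  proof (rule sum.cong[OF refl])
    fix \<phi> assume "\<phi> \<in> pq_shuffles p q"
    then have "\<phi> permutes {1..length ps + length qs}" by (simp add: pq_shuffles_def len)
    then have 1: "shsgn (\<lambda>j. j \<le> p) dg (shuffle_list (p + q) \<phi>) = of_int (shuffle_sign ps qs \<phi>)"
      using shsgn_shuffle[of \<phi> ps qs] by (simp add: dg_def len)
    have 2: "map f (shuffle_list (p + q) \<phi>) = map (\<lambda>j. f (inv_into UNIV \<phi> j)) [1..<p + q + 1]"
      by (simp add: shuffle_list_def del: upt_Suc)
    show "sc (shsgn (\<lambda>j. j \<le> p) dg (shuffle_list (p + q) \<phi>)) (wv (map f (shuffle_list (p + q) \<phi>)))
        = sc (of_int (shuffle_sign ps qs \<phi>)) (wv (map (\<lambda>j. f (inv_into UNIV \<phi> j)) [1..<p + q + 1]))"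
      unfolding 1 2 ..
  qed
  finally show ?thesis
    unfolding f_def p q map_nth_append_left map_nth_append_right .
qed

end

context bracket_words
begin

lemma Br_pq_shuffles:
  assumes xs: "list_all2 (\<lambda>x t. hl (of_int (t + 1)) x) xs ps" and ys: "list_all2 (\<lambda>y t. hl (of_int (t + 1)) y) ys qs"
    and p: "p = length xs" and q: "q = length ys" and n: "n = of_nat N"
  shows "Br (wv xs) (wv ys) = (\<Sum>\<phi>\<in>pq_shuffles p q.
    \<Sum>i\<in>{i. 1 \<le> i \<and> i < p + q \<and> inv_into UNIV \<phi> i \<le> p \<and> inv_into UNIV \<phi> (i + 1) > p}.
      sc (of_int (shuffle_sign ps qs \<phi>)) (wv (map (\<lambda>j. (xs @ ys) ! (inv_into UNIV \<phi> j - 1)) [1..<i] @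
        [sc (of_int (bracket_sign N ps qs \<phi> i))
          (Be ((xs @ ys) ! (inv_into UNIV \<phi> i - 1)) ((xs @ ys) ! (inv_into UNIV \<phi> (i + 1) - 1)))] @
        map (\<lambda>j. (xs @ ys) ! (inv_into UNIV \<phi> j - 1)) [i + 2..<p + q + 1])))"
proof -
  define f where "f = (\<lambda>j. (xs @ ys) ! (j - 1))"
  define dg :: "nat \<Rightarrow> bit" where "dg = (\<lambda>j. of_int ((ps @ qs) ! (j - 1) + 1))"
  have len: "p = length ps" "q = length qs"
    using list_all2_lengthD[OF xs] list_all2_lengthD[OF ys] p q by auto
  have "Br (wv (map f [1..<Suc p])) (wv (map f [Suc p..<Suc (p + q)]))
      = (\<Sum>l\<in>shuffles [1..<Suc p] [Suc p..<Suc (p + q)]. sc (shsgn (\<lambda>j. j \<le> p) dg l) (brl (\<lambda>j. j \<le> p) dg f l))"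
    using list_all2_append_nth[OF xs ys] by (intro Br_shuffles) (auto simp: dg_def f_def p q simp del: upt_Suc)
  also have "\<dots> = (\<Sum>\<phi>\<in>pq_shuffles p q. sc (shsgn (\<lambda>j. j \<le> p) dg (shuffle_list (p + q) \<phi>)) (brl (\<lambda>j. j \<le> p) dg f (shuffle_list (p + q) \<phi>)))"
    by (rule sum.reindex_bij_betw[OF bij_pq_shuffles, symmetric])
  also have "\<dots> = (\<Sum>\<phi>\<in>pq_shuffles p q.
    \<Sum>i\<in>{i. 1 \<le> i \<and> i < p + q \<and> inv_into UNIV \<phi> i \<le> p \<and> inv_into UNIV \<phi> (i + 1) > p}.
      sc (of_int (shuffle_sign ps qs \<phi>)) (wv (map (\<lambda>j. f (inv_into UNIV \<phi> j)) [1..<i] @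
        [sc (of_int (bracket_sign N ps qs \<phi> i)) (Be (f (inv_into UNIV \<phi> i)) (f (inv_into UNIV \<phi> (i + 1))))] @
        map (\<lambda>j. f (inv_into UNIV \<phi> j)) [i + 2..<p + q + 1])))"
  proof (rule sum.cong[OF refl])
    fix \<phi> assume "\<phi> \<in> pq_shuffles p q"
    then have \<phi>: "\<phi> permutes {1..length ps + length qs}" by (simp add: pq_shuffles_def len)
    then have 1: "shsgn (\<lambda>j. j \<le> p) dg (shuffle_list (p + q) \<phi>) = of_int (shuffle_sign ps qs \<phi>)"
      using shsgn_shuffle[of \<phi> ps qs] by (simp add: dg_def len)
    have 2: "brsgn n (\<lambda>j. j \<le> p) dg (shuffle_list (p + q) \<phi>) i = of_int (bracket_sign N ps qs \<phi> (Suc i))" for i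
      using brsgn_shuffle[OF \<phi>, of N i] by (simp add: dg_def len n)
    let ?I = "{i. 1 \<le> i \<and> i < p + q \<and> inv_into UNIV \<phi> i \<le> p \<and> inv_into UNIV \<phi> (i + 1) > p}"
    let ?J = "{i. i < p + q \<and> Suc i < p + q \<and> inv_into UNIV \<phi> (Suc i) \<le> p \<and> \<not> inv_into UNIV \<phi> (Suc (Suc i)) \<le> p}"
    let ?g = "\<lambda>i. wv (map (\<lambda>j. f (inv_into UNIV \<phi> j)) [1..<i] @
        [sc (of_int (bracket_sign N ps qs \<phi> i)) (Be (f (inv_into UNIV \<phi> i)) (f (inv_into UNIV \<phi> (i + 1))))] @
        map (\<lambda>j. f (inv_into UNIV \<phi> j)) [i + 2..<p + q + 1])"
    have "brl (\<lambda>j. j \<le> p) dg f (shuffle_list (p + q) \<phi>) = (\<Sum>i<p + q. if i \<in> ?J then ?g (Suc i) else 0)"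
      unfolding brl_def length_shuffle_list
      by (rule sum.cong[OF refl]) (auto simp: nth_shuffle_list 2 take_shuffle_list drop_shuffle_list comp_def simp del: upt_Suc)
    also have "\<dots> = (\<Sum>i\<in>?J. ?g (Suc i))"
      by (rule sum.mono_neutral_cong_right) auto
    also have "\<dots> = (\<Sum>i\<in>?I. ?g i)"
      by (rule sum.reindex_bij_witness[of _ "\<lambda>i. i - 1" Suc]) auto
    finally show "sc (shsgn (\<lambda>j. j \<le> p) dg (shuffle_list (p + q) \<phi>)) (brl (\<lambda>j. j \<le> p) dg f (shuffle_list (p + q) \<phi>))
        = (\<Sum>i\<in>?I. sc (of_int (shuffle_sign ps qs \<phi>)) (?g i))"
      unfolding 1 by (simp only: sc_sum)
  qed
  finally show ?thesis
    unfolding f_def p q map_nth_append_left map_nth_append_right .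
qed

end

section \<open>Modules in coordinates\<close>

lemma ground_simps [simp]:
  "carrier ground = UNIV" "\<zero>\<^bsub>ground\<^esub> = 0" "\<one>\<^bsub>ground\<^esub> = 1" "x \<oplus>\<^bsub>ground\<^esub> y = x + y" "x \<otimes>\<^bsub>ground\<^esub> y = x * y"
  by (simp_all add: ring_of_type_algebra_def)

lemma cring_ground: "cring (ground :: 'k::field ring)"
  by (rule cring_from_type_algebra)

definition restr :: "('x \<Rightarrow> bool) \<Rightarrow> ('x \<Rightarrow>\<^sub>0 'k::field) \<Rightarrow> ('x \<Rightarrow>\<^sub>0 'k)" where
  "restr R = ext (\<lambda>x. if R x then pt x else 0)"

lemma lin_restr [lin_intros]: "lin f \<Longrightarrow> lin (\<lambda>p. restr R (f p))"
  unfolding restr_def by (rule lin_ext_comp)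

lemmas restr_simps [simp] = lin_simps[OF lin_restr[OF lin_id]]

lemma restr_pt [simp]: "restr R (pt x) = (if R x then pt x else 0)"
  by (simp add: restr_def)

lemma homog_restr: "homog D g (restr (\<lambda>x. D x = g) p)"
  unfolding restr_def ext_def by (auto intro!: homog_sum homog_fscale)

lemma restr_homog:
  assumes "homog D g p"
  shows "restr (\<lambda>x. D x = h) p = (if g = h then p else 0)"
proof -
  have "restr (\<lambda>x. D x = h) p = ext (\<lambda>x. if g = h then pt x else 0) p"
    unfolding restr_def by (rule ext_cong) (use assms in \<open>auto simp: homog_def\<close>)
  then show ?thesis by simp
qed

lemma sum_restr:
  assumes "finite S" "D ` Poly_Mapping.keys p \<subseteq> S"
  shows "(\<Sum>g\<in>S. restr (\<lambda>x. D x = g) p) = p"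
proof (rule lin_eqI[of "\<lambda>p. \<Sum>g\<in>S. restr (\<lambda>x. D x = g) p" "\<lambda>p. p"])
  fix x assume "x \<in> Poly_Mapping.keys p"
  then have "D x \<in> S" using assms(2) by auto
  then show "(\<Sum>g\<in>S. restr (\<lambda>x. D x = g) (pt x)) = pt x"
    using assms(1) by (simp add: sum.delta)
qed (rule lin_intros)+

definition supp_in :: "'x set \<Rightarrow> ('x \<Rightarrow>\<^sub>0 'k::field) set" where
  "supp_in C = {p. Poly_Mapping.keys p \<subseteq> C}"

lemma subspace_supp_in: "fs.subspace (supp_in C :: ('x \<Rightarrow>\<^sub>0 'k::field) set)"
proof (rule fs.subspaceI)
  show "p + q \<in> supp_in C" if "p \<in> supp_in C" "q \<in> supp_in C" for p q :: "'x \<Rightarrow>\<^sub>0 'k"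
    using that Poly_Mapping.keys_add[of p q] by (auto simp: supp_in_def)
  show "fscale c p \<in> supp_in C" if "p \<in> supp_in C" for c and p :: "'x \<Rightarrow>\<^sub>0 'k"
    using that keys_fscale[of c p] by (auto simp: supp_in_def)
qed (simp add: supp_in_def)

lemma pt_supp_in [simp]: "pt x \<in> supp_in C \<longleftrightarrow> x \<in> C"
  by (simp add: supp_in_def)

lemma subspace_ext:
  "fs.subspace N \<Longrightarrow> (\<And>x. x \<in> Poly_Mapping.keys p \<Longrightarrow> f x \<in> N) \<Longrightarrow> ext f p \<in> N"
  unfolding ext_def by (intro fs.subspace_sum fs.subspace_scale)

lemma ext_supp_in: "p \<in> supp_in C \<Longrightarrow> (\<And>x. x \<in> C \<Longrightarrow> f x \<in> supp_in C') \<Longrightarrow> ext f p \<in> supp_in C'"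
  by (rule subspace_ext[OF subspace_supp_in]) (auto simp: supp_in_def[of C])

lemma ext2_supp_in:
  "p \<in> supp_in C \<Longrightarrow> q \<in> supp_in C' \<Longrightarrow> (\<And>x y. x \<in> C \<Longrightarrow> y \<in> C' \<Longrightarrow> f x y \<in> supp_in C'') \<Longrightarrow>
    ext2 f p q \<in> supp_in C''"
  unfolding ext2_def by (auto intro!: ext_supp_in)

lemma restr_supp_in: "p \<in> supp_in C \<Longrightarrow> restr R p \<in> supp_in C"
  unfolding restr_def by (erule ext_supp_in) (simp add: fs.subspace_0[OF subspace_supp_in])

text \<open>A module with a chosen basis, given as its coordinate isomorphism. Identities in the
  module are proved by applying \<open>psi\<close> and computing with finitely supported
  functions.\<close>

locale based =
  fixes V :: "('k::field, 'v) module" and B :: "'x set" and psi :: "'v \<Rightarrow> ('x \<Rightarrow>\<^sub>0 'k)"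
  assumes is_module: "module ground V"
    and psi_add: "x \<in> carrier V \<Longrightarrow> y \<in> carrier V \<Longrightarrow> psi (x \<oplus>\<^bsub>V\<^esub> y) = psi x + psi y"
    and psi_smult: "x \<in> carrier V \<Longrightarrow> psi (c \<odot>\<^bsub>V\<^esub> x) = fscale c (psi x)"
    and psi_bij: "bij_betw psi (carrier V) (supp_in B)"
begin

sublocale M: module ground V
  by (rule is_module)

lemma psi_inj: "x \<in> carrier V \<Longrightarrow> y \<in> carrier V \<Longrightarrow> psi x = psi y \<Longrightarrow> x = y"
  using psi_bij by (auto simp: bij_betw_def inj_on_def)

lemma psi_supp: "x \<in> carrier V \<Longrightarrow> psi x \<in> supp_in B"
  using psi_bij by (auto simp: bij_betw_def)

definition phi :: "('x \<Rightarrow>\<^sub>0 'k) \<Rightarrow> 'v" where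
  "phi p = inv_into (carrier V) psi p"

lemma phi_closed: "p \<in> supp_in B \<Longrightarrow> phi p \<in> carrier V"
  and psi_phi: "p \<in> supp_in B \<Longrightarrow> psi (phi p) = p"
  using psi_bij by (auto simp: phi_def bij_betw_def inv_into_into f_inv_into_f)

lemma phi_psi: "x \<in> carrier V \<Longrightarrow> phi (psi x) = x"
  using psi_bij by (simp add: phi_def bij_betw_def)

lemma psi_zero [simp]: "psi \<zero>\<^bsub>V\<^esub> = 0"
  using psi_add[of "\<zero>\<^bsub>V\<^esub>" "\<zero>\<^bsub>V\<^esub>"] by simp

lemma psi_eq_zero: "x \<in> carrier V \<Longrightarrow> psi x = 0 \<longleftrightarrow> x = \<zero>\<^bsub>V\<^esub>"
  using psi_inj[of x "\<zero>\<^bsub>V\<^esub>"] by auto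

lemma psi_minus: "x \<in> carrier V \<Longrightarrow> psi (\<ominus>\<^bsub>V\<^esub> x) = - psi x"
  using psi_add[of x "\<ominus>\<^bsub>V\<^esub> x"] by (simp add: M.r_neg add_eq_0_iff)

lemma sg_closed: "x \<in> carrier V \<Longrightarrow> sg V e x \<in> carrier V"
  by (simp add: sg_def)

lemma of_int_bit_eq_0: "(of_int e :: bit) = 0 \<longleftrightarrow> even e"
proof (cases "even e")
  case True
  then show ?thesis by (auto elim!: evenE)
next
  case False
  then obtain k where "e = 2 * k + 1" by (rule oddE)
  then show ?thesis by simp
qed

lemma psi_sg: "x \<in> carrier V \<Longrightarrow> psi (sg V e x) = sc (of_int e) (psi x)"
  by (simp add: sg_def sc_def psi_minus of_int_bit_eq_0 del: bit_not_one_iff bit_not_zero_iff)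

lemma psi_finsum: "(\<And>i. i \<in> S \<Longrightarrow> f i \<in> carrier V) \<Longrightarrow> psi (\<Oplus>\<^bsub>V\<^esub>i\<in>S. f i) = (\<Sum>i\<in>S. psi (f i))"
proof (induction S rule: infinite_finite_induct)
  case (insert i S)
  then have "(\<Oplus>\<^bsub>V\<^esub>i\<in>insert i S. f i) = f i \<oplus>\<^bsub>V\<^esub> (\<Oplus>\<^bsub>V\<^esub>i\<in>S. f i)"
    by (intro M.finsum_insert) auto
  moreover have "(\<Oplus>\<^bsub>V\<^esub>i\<in>S. f i) \<in> carrier V"
    using insert by (intro M.finsum_closed) auto
  ultimately show ?case using insert by (simp add: psi_add)
qed auto

definition bas :: "'x \<Rightarrow> 'v" where
  "bas x = phi (pt x)"

lemma bas_closed: "x \<in> B \<Longrightarrow> bas x \<in> carrier V" and psi_bas: "x \<in> B \<Longrightarrow> psi (bas x) = pt x"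
  by (simp_all add: bas_def phi_closed psi_phi)

lemma finsum_bas: "p \<in> supp_in B \<Longrightarrow>
  phi p = (\<Oplus>\<^bsub>V\<^esub>x\<in>Poly_Mapping.keys p. Poly_Mapping.lookup p x \<odot>\<^bsub>V\<^esub> bas x)"
proof (rule psi_inj)
  assume p: "p \<in> supp_in B"
  then have c: "Poly_Mapping.lookup p x \<odot>\<^bsub>V\<^esub> bas x \<in> carrier V" if "x \<in> Poly_Mapping.keys p" for x
    using that by (intro M.smult_closed bas_closed) (auto simp: supp_in_def)
  then show "(\<Oplus>\<^bsub>V\<^esub>x\<in>Poly_Mapping.keys p. Poly_Mapping.lookup p x \<odot>\<^bsub>V\<^esub> bas x) \<in> carrier V"
    by (intro M.finsum_closed) auto
  have "psi (\<Oplus>\<^bsub>V\<^esub>x\<in>Poly_Mapping.keys p. Poly_Mapping.lookup p x \<odot>\<^bsub>V\<^esub> bas x)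
      = (\<Sum>x\<in>Poly_Mapping.keys p. fscale (Poly_Mapping.lookup p x) (pt x))"
    using p c by (subst psi_finsum) (auto simp: psi_smult bas_closed psi_bas supp_in_def subset_iff intro!: sum.cong)
  then show "psi (phi p) = psi (\<Oplus>\<^bsub>V\<^esub>x\<in>Poly_Mapping.keys p. Poly_Mapping.lookup p x \<odot>\<^bsub>V\<^esub> bas x)"
    by (simp only: psi_phi[OF p] poly_mapping_sum_pt[symmetric])
qed (rule phi_closed)

text \<open>Linearity is asked only modulo \<open>N\<close> because a formal generator is
  multilinear only up to the relations. The lemma is applied to one slot of a tensor or word at a
  time, and with \<open>N\<close> zero to honest linear maps.\<close>

lemma expand_mod:
  assumes N: "fs.subspace N"
    and add: "\<And>x y. x \<in> carrier V \<Longrightarrow> y \<in> carrier V \<Longrightarrow> g (x \<oplus>\<^bsub>V\<^esub> y) - g x - g y \<in> N"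
    and smult: "\<And>c x. x \<in> carrier V \<Longrightarrow> g (c \<odot>\<^bsub>V\<^esub> x) - fscale c (g x) \<in> N"
    and v: "v \<in> carrier V"
  shows "g v - ext (\<lambda>x. g (bas x)) (psi v) \<in> N"
proof -
  have zero: "g \<zero>\<^bsub>V\<^esub> \<in> N"
    using smult[of "\<zero>\<^bsub>V\<^esub>" 0] by simp
  have "g (\<Oplus>\<^bsub>V\<^esub>x\<in>S. c x \<odot>\<^bsub>V\<^esub> bas x) - (\<Sum>x\<in>S. fscale (c x) (g (bas x))) \<in> N"
    if "finite S" "S \<subseteq> B" for S c
    using that
  proof (induction S)
    case empty
    then show ?case using zero by simp
  next
    case (insert x S)
    let ?s = "\<Oplus>\<^bsub>V\<^esub>x\<in>S. c x \<odot>\<^bsub>V\<^esub> bas x"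
    have c: "c x \<odot>\<^bsub>V\<^esub> bas x \<in> carrier V" if "x \<in> B" for x
      using that by (intro M.smult_closed bas_closed) auto
    then have s: "?s \<in> carrier V" using insert by (intro M.finsum_closed) auto
    have e: "(\<Oplus>\<^bsub>V\<^esub>x\<in>insert x S. c x \<odot>\<^bsub>V\<^esub> bas x) = c x \<odot>\<^bsub>V\<^esub> bas x \<oplus>\<^bsub>V\<^esub> ?s"
      using insert c by (intro M.finsum_insert) auto
    have 1: "g (c x \<odot>\<^bsub>V\<^esub> bas x \<oplus>\<^bsub>V\<^esub> ?s) - g (c x \<odot>\<^bsub>V\<^esub> bas x) - g ?s \<in> N"
      using add[OF c s] insert by auto
    have 2: "g (c x \<odot>\<^bsub>V\<^esub> bas x) - fscale (c x) (g (bas x)) \<in> N"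
      using smult[of "bas x" "c x"] insert bas_closed by auto
    have 3: "g ?s - (\<Sum>x\<in>S. fscale (c x) (g (bas x))) \<in> N" using insert by auto
    have 4: "g (c x \<odot>\<^bsub>V\<^esub> bas x \<oplus>\<^bsub>V\<^esub> ?s) - (\<Sum>x\<in>insert x S. fscale (c x) (g (bas x)))
      = (g (c x \<odot>\<^bsub>V\<^esub> bas x \<oplus>\<^bsub>V\<^esub> ?s) - g (c x \<odot>\<^bsub>V\<^esub> bas x) - g ?s)
        + (g (c x \<odot>\<^bsub>V\<^esub> bas x) - fscale (c x) (g (bas x))) + (g ?s - (\<Sum>x\<in>S. fscale (c x) (g (bas x))))"
      using insert by (simp add: algebra_simps)
    show ?case
      unfolding e 4 by (rule fs.subspace_add[OF N fs.subspace_add[OF N 1 2] 3])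
  qed
  from this[of "Poly_Mapping.keys (psi v)" "Poly_Mapping.lookup (psi v)"] show ?thesis
    using finsum_bas[OF psi_supp[OF v]] psi_supp[OF v] by (simp add: phi_psi v ext_def supp_in_def)
qed

end

section \<open>Spaces given by generators and relations, in coordinates\<close>

text \<open>\<open>R\<close> is the normal form of a generator and \<open>sec\<close> selects a
  generator for each basis element. Since relations have normal form zero and each generator is
  congruent to its normal form, the quotient is free on \<open>B\<close>.\<close>

locale presentation =
  fixes S :: "'x set" and N :: "('x \<Rightarrow>\<^sub>0 'k::field) set" and B :: "'y set"
    and R :: "'x \<Rightarrow> ('y \<Rightarrow>\<^sub>0 'k)" and sec :: "'y \<Rightarrow> 'x"
  assumes subspace_N: "fs.subspace N" and N_supp: "N \<subseteq> supp_in S"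
    and N_ker: "r \<in> N \<Longrightarrow> ext R r = 0"
    and R_supp: "x \<in> S \<Longrightarrow> R x \<in> supp_in B"
    and sec_closed: "y \<in> B \<Longrightarrow> sec y \<in> S" and R_sec: "y \<in> B \<Longrightarrow> R (sec y) = pt y"
    and reduce: "x \<in> S \<Longrightarrow> pt x - ext (\<lambda>y. pt (sec y)) (R x) \<in> N"
begin

abbreviation Qs :: "('k, ('x \<Rightarrow>\<^sub>0 'k) set) module" where "Qs \<equiv> quotient_space S N"

lemma N_zero: "0 \<in> N" and N_add: "p \<in> N \<Longrightarrow> q \<in> N \<Longrightarrow> p + q \<in> N"
  and N_diff: "p \<in> N \<Longrightarrow> q \<in> N \<Longrightarrow> p - q \<in> N" and N_fscale: "p \<in> N \<Longrightarrow> fscale c p \<in> N"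
  using subspace_N by (auto intro: fs.subspace_0 fs.subspace_add fs.subspace_diff fs.subspace_scale)

lemma N_iff: "p \<in> N \<longleftrightarrow> p \<in> supp_in S \<and> ext R p = 0"
proof
  assume p: "p \<in> supp_in S \<and> ext R p = 0"
  have "p - ext (\<lambda>y. pt (sec y)) (ext R p) = ext (\<lambda>x. pt x - ext (\<lambda>y. pt (sec y)) (R x)) p"
    by (rule lin_eqI[of "\<lambda>p. p - ext (\<lambda>y. pt (sec y)) (ext R p)"]) (auto intro!: lin_intros)
  also have "\<dots> \<in> N"
    using p by (intro subspace_ext[OF subspace_N] reduce) (auto simp: supp_in_def)
  finally show "p \<in> N" using p by simp
qed (use N_ker N_supp in auto)

lemma coset_iff: "q \<in> coset_of N p \<longleftrightarrow> q - p \<in> N"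
  by (auto simp: coset_of_def) (metis add.commute diff_add_cancel)

lemma coset_eq_iff: "coset_of N p = coset_of N q \<longleftrightarrow> p - q \<in> N"
proof
  assume "coset_of N p = coset_of N q"
  moreover have "p \<in> coset_of N p" by (simp add: coset_iff N_zero)
  ultimately show "p - q \<in> N" by (simp add: coset_iff)
next
  assume pq: "p - q \<in> N"
  have "r - p \<in> N \<longleftrightarrow> r - q \<in> N" for r
    using N_add[OF _ pq, of "r - p"] N_diff[OF _ pq, of "r - q"] by (auto simp: algebra_simps)
  then show "coset_of N p = coset_of N q" by (auto simp: coset_iff)
qed

lemma carrier_Qs: "carrier Qs = coset_of N ` supp_in S"
  by (auto simp: quotient_space_def supp_in_def)

lemma zero_Qs: "\<zero>\<^bsub>Qs\<^esub> = coset_of N 0"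
  by (auto simp: quotient_space_def coset_iff)

lemma add_Qs: "coset_of N p \<oplus>\<^bsub>Qs\<^esub> coset_of N q = coset_of N (p + q)"
proof -
  have "\<exists>p' q'. r = p' + q' \<and> p' - p \<in> N \<and> q' - q \<in> N" if "r - (p + q) \<in> N" for r
    using that N_zero by (intro exI[of _ p] exI[of _ "r - p"]) (auto simp: algebra_simps)
  moreover have "p' + q' - (p + q) \<in> N" if "p' - p \<in> N" "q' - q \<in> N" for p' q'
    using N_add[OF that] by (simp add: algebra_simps)
  ultimately show ?thesis by (auto simp: quotient_space_def coset_iff)
qed

lemma smult_Qs: "c \<odot>\<^bsub>Qs\<^esub> coset_of N p = coset_of N (fscale c p)"
proof -
  have "\<exists>p' r'. r = fscale c p' + r' \<and> p' - p \<in> N \<and> r' \<in> N" if "r - fscale c p \<in> N" for r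
    using that N_zero by (intro exI[of _ p] exI[of _ "r - fscale c p"]) auto
  moreover have "fscale c p' + r' - fscale c p \<in> N" if "p' - p \<in> N" "r' \<in> N" for p' r'
    using N_add[OF N_fscale[OF that(1), of c] that(2)]
    by (simp add: algebra_simps linD[of "fscale c"] fs.scale_right_diff_distrib)
  ultimately show ?thesis by (auto simp: quotient_space_def coset_iff)
qed

text \<open>The choice of a representative is immaterial by \<open>N_ker\<close>.\<close>

definition psi :: "('x \<Rightarrow>\<^sub>0 'k) set \<Rightarrow> ('y \<Rightarrow>\<^sub>0 'k)" where
  "psi \<xi> = ext R (SOME p. p \<in> \<xi>)"

lemma psi_coset: "p \<in> supp_in S \<Longrightarrow> psi (coset_of N p) = ext R p"
proof -
  have "p \<in> coset_of N p" by (simp add: coset_iff N_zero)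
  then have "(SOME q. q \<in> coset_of N p) \<in> coset_of N p" by (rule someI)
  then have "(SOME q. q \<in> coset_of N p) - p \<in> N" by (simp only: coset_iff)
  from N_ker[OF this] show "psi (coset_of N p) = ext R p" by (simp add: psi_def)
qed

lemma psi_mem: "\<xi> \<in> carrier Qs \<Longrightarrow> p \<in> \<xi> \<Longrightarrow> p \<in> supp_in S \<and> psi \<xi> = ext R p"
proof -
  assume "\<xi> \<in> carrier Qs" "p \<in> \<xi>"
  then obtain q where q: "q \<in> supp_in S" "\<xi> = coset_of N q" by (auto simp: carrier_Qs)
  then have d: "p - q \<in> N" using \<open>p \<in> \<xi>\<close> by (simp add: coset_iff)
  then have p: "p \<in> supp_in S"
    using fs.subspace_add[OF subspace_supp_in q(1), of "p - q"] N_supp by auto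
  moreover have "\<xi> = coset_of N p" using N_diff[OF N_zero d] by (simp add: q coset_eq_iff)
  ultimately show ?thesis using psi_coset by simp
qed

lemma module_Qs: "module ground Qs"
proof (rule moduleI)
  note s = fs.subspace_add[OF subspace_supp_in] fs.subspace_scale[OF subspace_supp_in]
  show "abelian_group Qs"
  proof (rule abelian_groupI)
    fix x assume "x \<in> carrier Qs"
    then obtain p where p: "p \<in> supp_in S" "x = coset_of N p" by (auto simp: carrier_Qs)
    then have "coset_of N (- p) \<in> carrier Qs"
      using fs.subspace_neg[OF subspace_supp_in] by (auto simp: carrier_Qs)
    then show "\<exists>y\<in>carrier Qs. y \<oplus>\<^bsub>Qs\<^esub> x = \<zero>\<^bsub>Qs\<^esub>"
      by (auto simp: p add_Qs zero_Qs intro!: bexI[of _ "coset_of N (- p)"])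
  qed (auto simp: carrier_Qs add_Qs zero_Qs add_ac fs.subspace_0[OF subspace_supp_in] intro!: s image_eqI)
qed (auto simp: cring_ground carrier_Qs add_Qs smult_Qs fscale_add fscale_add_left
      intro!: image_eqI fs.subspace_add[OF subspace_supp_in] fs.subspace_scale[OF subspace_supp_in])

sublocale based Qs B psi
proof (rule based.intro)
  show "module ground Qs" by (rule module_Qs)
next
  fix x y assume "x \<in> carrier Qs" "y \<in> carrier Qs"
  then show "psi (x \<oplus>\<^bsub>Qs\<^esub> y) = psi x + psi y"
    by (auto simp: carrier_Qs add_Qs psi_coset fs.subspace_add[OF subspace_supp_in])
next
  fix c x assume "x \<in> carrier Qs"
  then show "psi (c \<odot>\<^bsub>Qs\<^esub> x) = fscale c (psi x)"
    by (auto simp: carrier_Qs smult_Qs psi_coset fs.subspace_scale[OF subspace_supp_in])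
next
  have "inj_on psi (carrier Qs)"
  proof (rule inj_onI)
    fix x y assume "x \<in> carrier Qs" "y \<in> carrier Qs" "psi x = psi y"
    then obtain p q where "p \<in> supp_in S" "q \<in> supp_in S" "x = coset_of N p" "y = coset_of N q" "ext R p = ext R q"
      by (auto simp: carrier_Qs psi_coset)
    then show "x = y"
      by (simp add: coset_eq_iff N_iff fs.subspace_diff[OF subspace_supp_in])
  qed
  moreover have "psi ` carrier Qs = supp_in B"
  proof (intro equalityI subsetI)
    fix q assume "q \<in> psi ` carrier Qs"
    then show "q \<in> supp_in B"
      by (auto simp: carrier_Qs psi_coset intro!: ext_supp_in R_supp)
  next
    fix q :: "'y \<Rightarrow>\<^sub>0 'k" assume q: "q \<in> supp_in B"
    let ?p = "ext (\<lambda>y. pt (sec y)) q"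
    have p: "?p \<in> supp_in S" by (rule ext_supp_in[OF q]) (simp add: sec_closed)
    have "ext R ?p = ext pt q"
      unfolding ext_ext ext_pt by (rule ext_cong) (use q R_sec in \<open>auto simp: supp_in_def\<close>)
    then have "psi (coset_of N ?p) = q" by (simp add: psi_coset p)
    then show "q \<in> psi ` carrier Qs" using p by (metis carrier_Qs image_eqI)
  qed
  ultimately show "bij_betw psi (carrier Qs) (supp_in B)" by (simp add: bij_betw_def)
qed

text \<open>The definite description in \<open>lift\<close> is justified here: since
  \<open>f\<close> factors through the normal form by the linear map \<open>L\<close>, every
  representative yields a vector with the same coordinates.\<close>

lemma lift:
  assumes U: "based U B' psi'"
    and f: "\<And>x. x \<in> S \<Longrightarrow> f x \<in> carrier U \<and> psi' (f x) = L (R x)"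
    and L: "lin L" and \<xi>: "\<xi> \<in> carrier Qs"
  shows "lift U f \<xi> \<in> carrier U" and "psi' (lift U f \<xi>) = L (psi \<xi>)"
proof -
  interpret U: based U B' psi' by (rule U)
  let ?u = "\<lambda>p. \<Oplus>\<^bsub>U\<^esub>x\<in>Poly_Mapping.keys p. Poly_Mapping.lookup p x \<odot>\<^bsub>U\<^esub> f x"
  have u: "?u p \<in> carrier U \<and> psi' (?u p) = L (psi \<xi>)" if "p \<in> \<xi>" for p
  proof -
    have p: "p \<in> supp_in S" "psi \<xi> = ext R p" using psi_mem[OF \<xi> that] by auto
    then have c: "x \<in> Poly_Mapping.keys p \<Longrightarrow> f x \<in> carrier U \<and> psi' (f x) = L (R x)" for x
      using f by (auto simp: supp_in_def)
    then show ?thesis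
      by (auto simp: p U.psi_finsum U.psi_smult lin_lin_ext[OF L] ext_def[of "\<lambda>x. L (R x)"] intro!: U.M.finsum_closed)
  qed
  obtain p where "\<xi> = coset_of N p" using \<xi> by (auto simp: carrier_Qs)
  then have p: "p \<in> \<xi>" by (simp add: coset_iff N_zero)
  have "lift U f \<xi> = ?u p"
    unfolding lift_def
  proof (rule the_equality)
    show "\<exists>q\<in>\<xi>. ?u p = ?u q" using p by blast
    fix u assume "\<exists>q\<in>\<xi>. u = ?u q"
    then show "u = ?u p" using u p U.psi_inj by metis
  qed
  then show "lift U f \<xi> \<in> carrier U" "psi' (lift U f \<xi>) = L (psi \<xi>)"
    using u[OF p] by auto
qed

end

section \<open>Gradings in coordinates\<close>

locale graded_based = based V B psi
  for V :: "('k::field, 'v) module" and B :: "'x set" and psi :: "'v \<Rightarrow> ('x \<Rightarrow>\<^sub>0 'k)" +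
  fixes dg :: "'x \<Rightarrow> 'g" and G :: "'g \<Rightarrow> 'v set"
  assumes G_eq: "G g = {v \<in> carrier V. homog dg g (psi v)}"
begin

lemma G_D: "v \<in> G g \<Longrightarrow> v \<in> carrier V" "v \<in> G g \<Longrightarrow> homog dg g (psi v)"
  by (auto simp: G_eq)

lemma submodule_G: "submodule (G g) ground V"
proof (rule M.submoduleI)
  show "\<zero>\<^bsub>V\<^esub> \<in> G g" by (simp add: G_eq)
  show "\<ominus>\<^bsub>V\<^esub> a \<in> G g" if "a \<in> G g" for a
    using that by (auto simp: G_eq psi_minus)
  show "a \<oplus>\<^bsub>V\<^esub> b \<in> G g" if "a \<in> G g" "b \<in> G g" for a b
    using that by (auto simp: G_eq psi_add)
  show "c \<odot>\<^bsub>V\<^esub> a \<in> G g" if "a \<in> G g" for c a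
    using that by (auto simp: G_eq psi_smult)
qed (auto simp: G_eq)

definition component :: "'v \<Rightarrow> 'g \<Rightarrow> 'v" where
  "component v g = phi (restr (\<lambda>x. dg x = g) (psi v))"

lemma component:
  assumes "v \<in> carrier V"
  shows component_closed: "component v g \<in> carrier V"
    and psi_component: "psi (component v g) = restr (\<lambda>x. dg x = g) (psi v)"
  using restr_supp_in[OF psi_supp[OF assms]] by (simp_all add: component_def phi_closed psi_phi)

lemma decomposition_component:
  assumes v: "v \<in> carrier V"
  shows "decomposition V G v (component v)"
proof -
  let ?S = "{g. component v g \<noteq> \<zero>\<^bsub>V\<^esub>}"
  have "?S \<subseteq> dg ` Poly_Mapping.keys (psi v)"
  proof
    fix g assume "g \<in> ?S"
    then have ne: "restr (\<lambda>x. dg x = g) (psi v) \<noteq> 0"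
      using psi_eq_zero[OF component_closed[OF v]] psi_component[OF v] by simp
    show "g \<in> dg ` Poly_Mapping.keys (psi v)"
    proof (rule ccontr)
      assume "g \<notin> dg ` Poly_Mapping.keys (psi v)"
      then have "restr (\<lambda>x. dg x = g) (psi v) = ext (\<lambda>x. 0) (psi v)"
        unfolding restr_def by (intro ext_cong) auto
      then show False using ne by simp
    qed
  qed
  then have fin: "finite ?S" by (rule finite_subset) simp
  have "psi (\<Oplus>\<^bsub>V\<^esub>g\<in>?S. component v g) = (\<Sum>g\<in>?S. restr (\<lambda>x. dg x = g) (psi v))"
    by (simp add: psi_finsum component[OF v])
  also have "\<dots> = (\<Sum>g\<in>dg ` Poly_Mapping.keys (psi v). restr (\<lambda>x. dg x = g) (psi v))"
  proof (rule sum.mono_neutral_left[OF _ \<open>?S \<subseteq> _\<close>])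
    show "\<forall>g\<in>dg ` Poly_Mapping.keys (psi v) - ?S. restr (\<lambda>x. dg x = g) (psi v) = 0"
      using psi_component[OF v] by (metis (mono_tags, lifting) DiffD2 mem_Collect_eq psi_zero)
  qed simp
  also have "\<dots> = psi v" by (rule sum_restr) auto
  finally have "v = (\<Oplus>\<^bsub>V\<^esub>g\<in>?S. component v g)"
    by (intro psi_inj v) (auto intro!: M.finsum_closed component_closed[OF v])
  then show ?thesis
    using fin by (auto simp: decomposition_def G_eq component[OF v] homog_restr)
qed

lemma decomposition_unique:
  assumes "decomposition V G v f"
  shows "f = component v"
proof
  fix g
  let ?S = "{g. f g \<noteq> \<zero>\<^bsub>V\<^esub>}"
  have f: "f h \<in> carrier V" "homog dg h (psi (f h))" for h
    using assms by (auto simp: decomposition_def G_eq)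
  have fin: "finite ?S" and v: "v = (\<Oplus>\<^bsub>V\<^esub>g\<in>?S. f g)"
    using assms by (auto simp: decomposition_def)
  have vc: "v \<in> carrier V" unfolding v using f by (auto intro!: M.finsum_closed)
  have "psi (component v g) = restr (\<lambda>x. dg x = g) (psi v)" by (rule psi_component[OF vc])
  also have "psi v = (\<Sum>h\<in>?S. psi (f h))" by (subst v) (simp add: psi_finsum f)
  also have "restr (\<lambda>x. dg x = g) \<dots> = (\<Sum>h\<in>?S. if h = g then psi (f h) else 0)"
    by (simp add: restr_homog[OF f(2)])
  also have "\<dots> = psi (f g)"
    using fin by (auto simp: sum.delta')
  finally show "f g = component v g"
    using psi_inj[OF f(1) component_closed[OF vc]] by simp
qed

lemma grading: "grading V G"
  unfolding grading_def using submodule_G decomposition_component decomposition_unique by blast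

lemma hcomp_eq: "v \<in> carrier V \<Longrightarrow> hcomp V G v = component v"
  unfolding hcomp_def using decomposition_component decomposition_unique by (metis the_equality)

text \<open>One linear map \<open>L\<close> describes the formula in every degree, degree-dependent
  signs included, so summing over the components gives \<open>L\<close> of the whole.\<close>

lemma hsum:
  assumes U: "based U B' psi'" and L: "lin L" and v: "v \<in> carrier V"
    and f: "\<And>g y. y \<in> G g \<Longrightarrow> f g y \<in> carrier U \<and> psi' (f g y) = L (psi y)"
  shows "hsum U V G f v \<in> carrier U" "psi' (hsum U V G f v) = L (psi v)"
proof -
  interpret U: based U B' psi' by (rule U)
  let ?S = "{g. component v g \<noteq> \<zero>\<^bsub>V\<^esub>}"
  have d: "component v g \<in> G g" "v = (\<Oplus>\<^bsub>V\<^esub>g\<in>?S. component v g)" for g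
    using decomposition_component[OF v] by (auto simp: decomposition_def)
  have "psi' (hsum U V G f v) = (\<Sum>g\<in>?S. L (psi (component v g)))"
    unfolding hsum_def hcomp_eq[OF v] using f[OF d(1)] by (subst U.psi_finsum) auto
  also have "\<dots> = L (psi v)"
    by (subst d(2)) (simp add: psi_finsum component_closed[OF v] lin_sum[OF L])
  finally show "psi' (hsum U V G f v) = L (psi v)" .
  show "hsum U V G f v \<in> carrier U"
    unfolding hsum_def hcomp_eq[OF v] using f[OF d(1)] by (auto intro!: U.M.finsum_closed)
qed

end

section \<open>Tensor products in coordinates\<close>

lemma ext_single: "ext f (Poly_Mapping.single x c) = fscale c (f x)"
  by (cases "c = 0") (simp_all add: ext_def)

lemma single_supp_in: "x \<in> C \<Longrightarrow> Poly_Mapping.single x c \<in> supp_in C"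
  by (simp add: supp_in_def)

abbreviation tpsi :: "('v \<Rightarrow> ('x \<Rightarrow>\<^sub>0 'k::field)) \<Rightarrow> ('w \<Rightarrow> ('y \<Rightarrow>\<^sub>0 'k)) \<Rightarrow> ('v \<times> 'w \<Rightarrow>\<^sub>0 'k) set \<Rightarrow> ('x \<times> 'y \<Rightarrow>\<^sub>0 'k)"
  where "tpsi psi chi \<equiv> presentation.psi (\<lambda>(v, w). tn (psi v) (chi w))"

locale based_pair = V: based V B psi + W: based W C chi
  for V :: "('k::field, 'v) module" and B :: "'x set" and psi :: "'v \<Rightarrow> ('x \<Rightarrow>\<^sub>0 'k)"
    and W :: "('k, 'w) module" and C :: "'y set" and chi :: "'w \<Rightarrow> ('y \<Rightarrow>\<^sub>0 'k)"
begin

lemma tensor_relationsI: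
  assumes "x \<in> carrier V" "y \<in> carrier W"
  shows "x' \<in> carrier V \<Longrightarrow> pt (x \<oplus>\<^bsub>V\<^esub> x', y) - pt (x, y) - pt (x', y) \<in> tensor_relations V W"
    and "y' \<in> carrier W \<Longrightarrow> pt (x, y \<oplus>\<^bsub>W\<^esub> y') - pt (x, y) - pt (x, y') \<in> tensor_relations V W"
    and "pt (c \<odot>\<^bsub>V\<^esub> x, y) - fscale c (pt (x, y)) \<in> tensor_relations V W"
    and "pt (x, c \<odot>\<^bsub>W\<^esub> y) - fscale c (pt (x, y)) \<in> tensor_relations V W"
  unfolding tensor_relations_def
  by (rule fs.span_base; use assms in \<open>auto; blast\<close>)+

lemma subspace_relations: "fs.subspace (tensor_relations V W)"
  unfolding tensor_relations_def by (rule fs.subspace_span)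

lemma relations_in_kernel:
  "tensor_relations V W \<subseteq> {r \<in> supp_in (carrier V \<times> carrier W). ext (\<lambda>(v, w). tn (psi v) (chi w)) r = 0}"
proof -
  let ?K = "{r \<in> supp_in (carrier V \<times> carrier W). ext (\<lambda>(v, w). tn (psi v) (chi w)) r = 0}"
  note s = fs.subspace_diff[OF subspace_supp_in] fs.subspace_scale[OF subspace_supp_in]
  have "fs.subspace ?K"
    by (rule fs.subspaceI)
       (auto intro: fs.subspace_0[OF subspace_supp_in] fs.subspace_add[OF subspace_supp_in] s)
  then show ?thesis
    unfolding tensor_relations_def
    by (rule fs.span_minimal[rotated])
       (auto intro!: s single_supp_in simp: V.psi_add W.psi_add V.psi_smult W.psi_smult ext_single)
qed

text \<open>A pair is congruent to its coordinate tensor because each entry can be expanded along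
  its basis modulo the relations linear in that entry.\<close>

sublocale presentation "carrier V \<times> carrier W" "tensor_relations V W" "B \<times> C"
  "\<lambda>(v, w). tn (psi v) (chi w)" "\<lambda>(x, y). (V.bas x, W.bas y)"
proof
  show "fs.subspace (tensor_relations V W)" by (rule subspace_relations)
  show "tensor_relations V W \<subseteq> supp_in (carrier V \<times> carrier W)"
    and "\<And>r. r \<in> tensor_relations V W \<Longrightarrow> ext (\<lambda>(v, w). tn (psi v) (chi w)) r = 0"
    using relations_in_kernel by auto
next
  fix x assume "x \<in> carrier V \<times> carrier W"
  then obtain v w where x: "x = (v, w)" "v \<in> carrier V" "w \<in> carrier W" by auto
  then show "(case x of (v, w) \<Rightarrow> tn (psi v) (chi w)) \<in> supp_in (B \<times> C)"
    by (auto intro!: ext2_supp_in[OF V.psi_supp W.psi_supp])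
  let ?N = "tensor_relations V W"
  note sub = subspace_relations
  have 1: "pt (v, w) - ext (\<lambda>a. pt (V.bas a, w)) (psi v) \<in> ?N"
    using V.expand_mod[OF sub, of "\<lambda>v. pt (v, w)" v] tensor_relationsI[OF _ x(3)] x by simp
  have 2: "pt (V.bas a, w) - ext (\<lambda>b. pt (V.bas a, W.bas b)) (chi w) \<in> ?N" if "a \<in> B" for a
    using W.expand_mod[OF sub, of "\<lambda>w. pt (V.bas a, w)" w] tensor_relationsI[OF V.bas_closed[OF that]] x by simp
  have 3: "ext (\<lambda>a. pt (V.bas a, w) - ext (\<lambda>b. pt (V.bas a, W.bas b)) (chi w)) (psi v) \<in> ?N"
    using V.psi_supp[OF x(2)] by (intro subspace_ext[OF sub] 2) (auto simp: supp_in_def)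
  have 4: "ext (\<lambda>y. pt (case y of (x, y) \<Rightarrow> (V.bas x, W.bas y))) (tn (psi v) (chi w))
      = ext (\<lambda>a. ext (\<lambda>b. pt (V.bas a, W.bas b)) (chi w)) (psi v)"
    by (simp add: ext2_def ext_ext)
  have 5: "ext (\<lambda>a. pt (V.bas a, w) - ext (\<lambda>b. pt (V.bas a, W.bas b)) (chi w)) (psi v)
      = ext (\<lambda>a. pt (V.bas a, w)) (psi v) - ext (\<lambda>a. ext (\<lambda>b. pt (V.bas a, W.bas b)) (chi w)) (psi v)"
    by (simp add: ext_def fs.scale_right_diff_distrib sum_subtractf)
  show "pt x - ext (\<lambda>y. pt (case y of (x, y) \<Rightarrow> (V.bas x, W.bas y))) (case x of (v, w) \<Rightarrow> tn (psi v) (chi w)) \<in> ?N"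
    using fs.subspace_add[OF sub 1 3] unfolding x(1) prod.case 4 5 by simp
qed (auto simp: V.bas_closed W.bas_closed V.psi_bas W.psi_bas)

lemma based_tensor: "based (tensor V W) (B \<times> C) (tpsi psi chi)"
  unfolding tensor_def by (rule based_axioms)

lemma tens: 
  assumes "x \<in> carrier V" "y \<in> carrier W"
  shows "tens V W x y \<in> carrier (tensor V W)" "tpsi psi chi (tens V W x y) = tn (psi x) (chi y)"
  using assms by (auto simp: tens_def tensor_def carrier_Qs psi_coset intro!: imageI)

lemma tensor_lift:
  assumes "based U B' psi'" "lin L" "\<xi> \<in> carrier (tensor V W)"
    and "\<And>x y. x \<in> carrier V \<Longrightarrow> y \<in> carrier W \<Longrightarrow> f (x, y) \<in> carrier U \<and> psi' (f (x, y)) = L (tn (psi x) (chi y))"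
  shows "lift U f \<xi> \<in> carrier U" "psi' (lift U f \<xi>) = L (tpsi psi chi \<xi>)"
  using lift[OF assms(1) _ assms(2), of f \<xi>] assms(3,4) by (auto simp: tensor_def)

end

section \<open>Homogeneous bases\<close>

context
  fixes V :: "('k::field, 'v) module"
  assumes V: "module ground V"
begin

interpretation M: module ground V by (rule V)

lemma smult_zero: "x \<in> carrier V \<Longrightarrow> 0 \<odot>\<^bsub>V\<^esub> x = \<zero>\<^bsub>V\<^esub>"
  using M.smult_l_null[of x] by simp

definition combination :: "('v \<Rightarrow>\<^sub>0 'k) \<Rightarrow> 'v" where
  "combination p = (\<Oplus>\<^bsub>V\<^esub>x\<in>Poly_Mapping.keys p. Poly_Mapping.lookup p x \<odot>\<^bsub>V\<^esub> x)"

lemma combination_superset: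
  assumes "finite F" "Poly_Mapping.keys p \<subseteq> F" "F \<subseteq> carrier V"
  shows "combination p = (\<Oplus>\<^bsub>V\<^esub>x\<in>F. Poly_Mapping.lookup p x \<odot>\<^bsub>V\<^esub> x)"
  unfolding combination_def
  by (rule M.add.finprod_mono_neutral_cong_left) (use assms in \<open>auto simp: in_keys_iff smult_zero subset_iff\<close>)

lemma combination_closed: "p \<in> supp_in (carrier V) \<Longrightarrow> combination p \<in> carrier V"
  unfolding combination_def by (rule M.finsum_closed) (auto simp: supp_in_def)

lemma combination_add:
  assumes "p \<in> supp_in (carrier V)" "q \<in> supp_in (carrier V)"
  shows "combination (p + q) = combination p \<oplus>\<^bsub>V\<^esub> combination q"
proof -
  let ?F = "Poly_Mapping.keys p \<union> Poly_Mapping.keys q"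
  have F: "finite ?F" "?F \<subseteq> carrier V" using assms by (auto simp: supp_in_def)
  have "combination (p + q) = (\<Oplus>\<^bsub>V\<^esub>x\<in>?F. Poly_Mapping.lookup p x \<odot>\<^bsub>V\<^esub> x \<oplus>\<^bsub>V\<^esub> Poly_Mapping.lookup q x \<odot>\<^bsub>V\<^esub> x)"
    unfolding combination_superset[OF F(1) Poly_Mapping.keys_add F(2)]
    by (rule M.finsum_cong) (use F M.smult_l_distr in \<open>auto simp: lookup_add simp_implies_def\<close>)
  also have "\<dots> = combination p \<oplus>\<^bsub>V\<^esub> combination q"
    unfolding combination_superset[OF F(1) Un_upper1 F(2)] combination_superset[OF F(1) Un_upper2 F(2)]
    by (rule M.finsum_addf) (use F in auto)
  finally show ?thesis .
qed

lemma combination_fscale: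
  assumes "p \<in> supp_in (carrier V)"
  shows "combination (fscale c p) = c \<odot>\<^bsub>V\<^esub> combination p"
proof -
  have F: "finite (Poly_Mapping.keys p)" "Poly_Mapping.keys p \<subseteq> carrier V"
    using assms by (auto simp: supp_in_def)
  have "combination (fscale c p) = (\<Oplus>\<^bsub>V\<^esub>x\<in>Poly_Mapping.keys p. c \<odot>\<^bsub>V\<^esub> (Poly_Mapping.lookup p x \<odot>\<^bsub>V\<^esub> x))"
    unfolding combination_superset[OF F(1) keys_fscale F(2)]
    by (rule M.finsum_cong) (use F M.smult_assoc1 in \<open>auto simp: simp_implies_def\<close>)
  also have "\<dots> = c \<odot>\<^bsub>V\<^esub> combination p"
    unfolding combination_def by (rule M.finsum_smult_ldistr[symmetric]) (use F in auto)
  finally show ?thesis .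
qed

lemma combination_pt: "x \<in> carrier V \<Longrightarrow> combination (pt x) = x"
  using M.finsum_insert[of "{}" x "\<lambda>y. Poly_Mapping.lookup (pt x) y \<odot>\<^bsub>V\<^esub> y"] M.smult_one[of x]
  by (simp add: combination_def)

lemma combination_zero: "combination 0 = \<zero>\<^bsub>V\<^esub>"
  by (simp add: combination_def)

lemma combination_sum:
  "finite S \<Longrightarrow> (\<And>i. i \<in> S \<Longrightarrow> f i \<in> carrier V) \<Longrightarrow> combination (\<Sum>i\<in>S. pt (f i)) = (\<Oplus>\<^bsub>V\<^esub>i\<in>S. f i)"
proof (induction S rule: finite_induct)
  case (insert i S)
  have "(\<Sum>i\<in>S. pt (f i)) \<in> (supp_in (carrier V) :: ('v \<Rightarrow>\<^sub>0 'k) set)"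
    using insert by (intro fs.subspace_sum[OF subspace_supp_in]) auto
  moreover have "(\<Oplus>\<^bsub>V\<^esub>i\<in>insert i S. f i) = f i \<oplus>\<^bsub>V\<^esub> (\<Oplus>\<^bsub>V\<^esub>i\<in>S. f i)"
    using insert by (intro M.finsum_insert) auto
  moreover have "f i \<in> carrier V" using insert by simp
  ultimately show ?case
    using insert by (simp add: combination_add combination_pt)
qed (simp add: combination_zero)

lemma span_pt: "fs.span (pt ` C) = (supp_in C :: ('v \<Rightarrow>\<^sub>0 'k) set)"
proof (intro equalityI subsetI)
  fix p :: "'v \<Rightarrow>\<^sub>0 'k" assume "p \<in> supp_in C"
  then show "p \<in> fs.span (pt ` C)"
    by (subst ext_pt_id[symmetric], intro subspace_ext[OF fs.subspace_span])
       (auto simp: supp_in_def intro: fs.span_base)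
next
  fix p :: "'v \<Rightarrow>\<^sub>0 'k" assume "p \<in> fs.span (pt ` C)"
  moreover have "fs.span (pt ` C) \<subseteq> (supp_in C :: ('v \<Rightarrow>\<^sub>0 'k) set)"
    by (rule fs.span_minimal[OF _ subspace_supp_in]) auto
  ultimately show "p \<in> supp_in C" by auto
qed

text \<open>A basis of the kernel of the evaluation of formal combinations is extended by formal
  generators from \<open>T\<close>; the generators that are used form a basis.\<close>

lemma basis_from_spanning_set:
  assumes T: "T \<subseteq> carrier V" and span: "\<And>v. v \<in> carrier V \<Longrightarrow> \<exists>p\<in>supp_in T. combination p = v"
  obtains E psi where "E \<subseteq> T" "based V E psi" "\<And>e. e \<in> E \<Longrightarrow> psi e = pt e"
proof -
  let ?C = "supp_in (carrier V) :: ('v \<Rightarrow>\<^sub>0 'k) set"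
  \<comment> \<open>Independent sets are extended in the space of formal combinations, which is a
    whole type; \<open>V\<close> is recovered as the quotient of the combinations supported in its
    carrier by \<open>K\<close>.\<close>
  define K where "K = {p \<in> ?C. combination p = \<zero>\<^bsub>V\<^esub>}"
  note sub = fs.subspace_add[OF subspace_supp_in] fs.subspace_scale[OF subspace_supp_in] fs.subspace_0[OF subspace_supp_in]
  have K: "fs.subspace K"
    by (rule fs.subspaceI) (auto simp: K_def combination_zero combination_add combination_fscale intro: sub)
  obtain S where S: "S \<subseteq> K" "fs.independent S" "K \<subseteq> fs.span S"
    using fs.maximal_independent_subset[of K] by blast
  obtain B where B: "S \<subseteq> B" "B \<subseteq> S \<union> pt ` T" "fs.independent B" "S \<union> pt ` T \<subseteq> fs.span B"
    using fs.maximal_independent_subset_extend[of S "S \<union> pt ` T"] S by blast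
  have spanS: "fs.span S = K"
    using S fs.span_minimal[OF S(1) K] by auto
  define E where "E = {t \<in> T. pt t \<in> B - S}"
  have BE: "B = S \<union> pt ` E" using B by (auto simp: E_def)
  interpret P: vector_space_pair "fscale :: 'k \<Rightarrow> ('v \<Rightarrow>\<^sub>0 'k) \<Rightarrow> _" "fscale :: 'k \<Rightarrow> ('v \<Rightarrow>\<^sub>0 'k) \<Rightarrow> _"
    by unfold_locales
  \<comment> \<open>On the span of \<open>B\<close> this is the projection along \<open>K\<close>
    onto the span of the chosen generators, so \<open>g (pt v)\<close> will be the coordinate vector
    of \<open>v\<close>.\<close>
  obtain g where g: "Vector_Spaces.linear fscale fscale g" "\<forall>b\<in>B. g b = (if b \<in> S then 0 else b)"
    using P.linear_independent_extend[OF B(3), of "\<lambda>b. if b \<in> S then 0 else b"] by blast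
  interpret g: Vector_Spaces.linear fscale fscale g by (rule g(1))
  have lg: "lin g" by (simp add: lin_def g.add g.scale)
  have gS: "g p = 0" if "p \<in> K" for p
  proof -
    have "fs.subspace {p. g p = 0}" by (rule fs.subspaceI) (auto simp: lin_simps[OF lg])
    then have "fs.span S \<subseteq> {p. g p = 0}" using g(2) B(1) by (intro fs.span_minimal) auto
    then show ?thesis using that spanS by auto
  qed
  have gE: "g p = p" if "p \<in> supp_in E" for p
  proof (rule lin_eqI[OF lg lin_id])
    fix x assume "x \<in> Poly_Mapping.keys p"
    then have "x \<in> E" using that by (auto simp: supp_in_def)
    then show "g (pt x) = pt x" using g(2) by (auto simp: E_def)
  qed
  define psi where "psi v = g (pt v)" for v
  \<comment> \<open>A formal combination differs from the point at its value by an element of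
    \<open>K\<close>. This makes \<open>psi\<close> linear although \<open>pt\<close> is
    not.\<close>
  have g_psi: "g p = psi (combination p)" if "p \<in> ?C" for p
  proof -
    have c: "pt (combination p) \<in> ?C" using combination_closed[OF that] by simp
    have "combination (p - pt (combination p)) = combination p \<oplus>\<^bsub>V\<^esub> (- 1) \<odot>\<^bsub>V\<^esub> combination p"
      using combination_add[OF that sub(2)[OF c, of "- 1"]] combination_fscale[OF c, of "- 1"]
      by (simp add: combination_pt combination_closed[OF that] single_uminus)
    also have "\<dots> = (1 + - 1) \<odot>\<^bsub>V\<^esub> combination p"
      using M.smult_l_distr[of 1 "- 1" "combination p"] M.smult_one combination_closed[OF that] by simp
    also have "\<dots> = \<zero>\<^bsub>V\<^esub>"
      using M.smult_l_null[OF combination_closed[OF that]] by simp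
    finally have "p - pt (combination p) \<in> K"
      using fs.subspace_diff[OF subspace_supp_in that c] by (simp add: K_def)
    from gS[OF this] show ?thesis by (simp add: lin_simps[OF lg] psi_def)
  qed
  have split: "\<exists>s e. pt v = s + e \<and> s \<in> K \<and> e \<in> supp_in E" if v: "v \<in> carrier V" for v
  proof -
    obtain p where p: "p \<in> supp_in T" "combination p = v" using span[OF v] by auto
    then have pC: "p \<in> ?C" using T by (auto simp: supp_in_def)
    have "p \<in> fs.span B"
    proof -
      have "fs.span (pt ` T) \<subseteq> fs.span B"
        using B(4) by (intro fs.span_minimal fs.subspace_span) auto
      then show ?thesis using p span_pt by auto
    qed
    then have "p \<in> {x + y | x y. x \<in> fs.span S \<and> y \<in> fs.span (pt ` E)}"
      unfolding BE fs.span_Un by auto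
    then obtain s e where se: "p = s + e" "s \<in> K" "e \<in> supp_in E"
      using spanS span_pt by auto
    have e: "e \<in> ?C" using se(3) T by (auto simp: supp_in_def E_def)
    have "psi v = e"
      using g_psi[OF pC] p(2) gS[OF se(2)] gE[OF se(3)] by (simp add: se(1) lin_simps[OF lg])
    have "combination e = v"
    proof -
      have "combination p = combination s \<oplus>\<^bsub>V\<^esub> combination e"
        unfolding se(1) using se(2) e by (intro combination_add) (auto simp: K_def)
      then show ?thesis using p(2) se(2) combination_closed[OF e] by (simp add: K_def)
    qed
    have c: "pt v \<in> ?C" using v by simp
    have "combination (pt v - e) = combination (pt v) \<oplus>\<^bsub>V\<^esub> (- 1) \<odot>\<^bsub>V\<^esub> combination e"
      using combination_add[OF c sub(2)[OF e, of "- 1"]] combination_fscale[OF e, of "- 1"] by simp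
    also have "\<dots> = (1 + - 1) \<odot>\<^bsub>V\<^esub> v"
      using M.smult_l_distr[of 1 "- 1" v] M.smult_one v by (simp add: combination_pt \<open>combination e = v\<close>)
    also have "\<dots> = \<zero>\<^bsub>V\<^esub>" using M.smult_l_null[OF v] by simp
    finally have "pt v - e \<in> K" using fs.subspace_diff[OF subspace_supp_in c e] by (simp add: K_def)
    then show ?thesis using se(3) by (intro exI[of _ "pt v - e"] exI[of _ e]) simp
  qed
  have psi_E: "psi v \<in> supp_in E" "psi v = 0 \<Longrightarrow> v = \<zero>\<^bsub>V\<^esub>" if v: "v \<in> carrier V" for v
  proof -
    obtain s e where se: "pt v = s + e" "s \<in> K" "e \<in> supp_in E" using split[OF v] by blast
    then have e: "psi v = e" by (simp add: psi_def lin_simps[OF lg] gS gE)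
    then show "psi v \<in> supp_in E" using se by simp
    assume "psi v = 0"
    then have "pt v \<in> K" using se e by simp
    then show "v = \<zero>\<^bsub>V\<^esub>" using v by (simp add: K_def combination_pt)
  qed
  have psi_add: "psi (x \<oplus>\<^bsub>V\<^esub> y) = psi x + psi y" if "x \<in> carrier V" "y \<in> carrier V" for x y
    using g_psi[of "pt x + pt y"] that
    by (simp add: combination_add combination_pt lin_simps[OF lg] sub) (simp add: psi_def)
  have psi_smult: "psi (c \<odot>\<^bsub>V\<^esub> x) = fscale c (psi x)" if "x \<in> carrier V" for c x
    using g_psi[of "fscale c (pt x)"] that combination_fscale[of "pt x" c]
    by (simp add: combination_pt lin_simps[OF lg] sub single_supp_in del: fscale_simps(7)) (simp add: psi_def lin_simps[OF lg])
  have "based V E psi"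
  proof (rule based.intro[OF V psi_add psi_smult])
    have "inj_on psi (carrier V)"
    proof (rule inj_onI)
      fix x y assume xy: "x \<in> carrier V" "y \<in> carrier V" "psi x = psi y"
      have "psi (x \<oplus>\<^bsub>V\<^esub> (- 1) \<odot>\<^bsub>V\<^esub> y) = 0"
        using xy psi_smult[of y "- 1"] by (simp add: psi_add)
      then have "x \<oplus>\<^bsub>V\<^esub> (- 1) \<odot>\<^bsub>V\<^esub> y = \<zero>\<^bsub>V\<^esub>" using psi_E(2) xy by simp
      moreover have "y \<oplus>\<^bsub>V\<^esub> (- 1) \<odot>\<^bsub>V\<^esub> y = \<zero>\<^bsub>V\<^esub>"
        using M.smult_l_distr[of 1 "- 1" y] M.smult_one[of y] M.smult_l_null[of y] xy by simp
      ultimately show "x = y" using xy by (metis M.add.right_cancel M.smult_closed UNIV_I ground_simps(1))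
    qed
    moreover have "psi ` carrier V = supp_in E"
    proof (intro equalityI subsetI)
      fix q :: "'v \<Rightarrow>\<^sub>0 'k" assume q: "q \<in> supp_in E"
      then have "q \<in> ?C" using T by (auto simp: supp_in_def E_def)
      then have "psi (combination q) = q" "combination q \<in> carrier V"
        using g_psi[of q] gE[OF q] combination_closed by auto
      then show "q \<in> psi ` carrier V" by (metis image_eqI)
    qed (use psi_E in auto)
    ultimately show "bij_betw psi (carrier V) (supp_in E)" by (simp add: bij_betw_def)
  qed
  moreover have "psi e = pt e" if "e \<in> E" for e
    using gE[of "pt e"] that by (simp add: psi_def)
  moreover have "E \<subseteq> T" by (auto simp: E_def)
  ultimately show ?thesis using that by blast
qed

end

section \<open>The letters of the bar construction\<close>

locale bar_setup =
  fixes A :: "('k::field, 'a) module" and G :: "int \<Rightarrow> 'a set"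
    and dA :: "'a \<Rightarrow> 'a" and br :: "'a \<Rightarrow> 'a \<Rightarrow> 'a" and eps :: "'a \<Rightarrow> 'k" and n :: nat
  assumes n_ge: "n \<ge> 2"
    and commutative: "graded_commutative_algebra A G (\<lambda>t. t)"
    and poisson: "dg_poisson_algebra A G (\<lambda>t. t) (-1) dA (int n - 1) br"
    and augmented: "augmentation A G (\<lambda>t. t) (-1) dA eps"
    and nonneg: "\<And>t. t < 0 \<Longrightarrow> G t = {\<zero>\<^bsub>A\<^esub>}"
begin

sublocale P: dg_poisson_algebra A G "\<lambda>t. t" "-1" dA "int n - 1" br by (rule poisson)
sublocale C: graded_commutative_algebra A G "\<lambda>t. t" by (rule commutative)
sublocale U: augmentation A G "\<lambda>t. t" "-1" dA eps by (rule augmented)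
sublocale M: module ground A by (rule P.is_module)
sublocale R: ring A by (rule P.is_ring)

abbreviation I :: "'a set" where "I \<equiv> augmentation_ideal A eps"

lemma G_submodule: "submodule (G t) ground A"
  using P.is_grading by (simp add: grading_def)

lemma G_carrier: "a \<in> G t \<Longrightarrow> a \<in> carrier A"
  using M.submoduleE(1)[OF G_submodule] by auto

lemma G_zero: "\<zero>\<^bsub>A\<^esub> \<in> G t"
  using submodule.axioms(1)[OF G_submodule, THEN subgroup.one_closed] by simp

lemma G_add: "a \<in> G t \<Longrightarrow> b \<in> G t \<Longrightarrow> a \<oplus>\<^bsub>A\<^esub> b \<in> G t"
  by (rule M.submoduleE(5)[OF G_submodule])

lemma G_smult: "a \<in> G t \<Longrightarrow> c \<odot>\<^bsub>A\<^esub> a \<in> G t"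
  by (rule M.submoduleE(4)[OF G_submodule]) simp

lemma I_carrier: "a \<in> I \<Longrightarrow> a \<in> carrier A"
  by (simp add: augmentation_ideal_def)

lemma eps_add: "a \<in> carrier A \<Longrightarrow> b \<in> carrier A \<Longrightarrow> eps (a \<oplus>\<^bsub>A\<^esub> b) = eps a + eps b"
  and eps_smult: "a \<in> carrier A \<Longrightarrow> eps (c \<odot>\<^bsub>A\<^esub> a) = c * eps a"
  using U.eps_linear by (auto simp: klinear_form_def)

lemma eps_zero: "eps \<zero>\<^bsub>A\<^esub> = 0"
  using eps_smult[of "\<zero>\<^bsub>A\<^esub>" 0] by simp

lemma eps_minus: "a \<in> carrier A \<Longrightarrow> eps (\<ominus>\<^bsub>A\<^esub> a) = - eps a"
  using eps_add[of a "\<ominus>\<^bsub>A\<^esub> a"] by (simp add: M.r_neg eps_zero add_eq_0_iff)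

lemma I_zero: "\<zero>\<^bsub>A\<^esub> \<in> I" and I_add: "a \<in> I \<Longrightarrow> b \<in> I \<Longrightarrow> a \<oplus>\<^bsub>A\<^esub> b \<in> I"
  and I_smult: "a \<in> I \<Longrightarrow> c \<odot>\<^bsub>A\<^esub> a \<in> I" and I_minus: "a \<in> I \<Longrightarrow> \<ominus>\<^bsub>A\<^esub> a \<in> I"
  by (auto simp: augmentation_ideal_def eps_zero eps_add eps_smult eps_minus)

lemma I_submodule: "submodule I ground A"
  by (rule M.submoduleI) (auto simp: I_zero I_add I_smult I_minus I_carrier)

abbreviation VI :: "('k, 'a) module" where "VI \<equiv> A\<lparr>carrier := I\<rparr>"

lemma VI_module: "module ground VI"
  by (rule submodule.submodule_is_module[OF I_submodule P.is_module])

lemma decomposition_ex1: "a \<in> carrier A \<Longrightarrow> \<exists>!f. decomposition A G a f"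
  using P.is_grading by (simp add: grading_def)

lemma decomposition_hcomp: "a \<in> carrier A \<Longrightarrow> decomposition A G a (hcomp A G a)"
  unfolding hcomp_def by (rule theI'[OF decomposition_ex1])

lemma hcomp_unique: "a \<in> carrier A \<Longrightarrow> decomposition A G a f \<Longrightarrow> f = hcomp A G a"
  unfolding hcomp_def by (rule the1_equality[OF decomposition_ex1, symmetric])

lemma finsum_eps: "finite S \<Longrightarrow> (\<And>i. i \<in> S \<Longrightarrow> f i \<in> carrier A) \<Longrightarrow> eps (\<Oplus>\<^bsub>A\<^esub>i\<in>S. f i) = (\<Sum>i\<in>S. eps (f i))"
proof (induction S rule: finite_induct)
  case (insert i S)
  then have "(\<Oplus>\<^bsub>A\<^esub>i\<in>insert i S. f i) = f i \<oplus>\<^bsub>A\<^esub> (\<Oplus>\<^bsub>A\<^esub>i\<in>S. f i)"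
    by (intro M.finsum_insert) auto
  moreover have "(\<Oplus>\<^bsub>A\<^esub>i\<in>S. f i) \<in> carrier A" using insert by (intro M.finsum_closed) auto
  ultimately show ?case using insert by (simp add: eps_add)
qed (simp add: eps_zero)

lemma hcomp_G: "a \<in> carrier A \<Longrightarrow> hcomp A G a t \<in> G t"
  using decomposition_hcomp by (auto simp: decomposition_def)

text \<open>The augmentation vanishes in nonzero degrees, so applying it to the decomposition of
  \<open>a\<close> leaves only the component of degree 0, which must then be killed too.\<close>

lemma hcomp_I:
  assumes a: "a \<in> I"
  shows "hcomp A G a t \<in> I"
proof (cases "t = 0")
  case False
  then show ?thesis
    using hcomp_G[OF I_carrier[OF a], of t] U.eps_degree[OF _ False] G_carrier by (auto simp: augmentation_ideal_def)
next
  case True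
  let ?f = "hcomp A G a" let ?S = "{t. ?f t \<noteq> \<zero>\<^bsub>A\<^esub>}"
  have d: "finite ?S" "a = (\<Oplus>\<^bsub>A\<^esub>t\<in>?S. ?f t)"
    using decomposition_hcomp[OF I_carrier[OF a]] by (auto simp: decomposition_def)
  have "0 = eps a" using a by (simp add: augmentation_ideal_def)
  also have "\<dots> = (\<Sum>t\<in>?S. eps (?f t))"
    by (subst d(2)) (rule finsum_eps[OF d(1)], rule G_carrier, rule hcomp_G[OF I_carrier[OF a]])
  also have "\<dots> = (\<Sum>t\<in>?S. if t = 0 then eps (?f t) else 0)"
    using U.eps_degree[OF hcomp_G[OF I_carrier[OF a]]] by (intro sum.cong) auto
  also have "\<dots> = eps (?f 0)"
    using d(1) eps_zero by (auto simp: sum.delta)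
  finally show ?thesis
    using True hcomp_G[OF I_carrier[OF a]] G_carrier by (auto simp: augmentation_ideal_def)
qed

lemma finsum_VI: "finite S \<Longrightarrow> (\<And>i. i \<in> S \<Longrightarrow> f i \<in> I) \<Longrightarrow> (\<Oplus>\<^bsub>VI\<^esub>i\<in>S. f i) = (\<Oplus>\<^bsub>A\<^esub>i\<in>S. f i)"
proof (induction S rule: finite_induct)
  case (insert i S)
  interpret VI: module ground VI by (rule VI_module)
  have "(\<Oplus>\<^bsub>VI\<^esub>i\<in>insert i S. f i) = f i \<oplus>\<^bsub>VI\<^esub> (\<Oplus>\<^bsub>VI\<^esub>i\<in>S. f i)"
    using insert by (intro VI.finsum_insert) auto
  moreover have "(\<Oplus>\<^bsub>A\<^esub>i\<in>insert i S. f i) = f i \<oplus>\<^bsub>A\<^esub> (\<Oplus>\<^bsub>A\<^esub>i\<in>S. f i)"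
    using insert I_carrier by (intro M.finsum_insert) auto
  ultimately show ?case using insert by simp
qed (simp add: M.finsum_empty abelian_monoid.finsum_empty[OF abelian_group.axioms(1)[OF module.axioms(2)[OF VI_module]]])

lemma hcomp_sum:
  assumes a: "a \<in> I"
  shows "finite {t. hcomp A G a t \<noteq> \<zero>\<^bsub>A\<^esub>}"
    and "a = (\<Oplus>\<^bsub>VI\<^esub>t\<in>{t. hcomp A G a t \<noteq> \<zero>\<^bsub>A\<^esub>}. hcomp A G a t)"
  using decomposition_hcomp[OF I_carrier[OF a]] hcomp_I[OF a] by (auto simp: decomposition_def finsum_VI)

lemma I_induct [consumes 1, case_names homogeneous add]:
  assumes a: "a \<in> I" and h: "\<And>t x. x \<in> I \<Longrightarrow> x \<in> G t \<Longrightarrow> Q x"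
    and add: "\<And>x y. x \<in> I \<Longrightarrow> y \<in> I \<Longrightarrow> Q x \<Longrightarrow> Q y \<Longrightarrow> Q (x \<oplus>\<^bsub>A\<^esub> y)"
  shows "Q a"
proof -
  interpret VI: module ground VI by (rule VI_module)
  let ?f = "hcomp A G a"
  have f: "?f t \<in> I" "Q (?f t)" for t
    using hcomp_I[OF a] hcomp_G[OF I_carrier[OF a]] h by auto
  have "(\<Oplus>\<^bsub>VI\<^esub>t\<in>S. ?f t) \<in> I \<and> Q (\<Oplus>\<^bsub>VI\<^esub>t\<in>S. ?f t)" if "finite S" for S
    using that
  proof (induction S rule: finite_induct)
    case empty
    then show ?case using I_zero h[OF I_zero G_zero] VI.finsum_empty[of ?f] by simp
  next
    case (insert t S)
    have "(\<Oplus>\<^bsub>VI\<^esub>t\<in>insert t S. ?f t) = ?f t \<oplus>\<^bsub>A\<^esub> (\<Oplus>\<^bsub>VI\<^esub>t\<in>S. ?f t)"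
      using VI.finsum_insert[of S t ?f] insert f by auto
    then show ?case using insert f I_add add by auto
  qed
  from this[OF hcomp_sum(1)[OF a]] show ?thesis using hcomp_sum(2)[OF a] by simp
qed

lemma br_closed: "x \<in> carrier A \<Longrightarrow> y \<in> carrier A \<Longrightarrow> br x y \<in> carrier A"
  and br_add_right: "x \<in> carrier A \<Longrightarrow> y \<in> carrier A \<Longrightarrow> z \<in> carrier A \<Longrightarrow> br x (y \<oplus>\<^bsub>A\<^esub> z) = br x y \<oplus>\<^bsub>A\<^esub> br x z"
  and br_add_left: "x \<in> carrier A \<Longrightarrow> y \<in> carrier A \<Longrightarrow> z \<in> carrier A \<Longrightarrow> br (x \<oplus>\<^bsub>A\<^esub> y) z = br x z \<oplus>\<^bsub>A\<^esub> br y z"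
  and br_smult_right: "x \<in> carrier A \<Longrightarrow> y \<in> carrier A \<Longrightarrow> br x (c \<odot>\<^bsub>A\<^esub> y) = c \<odot>\<^bsub>A\<^esub> br x y"
  and br_smult_left: "x \<in> carrier A \<Longrightarrow> y \<in> carrier A \<Longrightarrow> br (c \<odot>\<^bsub>A\<^esub> x) y = c \<odot>\<^bsub>A\<^esub> br x y"
  using P.br_bilinear by (auto simp: kbilinear_def klinear_def)

lemma dA_closed: "x \<in> carrier A \<Longrightarrow> dA x \<in> carrier A"
  and dA_add: "x \<in> carrier A \<Longrightarrow> y \<in> carrier A \<Longrightarrow> dA (x \<oplus>\<^bsub>A\<^esub> y) = dA x \<oplus>\<^bsub>A\<^esub> dA y"
  and dA_smult: "x \<in> carrier A \<Longrightarrow> dA (c \<odot>\<^bsub>A\<^esub> x) = c \<odot>\<^bsub>A\<^esub> dA x"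
  using P.D_linear by (auto simp: klinear_def)

lemma dA_I: "x \<in> I \<Longrightarrow> dA x \<in> I"
  by (auto simp: augmentation_ideal_def dA_closed U.eps_D)

lemma mult_I: "x \<in> I \<Longrightarrow> y \<in> I \<Longrightarrow> x \<otimes>\<^bsub>A\<^esub> y \<in> I"
  by (auto simp: augmentation_ideal_def U.eps_mult)

text \<open>This is where the positivity of the degree of the bracket enters: a bracket of homogeneous
  elements has positive degree, or one of its arguments vanishes.\<close>

lemma br_I:
  assumes "x \<in> I" "y \<in> I"
  shows "br x y \<in> I"
  using assms(1)
proof (induction x rule: I_induct)
  case (homogeneous s x)
  have x: "x \<in> carrier A" using homogeneous I_carrier by auto
  show ?case using assms(2)
  proof (induction y rule: I_induct)
    case (homogeneous t y)
    have y: "y \<in> carrier A" using homogeneous I_carrier by auto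
    have br0: "br \<zero>\<^bsub>A\<^esub> y = \<zero>\<^bsub>A\<^esub>" "br x \<zero>\<^bsub>A\<^esub> = \<zero>\<^bsub>A\<^esub>"
      using br_smult_left[OF x y, of 0] br_smult_right[OF x y, of 0]
        M.smult_l_null[OF x] M.smult_l_null[OF y] M.smult_l_null[OF br_closed[OF x y]] by auto
    show ?case
    proof (cases "s < 0 \<or> t < 0")
      case True
      then have "x = \<zero>\<^bsub>A\<^esub> \<or> y = \<zero>\<^bsub>A\<^esub>"
        using nonneg \<open>x \<in> G s\<close> \<open>y \<in> G t\<close> by blast
      then have "br x y = \<zero>\<^bsub>A\<^esub>" using br0 by metis
      then show ?thesis using I_zero by simp
    next
      case False
      then have "s + t + (int n - 1) \<noteq> 0" using n_ge by auto
      then show ?thesis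
        using U.eps_degree[OF P.br_degree[OF \<open>x \<in> G s\<close> \<open>y \<in> G t\<close>] \<open>_ \<noteq> 0\<close>] br_closed[OF x y]
        by (simp only: augmentation_ideal_def mem_Collect_eq simp_thms)
    qed
  next
    case (add y z)
    then show ?case using x I_carrier br_add_right I_add by auto
  qed
next
  case (add x z)
  then show ?case using assms(2) I_carrier br_add_left I_add by auto
qed

text \<open>The ideal contains the components of its elements, so its homogeneous elements span it
  and a basis can be picked among them.\<close>

lemma homogeneous_basis:
  obtains E coord where "based VI E coord" "\<And>e. e \<in> E \<Longrightarrow> coord e = pt e" "E \<subseteq> (\<Union>t. I \<inter> G t)"
proof -
  have "\<exists>p\<in>supp_in (\<Union>t. I \<inter> G t). combination VI p = v" if v: "v \<in> carrier VI" for v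
  proof -
    let ?f = "hcomp A G v" let ?S = "{t. ?f t \<noteq> \<zero>\<^bsub>A\<^esub>}"
    have v: "v \<in> I" using that by simp
    have f: "?f t \<in> I \<inter> G t" for t using hcomp_I[OF v] hcomp_G[OF I_carrier[OF v]] by simp
    have "(\<Sum>t\<in>?S. pt (?f t)) \<in> (supp_in (\<Union>t. I \<inter> G t) :: ('a \<Rightarrow>\<^sub>0 'k) set)"
      using f by (intro fs.subspace_sum[OF subspace_supp_in]) auto
    moreover have "combination VI (\<Sum>t\<in>?S. pt (?f t)) = v"
      using combination_sum[OF VI_module hcomp_sum(1)[OF v], of ?f] f hcomp_sum(2)[OF v] by simp
    ultimately show ?thesis by blast
  qed
  then show ?thesis
    using basis_from_spanning_set[OF VI_module, of "\<Union>t. I \<inter> G t"] that by (metis (no_types, lifting) Int_lower1 UN_least partial_object.select_convs(1) partial_object.surjective partial_object.update_convs(1))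
qed

end

section \<open>The bar construction in coordinates\<close>

lemma wv_add_mid: "wv (us @ [x + y] @ vs) = wv (us @ [x] @ vs) + wv (us @ [y] @ vs)"
  by (induction us) simp_all

lemma wv_fscale_mid: "wv (us @ [fscale c x] @ vs) = fscale c (wv (us @ [x] @ vs))"
  by (induction us) simp_all

locale bar_coords = bar_setup A G dA br eps n
  for A :: "('k::field, 'a) module" and G :: "int \<Rightarrow> 'a set"
    and dA :: "'a \<Rightarrow> 'a" and br :: "'a \<Rightarrow> 'a \<Rightarrow> 'a" and eps :: "'a \<Rightarrow> 'k" and n :: nat +
  fixes E :: "'a set" and coord :: "'a \<Rightarrow> ('a \<Rightarrow>\<^sub>0 'k)"
  assumes based_I: "based VI E coord" and coord_E: "e \<in> E \<Longrightarrow> coord e = pt e"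
    and E_homogeneous: "E \<subseteq> (\<Union>t. I \<inter> G t)"
begin

sublocale L: based VI E coord by (rule based_I)

lemma E_I: "e \<in> E \<Longrightarrow> e \<in> I"
  using E_homogeneous by auto

lemma bas_E: "e \<in> E \<Longrightarrow> L.bas e = e"
  using L.psi_inj[of "L.bas e" e] L.bas_closed L.psi_bas coord_E E_I by simp

lemma coord_zero: "coord \<zero>\<^bsub>A\<^esub> = 0"
  using L.psi_zero by simp

lemma coord_add: "x \<in> I \<Longrightarrow> y \<in> I \<Longrightarrow> coord (x \<oplus>\<^bsub>A\<^esub> y) = coord x + coord y"
  using L.psi_add[of x y] by simp

lemma coord_smult: "x \<in> I \<Longrightarrow> coord (c \<odot>\<^bsub>A\<^esub> x) = fscale c (coord x)"
  using L.psi_smult[of x c] by simp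

lemma coord_minus: "x \<in> I \<Longrightarrow> coord (\<ominus>\<^bsub>A\<^esub> x) = - coord x"
  using coord_add[of x "\<ominus>\<^bsub>A\<^esub> x"] I_minus[of x] I_carrier[of x]
  by (simp add: M.r_neg coord_zero add_eq_0_iff)

lemma sg_I: "x \<in> I \<Longrightarrow> sg A e x \<in> I"
  by (simp add: sg_def I_minus)

lemma coord_sg: "x \<in> I \<Longrightarrow> coord (sg A e x) = sc (of_int e) (coord x)"
  by (simp add: sg_def sc_def coord_minus L.of_int_bit_eq_0 del: bit_not_one_iff bit_not_zero_iff)

lemma coord_supp: "x \<in> I \<Longrightarrow> coord x \<in> supp_in E"
  using L.psi_supp[of x] by simp

text \<open>Letters outside \<open>E\<close> are treated as zero, so that identities hold for all letters.\<close>

definition prj :: "'a \<Rightarrow> 'a" where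
  "prj a = (if a \<in> E then a else \<zero>\<^bsub>A\<^esub>)"

text \<open>A basis element is nonzero, so the chosen degree is its only one. Outside
  \<open>E\<close> the default 0 is harmless because \<open>prj\<close> sends such letters to
  zero.\<close>

definition deg :: "'a \<Rightarrow> int" where
  "deg a = (if a \<in> E then SOME t. a \<in> G t else 0)"

lemma prj_I: "prj a \<in> I"
  by (simp add: prj_def E_I I_zero)

lemma prj_G: "prj a \<in> G (deg a)"
proof (cases "a \<in> E")
  case True
  then have "\<exists>t. a \<in> G t" using E_homogeneous by auto
  then have "a \<in> G (SOME t. a \<in> G t)" by (rule someI_ex)
  then show ?thesis using True by (simp add: prj_def deg_def)
qed (simp add: prj_def G_zero)

text \<open>Letters occurring in a coordinate vector lie in \<open>E\<close>, where
  \<open>prj\<close> is the identity; the form with \<open>prj\<close> matches the definitions of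
  the letter operations.\<close>

lemma ext_coord:
  assumes "\<And>x y. x \<in> I \<Longrightarrow> y \<in> I \<Longrightarrow> g (x \<oplus>\<^bsub>A\<^esub> y) = g x + g y"
    and "\<And>c x. x \<in> I \<Longrightarrow> g (c \<odot>\<^bsub>A\<^esub> x) = fscale c (g x)" and "v \<in> I"
  shows "ext (\<lambda>a. g (prj a)) (coord v) = g v"
proof -
  have "g v - ext (\<lambda>x. g (L.bas x)) (coord v) \<in> {0}"
    using assms by (intro L.expand_mod) (auto intro: fs.subspace_single_0)
  moreover have "ext (\<lambda>a. g (prj a)) (coord v) = ext (\<lambda>x. g (L.bas x)) (coord v)"
    by (rule ext_cong) (use coord_supp[OF assms(3)] in \<open>auto simp: bas_E prj_def supp_in_def\<close>)
  ultimately show ?thesis by simp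
qed

lemma finsum_G:
  assumes "finite S" "\<And>i. i \<in> S \<Longrightarrow> f i \<in> I \<and> f i \<in> G t"
  shows "(\<Oplus>\<^bsub>VI\<^esub>i\<in>S. f i) \<in> G t"
  using assms
proof (induction S rule: finite_induct)
  case (insert i S)
  have "(\<Oplus>\<^bsub>VI\<^esub>i\<in>insert i S. f i) = f i \<oplus>\<^bsub>A\<^esub> (\<Oplus>\<^bsub>VI\<^esub>i\<in>S. f i)"
    using L.M.finsum_insert[of S i f] insert by auto
  then show ?case using insert G_add by simp
next
  case empty
  then show ?case using L.M.finsum_empty[of f] G_zero by simp
qed

lemma phi_G:
  assumes "p \<in> supp_in E" "homog deg t p"
  shows "L.phi p \<in> G t"
proof -
  have "Poly_Mapping.lookup p e \<odot>\<^bsub>A\<^esub> L.bas e \<in> I \<and> Poly_Mapping.lookup p e \<odot>\<^bsub>A\<^esub> L.bas e \<in> G t"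
    if "e \<in> Poly_Mapping.keys p" for e
  proof -
    have e: "e \<in> E" "deg e = t" using assms that by (auto simp: supp_in_def homog_def)
    then have "e \<in> G t" using prj_G[of e] by (simp add: prj_def)
    then show ?thesis using e by (simp add: bas_E I_smult E_I G_smult)
  qed
  then show ?thesis
    unfolding L.finsum_bas[OF assms(1)] by (intro finsum_G) auto
qed

text \<open>Grouping the coordinates of \<open>a\<close> by the degrees of their letters gives a
  decomposition of \<open>a\<close> into homogeneous elements. By uniqueness it is the trivial one,
  so letters of other degrees do not occur.\<close>

lemma coord_homogeneous:
  assumes a: "a \<in> I" "a \<in> G t"
  shows "homog deg t (coord a)"
proof -
  define f where "f g = L.phi (restr (\<lambda>e. deg e = g) (coord a))" for g
  have p: "restr (\<lambda>e. deg e = g) (coord a) \<in> supp_in E" for g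
    by (rule restr_supp_in[OF coord_supp[OF a(1)]])
  have f: "f g \<in> I" "f g \<in> G g" "coord (f g) = restr (\<lambda>e. deg e = g) (coord a)" for g
    using L.phi_closed[OF p] phi_G[OF p homog_restr] L.psi_phi[OF p] by (simp_all add: f_def)
  let ?S = "{g. f g \<noteq> \<zero>\<^bsub>A\<^esub>}"
  have zero: "f g = \<zero>\<^bsub>A\<^esub>" if "g \<notin> deg ` Poly_Mapping.keys (coord a)" for g
  proof -
    have "restr (\<lambda>e. deg e = g) (coord a) = ext (\<lambda>x. 0) (coord a)"
      unfolding restr_def using that by (intro ext_cong) auto
    then show ?thesis using L.psi_eq_zero[of "f g"] f by simp
  qed
  then have sub: "?S \<subseteq> deg ` Poly_Mapping.keys (coord a)" by blast
  then have fin: "finite ?S" by (rule finite_subset) simp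
  have "coord (\<Oplus>\<^bsub>VI\<^esub>g\<in>?S. f g) = (\<Sum>g\<in>?S. coord (f g))"
    using f by (intro L.psi_finsum) auto
  also have "\<dots> = (\<Sum>g\<in>deg ` Poly_Mapping.keys (coord a). restr (\<lambda>e. deg e = g) (coord a))"
    using sub by (intro sum.mono_neutral_cong_left) (auto simp: f(3)[symmetric] coord_zero)
  also have "\<dots> = coord a" by (rule sum_restr) auto
  finally have c: "coord (\<Oplus>\<^bsub>VI\<^esub>g\<in>?S. f g) = coord a" .
  have "(\<Oplus>\<^bsub>VI\<^esub>g\<in>?S. f g) \<in> carrier VI" by (rule L.M.finsum_closed) (use f in auto)
  then have "(\<Oplus>\<^bsub>VI\<^esub>g\<in>?S. f g) = a" using a c by (intro L.psi_inj) auto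
  then have "decomposition A G a f"
    using f fin finsum_VI[OF fin, of f] by (auto simp: decomposition_def)
  moreover have "decomposition A G a (\<lambda>g. if g = t then a else \<zero>\<^bsub>A\<^esub>)"
  proof -
    have "{g. (if g = t then a else \<zero>\<^bsub>A\<^esub>) \<noteq> \<zero>\<^bsub>A\<^esub>} = (if a = \<zero>\<^bsub>A\<^esub> then {} else {t})" by auto
    then show ?thesis
      using a G_zero I_carrier M.finsum_insert[of "{}" t "\<lambda>g. if g = t then a else \<zero>\<^bsub>A\<^esub>"]
      by (auto simp: decomposition_def)
  qed
  ultimately have "f = (\<lambda>g. if g = t then a else \<zero>\<^bsub>A\<^esub>)"
    using hcomp_unique[OF I_carrier[OF a(1)]] by metis
  then have "coord a = restr (\<lambda>e. deg e = t) (coord a)" using f(3)[of t] by simp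
  then show ?thesis using homog_restr by metis
qed

subsection \<open>The bar space\<close>

lemma bar_relationsI:
  assumes "us \<in> lists I" "vs \<in> lists I" "x \<in> I"
  shows "y \<in> I \<Longrightarrow> pt (us @ [x \<oplus>\<^bsub>A\<^esub> y] @ vs) - pt (us @ [x] @ vs) - pt (us @ [y] @ vs) \<in> bar_relations A eps"
    and "pt (us @ [c \<odot>\<^bsub>A\<^esub> x] @ vs) - fscale c (pt (us @ [x] @ vs)) \<in> bar_relations A eps"
proof -
  show "pt (us @ [x \<oplus>\<^bsub>A\<^esub> y] @ vs) - pt (us @ [x] @ vs) - pt (us @ [y] @ vs) \<in> bar_relations A eps" if "y \<in> I"
    unfolding bar_relations_def Let_def by (rule fs.span_base) (use assms that in blast)
  have "pt (us @ [c \<odot>\<^bsub>A\<^esub> x] @ vs) - Poly_Mapping.single (us @ [x] @ vs) c \<in> bar_relations A eps"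
    unfolding bar_relations_def Let_def by (rule fs.span_base) (use assms in blast)
  then show "pt (us @ [c \<odot>\<^bsub>A\<^esub> x] @ vs) - fscale c (pt (us @ [x] @ vs)) \<in> bar_relations A eps" by simp
qed

lemma subspace_bar_relations: "fs.subspace (bar_relations A eps)"
  unfolding bar_relations_def Let_def by (rule fs.subspace_span)

lemma bar_relations_minimal:
  assumes "fs.subspace K"
    and "\<And>us vs x y. us \<in> lists I \<Longrightarrow> vs \<in> lists I \<Longrightarrow> x \<in> I \<Longrightarrow> y \<in> I \<Longrightarrow>
      pt (us @ [x \<oplus>\<^bsub>A\<^esub> y] @ vs) - pt (us @ [x] @ vs) - pt (us @ [y] @ vs) \<in> K"
    and "\<And>us vs x c. us \<in> lists I \<Longrightarrow> vs \<in> lists I \<Longrightarrow> x \<in> I \<Longrightarrow>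
      pt (us @ [c \<odot>\<^bsub>A\<^esub> x] @ vs) - Poly_Mapping.single (us @ [x] @ vs) c \<in> K"
  shows "bar_relations A eps \<subseteq> K"
  unfolding bar_relations_def Let_def
  by (rule fs.span_minimal[OF _ assms(1)]) (use assms(2,3) in blast)

text \<open>Relations stay relations behind a further letter; this lets the tail of a word be
  reduced before its first letter.\<close>

lemma bar_relations_cons:
  assumes a: "a \<in> I" and q: "q \<in> bar_relations A eps"
  shows "cv (pt a) q \<in> bar_relations A eps"
proof -
  note sub = subspace_bar_relations
  let ?K = "{q. cv (pt a) q \<in> bar_relations A eps}"
  have "bar_relations A eps \<subseteq> ?K"
  proof (rule bar_relations_minimal)
    show "fs.subspace ?K"
      by (rule fs.subspaceI)
         (auto intro: fs.subspace_0[OF sub] fs.subspace_add[OF sub] fs.subspace_scale[OF sub])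
  next
    fix us vs x y assume *: "us \<in> lists I" "vs \<in> lists I" "x \<in> I" "y \<in> I"
    then show "pt (us @ [x \<oplus>\<^bsub>A\<^esub> y] @ vs) - pt (us @ [x] @ vs) - pt (us @ [y] @ vs) \<in> ?K"
      using bar_relationsI(1)[of "a # us" vs x y] a by simp
  next
    fix us vs x and c :: 'k assume *: "us \<in> lists I" "vs \<in> lists I" "x \<in> I"
    have "cv (pt a) (Poly_Mapping.single (us @ [x] @ vs) c) = fscale c (pt (a # us @ [x] @ vs))"
    proof -
      have "Poly_Mapping.single (us @ [x] @ vs) c = fscale c (pt (us @ [x] @ vs))" by simp
      then show ?thesis by (simp only: linD(2)[OF lin_ext2(2)] cv_pt)
    qed
    then show "pt (us @ [c \<odot>\<^bsub>A\<^esub> x] @ vs) - Poly_Mapping.single (us @ [x] @ vs) c \<in> ?K"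
      using bar_relationsI(2)[of "a # us" vs x c] a * by simp
  qed
  then show ?thesis using q by auto
qed

abbreviation wcoord :: "'a list \<Rightarrow> ('a list \<Rightarrow>\<^sub>0 'k)" where
  "wcoord w \<equiv> wv (map coord w)"

lemma wcoord_supp: "w \<in> lists I \<Longrightarrow> wcoord w \<in> supp_in (lists E)"
  by (induction w) (auto intro!: ext2_supp_in[OF coord_supp])

lemma wcoord_E: "w \<in> lists E \<Longrightarrow> wcoord w = pt w"
  by (induction w) (auto simp: coord_E)

text \<open>The tail is reduced by induction behind the fixed letter \<open>a\<close>, and
  \<open>a\<close> is then expanded in front of each word that results.\<close>

lemma wcoord_reduce: "w \<in> lists I \<Longrightarrow> pt w - wcoord w \<in> bar_relations A eps"
proof (induction w)
  case Nil
  then show ?case by (simp add: fs.subspace_0[OF subspace_bar_relations])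
next
  case (Cons a w)
  note sub = subspace_bar_relations
  have a: "a \<in> I" and w: "w \<in> lists I" using Cons by auto
  have "pt (a # u) - cv (coord a) (pt u) \<in> bar_relations A eps" if "u \<in> lists I" for u
  proof -
    have "pt (a # u) - ext (\<lambda>x. pt (L.bas x # u)) (coord a) \<in> bar_relations A eps"
      using a that bar_relationsI[of "[]" u] by (intro L.expand_mod[OF sub, of "\<lambda>a. pt (a # u)"]) auto
    moreover have "ext (\<lambda>x. pt (L.bas x # u)) (coord a) = cv (coord a) (pt u)"
      unfolding ext2_def ext_pt
      by (rule ext_cong) (use coord_supp[OF a] in \<open>auto simp: bas_E supp_in_def\<close>)
    ultimately show ?thesis by simp
  qed
  then have "ext (\<lambda>u. pt (a # u) - cv (coord a) (pt u)) (wcoord w) \<in> bar_relations A eps"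
    using wcoord_supp[OF w] E_I by (intro subspace_ext[OF sub]) (auto simp: supp_in_def)
  moreover have "ext (\<lambda>u. pt (a # u) - cv (coord a) (pt u)) (wcoord w)
      = cv (pt a) (wcoord w) - cv (coord a) (wcoord w)"
    by (rule lin_eqI[of "ext (\<lambda>u. pt (a # u) - cv (coord a) (pt u))"
          "\<lambda>p. cv (pt a) p - cv (coord a) p"]) (auto intro!: lin_intros)
  moreover have "cv (pt a) (pt w - wcoord w) \<in> bar_relations A eps"
    using Cons by (intro bar_relations_cons) auto
  ultimately show ?case
    using fs.subspace_add[OF sub, of "cv (pt a) (pt w - wcoord w)" "cv (pt a) (wcoord w) - cv (coord a) (wcoord w)"]
    by simp
qed

text \<open>Words in the basis are their own representatives, so the section is the identity and the
  bar space is free on them.\<close>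

sublocale Bp: presentation "lists I" "bar_relations A eps" "lists E" wcoord "\<lambda>w. w"
proof
  show "fs.subspace (bar_relations A eps)" by (rule subspace_bar_relations)
  let ?K = "{r \<in> supp_in (lists I). ext wcoord r = 0}"
  note s = fs.subspace_diff[OF subspace_supp_in] fs.subspace_scale[OF subspace_supp_in]
    fs.subspace_add[OF subspace_supp_in] fs.subspace_0[OF subspace_supp_in]
  have "bar_relations A eps \<subseteq> ?K"
  proof (rule bar_relations_minimal)
    show "fs.subspace ?K" by (rule fs.subspaceI) (auto intro: s)
  next
    fix us vs x y assume "us \<in> lists I" "vs \<in> lists I" "x \<in> I" "y \<in> I"
    then show "pt (us @ [x \<oplus>\<^bsub>A\<^esub> y] @ vs) - pt (us @ [x] @ vs) - pt (us @ [y] @ vs) \<in> ?K"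
      using wv_add_mid[of "map coord us" "coord x" "coord y" "map coord vs"]
      by (auto intro!: s I_add simp: coord_add)
  next
    fix us vs x and c :: 'k assume "us \<in> lists I" "vs \<in> lists I" "x \<in> I"
    then show "pt (us @ [c \<odot>\<^bsub>A\<^esub> x] @ vs) - Poly_Mapping.single (us @ [x] @ vs) c \<in> ?K"
      using wv_fscale_mid[of "map coord us" c "coord x" "map coord vs"]
      by (auto intro!: s I_smult single_supp_in simp: coord_smult ext_single)
  qed
  then show "bar_relations A eps \<subseteq> supp_in (lists I)"
    and "\<And>r. r \<in> bar_relations A eps \<Longrightarrow> ext wcoord r = 0" by auto
qed (auto simp: wcoord_supp wcoord_E wcoord_reduce E_I)

lemma bar_space_eq: "bar_space A eps = Bp.Qs"
  by (simp add: bar_space_def)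

lemma word: "w \<in> lists I \<Longrightarrow> word A eps w \<in> carrier Bp.Qs \<and> Bp.psi (word A eps w) = wcoord w"
  by (auto simp: word_def Bp.carrier_Qs Bp.psi_coset intro!: imageI)

definition degree_lists :: "'a list \<Rightarrow> int list set" where
  "degree_lists w = {ts. list_all2 (\<lambda>a t. hcomp A G a t \<noteq> \<zero>\<^bsub>A\<^esub>) w ts}"

lemma degree_lists_Cons:
  "degree_lists (a # w) = (\<lambda>(t, ts). t # ts) ` ({t. hcomp A G a t \<noteq> \<zero>\<^bsub>A\<^esub>} \<times> degree_lists w)"
  by (auto simp: degree_lists_def list_all2_Cons1 intro!: rev_image_eqI)

lemma coord_hcomp_sum: "a \<in> I \<Longrightarrow> (\<Sum>t\<in>{t. hcomp A G a t \<noteq> \<zero>\<^bsub>A\<^esub>}. coord (hcomp A G a t)) = coord a"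
  using hcomp_sum(2)[of a] hcomp_I[of a] L.psi_finsum[of "{t. hcomp A G a t \<noteq> \<zero>\<^bsub>A\<^esub>}" "hcomp A G a"]
  by simp

lemma sum_degree_lists:
  "w \<in> lists I \<Longrightarrow> (\<Sum>ts\<in>degree_lists w. wcoord (map2 (hcomp A G) w ts)) = wcoord w"
proof (induction w)
  case (Cons a w)
  let ?T = "{t. hcomp A G a t \<noteq> \<zero>\<^bsub>A\<^esub>}"
  have "(\<Sum>ts\<in>degree_lists (a # w). wcoord (map2 (hcomp A G) (a # w) ts))
      = (\<Sum>(t, ts)\<in>?T \<times> degree_lists w. cv (coord (hcomp A G a t)) (wcoord (map2 (hcomp A G) w ts)))"
    unfolding degree_lists_Cons by (subst sum.reindex) (auto simp: inj_on_def split_def)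
  also have "\<dots> = cv (\<Sum>t\<in>?T. coord (hcomp A G a t)) (\<Sum>ts\<in>degree_lists w. wcoord (map2 (hcomp A G) w ts))"
    by (simp add: sum.cartesian_product[symmetric]) (rule sum.swap)
  also have "\<dots> = wcoord (a # w)"
    using Cons coord_hcomp_sum[of a] by simp
  finally show ?case .
qed (simp add: degree_lists_def)

text \<open>The formula \<open>f\<close> has to be known on homogeneous words only: by
  multilinearity, the sum over all ways of taking components letter by letter reassembles the
  word.\<close>

lemma bar_lift:
  assumes U: "based U B' psi'" and L: "lin L" and \<xi>: "\<xi> \<in> carrier Bp.Qs"
    and f: "\<And>ts w. list_all2 (\<lambda>a t. a \<in> I \<inter> G t) w ts \<Longrightarrow> f ts w \<in> carrier U \<and> psi' (f ts w) = L (wcoord w)"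
  shows "bar_lift A G U f \<xi> \<in> carrier U" "psi' (bar_lift A G U f \<xi>) = L (Bp.psi \<xi>)"
proof -
  interpret U: based U B' psi' by (rule U)
  let ?F = "\<lambda>w. \<Oplus>\<^bsub>U\<^esub>ts\<in>degree_lists w. f ts (map2 (hcomp A G) w ts)"
  have h: "list_all2 (\<lambda>a t. a \<in> I \<inter> G t) (map2 (hcomp A G) w ts) ts" if "w \<in> lists I" "ts \<in> degree_lists w" for w ts
  proof -
    have "list_all2 (\<lambda>a t. hcomp A G a t \<noteq> \<zero>\<^bsub>A\<^esub>) w ts" using that by (simp add: degree_lists_def)
    then show ?thesis using that(1)
      by (induction rule: list_all2_induct) (auto simp: hcomp_I hcomp_G I_carrier)
  qed
  have F: "?F w \<in> carrier U \<and> psi' (?F w) = L (wcoord w)" if w: "w \<in> lists I" for w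
  proof
    show "?F w \<in> carrier U" using f[OF h[OF w]] by (intro U.M.finsum_closed) auto
    have "psi' (?F w) = (\<Sum>ts\<in>degree_lists w. L (wcoord (map2 (hcomp A G) w ts)))"
      using f[OF h[OF w]] by (subst U.psi_finsum) auto
    then show "psi' (?F w) = L (wcoord w)"
      unfolding lin_sum[OF L, symmetric] sum_degree_lists[OF w] .
  qed
  have "bar_lift A G U f \<xi> = lift U ?F \<xi>" by (simp add: bar_lift_def degree_lists_def)
  then show "bar_lift A G U f \<xi> \<in> carrier U" "psi' (bar_lift A G U f \<xi>) = L (Bp.psi \<xi>)"
    using Bp.lift[OF U F L \<xi>] by simp_all
qed

end

section \<open>The operations of the algebra as operations on shifted letters\<close>

lemma homog_map: "homog D g p \<Longrightarrow> homog (\<lambda>x. h (D x)) (h g) p"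
  by (auto simp: homog_def)

lemma ext_sc_fun: "ext (\<lambda>x. sc e (f x)) p = sc e (ext f p)"
  by (cases e) (simp_all add: ext_def sum_negf)

lemma cdw_zero_mh: "mh (\<lambda>a b. 0) a w = 0"
  by (cases w) auto

context bar_coords
begin

text \<open>A letter of degree \<open>t\<close> contributes \<open>t + 1\<close> to the total degree. The sign in \<open>lmult\<close> is that of
  the first summand of \<open>\<delta>\<close>.\<close>

definition par :: "'a \<Rightarrow> bit" where "par a = of_int (deg a + 1)"
definition bideg :: "'a \<Rightarrow> int \<times> int" where "bideg a = (1, deg a)"

definition lbr :: "'a \<Rightarrow> 'a \<Rightarrow> ('a \<Rightarrow>\<^sub>0 'k)" where "lbr a b = coord (br (prj a) (prj b))"
definition ld :: "'a \<Rightarrow> ('a \<Rightarrow>\<^sub>0 'k)" where "ld a = coord (dA (prj a))"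
definition lmult :: "'a \<Rightarrow> 'a \<Rightarrow> ('a \<Rightarrow>\<^sub>0 'k)" where "lmult a b = sc (par a) (coord (prj a \<otimes>\<^bsub>A\<^esub> prj b))"

lemma prj_carrier: "prj a \<in> carrier A"
  by (rule I_carrier[OF prj_I])

lemma coord_par: "x \<in> I \<Longrightarrow> x \<in> G t \<Longrightarrow> homog par (of_int (t + 1)) (coord x)"
  using homog_map[OF coord_homogeneous, of x t "\<lambda>t. of_int (t + 1)"] by (simp add: par_def[abs_def])

lemma coord_bideg: "x \<in> I \<Longrightarrow> x \<in> G t \<Longrightarrow> homog bideg (1, t) (coord x)"
  using homog_map[OF coord_homogeneous, of x t "\<lambda>t. (1, t)"] by (simp add: bideg_def[abs_def])

lemma lbr_left: "y \<in> I \<Longrightarrow> ext2 lbr (pt a) (coord y) = coord (br (prj a) y)"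
  using ext_coord[of "\<lambda>y. coord (br (prj a) y)" y]
  by (simp add: ext2_def lbr_def[abs_def] br_add_right br_smult_right coord_add coord_smult br_I prj_I prj_carrier I_carrier)

lemma lbr_right: "x \<in> I \<Longrightarrow> ext2 lbr (coord x) (pt b) = coord (br x (prj b))"
  using ext_coord[of "\<lambda>x. coord (br x (prj b))" x]
  by (simp add: ext2_def lbr_def br_add_left br_smult_left coord_add coord_smult br_I prj_I prj_carrier I_carrier)

lemma lbr_coord:
  assumes "x \<in> I" "y \<in> I"
  shows "ext2 lbr (coord x) (coord y) = coord (br x y)"
proof -
  have "ext2 lbr (coord x) (coord y) = ext (\<lambda>a. coord (br (prj a) y)) (coord x)"
    unfolding ext2_def by (rule ext_cong) (use lbr_left[OF assms(2)] in \<open>simp add: ext2_def\<close>)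
  also have "\<dots> = coord (br x y)"
    using assms by (intro ext_coord[of "\<lambda>x. coord (br x y)"])
      (simp_all add: br_add_left br_smult_left coord_add coord_smult br_I I_carrier)
  finally show ?thesis .
qed

lemma ld_coord: "x \<in> I \<Longrightarrow> ext ld (coord x) = coord (dA x)"
  using ext_coord[of "\<lambda>x. coord (dA x)" x]
  by (simp add: ld_def[abs_def] dA_add dA_smult coord_add coord_smult dA_I I_carrier)

lemma lmult_left: "y \<in> I \<Longrightarrow> ext2 lmult (pt a) (coord y) = sc (par a) (coord (prj a \<otimes>\<^bsub>A\<^esub> y))"
  using ext_coord[of "\<lambda>y. coord (prj a \<otimes>\<^bsub>A\<^esub> y)" y]
  by (simp add: ext2_def lmult_def[abs_def] ext_sc_fun R.r_distr P.smult_mult_right coord_add coord_smult mult_I prj_I prj_carrier I_carrier)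

text \<open>The sign in \<open>lmult\<close> depends on the first letter, so \<open>x\<close> must
  be homogeneous for one sign to come out of the expansion; \<open>y\<close> may be
  arbitrary.\<close>

lemma lmult_coord:
  assumes "x \<in> I" "y \<in> I" "x \<in> G s"
  shows "ext2 lmult (coord x) (coord y) = sc (of_int (s + 1)) (coord (x \<otimes>\<^bsub>A\<^esub> y))"
proof -
  have "ext2 lmult (coord x) (coord y) = ext (\<lambda>a. sc (of_int (s + 1)) (coord (prj a \<otimes>\<^bsub>A\<^esub> y))) (coord x)"
    unfolding ext2_def
    by (rule ext_cong)
       (use lmult_left[OF assms(2)] coord_par[OF assms(1,3)] in \<open>simp add: ext2_def homog_def\<close>)
  also have "\<dots> = sc (of_int (s + 1)) (coord (x \<otimes>\<^bsub>A\<^esub> y))"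
    unfolding ext_sc_fun using assms
    by (subst ext_coord[of "\<lambda>x. coord (x \<otimes>\<^bsub>A\<^esub> y)"])
      (simp_all add: R.l_distr P.smult_mult_left coord_add coord_smult mult_I I_carrier)
  finally show ?thesis .
qed

lemma lmult_right:
  assumes "x \<in> I" "x \<in> G s"
  shows "ext2 lmult (coord x) (pt b) = sc (of_int (s + 1)) (coord (x \<otimes>\<^bsub>A\<^esub> prj b))"
proof -
  have "ext2 lmult (coord x) (pt b) = ext (\<lambda>a. sc (of_int (s + 1)) (coord (prj a \<otimes>\<^bsub>A\<^esub> prj b))) (coord x)"
    unfolding ext2_def
    by (rule ext_cong) (use coord_par[OF assms] in \<open>simp add: lmult_def homog_def\<close>)
  also have "\<dots> = sc (of_int (s + 1)) (coord (x \<otimes>\<^bsub>A\<^esub> prj b))"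
    unfolding ext_sc_fun using assms
    by (subst ext_coord[of "\<lambda>x. coord (x \<otimes>\<^bsub>A\<^esub> prj b)"])
      (simp_all add: R.l_distr P.smult_mult_left coord_add coord_smult mult_I I_carrier prj_I prj_carrier)
  finally show ?thesis .
qed

lemma lbr_G: "br (prj a) (prj b) \<in> G (deg a + deg b + (int n - 1))"
  by (rule P.br_degree[OF prj_G prj_G])

lemma ld_G: "dA (prj a) \<in> G (deg a + - 1)"
  by (rule P.D_degree[OF prj_G])

lemma lmult_G: "prj a \<otimes>\<^bsub>A\<^esub> prj b \<in> G (deg a + deg b)"
  by (rule P.mult_degree[OF prj_G prj_G])

lemma lbr_bideg: "homog bideg (bideg a + bideg b + (-1, int n - 1)) (lbr a b)"
  using coord_bideg[OF br_I[OF prj_I prj_I] lbr_G, of a b] by (simp add: lbr_def bideg_def)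

lemma ld_bideg: "homog bideg (bideg a + (0, -1)) (ld a)"
  using coord_bideg[OF dA_I[OF prj_I] ld_G, of a] by (simp add: ld_def bideg_def)

lemma lmult_bideg: "homog bideg (bideg a + bideg b + (-1, 0)) (lmult a b)"
  using homog_sc[OF coord_bideg[OF mult_I[OF prj_I prj_I] lmult_G, of a b]] by (simp add: lmult_def bideg_def)

text \<open>With \<open>par\<close> equal to the degree plus one, the bracket of degree n - 1 has
  parity n, and the exponent |x| + n - 1 of the algebra becomes \<open>par a + of_nat n\<close>. So
  the laws for letters are those of the algebra, sign for sign.\<close>

sublocale BW: bracket_words par "TYPE('k)" "of_nat n" lbr
proof
  fix a b
  show "homog par (par a + par b + of_nat n) (lbr a b)"
    using coord_par[OF br_I[OF prj_I prj_I] lbr_G, of a b] by (simp add: lbr_def par_def bit_ring)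
  show "lbr a b = - sc ((par a + of_nat n) * (par b + of_nat n)) (lbr b a)"
    unfolding lbr_def P.br_antisym[OF prj_G prj_G, of a b]
    by (simp add: coord_minus coord_sg sg_I br_I prj_I par_def bit_ring)
next
  fix a b c
  show "ext2 lbr (pt a) (lbr b c) = ext2 lbr (lbr a b) (pt c)
      + sc ((par a + of_nat n) * (par b + of_nat n)) (ext2 lbr (pt b) (lbr a c))"
    using P.br_jacobi[OF prj_G prj_G prj_G, of a b c]
    by (simp add: lbr_def lbr_left lbr_right coord_add coord_sg sg_I br_I prj_I par_def bit_ring)
qed

lemma ld_par: "homog par (par a + 1) (ld a)"
  using coord_par[OF dA_I[OF prj_I] ld_G, of a] by (simp add: ld_def par_def bit_ring)

lemma lmult_par: "homog par (par a + par b + 1) (lmult a b)"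
  unfolding lmult_def
  using homog_sc[OF coord_par[OF mult_I[OF prj_I prj_I] lmult_G, of a b]] by (simp add: par_def bit_ring del: sc_simps)

lemma ld_bracket: "ext ld (lbr a b) = ext2 lbr (ld a) (pt b) + sc (par a + of_nat n) (ext2 lbr (pt a) (ld b))"
  using P.leibniz[OF prj_G prj_G, of a b]
  by (simp add: lbr_def ld_coord ld_def lbr_left lbr_right coord_add coord_sg sg_I br_I dA_I prj_I par_def bit_ring)

lemma lmult_bracket: "sc (par a + of_nat n) (ext2 lbr (pt a) (lmult b c)) =
    ext2 lmult (lbr a b) (pt c) + sc ((par a + of_nat n) * par b) (ext2 lmult (pt b) (lbr a c))"
  using P.br_poisson[OF prj_G prj_G prj_G, of a b c]
  by (simp add: lbr_def lmult_def lbr_left lmult_left lmult_right[OF _ lbr_G] coord_add coord_sg sg_I br_I mult_I prj_I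
      par_def bit_ring)

text \<open>Graded commutativity has exponent \<open>(par a + 1) * (par b + 1)\<close>. The two sign
  factors in \<open>lmult\<close> absorb the linear terms, and the constant 1 becomes the minus
  sign.\<close>

lemma lmult_antisym: "lmult a b = - sc (par a * par b) (lmult b a)"
  unfolding lmult_def C.graded_commutative[OF prj_G prj_G, of a b]
  by (simp add: coord_sg mult_I prj_I par_def bit_ring)

lemma ld_ld: "ext ld (ld a) = 0"
  by (simp add: ld_def ld_coord dA_I prj_I P.D_D prj_carrier coord_zero)

lemma ld_lmult: "ext ld (lmult a b) + ext2 lmult (ld a) (pt b) + sc (par a) (ext2 lmult (pt a) (ld b)) = 0"
  using P.D_mult[OF prj_G prj_carrier, of a b]
  by (simp add: lmult_def ld_coord ld_def lmult_left lmult_right[OF _ ld_G] coord_add coord_sg sg_I mult_I dA_I prj_I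
      par_def bit_ring)

text \<open>Associativity: after the signs in \<open>lmult\<close> are collected, the two products
  of three letters carry opposite signs.\<close>

lemma lmult_lmult: "ext2 lmult (lmult a b) (pt c) + sc (par a) (ext2 lmult (pt a) (lmult b c)) = 0"
  by (simp add: lmult_def lmult_left lmult_right[OF _ lmult_G] mult_I prj_I prj_carrier R.m_assoc par_def bit_ring)

sublocale DI: leibniz_words par "TYPE('k)" "of_nat n" lbr ld "\<lambda>a b. 0"
proof unfold_locales
  fix a b c
  show "homog par (par a + 1) (ld a)" by (rule ld_par)
  show "ext ld (lbr a b) = ext2 lbr (ld a) (pt b) + sc (par a + of_nat n) (ext2 lbr (pt a) (ld b))"
    by (rule ld_bracket)
qed (simp_all add: ext2_def)

sublocale DE: leibniz_words par "TYPE('k)" "of_nat n" lbr "\<lambda>a. 0" lmult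
proof unfold_locales
  fix a b c
  show "homog par (par a + par b + 1) (lmult a b)" by (rule lmult_par)
  show "lmult a b = - sc (par a * par b) (lmult b a)" by (rule lmult_antisym)
  show "sc (par a + of_nat n) (ext2 lbr (pt a) (lmult b c)) =
      ext2 lmult (lbr a b) (pt c) + sc ((par a + of_nat n) * par b) (ext2 lmult (pt b) (lbr a c))"
    by (rule lmult_bracket)
qed simp_all

text \<open>This coderivation is the total differential d + \<delta>, from which the anticommutation
  of d and \<delta> is extracted.\<close>

sublocale DS: coder_words par "TYPE('k)" ld lmult
  by unfold_locales (rule ld_par lmult_par)+

end

section \<open>Coordinates of the structure maps of the bar construction\<close>

lemma bar_sigma_0 [simp]: "bar_sigma ts 0 = 0"
  by (simp add: bar_sigma_def)

lemma bar_sigma_Cons_Suc [simp]: "bar_sigma (t # ts) (Suc i) = t + 1 + bar_sigma ts i"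
  by (simp add: bar_sigma_def)

lemma Dc_wv: "ext dcw (wv xs) = (\<Sum>i\<in>{0..length xs}. tn (wv (take i xs)) (wv (drop i xs)))"
proof (induction xs)
  case (Cons x xs)
  have "(\<Sum>i\<in>{0..length (x # xs)}. tn (wv (take i (x # xs))) (wv (drop i (x # xs))))
      = tn (pt []) (cv x (wv xs)) + (\<Sum>i\<in>{0..length xs}. tn (cv x (wv (take i xs))) (wv (drop i xs)))"
    unfolding list.size add_0_right add_Suc_right by (subst sum.atLeast0_atMost_Suc_shift) simp
  then show ?case by (simp add: Dc_cv Cons)
qed simp

lemma sum_pred_interval: "(\<Sum>i\<in>{1..m}. f (i - 1)) = (\<Sum>j<m. f j)" for f :: "nat \<Rightarrow> 'b::comm_monoid_add"
  by (rule sum.reindex_bij_witness[of _ Suc "\<lambda>i. i - 1"]) auto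

lemma lookup_cv_Nil: "Poly_Mapping.lookup (cv x p) [] = 0"
  by (simp add: ext2_def ext_def lookup_sum lookup_single)

context bar_coords
begin

abbreviation Q :: "('k, ('k, 'a) bar) module" where "Q \<equiv> Bp.Qs"
abbreviation coo :: "('k, 'a) bar \<Rightarrow> ('a list \<Rightarrow>\<^sub>0 'k)" where "coo \<equiv> Bp.psi"

lemma letters_par:
  "list_all2 (\<lambda>a t. a \<in> I \<inter> G t) w ts \<Longrightarrow> list_all2 (\<lambda>x t. homog par (of_int (t + 1)) x) (map coord w) ts"
  unfolding list.rel_map by (erule list_all2_mono) (metis IntE coord_par)

lemma letters_I: "list_all2 (\<lambda>a t. a \<in> I \<inter> G t) w ts \<Longrightarrow> w \<in> lists I"
  by (induction rule: list_all2_induct) auto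

lemma words_I_append:
  assumes "xs \<in> lists I" "ys \<in> lists I" "i < length xs + length ys"
  shows "(xs @ ys) ! i \<in> I"
  using assms by (metis append_in_lists_conv in_listsD length_append nth_mem)

lemma pq_shuffle_inv:
  assumes "\<phi> \<in> pq_shuffles p q" "j \<in> {1..p + q}"
  shows "inv_into UNIV \<phi> j \<in> {1..p + q}"
  using assms permutes_in_image[OF permutes_inv[of \<phi> "{1..p+q}"]] by (auto simp: pq_shuffles_def)

lemma Sh_words:
  assumes xs: "list_all2 (\<lambda>a t. a \<in> I \<inter> G t) xs ps" and ys: "list_all2 (\<lambda>a t. a \<in> I \<inter> G t) ys qs"
    and p: "p = length xs" and q: "q = length ys"
  defines "\<xi> \<equiv> (\<Oplus>\<^bsub>Q\<^esub>\<phi>\<in>pq_shuffles p q. sg Q (shuffle_sign ps qs \<phi>)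
      (word A eps (map (\<lambda>j. (xs @ ys) ! (inv_into UNIV \<phi> j - 1)) [1..<p + q + 1])))"
  shows "\<xi> \<in> carrier Q" "coo \<xi> = BW.Sh (wcoord xs) (wcoord ys)"
proof -
  let ?w = "\<lambda>\<phi>. map (\<lambda>j. (xs @ ys) ! (inv_into UNIV \<phi> j - 1)) [1..<p + q + 1]"
  have a: "(xs @ ys) ! (inv_into UNIV \<phi> j - 1) \<in> I"
    and c: "(map coord xs @ map coord ys) ! (inv_into UNIV \<phi> j - 1) = coord ((xs @ ys) ! (inv_into UNIV \<phi> j - 1))"
    if "\<phi> \<in> pq_shuffles p q" "j \<in> {1..<p + q + 1}" for \<phi> j
  proof -
    have i: "inv_into UNIV \<phi> j - 1 < length xs + length ys"
      using pq_shuffle_inv[OF that(1), of j] that(2) p q by auto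
    show "(xs @ ys) ! (inv_into UNIV \<phi> j - 1) \<in> I"
      by (rule words_I_append[OF letters_I[OF xs] letters_I[OF ys] i])
    show "(map coord xs @ map coord ys) ! (inv_into UNIV \<phi> j - 1) = coord ((xs @ ys) ! (inv_into UNIV \<phi> j - 1))"
      using nth_map[of "inv_into UNIV \<phi> j - 1" "xs @ ys" coord] i by simp
  qed
  have w: "?w \<phi> \<in> lists I" if "\<phi> \<in> pq_shuffles p q" for \<phi>
    using a[OF that] by (auto simp del: upt_Suc)
  note wd = word[OF w]
  show "\<xi> \<in> carrier Q"
    unfolding \<xi>_def using wd by (intro Bp.M.finsum_closed) (auto intro: Bp.sg_closed)
  have "coo \<xi> = (\<Sum>\<phi>\<in>pq_shuffles p q. sc (of_int (shuffle_sign ps qs \<phi>)) (wcoord (?w \<phi>)))"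
    unfolding \<xi>_def using wd
    by (subst Bp.psi_finsum) (auto simp: Bp.sg_closed Bp.psi_sg simp del: upt_Suc intro!: sum.cong)
  also have "\<dots> = BW.Sh (wcoord xs) (wcoord ys)"
    unfolding BW.Sh_pq_shuffles[OF letters_par[OF xs] letters_par[OF ys], unfolded length_map, OF p q]
    using c by (intro sum.cong refl arg_cong[where f = "sc _"] arg_cong[where f = wv]) (auto simp del: upt_Suc)
  finally show "coo \<xi> = BW.Sh (wcoord xs) (wcoord ys)" .
qed

lemma bar_mult:
  assumes \<xi>: "\<xi> \<in> carrier Q" and \<eta>: "\<eta> \<in> carrier Q"
  shows "bar_mult A G eps \<xi> \<eta> \<in> carrier Q" "coo (bar_mult A G eps \<xi> \<eta>) = BW.Sh (coo \<xi>) (coo \<eta>)"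
proof -
  let ?F = "\<lambda>ps xs qs ys. \<Oplus>\<^bsub>Q\<^esub>\<phi>\<in>pq_shuffles (length xs) (length ys). sg Q (shuffle_sign ps qs \<phi>)
      (word A eps (map (\<lambda>j. (xs @ ys) ! (inv_into UNIV \<phi> j - 1)) [1..<length xs + length ys + 1]))"
  have eq: "bar_mult A G eps \<xi> \<eta> = bar_lift A G Q (\<lambda>ps xs. bar_lift A G Q (?F ps xs) \<eta>) \<xi>"
    by (simp only: bar_mult_def Let_def bar_space_eq)
  have f: "?F ps xs qs ys \<in> carrier Q \<and> coo (?F ps xs qs ys) = BW.Sh (wcoord xs) (wcoord ys)"
    if "list_all2 (\<lambda>a t. a \<in> I \<inter> G t) xs ps" "list_all2 (\<lambda>a t. a \<in> I \<inter> G t) ys qs" for ps xs qs ys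
    by (rule conjI; rule Sh_words[OF that refl refl])
  have g: "bar_lift A G Q (?F ps xs) \<eta> \<in> carrier Q \<and> coo (bar_lift A G Q (?F ps xs) \<eta>) = BW.Sh (wcoord xs) (coo \<eta>)"
    if "list_all2 (\<lambda>a t. a \<in> I \<inter> G t) xs ps" for ps xs
    by (rule conjI; rule bar_lift[OF Bp.based_axioms lin_ext2(2)[of "shw par" "wcoord xs"] \<eta>]; rule f[OF that]; assumption)
  show "bar_mult A G eps \<xi> \<eta> \<in> carrier Q"
    unfolding eq by (rule bar_lift(1)[OF Bp.based_axioms lin_ext2(1)[of "shw par" "coo \<eta>"] \<xi>]; rule g; assumption)
  show "coo (bar_mult A G eps \<xi> \<eta>) = BW.Sh (coo \<xi>) (coo \<eta>)"
    unfolding eq by (rule bar_lift(2)[OF Bp.based_axioms lin_ext2(1)[of "shw par" "coo \<eta>"] \<xi>]; rule g; assumption)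
qed

lemma Br_words:
  assumes xs: "list_all2 (\<lambda>a t. a \<in> I \<inter> G t) xs ps" and ys: "list_all2 (\<lambda>a t. a \<in> I \<inter> G t) ys qs"
  shows "bar_bracket_words A eps br n ps xs qs ys \<in> carrier Q"
    "coo (bar_bracket_words A eps br n ps xs qs ys) = BW.Br (wcoord xs) (wcoord ys)"
proof -
  define p where "p = length xs"
  define q where "q = length ys"
  let ?a = "\<lambda>\<phi> j. (xs @ ys) ! (inv_into UNIV \<phi> j - 1)"
  let ?J = "\<lambda>\<phi>. {i. 1 \<le> i \<and> i < p + q \<and> inv_into UNIV \<phi> i \<le> p \<and> inv_into UNIV \<phi> (i + 1) > p}"
  let ?w = "\<lambda>\<phi> i. map (?a \<phi>) [1..<i] @ [sg A (bracket_sign n ps qs \<phi> i) (br (?a \<phi> i) (?a \<phi> (i + 1)))] @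
      map (?a \<phi>) [i + 2..<p + q + 1]"
  let ?g = "\<lambda>\<phi> i. sg Q (shuffle_sign ps qs \<phi>) (word A eps (?w \<phi> i))"
  have eq: "bar_bracket_words A eps br n ps xs qs ys = (\<Oplus>\<^bsub>Q\<^esub>\<phi>\<in>pq_shuffles p q. \<Oplus>\<^bsub>Q\<^esub>i\<in>?J \<phi>. ?g \<phi> i)"
    by (simp only: bar_bracket_words_def Let_def bar_space_eq p_def q_def)
  have a: "?a \<phi> j \<in> I" and c: "(map coord xs @ map coord ys) ! (inv_into UNIV \<phi> j - 1) = coord (?a \<phi> j)"
    if "\<phi> \<in> pq_shuffles p q" "j \<in> {1..<p + q + 1}" for \<phi> j
  proof -
    have i: "inv_into UNIV \<phi> j - 1 < length xs + length ys"
      using pq_shuffle_inv[OF that(1), of j] that(2) by (auto simp: p_def q_def)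
    show "?a \<phi> j \<in> I"
      by (rule words_I_append[OF letters_I[OF xs] letters_I[OF ys] i])
    show "(map coord xs @ map coord ys) ! (inv_into UNIV \<phi> j - 1) = coord (?a \<phi> j)"
      using nth_map[of "inv_into UNIV \<phi> j - 1" "xs @ ys" coord] i by simp
  qed
  have w: "?w \<phi> i \<in> lists I" if "\<phi> \<in> pq_shuffles p q" "i \<in> ?J \<phi>" for \<phi> i
    using a[OF that(1)] that(2) by (auto intro!: sg_I br_I simp del: upt_Suc)
  note wd = word[OF w]
  have g: "?g \<phi> i \<in> carrier Q \<and> coo (?g \<phi> i) = sc (of_int (shuffle_sign ps qs \<phi>)) (wcoord (?w \<phi> i))"
    if "\<phi> \<in> pq_shuffles p q" "i \<in> ?J \<phi>" for \<phi> i
    using wd[OF that] by (simp add: Bp.sg_closed Bp.psi_sg del: upt_Suc)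
  have s: "(\<Oplus>\<^bsub>Q\<^esub>i\<in>?J \<phi>. ?g \<phi> i) \<in> carrier Q \<and>
      coo (\<Oplus>\<^bsub>Q\<^esub>i\<in>?J \<phi>. ?g \<phi> i) = (\<Sum>i\<in>?J \<phi>. sc (of_int (shuffle_sign ps qs \<phi>)) (wcoord (?w \<phi> i)))"
    if "\<phi> \<in> pq_shuffles p q" for \<phi>
  proof
    show "(\<Oplus>\<^bsub>Q\<^esub>i\<in>?J \<phi>. ?g \<phi> i) \<in> carrier Q"
      by (rule Bp.M.finsum_closed) (use g[OF that] in blast)
    have "coo (\<Oplus>\<^bsub>Q\<^esub>i\<in>?J \<phi>. ?g \<phi> i) = (\<Sum>i\<in>?J \<phi>. coo (?g \<phi> i))"
      by (rule Bp.psi_finsum) (use g[OF that] in blast)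
    also have "\<dots> = (\<Sum>i\<in>?J \<phi>. sc (of_int (shuffle_sign ps qs \<phi>)) (wcoord (?w \<phi> i)))"
      by (rule sum.cong[OF refl]) (use g[OF that] in blast)
    finally show "coo (\<Oplus>\<^bsub>Q\<^esub>i\<in>?J \<phi>. ?g \<phi> i) = (\<Sum>i\<in>?J \<phi>. sc (of_int (shuffle_sign ps qs \<phi>)) (wcoord (?w \<phi> i)))" .
  qed
  show "bar_bracket_words A eps br n ps xs qs ys \<in> carrier Q"
    unfolding eq by (rule Bp.M.finsum_closed) (use s in blast)
  have "coo (bar_bracket_words A eps br n ps xs qs ys) = (\<Sum>\<phi>\<in>pq_shuffles p q. coo (\<Oplus>\<^bsub>Q\<^esub>i\<in>?J \<phi>. ?g \<phi> i))"
    unfolding eq by (rule Bp.psi_finsum) (use s in blast)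
  also have "\<dots> = (\<Sum>\<phi>\<in>pq_shuffles p q. \<Sum>i\<in>?J \<phi>. sc (of_int (shuffle_sign ps qs \<phi>)) (wcoord (?w \<phi> i)))"
    by (rule sum.cong[OF refl]) (use s in blast)
  also have "\<dots> = BW.Br (wcoord xs) (wcoord ys)"
    unfolding BW.Br_pq_shuffles[OF letters_par[OF xs] letters_par[OF ys], unfolded length_map, OF p_def q_def refl]
  proof (intro sum.cong refl arg_cong[where f = "sc _"] arg_cong[where f = wv])
    fix \<phi> i assume \<phi>: "\<phi> \<in> pq_shuffles p q" and i: "i \<in> ?J \<phi>"
    have ij: "i \<in> {1..<p + q + 1}" "i + 1 \<in> {1..<p + q + 1}" using i by auto
    have b: "coord (sg A (bracket_sign n ps qs \<phi> i) (br (?a \<phi> i) (?a \<phi> (i + 1))))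
        = sc (of_int (bracket_sign n ps qs \<phi> i)) (ext2 lbr (coord (?a \<phi> i)) (coord (?a \<phi> (i + 1))))"
      using a[OF \<phi> ij(1)] a[OF \<phi> ij(2)] by (simp add: coord_sg br_I lbr_coord)
    have m: "map coord (map (?a \<phi>) [k..<m]) = map (\<lambda>j. (map coord xs @ map coord ys) ! (inv_into UNIV \<phi> j - 1)) [k..<m]"
      if "1 \<le> k" "m \<le> p + q + 1" for k m
      using c[OF \<phi>] that by auto
    show "map coord (?w \<phi> i) = map (\<lambda>j. (map coord xs @ map coord ys) ! (inv_into UNIV \<phi> j - 1)) [1..<i] @
        [sc (of_int (bracket_sign n ps qs \<phi> i)) (ext2 lbr ((map coord xs @ map coord ys) ! (inv_into UNIV \<phi> i - 1))
          ((map coord xs @ map coord ys) ! (inv_into UNIV \<phi> (i + 1) - 1)))] @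
        map (\<lambda>j. (map coord xs @ map coord ys) ! (inv_into UNIV \<phi> j - 1)) [i + 2..<p + q + 1]"
      unfolding map_append c[OF \<phi> ij(1)] c[OF \<phi> ij(2)]
      using m[of 1 i] m[of "i + 2" "p + q + 1"] b ij by (simp del: upt_Suc)
  qed
  finally show "coo (bar_bracket_words A eps br n ps xs qs ys) = BW.Br (wcoord xs) (wcoord ys)" .
qed

text \<open>The witness of the theorem: the explicit formula, extended linearly in both arguments
  from homogeneous words, with no reference to the basis.\<close>

definition bar_br :: "('k, 'a) bar \<Rightarrow> ('k, 'a) bar \<Rightarrow> ('k, 'a) bar" where
  "bar_br \<xi> \<eta> = bar_lift A G Q (\<lambda>ps xs. bar_lift A G Q (bar_bracket_words A eps br n ps xs) \<eta>) \<xi>"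

lemma bar_br:
  assumes \<xi>: "\<xi> \<in> carrier Q" and \<eta>: "\<eta> \<in> carrier Q"
  shows "bar_br \<xi> \<eta> \<in> carrier Q" "coo (bar_br \<xi> \<eta>) = BW.Br (coo \<xi>) (coo \<eta>)"
proof -
  let ?F = "bar_bracket_words A eps br n"
  have f: "?F ps xs qs ys \<in> carrier Q \<and> coo (?F ps xs qs ys) = BW.Br (wcoord xs) (wcoord ys)"
    if "list_all2 (\<lambda>a t. a \<in> I \<inter> G t) xs ps" "list_all2 (\<lambda>a t. a \<in> I \<inter> G t) ys qs" for ps xs qs ys
    by (rule conjI; rule Br_words[OF that])
  have g: "bar_lift A G Q (?F ps xs) \<eta> \<in> carrier Q \<and> coo (bar_lift A G Q (?F ps xs) \<eta>) = BW.Br (wcoord xs) (coo \<eta>)"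
    if "list_all2 (\<lambda>a t. a \<in> I \<inter> G t) xs ps" for ps xs
    by (rule conjI; rule bar_lift[OF Bp.based_axioms lin_ext2(2)[of "brw par (of_nat n) lbr" "wcoord xs"] \<eta>];
        rule f[OF that]; assumption)
  show "bar_br \<xi> \<eta> \<in> carrier Q"
    unfolding bar_br_def
    by (rule bar_lift(1)[OF Bp.based_axioms lin_ext2(1)[of "brw par (of_nat n) lbr" "coo \<eta>"] \<xi>]; rule g; assumption)
  show "coo (bar_br \<xi> \<eta>) = BW.Br (coo \<xi>) (coo \<eta>)"
    unfolding bar_br_def
    by (rule bar_lift(2)[OF Bp.based_axioms lin_ext2(1)[of "brw par (of_nat n) lbr" "coo \<eta>"] \<xi>]; rule g; assumption)
qed

lemma bar_br_words:
  assumes xs: "list_all2 (\<lambda>a t. a \<in> I \<inter> G t) xs ps" and ys: "list_all2 (\<lambda>a t. a \<in> I \<inter> G t) ys qs"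
  shows "bar_br (word A eps xs) (word A eps ys) = bar_bracket_words A eps br n ps xs qs ys"
proof (rule Bp.psi_inj)
  note w = word[OF letters_I[OF xs]] word[OF letters_I[OF ys]]
  show "bar_br (word A eps xs) (word A eps ys) \<in> carrier Q"
    using w by (simp add: bar_br)
  show "coo (bar_br (word A eps xs) (word A eps ys)) = coo (bar_bracket_words A eps br n ps xs qs ys)"
    using w by (simp add: bar_br Br_words[OF xs ys])
qed (rule Br_words[OF xs ys])

lemma Df_int_words:
  "list_all2 (\<lambda>a t. a \<in> I \<inter> G t) w ts \<Longrightarrow> DI.Df (wcoord w) =
    (\<Sum>j<length w. sc (of_int (bar_sigma ts j)) (wcoord (take j w @ [dA (w ! j)] @ drop (Suc j) w)))"
proof (induction rule: list_all2_induct)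
  case (Cons a w t ts)
  \<comment> \<open>No letters are merged by d, so the recursion of the coderivation loses its
    second summand.\<close>
  have "mh (\<lambda>a b. 0) = (\<lambda>(a :: 'a) w. 0 :: _ \<Rightarrow>\<^sub>0 'k)"
    by (simp add: fun_eq_iff cdw_zero_mh)
  then have "ext2 (mh (\<lambda>a b. 0)) x p = 0" for x :: "'a \<Rightarrow>\<^sub>0 'k" and p :: "'a list \<Rightarrow>\<^sub>0 'k"
    by (simp add: ext2_def)
  then show ?case
    using Cons DI.Df_cv[OF coord_par, of a t "wcoord w"]
    by (simp add: ld_coord sum.lessThan_Suc_shift del: sum.lessThan_Suc)
qed simp

lemma Df_ext_words:
  "list_all2 (\<lambda>a t. a \<in> I \<inter> G t) w ts \<Longrightarrow> DE.Df (wcoord w) =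
    (\<Sum>j<length w - 1. sc (of_int (bar_sigma ts (Suc j))) (wcoord (take j w @ [w ! j \<otimes>\<^bsub>A\<^esub> w ! Suc j] @ drop (Suc (Suc j)) w)))"
proof (induction rule: list_all2_induct)
  case (Cons a w t ts)
  note c = DE.Df_cv[OF coord_par, of a t "wcoord w"]
  show ?case
  proof (cases w)
    case Nil
    then show ?thesis using Cons c by simp
  next
    case (Cons b u)
    then have b: "b \<in> I" using letters_I[OF Cons.hyps(2)] by simp
    have e: "of_int t + 1 + x = 1 + (of_int t + x)" for x :: bit by (simp add: add_ac)
    have "DE.Mh (coord a) (wcoord w) = sc (of_int (t + 1)) (cv (coord (a \<otimes>\<^bsub>A\<^esub> b)) (wcoord u))"
      using Cons.hyps(1) lmult_coord[of a b t] b by (simp add: Cons DE.Mh_cv)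
    then show ?thesis
      using c Cons.hyps(1) Cons.IH
      by (simp add: Cons e sum.lessThan_Suc_shift sum_negf del: sum.lessThan_Suc)
  qed
qed simp

lemma bar_internal:
  assumes "\<xi> \<in> carrier Q"
  shows "bar_internal A G eps dA \<xi> \<in> carrier Q" "coo (bar_internal A G eps dA \<xi>) = DI.Df (coo \<xi>)"
proof -
  let ?f = "\<lambda>ts as. \<Oplus>\<^bsub>Q\<^esub>i\<in>{1..length as}. sg Q (bar_sigma ts (i - 1))
      (word A eps (take (i - 1) as @ [dA (as ! (i - 1))] @ drop i as))"
  have f: "?f ts w \<in> carrier Q \<and> coo (?f ts w) = DI.Df (wcoord w)" if w: "list_all2 (\<lambda>a t. a \<in> I \<inter> G t) w ts" for ts w
  proof -
    have l: "take (i - 1) w @ [dA (w ! (i - 1))] @ drop i w \<in> lists I" if "i \<in> {1..length w}" for i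
      using letters_I[OF w] that by (auto intro!: dA_I dest: in_set_takeD in_set_dropD)
    note wd = word[OF l]
    have "coo (?f ts w) = (\<Sum>i\<in>{1..length w}. sc (of_int (bar_sigma ts (i - 1)))
        (wcoord (take (i - 1) w @ [dA (w ! (i - 1))] @ drop (Suc (i - 1)) w)))"
      using wd by (subst Bp.psi_finsum) (auto simp: Bp.sg_closed Bp.psi_sg intro!: sum.cong)
    also have "\<dots> = DI.Df (wcoord w)"
      unfolding Df_int_words[OF w]
      by (rule sum_pred_interval[of "\<lambda>j. sc (of_int (bar_sigma ts j)) (wcoord (take j w @ [dA (w ! j)] @ drop (Suc j) w))"])
    finally show ?thesis using wd by (auto intro!: Bp.M.finsum_closed Bp.sg_closed)
  qed
  have eq: "bar_internal A G eps dA \<xi> = bar_lift A G Q ?f \<xi>"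
    by (simp only: bar_internal_def Let_def bar_space_eq)
  show "bar_internal A G eps dA \<xi> \<in> carrier Q"
    unfolding eq by (rule bar_lift(1)[OF Bp.based_axioms lin_ext[of "cdw par ld (\<lambda>a b. 0)"] assms]; rule f; assumption)
  show "coo (bar_internal A G eps dA \<xi>) = DI.Df (coo \<xi>)"
    unfolding eq by (rule bar_lift(2)[OF Bp.based_axioms lin_ext[of "cdw par ld (\<lambda>a b. 0)"] assms]; rule f; assumption)
qed

lemma bar_external:
  assumes "\<xi> \<in> carrier Q"
  shows "bar_external A G eps \<xi> \<in> carrier Q" "coo (bar_external A G eps \<xi>) = DE.Df (coo \<xi>)"
proof -
  let ?f = "\<lambda>ts as. \<Oplus>\<^bsub>Q\<^esub>i\<in>{1..<length as}. sg Q (bar_sigma ts i)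
      (word A eps (take (i - 1) as @ [as ! (i - 1) \<otimes>\<^bsub>A\<^esub> as ! i] @ drop (i + 1) as))"
  have f: "?f ts w \<in> carrier Q \<and> coo (?f ts w) = DE.Df (wcoord w)" if w: "list_all2 (\<lambda>a t. a \<in> I \<inter> G t) w ts" for ts w
  proof -
    have l: "take (i - 1) w @ [w ! (i - 1) \<otimes>\<^bsub>A\<^esub> w ! i] @ drop (i + 1) w \<in> lists I" if "i \<in> {1..<length w}" for i
      using letters_I[OF w] that by (auto intro!: mult_I dest: in_set_takeD in_set_dropD)
    note wd = word[OF l]
    have "coo (?f ts w) = (\<Sum>i\<in>{1..<length w}. sc (of_int (bar_sigma ts i))
        (wcoord (take (i - 1) w @ [w ! (i - 1) \<otimes>\<^bsub>A\<^esub> w ! i] @ drop (i + 1) w)))"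
      using wd by (subst Bp.psi_finsum) (auto simp: Bp.sg_closed Bp.psi_sg intro!: sum.cong)
    also have "\<dots> = DE.Df (wcoord w)"
      unfolding Df_ext_words[OF w]
      by (rule sum.reindex_bij_witness[of _ Suc "\<lambda>i. i - 1"]) auto
    finally show ?thesis using wd by (auto intro!: Bp.M.finsum_closed Bp.sg_closed)
  qed
  have eq: "bar_external A G eps \<xi> = bar_lift A G Q ?f \<xi>"
    by (simp only: bar_external_def Let_def bar_space_eq)
  show "bar_external A G eps \<xi> \<in> carrier Q"
    unfolding eq by (rule bar_lift(1)[OF Bp.based_axioms lin_ext[of "cdw par (\<lambda>a. 0) lmult"] assms]; rule f; assumption)
  show "coo (bar_external A G eps \<xi>) = DE.Df (coo \<xi>)"
    unfolding eq by (rule bar_lift(2)[OF Bp.based_axioms lin_ext[of "cdw par (\<lambda>a. 0) lmult"] assms]; rule f; assumption)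
qed

lemma bar_counit:
  assumes "\<xi> \<in> carrier Q"
  shows "bar_counit \<xi> = Poly_Mapping.lookup (coo \<xi>) []"
proof -
  have w: "Poly_Mapping.lookup (wcoord w) [] = (if w = [] then 1 else 0)" for w
    by (cases w) (simp_all add: lookup_cv_Nil)
  have *: "Poly_Mapping.lookup p [] = Poly_Mapping.lookup (coo \<xi>) []" if "p \<in> \<xi>" for p
    using Bp.psi_mem[OF assms that]
    by (auto simp: ext_def lookup_sum w sum.delta if_distrib in_keys_iff cong: if_cong)
  obtain p where "p \<in> supp_in (lists I)" "\<xi> = coset_of (bar_relations A eps) p"
    using assms by (auto simp: Bp.carrier_Qs)
  then have p: "p \<in> \<xi>" by (simp add: Bp.coset_iff Bp.N_zero)
  show ?thesis unfolding bar_counit_def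
  proof (rule the_equality)
    show "\<exists>p\<in>\<xi>. Poly_Mapping.lookup (coo \<xi>) [] = Poly_Mapping.lookup p []" using * p by auto
    show "c = Poly_Mapping.lookup (coo \<xi>) []" if "\<exists>p\<in>\<xi>. c = Poly_Mapping.lookup p []" for c using * that by auto
  qed
qed

end

text \<open>Membership in a graded piece asks for a homogeneous representative of the coset; the
  normal form supplies one.\<close>

lemma (in presentation) representative:
  assumes "\<xi> \<in> carrier Qs"
  shows "ext (\<lambda>y. pt (sec y)) (psi \<xi>) \<in> \<xi>"
proof -
  let ?r = "\<lambda>q. ext (\<lambda>y. pt (sec y)) q"
  obtain p where p: "p \<in> supp_in S" and \<xi>: "\<xi> = coset_of N p"
    using assms by (auto simp: carrier_Qs)
  have q: "ext R p \<in> supp_in B" using p by (rule ext_supp_in) (rule R_supp)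
  then have "?r (ext R p) \<in> supp_in S" by (rule ext_supp_in) (simp add: sec_closed)
  moreover have "ext R (?r (ext R p)) = ext pt (ext R p)"
    unfolding ext_ext[of R] ext_pt by (rule ext_cong) (use q R_sec in \<open>auto simp: supp_in_def\<close>)
  ultimately have "?r (ext R p) - p \<in> N"
    using p by (simp add: N_iff fs.subspace_diff[OF subspace_supp_in])
  then show ?thesis by (simp only: \<xi> coset_iff psi_coset[OF p])
qed

lemma based_mult_update:
  assumes "based V B psi"
  shows "based (V\<lparr>monoid.mult := f, one := e\<rparr>) B psi"
proof -
  interpret based V B psi by (rule assms)
  let ?W = "V\<lparr>monoid.mult := f, one := e\<rparr>"
  have "abelian_group ?W"
    by (rule abelian_groupI)
      (auto simp: M.a_assoc M.a_comm M.a_lcomm intro: bexI[of _ "\<ominus>\<^bsub>V\<^esub> x" for x] M.l_neg)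
  then have "module ground ?W"
    using M.smult_assoc1 M.smult_l_distr M.smult_r_distr M.smult_one by (intro moduleI cring_ground) auto
  then show ?thesis
    using psi_bij by (auto intro!: based.intro simp: psi_add psi_smult)
qed

section \<open>The graded Poisson algebra and its comultiplication\<close>

context bar_coords
begin

abbreviation BA :: "('k, ('k, 'a) bar) module" where "BA \<equiv> bar_algebra A G eps"
abbreviation BG :: "int \<times> int \<Rightarrow> ('k, 'a) bar set" where "BG \<equiv> bar_grading A G eps"

lemma BA_simps [simp]:
  "carrier BA = carrier Q" "ring.add BA = ring.add Q" "ring.zero BA = ring.zero Q" "module.smult BA = module.smult Q"
  "monoid.mult BA = bar_mult A G eps" "\<one>\<^bsub>BA\<^esub> = word A eps []"
  by (simp_all add: bar_algebra_def bar_space_eq)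

sublocale BA: based BA "lists E" coo
  unfolding bar_algebra_def bar_space_eq by (rule based_mult_update) (rule Bp.based_axioms)

sublocale BB: based_pair BA "lists E" coo BA "lists E" coo ..

abbreviation TB :: "('k, (('k, 'a) bar \<times> ('k, 'a) bar \<Rightarrow>\<^sub>0 'k) set) module" where "TB \<equiv> tensor BA BA"
abbreviation tco :: "(('k, 'a) bar \<times> ('k, 'a) bar \<Rightarrow>\<^sub>0 'k) set \<Rightarrow> ('a list \<times> 'a list \<Rightarrow>\<^sub>0 'k)"
  where "tco \<equiv> tpsi coo coo"

sublocale TB: based TB "lists E \<times> lists E" tco by (rule BB.based_tensor)

lemma tensor_Q: "tensor Q Q = TB" "tens Q Q = tens BA BA"
  by (simp_all add: tensor_def tensor_relations_def tens_def fun_eq_iff)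

text \<open>Expanding homogeneous letters keeps their degrees, so a homogeneous representative has
  homogeneous coordinates. Conversely the coordinate vector is itself a representative.\<close>

lemma bar_grading_coo: "BG g = {\<xi> \<in> carrier BA. homog (wd bideg) g (coo \<xi>)}"
proof -
  have *: "wd bideg w = (int (length w), sum_list (map deg w))" for w
    by (induction w) (simp_all add: bideg_def zero_prod_def)
  have "homog (wd bideg) g (coo \<xi>)"
    if \<xi>: "\<xi> \<in> carrier Q" and p: "p \<in> \<xi>" and k: "Poly_Mapping.keys p \<subseteq> {as. int (length as) = fst g \<and>
      (\<exists>ts. list_all2 (\<lambda>a t. a \<in> G t) as ts \<and> sum_list ts = snd g)}" for \<xi> p
  proof -
    have "homog (wd bideg) g (wcoord w)" if w: "w \<in> Poly_Mapping.keys p" for w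
    proof -
      have "w \<in> lists I" using Bp.psi_mem[OF \<xi> p] w by (auto simp: supp_in_def)
      moreover obtain ts where ts: "list_all2 (\<lambda>a t. a \<in> G t) w ts" "sum_list ts = snd g" and l: "int (length w) = fst g"
        using k w by auto
      from ts(1) have "homog (wd bideg) (int (length w), sum_list ts) (wcoord w)" if "w \<in> lists I"
        using that
      proof (induction rule: list_all2_induct)
        case (Cons a w t ts)
        then show ?case
          using homog_cv[OF coord_bideg, of a t "(int (length w), sum_list ts)" "wcoord w"] by simp
      qed (simp add: homog_def zero_prod_def)
      ultimately show ?thesis using ts l by simp
    qed
    then show ?thesis using Bp.psi_mem[OF \<xi> p] by (auto simp: ext_def)
  qed
  moreover have "\<exists>p\<in>\<xi>. Poly_Mapping.keys p \<subseteq> {as. int (length as) = fst g \<and>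
      (\<exists>ts. list_all2 (\<lambda>a t. a \<in> G t) as ts \<and> sum_list ts = snd g)}"
    if \<xi>: "\<xi> \<in> carrier Q" and h: "homog (wd bideg) g (coo \<xi>)" for \<xi>
  proof
    show "coo \<xi> \<in> \<xi>" using Bp.representative[OF \<xi>] by simp
    have e: "a \<in> G (deg a)" if "a \<in> E" for a using prj_G[of a] that by (simp add: prj_def)
    have "list_all2 (\<lambda>a t. a \<in> G t) w (map deg w)" if "w \<in> lists E" for w
      using that by (induction w) (auto simp: e)
    then show "Poly_Mapping.keys (coo \<xi>) \<subseteq> {as. int (length as) = fst g \<and>
      (\<exists>ts. list_all2 (\<lambda>a t. a \<in> G t) as ts \<and> sum_list ts = snd g)}"
      using h Bp.psi_supp[OF \<xi>] by (fastforce simp: homog_def supp_in_def *)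
  qed
  ultimately show ?thesis by (auto simp: bar_grading_def bar_space_eq)
qed

sublocale GB: graded_based BA "lists E" coo "wd bideg" BG
  by unfold_locales (rule bar_grading_coo)

lemma wd_par: "wd par w = of_int (bitotal (wd bideg w))"
  by (induction w) (simp_all add: par_def bideg_def)

lemma BG_D:
  assumes "\<xi> \<in> BG g"
  shows "\<xi> \<in> carrier Q" "homog (wd par) (of_int (bitotal g)) (coo \<xi>)"
  using GB.G_D[OF assms] by (auto simp: homog_def wd_par)

lemma word_Nil: "word A eps [] \<in> carrier Q" "coo (word A eps []) = pt []"
  using word[of "[]"] by simp_all

lemma coo_eq_iff: "x \<in> carrier Q \<Longrightarrow> y \<in> carrier Q \<Longrightarrow> x = y \<longleftrightarrow> coo x = coo y"
  using Bp.psi_inj by blast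

lemma coo_closed [simp]:
  "\<zero>\<^bsub>Q\<^esub> \<in> carrier Q" "x \<in> carrier Q \<Longrightarrow> \<ominus>\<^bsub>BA\<^esub> x \<in> carrier Q" "x \<in> carrier Q \<Longrightarrow> sg BA e x \<in> carrier Q"
  "x \<in> carrier Q \<Longrightarrow> y \<in> carrier Q \<Longrightarrow> x \<oplus>\<^bsub>Q\<^esub> y \<in> carrier Q" "x \<in> carrier Q \<Longrightarrow> c \<odot>\<^bsub>Q\<^esub> x \<in> carrier Q"
  using BA.M.a_inv_closed[of x] BA.sg_closed[of x e] by simp_all

lemma coo_simps [simp]:
  "x \<in> carrier Q \<Longrightarrow> coo (\<ominus>\<^bsub>BA\<^esub> x) = - coo x" "x \<in> carrier Q \<Longrightarrow> coo (sg BA e x) = sc (of_int e) (coo x)"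
  "x \<in> carrier Q \<Longrightarrow> y \<in> carrier Q \<Longrightarrow> coo (x \<oplus>\<^bsub>Q\<^esub> y) = coo x + coo y"
  "x \<in> carrier Q \<Longrightarrow> coo (c \<odot>\<^bsub>Q\<^esub> x) = fscale c (coo x)"
  using BA.psi_minus[of x] BA.psi_sg[of x e] by (simp_all add: Bp.psi_add Bp.psi_smult)

lemma BG_iff: "x \<in> BG g \<longleftrightarrow> x \<in> carrier Q \<and> homog (wd bideg) g (coo x)"
  by (simp add: bar_grading_coo)

lemma bar_graded_algebra: "graded_algebra BA BG bitotal"
proof (rule graded_algebra.intro)
  show "ring BA"
  proof (rule ringI)
    show "abelian_group BA" by (rule BA.M.abelian_group_axioms)
    show "Group.monoid BA"
      by (rule monoidI) (simp_all add: coo_eq_iff bar_mult word_Nil BW.Sh_assoc)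
  qed (auto simp add: coo_eq_iff bar_mult)
  show "module ground BA" by (rule BA.is_module)
  show "grading BA BG" by (rule GB.grading)
  show "\<one>\<^bsub>BA\<^esub> \<in> BG 0"
    using homog_pt[of "wd bideg" "[]"] by (simp add: BG_iff word_Nil)
  show "x \<otimes>\<^bsub>BA\<^esub> y \<in> BG (g + h)" if "x \<in> BG g" "y \<in> BG h" for x y g h
    using that by (simp add: BG_iff bar_mult homog_Sh)
qed (simp_all add: coo_eq_iff bar_mult)

lemma bar_graded_commutative_algebra: "graded_commutative_algebra BA BG bitotal"
proof (intro graded_commutative_algebra.intro bar_graded_algebra graded_commutative_algebra_axioms.intro)
  fix x y g h assume "x \<in> BG g" "y \<in> BG h"
  note BG_D[OF this(1)] BG_D[OF this(2)]
  then show "x \<otimes>\<^bsub>BA\<^esub> y = sg BA (bitotal g * bitotal h) (y \<otimes>\<^bsub>BA\<^esub> x)"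
    using BW.Sh_comm[of "of_int (bitotal g)" "coo x" "of_int (bitotal h)" "coo y"]
    by (simp add: coo_eq_iff bar_mult)
qed

lemma bar_graded_poisson_algebra: "graded_poisson_algebra BA BG bitotal (-1, int n - 1) bar_br"
proof (intro graded_poisson_algebra.intro bar_graded_algebra graded_poisson_algebra_axioms.intro)
  show "kbilinear BA BA BA bar_br"
    by (auto simp: kbilinear_def klinear_def coo_eq_iff bar_br)
  show "bar_br x y \<in> BG (g + h + (-1, int n - 1))" if "x \<in> BG g" "y \<in> BG h" for x y g h
    using that by (simp add: BG_iff bar_br homog_Br lbr_bideg)
next
  let ?m = "bitotal (-1, int n - 1)"
  \<comment> \<open>The bracket has total degree n - 2, which has the parity of n used for
    words.\<close>
  have m: "of_int ?m = (of_nat n :: bit)" by simp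
  fix x y z g h i
  assume xy: "x \<in> BG g" "y \<in> BG h"
  note x = BG_D[OF xy(1)] and y = BG_D[OF xy(2)]
  show "bar_br x y = \<ominus>\<^bsub>BA\<^esub> sg BA ((bitotal g + ?m) * (bitotal h + ?m)) (bar_br y x)"
    using BW.Br_antisym[OF x(2) y(2)] x y m
    by (simp add: coo_eq_iff bar_br del: fst_conv snd_conv)
  assume "z \<in> BG i"
  note z = BG_D[OF this]
  show "bar_br x (y \<otimes>\<^bsub>BA\<^esub> z) =
      (bar_br x y \<otimes>\<^bsub>BA\<^esub> z) \<oplus>\<^bsub>BA\<^esub> sg BA (bitotal h * (bitotal g + ?m)) (y \<otimes>\<^bsub>BA\<^esub> bar_br x z)"
    using BW.Br_Sh[OF x(2) y(2), of "coo z"] x y z m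
    by (simp add: coo_eq_iff bar_br bar_mult del: fst_conv snd_conv)
  show "bar_br x (bar_br y z) =
      bar_br (bar_br x y) z \<oplus>\<^bsub>BA\<^esub> sg BA ((bitotal g + ?m) * (bitotal h + ?m)) (bar_br y (bar_br x z))"
    using BW.Br_jacobi[OF x(2) y(2), of "coo z"] x y z m
    by (simp add: coo_eq_iff bar_br del: fst_conv snd_conv)
qed

lemma bar_comult:
  assumes \<xi>: "\<xi> \<in> carrier Q"
  shows "bar_comult A eps \<xi> \<in> carrier TB" "tco (bar_comult A eps \<xi>) = Dc (coo \<xi>)"
proof -
  let ?f = "\<lambda>w. \<Oplus>\<^bsub>TB\<^esub>i\<in>{0..length w}. tens BA BA (word A eps (take i w)) (word A eps (drop i w))"
  have eq: "bar_comult A eps \<xi> = lift TB ?f \<xi>"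
    by (simp only: bar_comult_def Let_def bar_space_eq tensor_Q)
  have f: "?f w \<in> carrier TB \<and> tco (?f w) = Dc (wcoord w)" if w: "w \<in> lists I" for w
  proof -
    have td: "take i w \<in> lists I" "drop i w \<in> lists I" for i
      using w by (auto dest: in_set_takeD in_set_dropD)
    note wd = word[OF td(1)] word[OF td(2)]
    have t: "tens BA BA (word A eps (take i w)) (word A eps (drop i w)) \<in> carrier TB"
      "tco (tens BA BA (word A eps (take i w)) (word A eps (drop i w))) = tn (wcoord (take i w)) (wcoord (drop i w))" for i
      using wd BB.tens by auto
    show ?thesis
      by (simp add: TB.psi_finsum t Dc_wv take_map drop_map TB.M.finsum_closed)
  qed
  show "bar_comult A eps \<xi> \<in> carrier TB"
    unfolding eq by (rule Bp.lift(1)[OF TB.based_axioms _ lin_ext \<xi>]) (rule f)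
  show "tco (bar_comult A eps \<xi>) = Dc (coo \<xi>)"
    unfolding eq by (rule Bp.lift(2)[OF TB.based_axioms _ lin_ext \<xi>]) (rule f)
qed

end

section \<open>Structure maps on tensor powers of the bar construction\<close>

lemma ext_tn: "ext (\<lambda>(u, v). ext2 k (f u) (g v)) (tn p q) = ext2 k (ext f p) (ext g q)"
  by (rule lin_eqI2[of "\<lambda>p q. ext (\<lambda>(u, v). ext2 k (f u) (g v)) (tn p q)" "\<lambda>p q. ext2 k (ext f p) (ext g q)"];
      ((rule lin_intros)+)?) (simp_all add: ext2_pt)

lemma ext_tn_assoc: "ext (\<lambda>((u, v), w). pt (u, v, w)) (tn (tn p q) r) = tn p (tn q r)"
  by (rule lin_eqI3[of "\<lambda>p q r. ext (\<lambda>((u, v), w). pt (u, v, w)) (tn (tn p q) r)" "\<lambda>p q r. tn p (tn q r)"];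
      ((rule lin_intros)+)?) simp_all

lemma lin_lookup: "lin (\<lambda>p. fscale (Poly_Mapping.lookup p x) q)"
  by (simp add: lin_def lookup_add fscale_add_left)

lemma counit_tn:
  "ext (\<lambda>(u, v). if u = [] then pt v else 0) (tn p q) = fscale (Poly_Mapping.lookup p []) q"
  "ext (\<lambda>(u, v). if v = [] then pt u else 0) (tn p q) = fscale (Poly_Mapping.lookup q []) p"
proof -
  have l: "lin (\<lambda>q. fscale c (q :: _ \<Rightarrow>\<^sub>0 'b::field))" for c by (rule lin_fscale_fun[OF lin_id])
  show "ext (\<lambda>(u, v). if u = [] then pt v else 0) (tn p q) = fscale (Poly_Mapping.lookup p []) q"
    by (rule lin_eqI2[of "\<lambda>p q. ext (\<lambda>(u, v). if u = [] then pt v else 0) (tn p q)"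
          "\<lambda>p q. fscale (Poly_Mapping.lookup p []) q"])
      ((rule lin_lookup l lin_intros)+, simp_all add: lookup_single)
  show "ext (\<lambda>(u, v). if v = [] then pt u else 0) (tn p q) = fscale (Poly_Mapping.lookup q []) p"
    by (rule lin_eqI2[of "\<lambda>p q. ext (\<lambda>(u, v). if v = [] then pt u else 0) (tn p q)"
          "\<lambda>p q. fscale (Poly_Mapping.lookup q []) p"])
      ((rule lin_lookup l lin_intros)+, simp_all add: lookup_single)
qed

lemma lookup_sc: "Poly_Mapping.lookup (sc e p) x = sc e (Poly_Mapping.lookup p x)"
  by (simp add: sc_def)

lemma lookup_ext_zero: "(\<And>w. Poly_Mapping.lookup (f w) x = 0) \<Longrightarrow> Poly_Mapping.lookup (ext f p) x = 0"
  by (simp add: ext_def lookup_sum)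

lemma lookup_cdw_Nil: "Poly_Mapping.lookup (cdw par b1 b2 w) [] = 0"
proof (cases w)
  case (Cons a u)
  then show ?thesis by (cases u) (simp_all add: lookup_add lookup_sc lookup_cv_Nil)
qed simp

lemma lookup_Sh_Nil:
  fixes p q :: "'a list \<Rightarrow>\<^sub>0 'b::field"
  shows "Poly_Mapping.lookup (ext2 (shw par) p q) [] = Poly_Mapping.lookup p [] * Poly_Mapping.lookup q []"
proof -
  have *: "Poly_Mapping.lookup (shw par u v :: _ \<Rightarrow>\<^sub>0 'b) [] = (if u = [] \<and> v = [] then 1 else 0)" for u v
    by (cases u; cases v) (simp_all add: lookup_single lookup_add lookup_sc lookup_cv_Nil)
  \<comment> \<open>Scalars are encoded as vectors on a one-point set, so that equality of bilinear
    maps can be tested on basis words.\<close>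
  have "fscale (Poly_Mapping.lookup (ext2 (shw par) p q) []) (pt ()) =
      fscale (Poly_Mapping.lookup p [] * Poly_Mapping.lookup q []) (pt () :: _ \<Rightarrow>\<^sub>0 'b)"
    by (rule lin_eqI2[of "\<lambda>p q. fscale (Poly_Mapping.lookup (ext2 (shw par) p q) []) (pt ())"
          "\<lambda>p q. fscale (Poly_Mapping.lookup p [] * Poly_Mapping.lookup q []) (pt ())"])
       (simp_all add: lin_def lookup_add fscale_add_left ext2_pt * lookup_single when_def algebra_simps flip: single_add)
  from arg_cong[OF this, of "\<lambda>p. Poly_Mapping.lookup p ()"] show ?thesis by simp
qed

lemma ext_counit_word: "ext (\<lambda>w. if w = [] then pt [] else 0) p = fscale (Poly_Mapping.lookup p []) (pt [])"
  by (rule lin_eqI[of "ext (\<lambda>w. if w = [] then pt [] else 0)" "\<lambda>p. fscale (Poly_Mapping.lookup p []) (pt [])"])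
     (simp_all add: lin_def lookup_add single_add lookup_single)

context bar_coords
begin

text \<open>The common shape of the product and the bracket on the tensor square. Only the inner
  entries \<open>x2\<close> and \<open>y1\<close> are split into components, because only their
  degrees enter the signs.\<close>

lemma tensor_bilinear:
  assumes F: "\<And>x1 x2 y1 y2 g h. x1 \<in> carrier Q \<Longrightarrow> y2 \<in> carrier Q \<Longrightarrow> x2 \<in> BG g \<Longrightarrow> y1 \<in> BG h \<Longrightarrow>
      F x1 y2 g x2 h y1 \<in> carrier TB \<and> tco (F x1 y2 g x2 h y1) = ext2 k (tn (coo x1) (coo x2)) (tn (coo y1) (coo y2))"
    and \<xi>: "\<xi> \<in> carrier TB" and \<eta>: "\<eta> \<in> carrier TB"
  defines "\<zeta> \<equiv> lift TB (\<lambda>(x1, x2). lift TB (\<lambda>(y1, y2).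
       hsum TB BA BG (\<lambda>g2 x2. hsum TB BA BG (\<lambda>h1 y1. F x1 y2 g2 x2 h1 y1) y1) x2) \<eta>) \<xi>"
  shows "\<zeta> \<in> carrier TB" "tco \<zeta> = ext2 k (tco \<xi>) (tco \<eta>)"
proof -
  note bt = TB.based_axioms
  have 1: "hsum TB BA BG (\<lambda>h1 y1. F x1 y2 g2 x2 h1 y1) y1 \<in> carrier TB \<and>
      tco (hsum TB BA BG (\<lambda>h1 y1. F x1 y2 g2 x2 h1 y1) y1) = ext2 k (tn (coo x1) (coo x2)) (tn (coo y1) (coo y2))"
    if "x1 \<in> carrier Q" "y2 \<in> carrier Q" "x2 \<in> BG g2" "y1 \<in> carrier Q" for x1 x2 y1 y2 g2
  proof -
    have l: "lin (\<lambda>q. ext2 k (tn (coo x1) (coo x2)) (tn q (coo y2)))" by (rule lin_intros)+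
    show ?thesis
      by (rule conjI; (rule GB.hsum[OF bt l]); simp add: F that)
  qed
  have 2: "hsum TB BA BG (\<lambda>g2 x2. hsum TB BA BG (\<lambda>h1 y1. F x1 y2 g2 x2 h1 y1) y1) x2 \<in> carrier TB \<and>
      tco (hsum TB BA BG (\<lambda>g2 x2. hsum TB BA BG (\<lambda>h1 y1. F x1 y2 g2 x2 h1 y1) y1) x2)
      = ext2 k (tn (coo x1) (coo x2)) (tn (coo y1) (coo y2))"
    if "x1 \<in> carrier Q" "y2 \<in> carrier Q" "x2 \<in> carrier Q" "y1 \<in> carrier Q" for x1 x2 y1 y2
  proof -
    have l: "lin (\<lambda>p. ext2 k (tn (coo x1) p) (tn (coo y1) (coo y2)))" by (rule lin_intros)+
    show ?thesis
      by (rule conjI; (rule GB.hsum[OF bt l]); simp add: 1 that)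
  qed
  let ?L = "\<lambda>x1 x2. lift TB (\<lambda>(y1, y2).
       hsum TB BA BG (\<lambda>g2 x2. hsum TB BA BG (\<lambda>h1 y1. F x1 y2 g2 x2 h1 y1) y1) x2) \<eta>"
  have 3: "?L x1 x2 \<in> carrier TB \<and> tco (?L x1 x2) = ext2 k (tn (coo x1) (coo x2)) (tco \<eta>)"
    if "x1 \<in> carrier Q" "x2 \<in> carrier Q" for x1 x2
    by (rule conjI; (rule BB.tensor_lift[OF bt lin_ext2(2)[of k "tn (coo x1) (coo x2)"] \<eta>]); simp add: 2 that)
  show "\<zeta> \<in> carrier TB"
    unfolding \<zeta>_def by (rule BB.tensor_lift(1)[OF bt lin_ext2(1)[of k "tco \<eta>"] \<xi>]) (simp add: 3)
  show "tco \<zeta> = ext2 k (tco \<xi>) (tco \<eta>)"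
    unfolding \<zeta>_def by (rule BB.tensor_lift(2)[OF bt lin_ext2(1)[of k "tco \<eta>"] \<xi>]) (simp add: 3)
qed

lemma tens_BA [simp]:
  "x \<in> carrier Q \<Longrightarrow> y \<in> carrier Q \<Longrightarrow> tens BA BA x y \<in> carrier TB"
  "x \<in> carrier Q \<Longrightarrow> y \<in> carrier Q \<Longrightarrow> tco (tens BA BA x y) = tn (coo x) (coo y)"
  using BB.tens[of x y] by simp_all

lemma tensor_mult:
  assumes "\<xi> \<in> carrier TB" "\<eta> \<in> carrier TB"
  shows "tensor_mult BA BG bitotal \<xi> \<eta> \<in> carrier TB" "tco (tensor_mult BA BG bitotal \<xi> \<eta>) = BW.Sh2 (tco \<xi>) (tco \<eta>)"
proof -
  let ?F = "\<lambda>x1 y2 g2 x2 h1 y1. sg TB (bitotal g2 * bitotal h1) (tens BA BA (x1 \<otimes>\<^bsub>BA\<^esub> y1) (x2 \<otimes>\<^bsub>BA\<^esub> y2))"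
  have F: "?F x1 y2 g x2 h y1 \<in> carrier TB \<and>
      tco (?F x1 y2 g x2 h y1) = BW.Sh2 (tn (coo x1) (coo x2)) (tn (coo y1) (coo y2))"
    if "x1 \<in> carrier Q" "y2 \<in> carrier Q" "x2 \<in> BG g" "y1 \<in> BG h" for x1 x2 y1 y2 g h
    using that(1,2) BG_D[OF that(3)] BG_D[OF that(4)] BW.Sh2_tn[of "of_int (bitotal g)" "coo x2" "of_int (bitotal h)" "coo y1"]
    by (simp add: bar_mult TB.psi_sg TB.sg_closed)
  show "tensor_mult BA BG bitotal \<xi> \<eta> \<in> carrier TB"
    unfolding tensor_mult_def Let_def by (rule tensor_bilinear(1)[OF _ assms]) (rule F)
  show "tco (tensor_mult BA BG bitotal \<xi> \<eta>) = BW.Sh2 (tco \<xi>) (tco \<eta>)"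
    unfolding tensor_mult_def Let_def by (rule tensor_bilinear(2)[OF _ assms]) (rule F)
qed

lemma tensor_bracket:
  assumes "\<xi> \<in> carrier TB" "\<eta> \<in> carrier TB" and m: "of_int m = (of_nat n :: bit)"
  shows "tensor_bracket BA BG bitotal m bar_br \<xi> \<eta> \<in> carrier TB"
    "tco (tensor_bracket BA BG bitotal m bar_br \<xi> \<eta>) = BW.Br2 (tco \<xi>) (tco \<eta>)"
proof -
  let ?F = "\<lambda>x1 y2 g2 x2 h1 y1. sg TB (bitotal g2 * (bitotal h1 + m)) (tens BA BA (bar_br x1 y1) (x2 \<otimes>\<^bsub>BA\<^esub> y2)) \<oplus>\<^bsub>TB\<^esub>
         sg TB ((bitotal g2 + m) * bitotal h1) (tens BA BA (x1 \<otimes>\<^bsub>BA\<^esub> y1) (bar_br x2 y2))"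
  have F: "?F x1 y2 g x2 h y1 \<in> carrier TB \<and>
      tco (?F x1 y2 g x2 h y1) = BW.Br2 (tn (coo x1) (coo x2)) (tn (coo y1) (coo y2))"
    if "x1 \<in> carrier Q" "y2 \<in> carrier Q" "x2 \<in> BG g" "y1 \<in> BG h" for x1 x2 y1 y2 g h
    using that(1,2) BG_D[OF that(3)] BG_D[OF that(4)] BW.Br2_tn[of "of_int (bitotal g)" "coo x2" "of_int (bitotal h)" "coo y1"] m
    by (simp add: bar_mult bar_br TB.psi_sg TB.sg_closed TB.psi_add)
  show "tensor_bracket BA BG bitotal m bar_br \<xi> \<eta> \<in> carrier TB"
    unfolding tensor_bracket_def Let_def by (rule tensor_bilinear(1)[OF _ assms(1,2)]) (rule F)
  show "tco (tensor_bracket BA BG bitotal m bar_br \<xi> \<eta>) = BW.Br2 (tco \<xi>) (tco \<eta>)"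
    unfolding tensor_bracket_def Let_def by (rule tensor_bilinear(2)[OF _ assms(1,2)]) (rule F)
qed

lemma tensor_differential:
  assumes D: "\<And>x. x \<in> carrier Q \<Longrightarrow> D x \<in> carrier Q \<and> coo (D x) = f (coo x)" and f: "lin f"
    and k: "\<And>dp p q. homog (wd par) dp p \<Longrightarrow> ext k (tn p q) = tn (f p) q + sc dp (tn p (f q))"
    and \<xi>: "\<xi> \<in> carrier TB"
  shows "tensor_differential BA BG bitotal D \<xi> \<in> carrier TB" "tco (tensor_differential BA BG bitotal D \<xi>) = ext k (tco \<xi>)"
proof -
  have h: "hsum TB BA BG (\<lambda>g x. sg TB (bitotal g) (tens BA BA x (D y))) x \<in> carrier TB \<and>
      tco (hsum TB BA BG (\<lambda>g x. sg TB (bitotal g) (tens BA BA x (D y))) x) = ext k (tn (coo x) (coo y)) - tn (f (coo x)) (coo y)"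
    if x: "x \<in> carrier Q" and y: "y \<in> carrier Q" for x y
  proof -
    \<comment> \<open>The summand with a sign depending on the degree of \<open>x\<close> is written
      as a difference, which is linear in \<open>x\<close> without mention of degrees.\<close>
    have l: "lin (\<lambda>p. ext k (tn p (coo y)) - tn (f p) (coo y))"
      by (rule lin_intros f)+
    have "sg TB (bitotal g) (tens BA BA x (D y)) \<in> carrier TB \<and>
        tco (sg TB (bitotal g) (tens BA BA x (D y))) = ext k (tn (coo x) (coo y)) - tn (f (coo x)) (coo y)"
      if "x \<in> BG g" for x g
      using BG_D[OF that] D[OF y] k[of "of_int (bitotal g)" "coo x" "coo y"] by (simp add: TB.psi_sg TB.sg_closed)
    note g = this
    show ?thesis
      by (rule conjI; (rule GB.hsum[OF TB.based_axioms l]); simp add: g x)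
  qed
  let ?F = "\<lambda>(x, y). tens BA BA (D x) y \<oplus>\<^bsub>TB\<^esub> hsum TB BA BG (\<lambda>g x. sg TB (bitotal g) (tens BA BA x (D y))) x"
  have F: "?F (x, y) \<in> carrier TB \<and> tco (?F (x, y)) = ext k (tn (coo x) (coo y))"
    if "x \<in> carrier BA" "y \<in> carrier BA" for x y
    using that h[of x y] D[of x] by (simp add: TB.psi_add)
  show "tensor_differential BA BG bitotal D \<xi> \<in> carrier TB"
    unfolding tensor_differential_def Let_def
    by (rule BB.tensor_lift(1)[OF TB.based_axioms lin_ext \<xi>]) (rule F)
  show "tco (tensor_differential BA BG bitotal D \<xi>) = ext k (tco \<xi>)"
    unfolding tensor_differential_def Let_def
    by (rule BB.tensor_lift(2)[OF TB.based_axioms lin_ext \<xi>]) (rule F)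
qed

sublocale TBA: based_pair TB "lists E \<times> lists E" tco BA "lists E" coo ..
sublocale BTA: based_pair BA "lists E" coo TB "lists E \<times> lists E" tco ..

lemma TB_eq_iff: "\<xi> \<in> carrier TB \<Longrightarrow> \<eta> \<in> carrier TB \<Longrightarrow> \<xi> = \<eta> \<longleftrightarrow> tco \<xi> = tco \<eta>"
  using TB.psi_inj by blast

lemma tensor_assoc:
  assumes "\<zeta> \<in> carrier (tensor TB BA)"
  shows "tensor_assoc BA BA BA \<zeta> \<in> carrier (tensor BA TB)"
    "tpsi coo tco (tensor_assoc BA BA BA \<zeta>) = ext (\<lambda>((u, v), w). pt (u, v, w)) (tpsi tco coo \<zeta>)"
proof -
  note b = BTA.based_tensor
  let ?f = "\<lambda>z \<xi>. lift (tensor BA TB) (\<lambda>(x, y). tens BA TB x (tens BA BA y z)) \<xi>"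
  have f: "?f z \<xi> \<in> carrier (tensor BA TB) \<and> tpsi coo tco (?f z \<xi>) = ext (\<lambda>((u, v), w). pt (u, v, w)) (tn (tco \<xi>) (coo z))"
    if "\<xi> \<in> carrier TB" "z \<in> carrier BA" for \<xi> z
  proof -
    have l: "lin (\<lambda>p. ext (\<lambda>((u, v), w). pt (u, v, w)) (tn p (coo z)))" by (rule lin_intros)+
    have g: "(\<lambda>(x, y). tens BA TB x (tens BA BA y z)) (x, y) \<in> carrier (tensor BA TB) \<and>
        tpsi coo tco ((\<lambda>(x, y). tens BA TB x (tens BA BA y z)) (x, y))
        = ext (\<lambda>((u, v), w). pt (u, v, w)) (tn (tn (coo x) (coo y)) (coo z))"
      if "x \<in> carrier BA" "y \<in> carrier BA" for x y
      using that \<open>z \<in> carrier BA\<close> BTA.tens[of x "tens BA BA y z"] by (simp add: ext_tn_assoc)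
    show ?thesis
      by (rule conjI; rule BB.tensor_lift[OF b l \<open>\<xi> \<in> carrier TB\<close>]; rule g; assumption)
  qed
  let ?F = "\<lambda>(\<xi>, z). ?f z \<xi>"
  have F: "?F (\<xi>, z) \<in> carrier (tensor BA TB) \<and>
      tpsi coo tco (?F (\<xi>, z)) = ext (\<lambda>((u, v), w). pt (u, v, w)) (tn (tco \<xi>) (coo z))"
    if "\<xi> \<in> carrier TB" "z \<in> carrier BA" for \<xi> z
    using f[OF that] by simp
  show "tensor_assoc BA BA BA \<zeta> \<in> carrier (tensor BA TB)"
    unfolding tensor_assoc_def by (rule TBA.tensor_lift(1)[OF b lin_ext assms]) (rule F)
  show "tpsi coo tco (tensor_assoc BA BA BA \<zeta>) = ext (\<lambda>((u, v), w). pt (u, v, w)) (tpsi tco coo \<zeta>)"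
    unfolding tensor_assoc_def by (rule TBA.tensor_lift(2)[OF b lin_ext assms]) (rule F)
qed

lemma tensor_map_comult_left:
  assumes "\<xi> \<in> carrier TB"
  shows "tensor_map TB BA (bar_comult A eps) (\<lambda>y. y) \<xi> \<in> carrier (tensor TB BA)"
    "tpsi tco coo (tensor_map TB BA (bar_comult A eps) (\<lambda>y. y) \<xi>) = ext (\<lambda>(u, v). tn (dcw u) (pt v)) (tco \<xi>)"
proof -
  let ?F = "\<lambda>(x, y). tens TB BA (bar_comult A eps x) y"
  have F: "?F (x, y) \<in> carrier (tensor TB BA) \<and>
      tpsi tco coo (?F (x, y)) = ext (\<lambda>(u, v). tn (dcw u) (pt v)) (tn (coo x) (coo y))"
    if "x \<in> carrier BA" "y \<in> carrier BA" for x y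
    using that bar_comult[of x] TBA.tens[of "bar_comult A eps x" y] by (simp add: ext_tn)
  show "tensor_map TB BA (bar_comult A eps) (\<lambda>y. y) \<xi> \<in> carrier (tensor TB BA)"
    unfolding tensor_map_def by (rule BB.tensor_lift(1)[OF TBA.based_tensor lin_ext assms]) (rule F)
  show "tpsi tco coo (tensor_map TB BA (bar_comult A eps) (\<lambda>y. y) \<xi>) = ext (\<lambda>(u, v). tn (dcw u) (pt v)) (tco \<xi>)"
    unfolding tensor_map_def by (rule BB.tensor_lift(2)[OF TBA.based_tensor lin_ext assms]) (rule F)
qed

lemma tensor_map_comult_right:
  assumes "\<xi> \<in> carrier TB"
  shows "tensor_map BA TB (\<lambda>y. y) (bar_comult A eps) \<xi> \<in> carrier (tensor BA TB)"
    "tpsi coo tco (tensor_map BA TB (\<lambda>y. y) (bar_comult A eps) \<xi>) = ext (\<lambda>(u, v). tn (pt u) (dcw v)) (tco \<xi>)"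
proof -
  let ?F = "\<lambda>(x, y). tens BA TB x (bar_comult A eps y)"
  have F: "?F (x, y) \<in> carrier (tensor BA TB) \<and>
      tpsi coo tco (?F (x, y)) = ext (\<lambda>(u, v). tn (pt u) (dcw v)) (tn (coo x) (coo y))"
    if "x \<in> carrier BA" "y \<in> carrier BA" for x y
    using that bar_comult[of y] BTA.tens[of x "bar_comult A eps y"] by (simp add: ext_tn)
  show "tensor_map BA TB (\<lambda>y. y) (bar_comult A eps) \<xi> \<in> carrier (tensor BA TB)"
    unfolding tensor_map_def by (rule BB.tensor_lift(1)[OF BTA.based_tensor lin_ext assms]) (rule F)
  show "tpsi coo tco (tensor_map BA TB (\<lambda>y. y) (bar_comult A eps) \<xi>) = ext (\<lambda>(u, v). tn (pt u) (dcw v)) (tco \<xi>)"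
    unfolding tensor_map_def by (rule BB.tensor_lift(2)[OF BTA.based_tensor lin_ext assms]) (rule F)
qed

lemma bar_coassoc:
  assumes "x \<in> carrier Q"
  shows "tensor_assoc BA BA BA (tensor_map TB BA (bar_comult A eps) (\<lambda>y. y) (bar_comult A eps x)) =
      tensor_map BA TB (\<lambda>y. y) (bar_comult A eps) (bar_comult A eps x)"
proof (rule based.psi_inj[OF BTA.based_tensor])
  note c = bar_comult[OF assms]
  note l = tensor_map_comult_left[OF c(1)] and r = tensor_map_comult_right[OF c(1)]
  note a = tensor_assoc[OF l(1)]
  show "tensor_assoc BA BA BA (tensor_map TB BA (bar_comult A eps) (\<lambda>y. y) (bar_comult A eps x)) \<in> carrier (tensor BA TB)"
    by (rule a)
  show "tensor_map BA TB (\<lambda>y. y) (bar_comult A eps) (bar_comult A eps x) \<in> carrier (tensor BA TB)"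
    by (rule r)
  show "tpsi coo tco (tensor_assoc BA BA BA (tensor_map TB BA (bar_comult A eps) (\<lambda>y. y) (bar_comult A eps x))) =
      tpsi coo tco (tensor_map BA TB (\<lambda>y. y) (bar_comult A eps) (bar_comult A eps x))"
    unfolding a(2) l(2) r(2) c(2)
    by (rule lin_eqI[of "\<lambda>p. ext (\<lambda>((u, v), w). pt (u, v, w)) (ext (\<lambda>(u, v). tn (dcw u) (pt v)) (Dc p))"
          "\<lambda>p. ext (\<lambda>(u, v). tn (pt u) (dcw v)) (Dc p)"]; ((rule lin_intros)+)?) (simp add: dcw_coassoc)
qed

lemma lift_comult:
  assumes f: "\<And>y z. y \<in> carrier BA \<Longrightarrow> z \<in> carrier BA \<Longrightarrow> f (y, z) \<in> carrier Q \<and> coo (f (y, z)) = ext k (tn (coo y) (coo z))"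
    and x: "x \<in> carrier Q"
  shows "lift BA f (bar_comult A eps x) \<in> carrier Q"
    "coo (lift BA f (bar_comult A eps x)) = ext (\<lambda>w. ext k (dcw w)) (coo x)"
  using BB.tensor_lift[OF BA.based_axioms lin_ext[of k] bar_comult(1)[OF x], of f] f
  by (simp_all add: bar_comult(2)[OF x] ext_ext)

text \<open>The counit and antipode axioms all have this shape, which reduces them to identities for
  deconcatenated basis words.\<close>

lemma lift_comult_eqI:
  assumes "\<And>y z. y \<in> carrier BA \<Longrightarrow> z \<in> carrier BA \<Longrightarrow> f (y, z) \<in> carrier Q \<and> coo (f (y, z)) = ext k (tn (coo y) (coo z))"
    and "x \<in> carrier Q" "z \<in> carrier Q" "ext (\<lambda>w. ext k (dcw w)) (coo x) = coo z"
  shows "lift BA f (bar_comult A eps x) = z"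
proof (rule Bp.psi_inj)
  show "lift BA f (bar_comult A eps x) \<in> carrier Q"
    by (rule lift_comult(1)[OF _ assms(2)]) (rule assms(1))
  have "coo (lift BA f (bar_comult A eps x)) = ext (\<lambda>w. ext k (dcw w)) (coo x)"
    by (rule lift_comult(2)[OF _ assms(2)]) (rule assms(1))
  then show "coo (lift BA f (bar_comult A eps x)) = coo z" by (simp only: assms(4))
qed (rule assms(3))

section \<open>The antipode and the Hopf algebra structure\<close>

definition bar_antipode :: "('k, 'a) bar \<Rightarrow> ('k, 'a) bar" where
  "bar_antipode x = Bp.phi (ext BW.antipode_left (coo x))"

text \<open>That no letters outside \<open>E\<close> appear is read off from the closure of
  \<open>bar_mult\<close> instead of an induction on words.\<close>

lemma Sh_supp:
  assumes "p \<in> supp_in (lists E)" "q \<in> supp_in (lists E)"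
  shows "BW.Sh p q \<in> supp_in (lists E)"
  using bar_mult[of "Bp.phi p" "Bp.phi q"] Bp.psi_supp[of "bar_mult A G eps (Bp.phi p) (Bp.phi q)"] assms
  by (simp add: Bp.phi_closed Bp.psi_phi)

lemma antipode_supp: "w \<in> lists E \<Longrightarrow> (BW.antipode_left w :: _ \<Rightarrow>\<^sub>0 'k) \<in> supp_in (lists E)"
proof (induction w rule: length_induct)
  case (1 w)
  have td: "take i w \<in> lists E" "drop i w \<in> lists E" for i
    using 1(2) by (auto dest: in_set_takeD in_set_dropD)
  then have "(BW.antipode_left (take i w) :: _ \<Rightarrow>\<^sub>0 'k) \<in> supp_in (lists E)" if "i < length w" for i
    using 1(1) that by simp
  then show ?case
    unfolding BW.antipode_left.simps[of w] using td
    by (auto intro!: fs.subspace_neg[OF subspace_supp_in] fs.subspace_sum[OF subspace_supp_in] Sh_supp)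
qed

lemma bar_antipode:
  assumes "x \<in> carrier Q"
  shows "bar_antipode x \<in> carrier Q" "coo (bar_antipode x) = ext BW.antipode_left (coo x)"
  using ext_supp_in[OF Bp.psi_supp[OF assms] antipode_supp]
  by (simp_all add: bar_antipode_def Bp.phi_closed Bp.psi_phi)

lemma bar_graded_hopf_algebra: "graded_hopf_algebra BA BG bitotal (bar_comult A eps) bar_counit"
proof (intro graded_hopf_algebra.intro bar_graded_algebra graded_hopf_algebra_axioms.intro)
  show "klinear BA TB (bar_comult A eps)"
    by (simp add: klinear_def TB_eq_iff bar_comult TB.psi_add TB.psi_smult)
  show "klinear_form BA bar_counit"
    by (simp add: klinear_form_def bar_counit lookup_add)
next
  fix x g assume x: "x \<in> BG g"
  let ?S = "\<Union>h. BG h \<times> BG (g - h)"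
  \<comment> \<open>Bidegrees of the two factors add up to \<open>g\<close>, so replacing basis
    words by basis elements in this vector gives the representative that
    \<open>tensor_grading\<close> asks for.\<close>
  have c: "Dc (coo x) \<in> supp_in {(u, v). u \<in> lists E \<and> v \<in> lists E \<and> wd bideg u + wd bideg v = g}"
  proof -
    have "Dc (coo x) \<in> supp_in (lists E \<times> lists E)"
      using TB.psi_supp[OF bar_comult(1)[of x]] BG_D[OF x] by (simp add: bar_comult)
    moreover have "homog (\<lambda>(u, v). wd bideg u + wd bideg v) g (Dc (coo x))"
      by (rule homog_ext[of "wd bideg" g]) (use x homog_dcw[of bideg] in \<open>auto simp: BG_iff\<close>)
    ultimately show ?thesis by (auto simp: supp_in_def homog_def)
  qed
  have m: "(BA.bas u, BA.bas v) \<in> ?S"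
    if "u \<in> lists E" "v \<in> lists E" "wd bideg u + wd bideg v = g" for u v
  proof -
    have b: "BA.bas w \<in> BG (wd bideg w)" if "w \<in> lists E" for w
      using BA.bas_closed[OF that] BA.psi_bas[OF that] homog_pt[of "wd bideg" w] by (simp add: BG_iff)
    have "wd bideg v = g - wd bideg u" using that(3) by auto
    then have "BA.bas v \<in> BG (g - wd bideg u)" using b[OF that(2)] by simp
    then show ?thesis by (intro UN_I[of "wd bideg u"] SigmaI UNIV_I b[OF that(1)])
  qed
  from c have "ext (\<lambda>(u, v). pt (BA.bas u, BA.bas v)) (Dc (coo x)) \<in> supp_in ?S"
  proof (rule ext_supp_in)
    fix y assume "y \<in> {(u, v). u \<in> lists E \<and> v \<in> lists E \<and> wd bideg u + wd bideg v = g}"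
    then obtain u v where y: "y = (u, v)" and uv: "u \<in> lists E" "v \<in> lists E" "wd bideg u + wd bideg v = g" by auto
    show "(case y of (u, v) \<Rightarrow> pt (BA.bas u, BA.bas v)) \<in> supp_in ?S"
      unfolding y prod.case pt_supp_in by (rule m[OF uv])
  qed
  then have k: "Poly_Mapping.keys (ext (\<lambda>(u, v). pt (BA.bas u, BA.bas v)) (Dc (coo x)) :: _ \<Rightarrow>\<^sub>0 'k) \<subseteq> ?S"
    by (simp only: supp_in_def mem_Collect_eq)
  have "ext (\<lambda>y. pt (case y of (u, v) \<Rightarrow> (BA.bas u, BA.bas v))) (tco (bar_comult A eps x)) \<in> bar_comult A eps x"
    using bar_comult(1)[of x] BG_D[OF x] by (intro BB.representative) (simp add: tensor_def)
  moreover have "(\<lambda>y. pt (case y of (u, v) \<Rightarrow> (BA.bas u, BA.bas v))) = (\<lambda>(u, v). pt (BA.bas u, BA.bas v) :: _ \<Rightarrow>\<^sub>0 'k)"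
    by auto
  ultimately have "ext (\<lambda>(u, v). pt (BA.bas u, BA.bas v)) (Dc (coo x)) \<in> bar_comult A eps x"
    by (simp only: bar_comult(2)[OF BG_D(1)[OF x]])
  with k show "bar_comult A eps x \<in> tensor_grading BA BG g"
    unfolding tensor_grading_def using bar_comult(1)[OF BG_D(1)[OF x]] by blast
next
  fix x g assume "x \<in> BG g" "g \<noteq> 0"
  then have "[] \<notin> Poly_Mapping.keys (coo x)" and "x \<in> carrier Q" by (auto simp: BG_iff homog_def)
  then show "bar_counit x = 0" by (simp add: bar_counit in_keys_iff)
next
  fix x assume x: "x \<in> carrier BA"
  then show "tensor_assoc BA BA BA (tensor_map TB BA (bar_comult A eps) (\<lambda>y. y) (bar_comult A eps x)) =
      tensor_map BA TB (\<lambda>y. y) (bar_comult A eps) (bar_comult A eps x)"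
    by (simp add: bar_coassoc)
  show "lift BA (\<lambda>(y, z). bar_counit y \<odot>\<^bsub>BA\<^esub> z) (bar_comult A eps x) = x"
    using x by (intro lift_comult_eqI[of _ "\<lambda>(u, v). if u = [] then pt v else 0"])
      (simp_all add: bar_counit counit_tn dcw_counit)
  show "lift BA (\<lambda>(y, z). bar_counit z \<odot>\<^bsub>BA\<^esub> y) (bar_comult A eps x) = x"
    using x by (intro lift_comult_eqI[of _ "\<lambda>(u, v). if v = [] then pt u else 0"])
      (simp_all add: bar_counit counit_tn dcw_counit)
next
  show "bar_comult A eps \<one>\<^bsub>BA\<^esub> = tens BA BA \<one>\<^bsub>BA\<^esub> \<one>\<^bsub>BA\<^esub>"
    by (simp add: TB_eq_iff bar_comult word_Nil)
  show "bar_counit \<one>\<^bsub>BA\<^esub> = 1"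
    by (simp add: bar_counit word_Nil)
next
  fix x y assume "x \<in> carrier BA" "y \<in> carrier BA"
  then show "bar_comult A eps (x \<otimes>\<^bsub>BA\<^esub> y) = tensor_mult BA BG bitotal (bar_comult A eps x) (bar_comult A eps y)"
    and "bar_counit (x \<otimes>\<^bsub>BA\<^esub> y) = bar_counit x * bar_counit y"
    by (simp_all add: TB_eq_iff bar_comult bar_mult tensor_mult BW.Dc_Sh bar_counit lookup_Sh_Nil)
next
  have "klinear BA BA bar_antipode"
    by (auto simp: klinear_def coo_eq_iff bar_antipode)
  moreover have "\<forall>g. \<forall>x\<in>BG g. bar_antipode x \<in> BG g"
  proof (intro allI ballI)
    fix g x assume x: "x \<in> BG g"
    have "homog (wd bideg) g (ext BW.antipode_left (coo x))"
    proof (rule homog_ext)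
      show "homog (wd bideg) g (coo x)" using x by (simp add: BG_iff)
      show "homog (wd bideg) g (BW.antipode_left w :: _ \<Rightarrow>\<^sub>0 'k)" if "wd bideg w = g" for w
        using BW.homog_antipode[of bideg w] that by simp
    qed
    then show "bar_antipode x \<in> BG g" using BG_D(1)[OF x] by (simp add: BG_iff bar_antipode)
  qed
  moreover have "lift BA (\<lambda>(y, z). bar_antipode y \<otimes>\<^bsub>BA\<^esub> z) (bar_comult A eps x) = bar_counit x \<odot>\<^bsub>BA\<^esub> \<one>\<^bsub>BA\<^esub>"
    if "x \<in> carrier BA" for x
    using that
    by (intro lift_comult_eqI[of _ "\<lambda>(u, v). BW.Sh (BW.antipode_left u) (pt v)"])
      (simp_all add: bar_antipode bar_mult ext_tn word_Nil bar_counit BW.conv_antipode_left ext_counit_word)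
  moreover have "lift BA (\<lambda>(y, z). y \<otimes>\<^bsub>BA\<^esub> bar_antipode z) (bar_comult A eps x) = bar_counit x \<odot>\<^bsub>BA\<^esub> \<one>\<^bsub>BA\<^esub>"
    if "x \<in> carrier BA" for x
    using that
    by (intro lift_comult_eqI[of _ "\<lambda>(u, v). BW.Sh (pt u) (BW.antipode_left v)"])
      (simp_all add: bar_antipode bar_mult ext_tn word_Nil bar_counit BW.conv_antipode ext_counit_word)
  ultimately show "\<exists>S. klinear BA BA S \<and> (\<forall>g. \<forall>x\<in>BG g. S x \<in> BG g) \<and>
      (\<forall>x\<in>carrier BA. lift BA (\<lambda>(y, z). S y \<otimes>\<^bsub>BA\<^esub> z) (bar_comult A eps x) = bar_counit x \<odot>\<^bsub>BA\<^esub> \<one>\<^bsub>BA\<^esub> \<and>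
        lift BA (\<lambda>(y, z). y \<otimes>\<^bsub>BA\<^esub> S z) (bar_comult A eps x) = bar_counit x \<odot>\<^bsub>BA\<^esub> \<one>\<^bsub>BA\<^esub>)"
    by blast
qed

lemma bar_graded_poisson_hopf_algebra:
  "graded_poisson_hopf_algebra BA BG bitotal (bar_comult A eps) bar_counit (-1, int n - 1) bar_br"
proof (intro graded_poisson_hopf_algebra.intro bar_graded_hopf_algebra bar_graded_poisson_algebra
    graded_poisson_hopf_algebra_axioms.intro)
  fix x y assume x: "x \<in> carrier BA" and y: "y \<in> carrier BA"
  have "of_int (bitotal (-1, int n - 1)) = (of_nat n :: bit)" by simp
  note b = tensor_bracket[OF bar_comult(1) bar_comult(1) this, of x y]
  show "bar_comult A eps (bar_br x y) =
      tensor_bracket BA BG bitotal (bitotal (-1, int n - 1)) bar_br (bar_comult A eps x) (bar_comult A eps y)"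
    using x y b by (simp add: TB_eq_iff bar_comult bar_br BW.Dc_Br del: fst_conv snd_conv)
qed

text \<open>The axioms see a differential only through its coordinate map \<open>f\<close> and the
  induced map \<open>k\<close> on pairs of words, so d and \<delta> are treated together.\<close>

lemma bar_differential:
  assumes D: "\<And>x. x \<in> carrier Q \<Longrightarrow> D x \<in> carrier Q" "\<And>x. x \<in> carrier Q \<Longrightarrow> coo (D x) = f (coo x)"
    and e: "bitotal e = -1" and f: "lin f"
    and degree: "\<And>g p. homog (wd bideg) g p \<Longrightarrow> homog (wd bideg) (g + e) (f p)"
    and square: "\<And>p. f (f p) = 0"
    and Sh: "\<And>dp p q. homog (wd par) dp p \<Longrightarrow> f (BW.Sh p q) = BW.Sh (f p) q + sc dp (BW.Sh p (f q))"
    and Br: "\<And>dp p q. homog (wd par) dp p \<Longrightarrow> f (BW.Br p q) = BW.Br (f p) q + sc (dp + of_nat n) (BW.Br p (f q))"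
    and Dc: "\<And>p. Dc (f p) = ext k (Dc p)"
    and k: "\<And>dp p q. homog (wd par) dp p \<Longrightarrow> ext k (tn p q) = tn (f p) q + sc dp (tn p (f q))"
    and counit: "\<And>p. Poly_Mapping.lookup (f p) [] = 0"
  shows "dg_hopf_algebra BA BG bitotal (bar_comult A eps) bar_counit e D"
    and "dg_poisson_algebra BA BG bitotal e D (-1, int n - 1) bar_br"
proof -
  have dga: "dg_algebra BA BG bitotal e D"
  proof (intro dg_algebra.intro bar_graded_algebra dg_algebra_axioms.intro e)
    show "klinear BA BA D"
      by (auto simp: klinear_def coo_eq_iff D lin_simps[OF f])
    show "D x \<in> BG (g + e)" if "x \<in> BG g" for x g
      using that by (simp add: BG_iff D degree)
    show "D (D x) = \<zero>\<^bsub>BA\<^esub>" if "x \<in> carrier BA" for x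
      using that by (simp add: coo_eq_iff D square)
    show "D (x \<otimes>\<^bsub>BA\<^esub> y) = D x \<otimes>\<^bsub>BA\<^esub> y \<oplus>\<^bsub>BA\<^esub> sg BA (bitotal g) (x \<otimes>\<^bsub>BA\<^esub> D y)"
      if "x \<in> BG g" "y \<in> carrier BA" for x y g
      using BG_D[OF that(1)] that(2) Sh[of "of_int (bitotal g)" "coo x" "coo y"]
      by (simp add: coo_eq_iff D bar_mult)
  qed
  then show "dg_hopf_algebra BA BG bitotal (bar_comult A eps) bar_counit e D"
  proof (intro dg_hopf_algebra.intro bar_graded_hopf_algebra dg_hopf_algebra_axioms.intro)
    fix x assume x: "x \<in> carrier BA"
    note d = tensor_differential[of D f k, OF _ f k bar_comult(1)[of x]]
    show "bar_comult A eps (D x) = tensor_differential BA BG bitotal D (bar_comult A eps x)"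
      using x d by (simp add: TB_eq_iff bar_comult D Dc)
    show "bar_counit (D x) = 0" using x by (simp add: bar_counit D counit)
  qed
  have m: "of_int (bitotal (-1, int n - 1)) = (of_nat n :: bit)" by simp
  from dga show "dg_poisson_algebra BA BG bitotal e D (-1, int n - 1) bar_br"
  proof (intro dg_poisson_algebra.intro bar_graded_poisson_algebra dg_poisson_algebra_axioms.intro)
    fix x y g h assume "x \<in> BG g" "y \<in> BG h"
    note x = BG_D[OF this(1)] and y = BG_D[OF this(2)]
    show "D (bar_br x y) = bar_br (D x) y \<oplus>\<^bsub>BA\<^esub> sg BA (bitotal g + bitotal (-1, int n - 1)) (bar_br x (D y))"
      using x y m Br[of "of_int (bitotal g)" "coo x" "coo y"]
      by (simp add: coo_eq_iff D bar_br del: fst_conv snd_conv)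
  qed
qed

lemma DI_DI: "DI.Df (DI.Df p) = 0"
  by (rule DI.Df_Df) (simp_all add: ld_ld ext2_def)

lemma DE_DE: "DE.Df (DE.Df p) = 0"
  by (rule DE.Df_Df) (simp_all add: lmult_lmult)

text \<open>Expanding the square of d + \<delta> and removing the squares of d and \<delta> leaves
  the mixed terms. The Leibniz rule of the algebra enters through \<open>ld_lmult\<close>.\<close>

lemma DI_DE: "DI.Df (DE.Df p) + DE.Df (DI.Df p) = 0"
proof -
  have s: "DS.Df q = DI.Df q + DE.Df q" for q
    unfolding ext_add_fun[symmetric] using cdw_add[of par ld "\<lambda>a. 0" "\<lambda>a b. 0" lmult] by (intro ext_cong) simp
  have "DS.Df (DS.Df p) = 0"
    by (rule DS.Df_Df) (rule ld_ld ld_lmult lmult_lmult)+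
  then show ?thesis by (simp add: s DI_DI DE_DE add.commute)
qed

lemma bar_internal_differential:
  "dg_hopf_algebra BA BG bitotal (bar_comult A eps) bar_counit (0, -1) (bar_internal A G eps dA)"
  "dg_poisson_algebra BA BG bitotal (0, -1) (bar_internal A G eps dA) (-1, int n - 1) bar_br"
proof -
  have degree: "homog (wd bideg) (g + (0, -1)) (DI.Df p)" if "homog (wd bideg) g p" for g p
    by (rule homog_Df[OF ld_bideg homog_0 that])
  have e: "bitotal (0, -1) = -1" by simp
  note d = bar_differential[of "bar_internal A G eps dA" DI.Df "(0, -1)" "d2w par ld (\<lambda>a b. 0)",
      OF _ _ e lin_ext _ DI_DI _ _ DI.Dc_Df _ lookup_ext_zero[OF lookup_cdw_Nil]]
  show "dg_hopf_algebra BA BG bitotal (bar_comult A eps) bar_counit (0, -1) (bar_internal A G eps dA)"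
    by (rule d(1); (rule bar_internal degree DI.Df_Sh DI.Df_Br DI.D2_tn; assumption))
  show "dg_poisson_algebra BA BG bitotal (0, -1) (bar_internal A G eps dA) (-1, int n - 1) bar_br"
    by (rule d(2); (rule bar_internal degree DI.Df_Sh DI.Df_Br DI.D2_tn; assumption))
qed

lemma bar_external_differential:
  "dg_hopf_algebra BA BG bitotal (bar_comult A eps) bar_counit (-1, 0) (bar_external A G eps)"
  "dg_poisson_algebra BA BG bitotal (-1, 0) (bar_external A G eps) (-1, int n - 1) bar_br"
proof -
  have degree: "homog (wd bideg) (g + (-1, 0)) (DE.Df p)" if "homog (wd bideg) g p" for g p
    by (rule homog_Df[OF homog_0 lmult_bideg that])
  have e: "bitotal (-1, 0) = -1" by simp
  note d = bar_differential[of "bar_external A G eps" DE.Df "(-1, 0)" "d2w par (\<lambda>a. 0) lmult",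
      OF _ _ e lin_ext _ DE_DE _ _ DE.Dc_Df _ lookup_ext_zero[OF lookup_cdw_Nil]]
  show "dg_hopf_algebra BA BG bitotal (bar_comult A eps) bar_counit (-1, 0) (bar_external A G eps)"
    by (rule d(1); (rule bar_external degree DE.Df_Sh DE.Df_Br DE.D2_tn; assumption))
  show "dg_poisson_algebra BA BG bitotal (-1, 0) (bar_external A G eps) (-1, int n - 1) bar_br"
    by (rule d(2); (rule bar_external degree DE.Df_Sh DE.Df_Br DE.D2_tn; assumption))
qed

lemma bar_poisson_hopf_algebra:
  "commutative_differential_bigraded_poisson_hopf_algebra BA BG (bar_comult A eps) bar_counit
    (bar_internal A G eps dA) (bar_external A G eps) (-1, int n - 1) bar_br"
proof (rule commutative_differential_bigraded_poisson_hopf_algebra.intro[OF bar_graded_commutative_algebra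
      bar_graded_poisson_hopf_algebra bar_internal_differential(1) bar_external_differential(1)
      bar_internal_differential(2) bar_external_differential(2)])
  show "commutative_differential_bigraded_poisson_hopf_algebra_axioms BA (bar_internal A G eps dA) (bar_external A G eps)"
    by (rule commutative_differential_bigraded_poisson_hopf_algebra_axioms.intro)
      (simp add: coo_eq_iff bar_internal bar_external DI_DE)
qed

end

theorem theorem3p1:
  fixes A :: "('k::field, 'a) module" and G :: "int \<Rightarrow> 'a set"
    and dA :: "'a \<Rightarrow> 'a" and br :: "'a \<Rightarrow> 'a \<Rightarrow> 'a" and eps :: "'a \<Rightarrow> 'k" and n :: nat
  assumes "n \<ge> 2"
    and "graded_commutative_algebra A G (\<lambda>t. t)"
    and "dg_poisson_algebra A G (\<lambda>t. t) (-1) dA (int n - 1) br"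
    and "augmentation A G (\<lambda>t. t) (-1) dA eps"
    and "\<And>t. t < 0 \<Longrightarrow> G t = {\<zero>\<^bsub>A\<^esub>}"
  shows "\<exists>bar_br.
    commutative_differential_bigraded_poisson_hopf_algebra
      (bar_algebra A G eps) (bar_grading A G eps) (bar_comult A eps) bar_counit
      (bar_internal A G eps dA) (bar_external A G eps) (-1, int n - 1) bar_br \<and>
    (\<forall>ps xs qs ys.
       list_all2 (\<lambda>x t. x \<in> augmentation_ideal A eps \<inter> G t) xs ps \<longrightarrow>
       list_all2 (\<lambda>y t. y \<in> augmentation_ideal A eps \<inter> G t) ys qs \<longrightarrow>
       bar_br (word A eps xs) (word A eps ys) = bar_bracket_words A eps br n ps xs qs ys)"
proof -
  interpret bar_setup A G dA br eps n
    using assms by (rule bar_setup.intro)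
  show ?thesis
  \<comment> \<open>The basis serves the verification only; neither the structure maps nor the
    bracket are built from it.\<close>
  proof (rule homogeneous_basis)
    fix E coord assume "based VI E coord" "\<And>e. e \<in> E \<Longrightarrow> coord e = pt e" "E \<subseteq> (\<Union>t. I \<inter> G t)"
    then interpret bar_coords A G dA br eps n E coord
      by (intro bar_coords.intro bar_coords_axioms.intro bar_setup_axioms)
    show ?thesis
      by (intro exI[of _ bar_br] conjI allI impI) (rule bar_poisson_hopf_algebra, rule bar_br_words)
  qed
qed

end
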